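(* Let $\mathcal C$ be a connected cogroupoid over a field $k$. Then for any $X,Y\in\mathrm{ob}(\mathcal C)$, the functor $$\mathcal{YD}_{\mathcal C(X,X)}^{\mathcal C(X,X)}\to\mathcal{YD}_{\mathcal C(Y,Y)}^{\mathcal C(Y,Y)},\quad V\mapsto V\square_{\mathcal C(X,X)}\mathcal C(X,Y)$$ is an equivalence of $k$-linear monoidal categories.
   Context: Algebras are associative unital $k$-algebras, $m$ denotes multiplication. A cocategory $\mathcal C$ consists of a set $\mathrm{ob}(\mathcal C)$; for all $X,Y\in \mathrm{ob}(\mathcal C)$ a $k$-algebra $\mathcal C(X,Y)$; and for all $X,Y,Z$ algebra morphisms $\Delta_{X,Y}^Z:\mathcal C(X,Y)\to\mathcal C(X,Z)\otimes\mathcal C(Z,Y)$ and $\varepsilon_X:\mathcal C(X,X)\to k$ such that $(\Delta_{X,Z}^T\otimes 1)\Delta_{X,Y}^Z=(1\otimes\Delta_{T,Y}^Z)\Delta_{X,Y}^T$ and $(1\otimes\varepsilon_Y)\Delta_{X,Y}^Y=\mathrm{id}=(\varepsilon_X\otimes 1)\Delta_{X,Y}^X$. A cogroupoid is a cocategory together with linear maps $S_{X,Y}:\mathcal C(X,Y)\to\mathcal C(Y,X)$ such that for all $X,Y$ and $a\in\mathcal C(X,X)$: $m(1\otimes S_{Y,X})\Delta_{X,X}^Y(a)=\varepsilon_X(a)1$ in $\mathcal C(X,Y)$ and $m(S_{X,Y}\otimes 1)\Delta_{X,X}^Y(a)=\varepsilon_X(a)1$ in $\mathcal C(Y,X)$.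 It is connected if $\mathcal C(X,Y)\neq(0)$ for all $X,Y$. Each $\mathcal C(X,X)$ is a Hopf algebra (structure maps $\Delta_{X,X}^X,\varepsilon_X,S_{X,X}$) and $\mathcal C(X,Y)$ is a $\mathcal C(X,X)$-$\mathcal C(Y,Y)$-bicomodule algebra via $\Delta_{X,Y}^X$ and $\Delta_{X,Y}^Y$. Sweedler notation: $\Delta_{X,Y}^Z(a^{X,Y})=a_{(1)}^{X,Z}\otimes a_{(2)}^{Z,Y}$, and similarly for iterated maps. $\mathcal{YD}_H^H$ is the monoidal category of right-right Yetter–Drinfeld modules over a Hopf algebra $H$: right $H$-comodules and right $H$-modules $V$ with $(v\leftarrow x)_{(0)}\otimes(v\leftarrow x)_{(1)}=v_{(0)}\leftarrow x_{(2)}\otimes S(x_{(1)})v_{(1)}x_{(3)}$; morphisms are linear colinear maps; tensor product is the usual one of modules and comodules. $V\square_CW=\ker(\alpha_V\otimes1_W-1_V\otimes\alpha_W)\subset V\otimes W$ is the cotensor product ($\alpha_V,\alpha_W$ the coactions). $V\square_{\mathcal C(X,X)}\mathcal C(X,Y)$ is a Yetter–Drinfeld module over $\mathcal C(Y,Y)$ with coaction induced by $1\otimes\Delta_{X,Y}^Y$ and action induced by $$(v\otimes a^{X,Y})\leftarrow b^{Y,Y}=v\leftarrow b_{(2)}^{X,X}\otimes S_{Y,X}(b_{(1)}^{Y,X})a^{X,Y}b_{(3)}^{X,Y}.$$ The monoidal constraints of the functor are $(\sum_iv_i\otimes a_i)\otimes(\sum_jw_j\otimes b_j)\mapsto\sum_{i,j}v_i\otimes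 w_j\otimes a_ib_j$, and $k\to k\square_{\mathcal C(X,X)}\mathcal C(X,Y)$, $1\mapsto1\otimes1$. *)

theory Defs
  imports "HOL-Algebra.Module" "HOL-Algebra.QuotRing" "HOL-Library.Equipollence"
begin

section \<open>Linear maps and tensor products\<close>

text \<open>A vector space over a field \<open>k\<close> is a \<^term>\<open>V\<close> with \<^prop>\<open>module k V\<close>. As the type of module records
  extends that of rings, the fields \<^const>\<open>mult\<close> and \<^const>\<open>one\<close> of a mere vector space carry no
  information.\<close>

definition lin_maps ::
  "('k, 'r) ring_scheme \<Rightarrow> ('k, 'v, 'm) module_scheme \<Rightarrow> ('k, 'w, 'n) module_scheme \<Rightarrow> ('v \<Rightarrow> 'w) set"
where
  "lin_maps k V W = {f \<in> carrier V \<rightarrow> carrier W.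
     (\<forall>x\<in>carrier V. \<forall>y\<in>carrier V. f (x \<oplus>\<^bsub>V\<^esub> y) = f x \<oplus>\<^bsub>W\<^esub> f y) \<and>
     (\<forall>c\<in>carrier k. \<forall>x\<in>carrier V. f (c \<odot>\<^bsub>V\<^esub> x) = c \<odot>\<^bsub>W\<^esub> f x)}"

definition bilin_maps ::
  "('k, 'r) ring_scheme \<Rightarrow> ('k, 'v, 'm) module_scheme \<Rightarrow> ('k, 'w, 'n) module_scheme \<Rightarrow>
   ('k, 'u, 'l) module_scheme \<Rightarrow> ('v \<Rightarrow> 'w \<Rightarrow> 'u) set"
where
  "bilin_maps k V W U = {\<beta>.
     (\<forall>x\<in>carrier V. \<beta> x \<in> lin_maps k W U) \<and> (\<forall>y\<in>carrier W. (\<lambda>x. \<beta> x y) \<in> lin_maps k V U)}"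

text \<open>Associative unital, not necessarily commutative, algebras; the library's \<^locale>\<open>algebra\<close>
  requires commutativity.\<close>

locale assoc_algebra = module R A + ring A for R :: "('k, 'r) ring_scheme" and A (structure) +
  assumes smult_mult_left: "\<lbrakk>c \<in> carrier R; x \<in> carrier A; y \<in> carrier A\<rbrakk> \<Longrightarrow>
      (c \<odot>\<^bsub>A\<^esub> x) \<otimes>\<^bsub>A\<^esub> y = c \<odot>\<^bsub>A\<^esub> (x \<otimes>\<^bsub>A\<^esub> y)"
    and smult_mult_right: "\<lbrakk>c \<in> carrier R; x \<in> carrier A; y \<in> carrier A\<rbrakk> \<Longrightarrow>
      x \<otimes>\<^bsub>A\<^esub> (c \<odot>\<^bsub>A\<^esub> y) = c \<odot>\<^bsub>A\<^esub> (x \<otimes>\<^bsub>A\<^esub> y)"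

definition alg_maps ::
  "('k, 'r) ring_scheme \<Rightarrow> ('k, 'v, 'm) module_scheme \<Rightarrow> ('k, 'w, 'n) module_scheme \<Rightarrow> ('v \<Rightarrow> 'w) set"
where
  "alg_maps k A B = lin_maps k A B \<inter> ring_hom A B"

definition base_algebra :: "('k, 'r) ring_scheme \<Rightarrow> ('k, 'k) module" where
  "base_algebra k = \<lparr>carrier = carrier k, mult = mult k, one = one k, zero = zero k, add = add k,
     smult = mult k\<rparr>"

definition free_space :: "('k, 'r) ring_scheme \<Rightarrow> 's set \<Rightarrow> ('k, 's \<Rightarrow> 'k) module" where
  "free_space k S = \<lparr>
     carrier = {f. (\<forall>p. f p \<in> carrier k) \<and> finite {p. f p \<noteq> \<zero>\<^bsub>k\<^esub>} \<and> {p. f p \<noteq> \<zero>\<^bsub>k\<^esub>} \<subseteq> S},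
     mult = (\<lambda>_ _. undefined), one = undefined,
     zero = (\<lambda>p. \<zero>\<^bsub>k\<^esub>), add = (\<lambda>f g p. f p \<oplus>\<^bsub>k\<^esub> g p),
     smult = (\<lambda>c f p. c \<otimes>\<^bsub>k\<^esub> f p)\<rparr>"

definition free_gen :: "('k, 'r) ring_scheme \<Rightarrow> 's \<Rightarrow> 's \<Rightarrow> 'k" where
  "free_gen k p = (\<lambda>q. if q = p then \<one>\<^bsub>k\<^esub> else \<zero>\<^bsub>k\<^esub>)"

text \<open>\<^bold>\<open>The tensor product\<close> \<open>V \<otimes> W\<close> is the free space on \<open>V \<times> W\<close> modulo the subspace generated by the
  bilinearity relations; its elements are cosets.\<close>

definition bilinearity_relations ::
  "('k, 'r) ring_scheme \<Rightarrow> ('k, 'v, 'm) module_scheme \<Rightarrow> ('k, 'w, 'n) module_scheme \<Rightarrow> ('v \<times> 'w \<Rightarrow> 'k) set"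
where
  "bilinearity_relations k V W = (let F = free_space k (carrier V \<times> carrier W); d = free_gen k in
     {d (v \<oplus>\<^bsub>V\<^esub> v', w) \<ominus>\<^bsub>F\<^esub> (d (v, w) \<oplus>\<^bsub>F\<^esub> d (v', w)) | v v' w.
        v \<in> carrier V \<and> v' \<in> carrier V \<and> w \<in> carrier W} \<union>
     {d (v, w \<oplus>\<^bsub>W\<^esub> w') \<ominus>\<^bsub>F\<^esub> (d (v, w) \<oplus>\<^bsub>F\<^esub> d (v, w')) | v w w'.
        v \<in> carrier V \<and> w \<in> carrier W \<and> w' \<in> carrier W} \<union>
     {d (c \<odot>\<^bsub>V\<^esub> v, w) \<ominus>\<^bsub>F\<^esub> (c \<odot>\<^bsub>F\<^esub> d (v, w)) | c v w.
        c \<in> carrier k \<and> v \<in> carrier V \<and> w \<in> carrier W} \<union>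
     {d (v, c \<odot>\<^bsub>W\<^esub> w) \<ominus>\<^bsub>F\<^esub> (c \<odot>\<^bsub>F\<^esub> d (v, w)) | c v w.
        c \<in> carrier k \<and> v \<in> carrier V \<and> w \<in> carrier W})"

definition relation_space ::
  "('k, 'r) ring_scheme \<Rightarrow> ('k, 'v, 'm) module_scheme \<Rightarrow> ('k, 'w, 'n) module_scheme \<Rightarrow> ('v \<times> 'w \<Rightarrow> 'k) set"
where
  "relation_space k V W =
     \<Inter>{N. submodule N k (free_space k (carrier V \<times> carrier W)) \<and> bilinearity_relations k V W \<subseteq> N}"

definition tensor ::
  "('k, 'r) ring_scheme \<Rightarrow> ('k, 'v, 'm) module_scheme \<Rightarrow> ('k, 'w, 'n) module_scheme \<Rightarrow>
   ('k, ('v \<times> 'w \<Rightarrow> 'k) set) module"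
where
  "tensor k V W = (let F = free_space k (carrier V \<times> carrier W); N = relation_space k V W in
     \<lparr>carrier = a_rcosets\<^bsub>F\<^esub> N, mult = (\<lambda>_ _. undefined), one = undefined,
      zero = N, add = set_add F, smult = (\<lambda>c K. \<Union>f\<in>K. N +>\<^bsub>F\<^esub> (c \<odot>\<^bsub>F\<^esub> f))\<rparr>)"

definition pure ::
  "('k, 'r) ring_scheme \<Rightarrow> ('k, 'v, 'm) module_scheme \<Rightarrow> ('k, 'w, 'n) module_scheme \<Rightarrow> 'v \<Rightarrow> 'w \<Rightarrow>
   ('v \<times> 'w \<Rightarrow> 'k) set"
where
  "pure k V W v w = relation_space k V W +>\<^bsub>free_space k (carrier V \<times> carrier W)\<^esub> free_gen k (v, w)"

text \<open>\<open>sweedler k U t (\<lambda>a b. \<beta> a b)\<close> is the sum in \<open>U\<close> of the \<open>\<beta> v\<^sub>i w\<^sub>i\<close>, for any writing of \<open>t\<close> as a sum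
  of pure tensors \<open>v\<^sub>i \<otimes> w\<^sub>i\<close>, that is, the value at \<open>t\<close> of the linear map induced by the bilinear map
  \<open>\<beta>\<close>: it does not depend on the representative \<open>f\<close> of the coset \<open>t\<close>. With \<open>t = \<Delta> x\<close> this is
  Sweedler's notation, \<open>a\<close> and \<open>b\<close> standing for \<open>x\<^sub>1\<close> and \<open>x\<^sub>2\<close>.\<close>

definition sweedler ::
  "('k, 'r) ring_scheme \<Rightarrow> ('k, 'u, 'l) module_scheme \<Rightarrow> ('v \<times> 'w \<Rightarrow> 'k) set \<Rightarrow> ('v \<Rightarrow> 'w \<Rightarrow> 'u) \<Rightarrow> 'u"
where
  "sweedler k U t \<beta> =
     the_elem ((\<lambda>f. \<Oplus>\<^bsub>U\<^esub>p\<in>{p. f p \<noteq> \<zero>\<^bsub>k\<^esub>}. f p \<odot>\<^bsub>U\<^esub> \<beta> (fst p) (snd p)) ` t)"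

text \<open>\<open>tensor_map k V' W' f g\<close> is \<open>f \<otimes> g\<close>, where \<open>V'\<close> and \<open>W'\<close> are the codomains of \<open>f\<close> and \<open>g\<close>.\<close>

definition tensor_map ::
  "('k, 'r) ring_scheme \<Rightarrow> ('k, 'c, 'm) module_scheme \<Rightarrow> ('k, 'd, 'n) module_scheme \<Rightarrow>
   ('v \<Rightarrow> 'c) \<Rightarrow> ('w \<Rightarrow> 'd) \<Rightarrow> ('v \<times> 'w \<Rightarrow> 'k) set \<Rightarrow> ('c \<times> 'd \<Rightarrow> 'k) set"
where
  "tensor_map k V' W' f g t = sweedler k (tensor k V' W') t (\<lambda>v w. pure k V' W' (f v) (g w))"

definition tensor_assoc ::
  "('k, 'r) ring_scheme \<Rightarrow> ('k, 'u, 'l) module_scheme \<Rightarrow> ('k, 'v, 'm) module_scheme \<Rightarrow>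
   ('k, 'w, 'n) module_scheme \<Rightarrow> (('u \<times> 'v \<Rightarrow> 'k) set \<times> 'w \<Rightarrow> 'k) set \<Rightarrow>
   ('u \<times> ('v \<times> 'w \<Rightarrow> 'k) set \<Rightarrow> 'k) set"
where
  "tensor_assoc k U V W t = (let T = tensor k U (tensor k V W) in
     sweedler k T t (\<lambda>s w. sweedler k T s (\<lambda>u v. pure k U (tensor k V W) u (pure k V W v w))))"

definition tensor_algebra ::
  "('k, 'r) ring_scheme \<Rightarrow> ('k, 'v, 'm) module_scheme \<Rightarrow> ('k, 'w, 'n) module_scheme \<Rightarrow>
   ('k, ('v \<times> 'w \<Rightarrow> 'k) set) module"
where
  "tensor_algebra k A B = (tensor k A B)
     \<lparr>mult := (\<lambda>s t. sweedler k (tensor k A B) s (\<lambda>a b. sweedler k (tensor k A B) t (\<lambda>a' b'.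
                 pure k A B (a \<otimes>\<^bsub>A\<^esub> a') (b \<otimes>\<^bsub>B\<^esub> b')))),
      one := pure k A B \<one>\<^bsub>A\<^esub> \<one>\<^bsub>B\<^esub>\<rparr>"


section \<open>Cogroupoids\<close>

text \<open>\<open>cocomp C X Y Z\<close> is \<open>\<Delta>\<^sub>X\<^sub>,\<^sub>Y\<close> with upper index \<open>Z\<close>, and \<open>anti C X Y\<close> is \<open>S\<^sub>X\<^sub>,\<^sub>Y\<close>.\<close>

record ('k, 'a, 'o) cogroupoid_data =
  ob :: "'o set"
  alg :: "'o \<Rightarrow> 'o \<Rightarrow> ('k, 'a) module"
  cocomp :: "'o \<Rightarrow> 'o \<Rightarrow> 'o \<Rightarrow> 'a \<Rightarrow> ('a \<times> 'a \<Rightarrow> 'k) set"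
  coun :: "'o \<Rightarrow> 'a \<Rightarrow> 'k"
  anti :: "'o \<Rightarrow> 'o \<Rightarrow> 'a \<Rightarrow> 'a"

locale cocategory =
  fixes k :: "('k, 'r) ring_scheme" and C :: "('k, 'a, 'o) cogroupoid_data"
  assumes alg_algebra: "\<lbrakk>X \<in> ob C; Y \<in> ob C\<rbrakk> \<Longrightarrow> assoc_algebra k (alg C X Y)"
    and cocomp_alg_map: "\<lbrakk>X \<in> ob C; Y \<in> ob C; Z \<in> ob C\<rbrakk> \<Longrightarrow>
      cocomp C X Y Z \<in> alg_maps k (alg C X Y) (tensor_algebra k (alg C X Z) (alg C Z Y))"
    and coun_alg_map: "X \<in> ob C \<Longrightarrow> coun C X \<in> alg_maps k (alg C X X) (base_algebra k)"
    and coassoc: "\<lbrakk>X \<in> ob C; Y \<in> ob C; Z \<in> ob C; T \<in> ob C; a \<in> carrier (alg C X Y)\<rbrakk> \<Longrightarrow>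
      tensor_assoc k (alg C X T) (alg C T Z) (alg C Z Y)
        (tensor_map k (tensor k (alg C X T) (alg C T Z)) (alg C Z Y)
           (cocomp C X Z T) (\<lambda>b. b) (cocomp C X Y Z a)) =
      tensor_map k (alg C X T) (tensor k (alg C T Z) (alg C Z Y))
           (\<lambda>b. b) (cocomp C T Y Z) (cocomp C X Y T a)"
    and coun_right: "\<lbrakk>X \<in> ob C; Y \<in> ob C; a \<in> carrier (alg C X Y)\<rbrakk> \<Longrightarrow>
      sweedler k (alg C X Y) (cocomp C X Y Y a) (\<lambda>b c. coun C Y c \<odot>\<^bsub>alg C X Y\<^esub> b) = a"
    and coun_left: "\<lbrakk>X \<in> ob C; Y \<in> ob C; a \<in> carrier (alg C X Y)\<rbrakk> \<Longrightarrow>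
      sweedler k (alg C X Y) (cocomp C X Y X a) (\<lambda>b c. coun C X b \<odot>\<^bsub>alg C X Y\<^esub> c) = a"

locale cogroupoid = cocategory k C
  for k :: "('k, 'r) ring_scheme" and C :: "('k, 'a, 'o) cogroupoid_data" +
  assumes anti_lin: "\<lbrakk>X \<in> ob C; Y \<in> ob C\<rbrakk> \<Longrightarrow> anti C X Y \<in> lin_maps k (alg C X Y) (alg C Y X)"
    and anti_right: "\<lbrakk>X \<in> ob C; Y \<in> ob C; a \<in> carrier (alg C X X)\<rbrakk> \<Longrightarrow>
      sweedler k (alg C X Y) (cocomp C X X Y a) (\<lambda>b c. b \<otimes>\<^bsub>alg C X Y\<^esub> anti C Y X c) =
      coun C X a \<odot>\<^bsub>alg C X Y\<^esub> \<one>\<^bsub>alg C X Y\<^esub>"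
    and anti_left: "\<lbrakk>X \<in> ob C; Y \<in> ob C; a \<in> carrier (alg C X X)\<rbrakk> \<Longrightarrow>
      sweedler k (alg C Y X) (cocomp C X X Y a) (\<lambda>b c. anti C X Y b \<otimes>\<^bsub>alg C Y X\<^esub> c) =
      coun C X a \<odot>\<^bsub>alg C Y X\<^esub> \<one>\<^bsub>alg C Y X\<^esub>"

definition connected_cogroupoid :: "('k, 'a, 'o) cogroupoid_data \<Rightarrow> bool" where
  "connected_cogroupoid C \<longleftrightarrow> (\<forall>X\<in>ob C. \<forall>Y\<in>ob C. carrier (alg C X Y) \<noteq> {\<zero>\<^bsub>alg C X Y\<^esub>})"


section \<open>Yetter--Drinfeld modules\<close>

record ('k, 'h) hopf_data = "('k, 'h) module" +
  comul :: "'h \<Rightarrow> ('h \<times> 'h \<Rightarrow> 'k) set"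
  counit :: "'h \<Rightarrow> 'k"
  antipode :: "'h \<Rightarrow> 'h"

definition hopf_at :: "('k, 'a, 'o) cogroupoid_data \<Rightarrow> 'o \<Rightarrow> ('k, 'a) hopf_data" where
  "hopf_at C X = module.extend (alg C X X)
     \<lparr>comul = cocomp C X X X, counit = coun C X, antipode = anti C X X\<rparr>"

record ('k, 'h, 'v) yd_data = "('k, 'v) module" +
  ract :: "'v \<Rightarrow> 'h \<Rightarrow> 'v"
  coact :: "'v \<Rightarrow> ('v \<times> 'h \<Rightarrow> 'k) set"

text \<open>In the compatibility condition, \<open>x\<^sub>1 \<otimes> x\<^sub>2 \<otimes> x\<^sub>3\<close> is \<open>(1 \<otimes> \<Delta>) (\<Delta> x)\<close>.\<close>

locale yd_module = module k V
  for k :: "('k, 'r) ring_scheme" and H :: "('k, 'h) hopf_data" and V :: "('k, 'h, 'v) yd_data" +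
  assumes ract_bilin: "ract V \<in> bilin_maps k V H V"
    and ract_one: "v \<in> carrier V \<Longrightarrow> ract V v \<one>\<^bsub>H\<^esub> = v"
    and ract_mult: "\<lbrakk>v \<in> carrier V; x \<in> carrier H; y \<in> carrier H\<rbrakk> \<Longrightarrow>
      ract V v (x \<otimes>\<^bsub>H\<^esub> y) = ract V (ract V v x) y"
    and coact_lin: "coact V \<in> lin_maps k V (tensor k V H)"
    and coact_coassoc: "v \<in> carrier V \<Longrightarrow>
      tensor_assoc k V H H (tensor_map k (tensor k V H) H (coact V) (\<lambda>x. x) (coact V v)) =
      tensor_map k V (tensor k H H) (\<lambda>u. u) (comul H) (coact V v)"
    and coact_counit: "v \<in> carrier V \<Longrightarrow>
      sweedler k V (coact V v) (\<lambda>v0 v1. counit H v1 \<odot>\<^bsub>V\<^esub> v0) = v"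
    and yd_condition: "\<lbrakk>v \<in> carrier V; x \<in> carrier H\<rbrakk> \<Longrightarrow>
      coact V (ract V v x) =
      sweedler k (tensor k V H) (coact V v) (\<lambda>v0 v1.
        sweedler k (tensor k V H) (comul H x) (\<lambda>x1 x'.
          sweedler k (tensor k V H) (comul H x') (\<lambda>x2 x3.
            pure k V H (ract V v0 x2) (antipode H x1 \<otimes>\<^bsub>H\<^esub> v1 \<otimes>\<^bsub>H\<^esub> x3))))"

definition yd_maps ::
  "('k, 'r) ring_scheme \<Rightarrow> ('k, 'h) hopf_data \<Rightarrow> ('k, 'h, 'v) yd_data \<Rightarrow> ('k, 'h, 'w) yd_data \<Rightarrow>
   ('v \<Rightarrow> 'w) set"
where
  "yd_maps k H V W = {f \<in> lin_maps k V W.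
     (\<forall>v\<in>carrier V. \<forall>x\<in>carrier H. f (ract V v x) = ract W (f v) x) \<and>
     (\<forall>v\<in>carrier V. coact W (f v) = tensor_map k W H f (\<lambda>x. x) (coact V v))}"

definition yd_unit :: "('k, 'r) ring_scheme \<Rightarrow> ('k, 'h) hopf_data \<Rightarrow> ('k, 'h, 'k) yd_data" where
  "yd_unit k H = module.extend (base_algebra k)
     \<lparr>ract = (\<lambda>c x. c \<otimes>\<^bsub>k\<^esub> counit H x), coact = (\<lambda>c. pure k (base_algebra k) H c \<one>\<^bsub>H\<^esub>)\<rparr>"

definition yd_tensor ::
  "('k, 'r) ring_scheme \<Rightarrow> ('k, 'h) hopf_data \<Rightarrow> ('k, 'h, 'v) yd_data \<Rightarrow> ('k, 'h, 'w) yd_data \<Rightarrow>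
   ('k, 'h, ('v \<times> 'w \<Rightarrow> 'k) set) yd_data"
where
  "yd_tensor k H V W = module.extend (tensor k V W)
     \<lparr>ract = (\<lambda>t x. sweedler k (tensor k V W) (comul H x) (\<lambda>x1 x2.
         tensor_map k V W (\<lambda>v. ract V v x1) (\<lambda>w. ract W w x2) t)),
      coact = (\<lambda>t. let T = tensor k (tensor k V W) H in
         sweedler k T t (\<lambda>v w. sweedler k T (coact V v) (\<lambda>v0 v1. sweedler k T (coact W w) (\<lambda>w0 w1.
           pure k (tensor k V W) H (pure k V W v0 w0) (v1 \<otimes>\<^bsub>H\<^esub> w1)))))\<rparr>"


section \<open>The cotensor product with \<open>\<C>(X,Y)\<close>\<close>

definition cotensor ::
  "('k, 'r) ring_scheme \<Rightarrow> ('k, 'h, 'p) module_scheme \<Rightarrow> ('k, 'v, 'm) module_scheme \<Rightarrow>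
   ('v \<Rightarrow> ('v \<times> 'h \<Rightarrow> 'k) set) \<Rightarrow> ('k, 'w, 'n) module_scheme \<Rightarrow> ('w \<Rightarrow> ('h \<times> 'w \<Rightarrow> 'k) set) \<Rightarrow>
   ('k, ('v \<times> 'w \<Rightarrow> 'k) set) module"
where
  "cotensor k H V \<alpha> W \<beta> = (tensor k V W)
     \<lparr>carrier := a_kernel (tensor k V W) (tensor k V (tensor k H W))
        (\<lambda>t. tensor_assoc k V H W (tensor_map k (tensor k V H) W \<alpha> (\<lambda>w. w) t)
             \<ominus>\<^bsub>tensor k V (tensor k H W)\<^esub> tensor_map k V (tensor k H W) (\<lambda>v. v) \<beta> t)\<rparr>"

text \<open>The action is that of \<open>b\<^sub>1 \<otimes> b\<^sub>2 \<otimes> b\<^sub>3 \<in> \<C>(Y,X) \<otimes> \<C>(X,X) \<otimes> \<C>(X,Y)\<close>. The coaction at \<open>t\<close> is the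
  element \<open>u\<close> of \<open>(V \<box> \<C>(X,Y)) \<otimes> \<C>(Y,Y)\<close> that the (injective) linear map induced by the inclusion
  of \<open>V \<box> \<C>(X,Y)\<close> in \<open>V \<otimes> \<C>(X,Y)\<close> sends to \<open>(1 \<otimes> \<Delta>) t\<close>.\<close>

definition cotensor_yd ::
  "('k, 'r) ring_scheme \<Rightarrow> ('k, 'a, 'o) cogroupoid_data \<Rightarrow> 'o \<Rightarrow> 'o \<Rightarrow> ('k, 'a, 'v) yd_data \<Rightarrow>
   ('k, 'a, ('v \<times> 'a \<Rightarrow> 'k) set) yd_data"
where
  "cotensor_yd k C X Y V =
    (let A = alg C X Y; B = alg C Y Y;
         M = cotensor k (alg C X X) V (coact V) A (cocomp C X Y X)
     in module.extend M
       \<lparr>ract = (\<lambda>t b. sweedler k (tensor k V A) (cocomp C Y Y X b) (\<lambda>b1 b'.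
           sweedler k (tensor k V A) (cocomp C X Y X b') (\<lambda>b2 b3.
             tensor_map k V A (\<lambda>v. ract V v b2) (\<lambda>a. anti C Y X b1 \<otimes>\<^bsub>A\<^esub> a \<otimes>\<^bsub>A\<^esub> b3) t))),
        coact = (\<lambda>t. THE u. u \<in> carrier (tensor k M B) \<and>
           tensor_assoc k V A B (tensor_map k (tensor k V A) B (\<lambda>s. s) (\<lambda>b. b) u) =
           tensor_map k V (tensor k A B) (\<lambda>v. v) (cocomp C X Y Y) t)\<rparr>)"


section \<open>\<open>k\<close>-linear monoidal categories\<close>

text \<open>Hom-sets are given as modules. In \<open>mcomp D A B E g f\<close>, the morphisms are \<open>f : A \<rightarrow> B\<close> and
  \<open>g : B \<rightarrow> E\<close>; in \<open>tmor D A A' B B' f g\<close>, they are \<open>f : A \<rightarrow> A'\<close> and \<open>g : B \<rightarrow> B'\<close>.\<close>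

record ('k, 'x, 'm) moncat_data =
  objs :: "'x set"
  hom_sp :: "'x \<Rightarrow> 'x \<Rightarrow> ('k, 'm) module"
  ident :: "'x \<Rightarrow> 'm"
  mcomp :: "'x \<Rightarrow> 'x \<Rightarrow> 'x \<Rightarrow> 'm \<Rightarrow> 'm \<Rightarrow> 'm"
  tunit :: "'x"
  tobj :: "'x \<Rightarrow> 'x \<Rightarrow> 'x"
  tmor :: "'x \<Rightarrow> 'x \<Rightarrow> 'x \<Rightarrow> 'x \<Rightarrow> 'm \<Rightarrow> 'm \<Rightarrow> 'm"
  assoc :: "'x \<Rightarrow> 'x \<Rightarrow> 'x \<Rightarrow> 'm"
  lunit :: "'x \<Rightarrow> 'm"
  runit :: "'x \<Rightarrow> 'm"

abbreviation homs :: "('k, 'x, 'm) moncat_data \<Rightarrow> 'x \<Rightarrow> 'x \<Rightarrow> 'm set" where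
  "homs D A B \<equiv> carrier (hom_sp D A B)"

definition iso_mor :: "('k, 'x, 'm) moncat_data \<Rightarrow> 'x \<Rightarrow> 'x \<Rightarrow> 'm \<Rightarrow> bool" where
  "iso_mor D A B f \<longleftrightarrow> f \<in> homs D A B \<and>
     (\<exists>g\<in>homs D B A. mcomp D A B A g f = ident D A \<and> mcomp D B A B f g = ident D B)"

locale klinear_category =
  fixes k :: "('k, 'r) ring_scheme" and D :: "('k, 'x, 'm) moncat_data"
  assumes hom_module: "\<lbrakk>A \<in> objs D; B \<in> objs D\<rbrakk> \<Longrightarrow> module k (hom_sp D A B)"
    and ident_hom: "A \<in> objs D \<Longrightarrow> ident D A \<in> homs D A A"
    and mcomp_bilin: "\<lbrakk>A \<in> objs D; B \<in> objs D; E \<in> objs D\<rbrakk> \<Longrightarrow>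
      mcomp D A B E \<in> bilin_maps k (hom_sp D B E) (hom_sp D A B) (hom_sp D A E)"
    and ident_left: "\<lbrakk>A \<in> objs D; B \<in> objs D; f \<in> homs D A B\<rbrakk> \<Longrightarrow> mcomp D A B B (ident D B) f = f"
    and ident_right: "\<lbrakk>A \<in> objs D; B \<in> objs D; f \<in> homs D A B\<rbrakk> \<Longrightarrow> mcomp D A A B f (ident D A) = f"
    and mcomp_assoc: "\<lbrakk>A \<in> objs D; B \<in> objs D; E \<in> objs D; G \<in> objs D;
        f \<in> homs D A B; g \<in> homs D B E; h \<in> homs D E G\<rbrakk> \<Longrightarrow>
      mcomp D A E G h (mcomp D A B E g f) = mcomp D A B G (mcomp D B E G h g) f"

locale klinear_monoidal_category = klinear_category k D
  for k :: "('k, 'r) ring_scheme" and D :: "('k, 'x, 'm) moncat_data" +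
  assumes tunit_obj: "tunit D \<in> objs D"
    and tobj_obj: "\<lbrakk>A \<in> objs D; B \<in> objs D\<rbrakk> \<Longrightarrow> tobj D A B \<in> objs D"
    and tmor_bilin: "\<lbrakk>A \<in> objs D; A' \<in> objs D; B \<in> objs D; B' \<in> objs D\<rbrakk> \<Longrightarrow>
      tmor D A A' B B' \<in>
        bilin_maps k (hom_sp D A A') (hom_sp D B B') (hom_sp D (tobj D A B) (tobj D A' B'))"
    and tmor_ident: "\<lbrakk>A \<in> objs D; B \<in> objs D\<rbrakk> \<Longrightarrow>
      tmor D A A B B (ident D A) (ident D B) = ident D (tobj D A B)"
    and tmor_mcomp: "\<lbrakk>A \<in> objs D; A' \<in> objs D; A'' \<in> objs D; B \<in> objs D; B' \<in> objs D; B'' \<in> objs D;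
        f \<in> homs D A A'; f' \<in> homs D A' A''; g \<in> homs D B B'; g' \<in> homs D B' B''\<rbrakk> \<Longrightarrow>
      tmor D A A'' B B'' (mcomp D A A' A'' f' f) (mcomp D B B' B'' g' g) =
      mcomp D (tobj D A B) (tobj D A' B') (tobj D A'' B'')
        (tmor D A' A'' B' B'' f' g') (tmor D A A' B B' f g)"
    and assoc_iso: "\<lbrakk>A \<in> objs D; B \<in> objs D; E \<in> objs D\<rbrakk> \<Longrightarrow>
      iso_mor D (tobj D (tobj D A B) E) (tobj D A (tobj D B E)) (assoc D A B E)"
    and assoc_natural: "\<lbrakk>A \<in> objs D; A' \<in> objs D; B \<in> objs D; B' \<in> objs D; E \<in> objs D; E' \<in> objs D;
        f \<in> homs D A A'; g \<in> homs D B B'; h \<in> homs D E E'\<rbrakk> \<Longrightarrow>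
      mcomp D (tobj D (tobj D A B) E) (tobj D (tobj D A' B') E') (tobj D A' (tobj D B' E'))
        (assoc D A' B' E')
        (tmor D (tobj D A B) (tobj D A' B') E E' (tmor D A A' B B' f g) h) =
      mcomp D (tobj D (tobj D A B) E) (tobj D A (tobj D B E)) (tobj D A' (tobj D B' E'))
        (tmor D A A' (tobj D B E) (tobj D B' E') f (tmor D B B' E E' g h))
        (assoc D A B E)"
    and lunit_iso: "A \<in> objs D \<Longrightarrow> iso_mor D (tobj D (tunit D) A) A (lunit D A)"
    and lunit_natural: "\<lbrakk>A \<in> objs D; B \<in> objs D; f \<in> homs D A B\<rbrakk> \<Longrightarrow>
      mcomp D (tobj D (tunit D) A) (tobj D (tunit D) B) B
        (lunit D B) (tmor D (tunit D) (tunit D) A B (ident D (tunit D)) f) =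
      mcomp D (tobj D (tunit D) A) A B f (lunit D A)"
    and runit_iso: "A \<in> objs D \<Longrightarrow> iso_mor D (tobj D A (tunit D)) A (runit D A)"
    and runit_natural: "\<lbrakk>A \<in> objs D; B \<in> objs D; f \<in> homs D A B\<rbrakk> \<Longrightarrow>
      mcomp D (tobj D A (tunit D)) (tobj D B (tunit D)) B
        (runit D B) (tmor D A B (tunit D) (tunit D) f (ident D (tunit D))) =
      mcomp D (tobj D A (tunit D)) A B f (runit D A)"
    and pentagon: "\<lbrakk>A \<in> objs D; B \<in> objs D; E \<in> objs D; G \<in> objs D\<rbrakk> \<Longrightarrow>
      mcomp D (tobj D (tobj D (tobj D A B) E) G) (tobj D (tobj D A B) (tobj D E G))
          (tobj D A (tobj D B (tobj D E G)))
        (assoc D A B (tobj D E G)) (assoc D (tobj D A B) E G) =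
      mcomp D (tobj D (tobj D (tobj D A B) E) G) (tobj D A (tobj D (tobj D B E) G))
          (tobj D A (tobj D B (tobj D E G)))
        (tmor D A A (tobj D (tobj D B E) G) (tobj D B (tobj D E G)) (ident D A) (assoc D B E G))
        (mcomp D (tobj D (tobj D (tobj D A B) E) G) (tobj D (tobj D A (tobj D B E)) G)
            (tobj D A (tobj D (tobj D B E) G))
          (assoc D A (tobj D B E) G)
          (tmor D (tobj D (tobj D A B) E) (tobj D A (tobj D B E)) G G
             (assoc D A B E) (ident D G)))"
    and triangle: "\<lbrakk>A \<in> objs D; B \<in> objs D\<rbrakk> \<Longrightarrow>
      mcomp D (tobj D (tobj D A (tunit D)) B) (tobj D A (tobj D (tunit D) B)) (tobj D A B)
        (tmor D A A (tobj D (tunit D) B) B (ident D A) (lunit D B)) (assoc D A (tunit D) B) =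
      tmor D (tobj D A (tunit D)) A B B (runit D A) (ident D B)"

text \<open>\<open>Fm A B\<close> is the action of the functor on the morphisms from \<open>A\<close> to \<open>B\<close>.\<close>

locale klinear_functor =
  fixes k :: "('k, 'r) ring_scheme"
    and D :: "('k, 'x, 'm) moncat_data" and E :: "('k, 'y, 'n) moncat_data"
    and Fo :: "'x \<Rightarrow> 'y" and Fm :: "'x \<Rightarrow> 'x \<Rightarrow> 'm \<Rightarrow> 'n"
  assumes Fo_obj: "A \<in> objs D \<Longrightarrow> Fo A \<in> objs E"
    and Fm_lin: "\<lbrakk>A \<in> objs D; B \<in> objs D\<rbrakk> \<Longrightarrow>
      Fm A B \<in> lin_maps k (hom_sp D A B) (hom_sp E (Fo A) (Fo B))"
    and Fm_ident: "A \<in> objs D \<Longrightarrow> Fm A A (ident D A) = ident E (Fo A)"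
    and Fm_mcomp: "\<lbrakk>A \<in> objs D; B \<in> objs D; G \<in> objs D; f \<in> homs D A B; g \<in> homs D B G\<rbrakk> \<Longrightarrow>
      Fm A G (mcomp D A B G g f) = mcomp E (Fo A) (Fo B) (Fo G) (Fm B G g) (Fm A B f)"

definition natural_iso ::
  "('k, 'x, 'm) moncat_data \<Rightarrow> ('k, 'y, 'n) moncat_data \<Rightarrow> ('x \<Rightarrow> 'y) \<Rightarrow> ('x \<Rightarrow> 'x \<Rightarrow> 'm \<Rightarrow> 'n) \<Rightarrow>
   ('x \<Rightarrow> 'y) \<Rightarrow> ('x \<Rightarrow> 'x \<Rightarrow> 'm \<Rightarrow> 'n) \<Rightarrow> ('x \<Rightarrow> 'n) \<Rightarrow> bool"
where
  "natural_iso D E Fo Fm Go Gm \<tau> \<longleftrightarrow>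
     (\<forall>A\<in>objs D. iso_mor E (Fo A) (Go A) (\<tau> A)) \<and>
     (\<forall>A\<in>objs D. \<forall>B\<in>objs D. \<forall>f\<in>homs D A B.
        mcomp E (Fo A) (Fo B) (Go B) (\<tau> B) (Fm A B f) = mcomp E (Fo A) (Go A) (Go B) (Gm A B f) (\<tau> A))"

definition klinear_equivalence ::
  "('k, 'r) ring_scheme \<Rightarrow> ('k, 'x, 'm) moncat_data \<Rightarrow> ('k, 'y, 'n) moncat_data \<Rightarrow>
   ('x \<Rightarrow> 'y) \<Rightarrow> ('x \<Rightarrow> 'x \<Rightarrow> 'm \<Rightarrow> 'n) \<Rightarrow> bool"
where
  "klinear_equivalence k D E Fo Fm \<longleftrightarrow>
     klinear_functor k D E Fo Fm \<and>
     (\<exists>Go Gm \<sigma> \<tau>. klinear_functor k E D Go Gm \<and>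
        natural_iso D D (\<lambda>A. A) (\<lambda>A B f. f)
          (\<lambda>A. Go (Fo A)) (\<lambda>A B f. Gm (Fo A) (Fo B) (Fm A B f)) \<sigma> \<and>
        natural_iso E E (\<lambda>A. Fo (Go A)) (\<lambda>A B f. Fm (Go A) (Go B) (Gm A B f))
          (\<lambda>A. A) (\<lambda>A B f. f) \<tau>)"

text \<open>Strong monoidal functors, with constraints \<open>\<mu> A B : F A \<otimes> F B \<rightarrow> F (A \<otimes> B)\<close> and \<open>\<eta> : I \<rightarrow> F I\<close>.\<close>

locale monoidal_constraints =
  fixes D :: "('k, 'x, 'm) moncat_data" and E :: "('k, 'y, 'n) moncat_data"
    and Fo :: "'x \<Rightarrow> 'y" and Fm :: "'x \<Rightarrow> 'x \<Rightarrow> 'm \<Rightarrow> 'n"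
    and \<mu> :: "'x \<Rightarrow> 'x \<Rightarrow> 'n" and \<eta> :: "'n"
  assumes eta_iso: "iso_mor E (tunit E) (Fo (tunit D)) \<eta>"
    and mu_iso: "\<lbrakk>A \<in> objs D; B \<in> objs D\<rbrakk> \<Longrightarrow>
      iso_mor E (tobj E (Fo A) (Fo B)) (Fo (tobj D A B)) (\<mu> A B)"
    and mu_natural: "\<lbrakk>A \<in> objs D; A' \<in> objs D; B \<in> objs D; B' \<in> objs D;
        f \<in> homs D A A'; g \<in> homs D B B'\<rbrakk> \<Longrightarrow>
      mcomp E (tobj E (Fo A) (Fo B)) (tobj E (Fo A') (Fo B')) (Fo (tobj D A' B'))
        (\<mu> A' B') (tmor E (Fo A) (Fo A') (Fo B) (Fo B') (Fm A A' f) (Fm B B' g)) =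
      mcomp E (tobj E (Fo A) (Fo B)) (Fo (tobj D A B)) (Fo (tobj D A' B'))
        (Fm (tobj D A B) (tobj D A' B') (tmor D A A' B B' f g)) (\<mu> A B)"
    and mu_assoc: "\<lbrakk>A \<in> objs D; B \<in> objs D; G \<in> objs D\<rbrakk> \<Longrightarrow>
      mcomp E (tobj E (tobj E (Fo A) (Fo B)) (Fo G)) (Fo (tobj D (tobj D A B) G))
          (Fo (tobj D A (tobj D B G)))
        (Fm (tobj D (tobj D A B) G) (tobj D A (tobj D B G)) (assoc D A B G))
        (mcomp E (tobj E (tobj E (Fo A) (Fo B)) (Fo G)) (tobj E (Fo (tobj D A B)) (Fo G))
            (Fo (tobj D (tobj D A B) G))
          (\<mu> (tobj D A B) G)
          (tmor E (tobj E (Fo A) (Fo B)) (Fo (tobj D A B)) (Fo G) (Fo G)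
             (\<mu> A B) (ident E (Fo G)))) =
      mcomp E (tobj E (tobj E (Fo A) (Fo B)) (Fo G)) (tobj E (Fo A) (Fo (tobj D B G)))
          (Fo (tobj D A (tobj D B G)))
        (\<mu> A (tobj D B G))
        (mcomp E (tobj E (tobj E (Fo A) (Fo B)) (Fo G)) (tobj E (Fo A) (tobj E (Fo B) (Fo G)))
            (tobj E (Fo A) (Fo (tobj D B G)))
          (tmor E (Fo A) (Fo A) (tobj E (Fo B) (Fo G)) (Fo (tobj D B G))
             (ident E (Fo A)) (\<mu> B G))
          (assoc E (Fo A) (Fo B) (Fo G)))"
    and mu_lunit: "A \<in> objs D \<Longrightarrow>
      mcomp E (tobj E (tunit E) (Fo A)) (Fo (tobj D (tunit D) A)) (Fo A)
        (Fm (tobj D (tunit D) A) A (lunit D A))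
        (mcomp E (tobj E (tunit E) (Fo A)) (tobj E (Fo (tunit D)) (Fo A))
            (Fo (tobj D (tunit D) A))
          (\<mu> (tunit D) A)
          (tmor E (tunit E) (Fo (tunit D)) (Fo A) (Fo A) \<eta> (ident E (Fo A)))) =
      lunit E (Fo A)"
    and mu_runit: "A \<in> objs D \<Longrightarrow>
      mcomp E (tobj E (Fo A) (tunit E)) (Fo (tobj D A (tunit D))) (Fo A)
        (Fm (tobj D A (tunit D)) A (runit D A))
        (mcomp E (tobj E (Fo A) (tunit E)) (tobj E (Fo A) (Fo (tunit D)))
            (Fo (tobj D A (tunit D)))
          (\<mu> A (tunit D))
          (tmor E (Fo A) (Fo A) (tunit E) (Fo (tunit D)) (ident E (Fo A)) \<eta>)) =
      runit E (Fo A)"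

text \<open>As usual, an equivalence of monoidal categories is a strong monoidal functor that is an equivalence
  of the underlying (\<open>k\<close>-linear) categories; a quasi-inverse then inherits a monoidal structure.\<close>

definition klinear_monoidal_equivalence ::
  "('k, 'r) ring_scheme \<Rightarrow> ('k, 'x, 'm) moncat_data \<Rightarrow> ('k, 'y, 'n) moncat_data \<Rightarrow>
   ('x \<Rightarrow> 'y) \<Rightarrow> ('x \<Rightarrow> 'x \<Rightarrow> 'm \<Rightarrow> 'n) \<Rightarrow> ('x \<Rightarrow> 'x \<Rightarrow> 'n) \<Rightarrow> 'n \<Rightarrow> bool"
where
  "klinear_monoidal_equivalence k D E Fo Fm \<mu> \<eta> \<longleftrightarrow>
     klinear_monoidal_category k D \<and> klinear_monoidal_category k E \<and>
     monoidal_constraints D E Fo Fm \<mu> \<eta> \<and> klinear_equivalence k D E Fo Fm"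


section \<open>The category of Yetter--Drinfeld modules\<close>

text \<open>The objects of the category are the Yetter--Drinfeld modules whose underlying set is a subset of
  a type \<open>'u\<close>, which plays the role of the universe of sets. Tensor products, cotensor products and the
  unit object live on other types; they are transported to \<open>'u\<close> along an arbitrary injection \<open>enc M\<close> of
  their carrier, which exists when \<open>'u\<close> is infinite and at least as large as the field and the algebras
  involved.\<close>

definition enc :: "('k, 'h, 'x) yd_data \<Rightarrow> 'x \<Rightarrow> 'u" where
  "enc M = (SOME g. inj_on g (carrier M))"

definition dec :: "('k, 'h, 'x) yd_data \<Rightarrow> 'u \<Rightarrow> 'x" where
  "dec M = inv_into (carrier M) (enc M)"

definition pack ::
  "('k, 'r) ring_scheme \<Rightarrow> ('k, 'h) hopf_data \<Rightarrow> ('k, 'h, 'x) yd_data \<Rightarrow> ('k, 'h, 'u) yd_data"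
where
  "pack k H M =
    (let P = \<lparr>carrier = enc M ` carrier M, mult = (\<lambda>_ _. undefined), one = undefined,
              zero = enc M \<zero>\<^bsub>M\<^esub>, add = (\<lambda>x y. enc M (dec M x \<oplus>\<^bsub>M\<^esub> dec M y)),
              smult = (\<lambda>c x. enc M (c \<odot>\<^bsub>M\<^esub> dec M x))\<rparr>
     in module.extend P
       \<lparr>ract = (\<lambda>x h. enc M (ract M (dec M x) h)),
        coact = (\<lambda>x. tensor_map k P H (enc M) (\<lambda>h. h) (coact M (dec M x)))\<rparr>)"

definition yd_hom_space ::
  "('k, 'r) ring_scheme \<Rightarrow> ('k, 'h) hopf_data \<Rightarrow> ('k, 'h, 'v) yd_data \<Rightarrow> ('k, 'h, 'w) yd_data \<Rightarrow>
   ('k, 'v \<Rightarrow> 'w) module"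
where
  "yd_hom_space k H V W = \<lparr>
     carrier = yd_maps k H V W \<inter> extensional (carrier V),
     mult = (\<lambda>_ _. undefined), one = undefined,
     zero = (\<lambda>v\<in>carrier V. \<zero>\<^bsub>W\<^esub>), add = (\<lambda>f g. \<lambda>v\<in>carrier V. f v \<oplus>\<^bsub>W\<^esub> g v),
     smult = (\<lambda>c f. \<lambda>v\<in>carrier V. c \<odot>\<^bsub>W\<^esub> f v)\<rparr>"

definition yd_tobj ::
  "('k, 'r) ring_scheme \<Rightarrow> ('k, 'h) hopf_data \<Rightarrow> ('k, 'h, 'u) yd_data \<Rightarrow> ('k, 'h, 'u) yd_data \<Rightarrow>
   ('k, 'h, 'u) yd_data"
where
  "yd_tobj k H V W = pack k H (yd_tensor k H V W)"

definition yd_tunit :: "('k, 'r) ring_scheme \<Rightarrow> ('k, 'h) hopf_data \<Rightarrow> ('k, 'h, 'u) yd_data" where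
  "yd_tunit k H = pack k H (yd_unit k H)"

text \<open>\<open>yd_pure k H V W v w\<close> is \<open>v \<otimes> w\<close> as an element of the object \<open>yd_tobj k H V W\<close>, and
  \<open>yd_sweedler k H V W U x \<beta>\<close> is the sum of the \<open>\<beta> v\<^sub>i w\<^sub>i\<close> in \<open>U\<close> for an element \<open>x\<close> of that object.\<close>

definition yd_pure ::
  "('k, 'r) ring_scheme \<Rightarrow> ('k, 'h) hopf_data \<Rightarrow> ('k, 'h, 'u) yd_data \<Rightarrow> ('k, 'h, 'u) yd_data \<Rightarrow>
   'u \<Rightarrow> 'u \<Rightarrow> 'u"
where
  "yd_pure k H V W v w = enc (yd_tensor k H V W) (pure k V W v w)"

definition yd_sweedler ::
  "('k, 'r) ring_scheme \<Rightarrow> ('k, 'h) hopf_data \<Rightarrow> ('k, 'h, 'u) yd_data \<Rightarrow> ('k, 'h, 'u) yd_data \<Rightarrow>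
   ('k, 'w, 'n) module_scheme \<Rightarrow> 'u \<Rightarrow> ('u \<Rightarrow> 'u \<Rightarrow> 'w) \<Rightarrow> 'w"
where
  "yd_sweedler k H V W U x \<beta> = sweedler k U (dec (yd_tensor k H V W) x) \<beta>"

definition YD ::
  "('k, 'r) ring_scheme \<Rightarrow> ('k, 'h) hopf_data \<Rightarrow> ('k, ('k, 'h, 'u) yd_data, 'u \<Rightarrow> 'u) moncat_data"
where
  "YD k H = \<lparr>
     objs = {V. yd_module k H V},
     hom_sp = yd_hom_space k H,
     ident = (\<lambda>V. \<lambda>v\<in>carrier V. v),
     mcomp = (\<lambda>V W U g f. compose (carrier V) g f),
     tunit = yd_tunit k H,
     tobj = yd_tobj k H,
     tmor = (\<lambda>V V' W W' f g. \<lambda>x\<in>carrier (yd_tobj k H V W).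
        yd_sweedler k H V W (yd_tobj k H V' W') x (\<lambda>v w. yd_pure k H V' W' (f v) (g w))),
     assoc = (\<lambda>U V W. \<lambda>x\<in>carrier (yd_tobj k H (yd_tobj k H U V) W).
        let T = yd_tobj k H U (yd_tobj k H V W) in
        yd_sweedler k H (yd_tobj k H U V) W T x (\<lambda>s w. yd_sweedler k H U V T s (\<lambda>u v.
          yd_pure k H U (yd_tobj k H V W) u (yd_pure k H V W v w)))),
     lunit = (\<lambda>V. \<lambda>x\<in>carrier (yd_tobj k H (yd_tunit k H) V).
        yd_sweedler k H (yd_tunit k H) V V x (\<lambda>c v. dec (yd_unit k H) c \<odot>\<^bsub>V\<^esub> v)),
     runit = (\<lambda>V. \<lambda>x\<in>carrier (yd_tobj k H V (yd_tunit k H)).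
        yd_sweedler k H V (yd_tunit k H) V x (\<lambda>v c. dec (yd_unit k H) c \<odot>\<^bsub>V\<^esub> v))\<rparr>"


section \<open>The functor \<open>V \<mapsto> V \<box> \<C>(X,Y)\<close>\<close>

definition cot_obj ::
  "('k, 'r) ring_scheme \<Rightarrow> ('k, 'a, 'o) cogroupoid_data \<Rightarrow> 'o \<Rightarrow> 'o \<Rightarrow>
   ('k, 'a, 'u) yd_data \<Rightarrow> ('k, 'a, 'u) yd_data"
where
  "cot_obj k C X Y V = pack k (hopf_at C Y) (cotensor_yd k C X Y V)"

definition cot_mor ::
  "('k, 'r) ring_scheme \<Rightarrow> ('k, 'a, 'o) cogroupoid_data \<Rightarrow> 'o \<Rightarrow> 'o \<Rightarrow>
   ('k, 'a, 'u) yd_data \<Rightarrow> ('k, 'a, 'u) yd_data \<Rightarrow> ('u \<Rightarrow> 'u) \<Rightarrow> 'u \<Rightarrow> 'u"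
where
  "cot_mor k C X Y V W f = (\<lambda>x\<in>carrier (cot_obj k C X Y V).
     enc (cotensor_yd k C X Y W)
       (tensor_map k W (alg C X Y) f (\<lambda>a. a) (dec (cotensor_yd k C X Y V) x)))"

definition cot_mu ::
  "('k, 'r) ring_scheme \<Rightarrow> ('k, 'a, 'o) cogroupoid_data \<Rightarrow> 'o \<Rightarrow> 'o \<Rightarrow>
   ('k, 'a, 'u) yd_data \<Rightarrow> ('k, 'a, 'u) yd_data \<Rightarrow> 'u \<Rightarrow> 'u"
where
  "cot_mu k C X Y V W =
    (let HX = hopf_at C X; HY = hopf_at C Y; A = alg C X Y;
         FV = cot_obj k C X Y V; FW = cot_obj k C X Y W;
         VW = yd_tobj k HX V W; T = tensor k VW A
     in (\<lambda>x\<in>carrier (yd_tobj k HY FV FW). enc (cotensor_yd k C X Y VW)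
       (yd_sweedler k HY FV FW T x (\<lambda>s t.
          sweedler k T (dec (cotensor_yd k C X Y V) s) (\<lambda>v a.
            sweedler k T (dec (cotensor_yd k C X Y W) t) (\<lambda>w b.
              pure k VW A (yd_pure k HX V W v w) (a \<otimes>\<^bsub>A\<^esub> b)))))))"

definition cot_eta ::
  "('k, 'r) ring_scheme \<Rightarrow> ('k, 'a, 'o) cogroupoid_data \<Rightarrow> 'o \<Rightarrow> 'o \<Rightarrow> 'u \<Rightarrow> 'u"
where
  "cot_eta k C X Y =
    (let HX = hopf_at C X; HY = hopf_at C Y; A = alg C X Y; I = yd_tunit k HX :: ('k, 'a, 'u) yd_data
     in (\<lambda>c\<in>carrier (yd_tunit k HY). enc (cotensor_yd k C X Y I)
       (dec (yd_unit k HY) c \<odot>\<^bsub>tensor k I A\<^esub> pure k I A (enc (yd_unit k HX) \<one>\<^bsub>k\<^esub>) \<one>\<^bsub>A\<^esub>)))"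

end

theory Submission
  imports Defs "HOL-Algebra.Free_Abelian_Groups"
begin

text \<open>
  Why the theorem is true. The comultiplications \<open>\<C>(X,X) \<rightarrow> \<C>(X,Y) \<otimes> \<C>(Y,X)\<close> and the antipodes make
  \<open>\<C>(Y,X)\<close> inverse to \<open>\<C>(X,Y)\<close> for the cotensor product, so the functor \<open>F V = V \<box> \<C>(X,Y)\<close> should be
  inverted by the same construction with \<open>X\<close> and \<open>Y\<close> exchanged. The comparison map is
  \<open>\<sigma> v = v\<^sub>0 \<otimes> v\<^sub>1 \<otimes> v\<^sub>2\<close>, from \<open>V\<close> to \<open>(V \<box> \<C>(X,Y)) \<box> \<C>(Y,X)\<close>. Choose a linear functional \<open>\<omega>\<close> on
  \<open>\<C>(X,Y)\<close> with \<open>\<omega> 1 = 1\<close>, which exists as \<open>\<C>(X,Y)\<close> is not zero; then \<open>v \<otimes> a \<otimes> b \<mapsto> \<omega> (a S(b)) v\<close> is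
  inverse to \<open>\<sigma>\<close> (\<open>sig_bij\<close>). For one side of this, \<open>v\<^sub>1 S(v\<^sub>2)\<close> collapses to \<open>\<epsilon>\<close>; for the other, the equations
  that define the two cotensor products move all comultiplications onto \<open>b\<close>, where they collapse too.

  \<open>F\<close> is monoidal because \<open>(v \<otimes> a) \<otimes> (w \<otimes> b) \<mapsto> v \<otimes> w \<otimes> a b\<close> has the inverse
  \<open>v \<otimes> w \<otimes> c \<mapsto> (v\<^sub>0 \<otimes> v\<^sub>1) \<otimes> (w \<otimes> S(v\<^sub>2) c)\<close> on cotensor products (\<open>cot_mu_iso\<close>), and because an element \<open>a\<close> of
  \<open>\<C>(X,Y)\<close> with \<open>a\<^sub>1 \<otimes> a\<^sub>2 = 1 \<otimes> a\<close> is the scalar \<open>\<omega> a\<close> (\<open>cot_eta_iso\<close>). Coherence is checked on pure tensors.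

  That \<open>F V\<close> is a Yetter--Drinfeld module (\<open>cN_yd\<close>) and that \<open>\<sigma>\<close> and the monoidal constraint are linear over the
  algebras rests on two identities for expressions \<open>S(x\<^sub>1) y x\<^sub>3\<close>: \<open>sw_adjoint_cancel\<close> for products and
  \<open>sw_adjoint_comult\<close> for the comultiplication; the latter rests on \<open>S\<close> reversing
  comultiplications (\<open>anti_comult\<close>), as it reverses products (\<open>anti_mult\<close>).

  Over a field, tensoring is exact. This is used in one form only: \<open>V \<box> \<C>(X,Y)\<close> is the image of a linear
  projection of \<open>V \<otimes> \<C>(X,Y)\<close> whose tensor product with the identity of any space \<open>B\<close> fixes each element that
  satisfies the defining equation of \<open>(V \<box> \<C>(X,Y)) \<otimes> B\<close> (\<open>cot_proj_tensor\<close>). A formula that lies in a cotensor product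
  only as a whole can so be written term by term, by projecting each term.

  All identities are between iterated sums over the components of comultiplications and coactions. They are
  proved by rewriting such sums; the multilinearity conditions are left to the rule collection \<open>mlin\<close>.
\<close>

text \<open>Shorthand for elements and operations of a structure that is named explicitly.\<close>

abbreviation (input) elem (infix "<:" 50) where "x <: V \<equiv> x \<in> carrier V"
abbreviation (input) add_in ("(_ +[_] _)" [65, 0, 66] 65) where "x +[V] y \<equiv> x \<oplus>\<^bsub>V\<^esub> y"
abbreviation (input) mult_in ("(_ \<otimes>[_] _)" [70, 0, 71] 70) where "x \<otimes>[V] y \<equiv> x \<otimes>\<^bsub>V\<^esub> y"
abbreviation (input) smult_in ("(_ *[_] _)" [70, 0, 71] 70) where "c *[V] x \<equiv> c \<odot>\<^bsub>V\<^esub> x"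
abbreviation (input) one_in ("\<one>[_]") where "\<one>[V] \<equiv> \<one>\<^bsub>V\<^esub>"
abbreviation (input) zero_in ("\<zero>[_]") where "\<zero>[V] \<equiv> \<zero>\<^bsub>V\<^esub>"

hide_const (open) Wellorder_Constructions.zero

section \<open>Linear maps\<close>

lemma lin_mapsI:
 assumes "!!x. x <: V ==> f x <: W"
  and "!!x y. [|x <: V; y <: V|] ==> f (x +[V] y) = f x +[W] f y"
  and "!!c x. [|c <: k; x <: V|] ==> f (c *[V] x) = c *[W] f x"
 shows "f : lin_maps k V W"
 using assms by (auto simp: lin_maps_def)

lemma lin_closed: "[|f : lin_maps k V W; x <: V|] ==> f x <: W"
 and lin_add: "[|f : lin_maps k V W; x <: V; y <: V|] ==> f (x +[V] y) = f x +[W] f y"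
 and lin_smult: "[|f : lin_maps k V W; c <: k; x <: V|] ==> f (c *[V] x) = c *[W] f x"
 by (auto simp: lin_maps_def)

lemma lin_zero:
 assumes "module k V" "module k W" "f : lin_maps k V W"
 shows "f \<zero>[V] = \<zero>[W]"
proof -
 interpret V: module k V by fact
 interpret W: module k W by fact
 have "f \<zero>[V] = f (\<zero>\<^bsub>k\<^esub> *[V] \<zero>[V])" by simp
 also have "... = \<zero>[k] *[W] f \<zero>[V]" by (rule lin_smult[OF assms(3)]) auto
 also have "... = \<zero>[W]" using lin_closed[OF assms(3) V.zero_closed] by simp
 finally show ?thesis .
qed

lemma module_inv_smult:
 assumes "module k V" "x <: V"
 shows "\<ominus>\<^bsub>V\<^esub> x = (\<ominus>\<^bsub>k\<^esub> \<one>[k]) *[V] x"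
proof -
 interpret V: module k V by fact
 show ?thesis using assms(2) by (simp add: V.smult_l_minus)
qed

lemma lin_inv:
 assumes "module k V" "module k W" "f : lin_maps k V W" "x <: V"
 shows "f (\<ominus>\<^bsub>V\<^esub> x) = \<ominus>\<^bsub>W\<^esub> f x"
proof -
 interpret V: module k V by fact
 show ?thesis using assms
  by (simp add: module_inv_smult[OF assms(1)] module_inv_smult[OF assms(2)] lin_smult[OF assms(3)] lin_closed[OF assms(3)])
qed

lemma lin_comp: "[|g : lin_maps k W U; f : lin_maps k V W|] ==> (%x. g (f x)) : lin_maps k V U"
 by (auto simp: lin_maps_def Pi_def)

lemma lin_id: "(%x. x) : lin_maps k V V"
 by (auto simp: lin_maps_def)

lemma lin_cong:
 assumes "f : lin_maps k V W" "module k V" "!!x. x <: V ==> f x = g x"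
 shows "g : lin_maps k V W"
proof -
 interpret V: module k V by fact
 show ?thesis using assms(1,3) by (auto simp: lin_maps_def Pi_def)
qed

lemma lin_plus:
 assumes "module k U" "f : lin_maps k V U" "g : lin_maps k V U"
 shows "(%x. f x +[U] g x) : lin_maps k V U"
proof -
 interpret U: module k U by fact
 show ?thesis
  using lin_closed[OF assms(2)] lin_closed[OF assms(3)]
  by (intro lin_mapsI)
   (auto simp: lin_add[OF assms(2)] lin_add[OF assms(3)] lin_smult[OF assms(2)] lin_smult[OF assms(3)]
    U.smult_r_distr U.a_ac)
qed

lemma lin_finsum:
 assumes "module k V" "module k W" "f : lin_maps k V W" "finite A" "!!a. a \<in> A ==> g a <: V"
 shows "f (\<Oplus>\<^bsub>V\<^esub>a\<in>A. g a) = (\<Oplus>\<^bsub>W\<^esub>a\<in>A. f (g a))"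
proof -
 interpret V: module k V by fact
 interpret W: module k W by fact
 show ?thesis using assms(4,5)
 proof (induction A rule: finite_induct)
  case empty
  then show ?case using lin_zero[OF assms(1-3)] by simp
 next
  case (insert a A)
  then show ?case
   using lin_closed[OF assms(3)] by (subst V.finsum_insert W.finsum_insert; auto simp: lin_add[OF assms(3)])+
 qed
qed

lemma finsum_swap:
 assumes "abelian_monoid G" "finite A" "finite B"
  and "!!a b. [|a \<in> A; b \<in> B|] ==> f a b <: G"
 shows "(\<Oplus>\<^bsub>G\<^esub>a\<in>A. \<Oplus>\<^bsub>G\<^esub>b\<in>B. f a b) = (\<Oplus>\<^bsub>G\<^esub>b\<in>B. \<Oplus>\<^bsub>G\<^esub>a\<in>A. f a b)"
proof -
 interpret G: abelian_monoid G by fact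
 show ?thesis using assms(2,4)
 proof (induction A rule: finite_induct)
  case empty
  then show ?case by simp
 next
  case (insert a A)
  have "(\<Oplus>\<^bsub>G\<^esub>b\<in>B. \<Oplus>\<^bsub>G\<^esub>a\<in>insert a A. f a b) = (\<Oplus>\<^bsub>G\<^esub>b\<in>B. f a b +[G] (\<Oplus>\<^bsub>G\<^esub>a\<in>A. f a b))"
   using insert by (intro G.finsum_cong') (auto intro!: G.finsum_insert G.finsum_closed)
  also have "... = (\<Oplus>\<^bsub>G\<^esub>b\<in>B. f a b) +[G] (\<Oplus>\<^bsub>G\<^esub>b\<in>B. \<Oplus>\<^bsub>G\<^esub>a\<in>A. f a b)"
   using insert by (intro G.finsum_addf) (auto intro!: G.finsum_closed)
  finally show ?case
   using insert by (subst G.finsum_insert) (auto intro!: G.finsum_closed)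
 qed
qed


section \<open>Tensor products\<close>

lemma free_space_simps [simp]:
 "\<zero>[free_space k S] = (%p. \<zero>[k])"
 "f +[free_space k S] g = (%p. f p +[k] g p)"
 "c *[free_space k S] f = (%p. c \<otimes>[k] f p)"
 by (simp_all add: free_space_def)

lemma free_space_carrier:
 "f <: free_space k S \<longleftrightarrow>
   (\<forall>p. f p <: k) \<and> finite {p. f p \<noteq> \<zero>[k]} \<and> {p. f p \<noteq> \<zero>[k]} \<subseteq> S"
 by (simp add: free_space_def)

lemma free_space_module:
 assumes "cring k" shows "module k (free_space k S)"
proof -
 interpret k: cring k by fact
 let ?F = "free_space k S"
 have add: "f +[?F] g <: ?F" if "f <: ?F" "g <: ?F" for f g
 proof -
  have "{p. (f +[?F] g) p \<noteq> \<zero>[k]} \<subseteq> {p. f p \<noteq> \<zero>[k]} \<union> {p. g p \<noteq> \<zero>[k]}" by auto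
  then show ?thesis using that
   by (auto simp: free_space_carrier intro: finite_subset[of _ "{p. f p \<noteq> \<zero>[k]} \<union> {p. g p \<noteq> \<zero>[k]}"])
 qed
 have smult: "c *[?F] f <: ?F" if "c <: k" "f <: ?F" for c f
 proof -
  have "{p. (c *[?F] f) p \<noteq> \<zero>[k]} \<subseteq> {p. f p \<noteq> \<zero>[k]}" using that by auto
  then show ?thesis using that
   by (auto simp: free_space_carrier intro: finite_subset[of _ "{p. f p \<noteq> \<zero>[k]}"])
 qed
 have inv: "(%p. \<ominus>\<^bsub>k\<^esub> f p) <: ?F" if "f <: ?F" for f
 proof -
  have "{p. (\<ominus>\<^bsub>k\<^esub> f p) \<noteq> \<zero>[k]} \<subseteq> {p. f p \<noteq> \<zero>[k]}" using that by auto
  then show ?thesis using that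
   by (auto simp: free_space_carrier intro: finite_subset[of _ "{p. f p \<noteq> \<zero>[k]}"])
 qed
 have "abelian_group ?F"
 proof (intro abelian_groupI)
  fix f assume f: "f <: ?F"
  show "\<exists>g\<in>carrier ?F. g +[?F] f = \<zero>[?F]"
   using f inv[OF f] by (intro bexI[of _ "%p. \<ominus>\<^bsub>k\<^esub> f p"]) (auto simp: free_space_carrier k.l_neg)
 qed (use add in \<open>auto simp: free_space_carrier k.a_ac\<close>)
 then show ?thesis
  by (intro moduleI assms add smult)
   (auto simp: free_space_carrier k.l_distr k.r_distr k.m_assoc)
qed

lemma free_gen_carrier:
 assumes "cring k" "p \<in> S" shows "free_gen k p <: free_space k S"
proof -
 interpret k: cring k by fact
 have "{q. free_gen k p q \<noteq> \<zero>[k]} \<subseteq> {p}" by (auto simp: free_gen_def)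
 then show ?thesis using assms(2)
  by (auto simp: free_space_carrier free_gen_def intro: finite_subset[of _ "{p}"])
qed

text \<open>The linear extension of a map \<open>g\<close> on generators to finitely supported functions.\<close>

definition free_ext :: "('k, 'r) ring_scheme \<Rightarrow> ('k, 'u, 'l) module_scheme \<Rightarrow> ('p \<Rightarrow> 'u) \<Rightarrow> ('p \<Rightarrow> 'k) \<Rightarrow> 'u"
where
 "free_ext k U g f = (\<Oplus>\<^bsub>U\<^esub>p\<in>{p. f p \<noteq> \<zero>[k]}. f p *[U] g p)"

lemma free_ext_superset:
 assumes "module k U" "finite A" "{p. f p \<noteq> \<zero>[k]} \<subseteq> A" "!!p. p \<in> A ==> f p <: k"
  and "!!p. p \<in> A ==> g p <: U"
 shows "free_ext k U g f = (\<Oplus>\<^bsub>U\<^esub>p\<in>A. f p *[U] g p)"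
proof -
 interpret U: module k U by fact
 show ?thesis unfolding free_ext_def
  using assms(2-) by (intro U.add.finprod_mono_neutral_cong_left) auto
qed

lemma free_ext_lin:
 assumes "module k U" "!!p. p \<in> S ==> g p <: U"
 shows "free_ext k U g : lin_maps k (free_space k S) U"
proof -
 interpret U: module k U by fact
 have kr: "cring k" by unfold_locales
 interpret F: module k "free_space k S" by (rule free_space_module[OF kr])
 show ?thesis
 proof (intro lin_mapsI)
  fix f assume f: "f <: free_space k S"
  then show "free_ext k U g f <: U"
   unfolding free_ext_def using assms(2) by (intro U.finsum_closed) (auto simp: free_space_carrier)
  fix h assume h: "h <: free_space k S"
  let ?A = "{p. f p \<noteq> \<zero>[k]} \<union> {p. h p \<noteq> \<zero>[k]}"
  have A: "finite ?A" "?A \<subseteq> S" using f h by (auto simp: free_space_carrier)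
  have fh: "f p <: k" "h p <: k" for p using f h by (auto simp: free_space_carrier)
  have g: "g p <: U" if "p \<in> ?A" for p using that A assms(2) by auto
  have "free_ext k U g (f +[free_space k S] h) = (\<Oplus>\<^bsub>U\<^esub>p\<in>?A. (f p +[k] h p) *[U] g p)"
   using A g fh by (subst free_ext_superset[OF assms(1) A(1)]) auto
  also have "... = (\<Oplus>\<^bsub>U\<^esub>p\<in>?A. f p *[U] g p +[U] h p *[U] g p)"
   using g fh by (intro U.finsum_cong') (auto simp: U.smult_l_distr)
  also have "... = (\<Oplus>\<^bsub>U\<^esub>p\<in>?A. f p *[U] g p) +[U] (\<Oplus>\<^bsub>U\<^esub>p\<in>?A. h p *[U] g p)"
   using g fh by (intro U.finsum_addf) auto
  also have "... = free_ext k U g f +[U] free_ext k U g h"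
   using A g fh by (subst (1 2) free_ext_superset[OF assms(1) A(1)]) auto
  finally show "free_ext k U g (f +[free_space k S] h) = free_ext k U g f +[U] free_ext k U g h" .
 next
  fix c f assume c: "c <: k" and f: "f <: free_space k S"
  let ?A = "{p. f p \<noteq> \<zero>[k]}"
  have A: "finite ?A" "?A \<subseteq> S" using f by (auto simp: free_space_carrier)
  have fh: "f p <: k" for p using f by (auto simp: free_space_carrier)
  have g: "g p <: U" if "p \<in> ?A" for p using that A assms(2) by auto
  have "free_ext k U g (c *[free_space k S] f) = (\<Oplus>\<^bsub>U\<^esub>p\<in>?A. (c \<otimes>[k] f p) *[U] g p)"
   using A g fh c by (subst free_ext_superset[OF assms(1) A(1)]) auto
  also have "... = (\<Oplus>\<^bsub>U\<^esub>p\<in>?A. c *[U] (f p *[U] g p))"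
   using g fh c by (intro U.finsum_cong') (auto simp: U.smult_assoc1)
  also have "... = c *[U] free_ext k U g f"
   unfolding free_ext_def using A g fh c by (subst U.finsum_smult_ldistr) auto
  finally show "free_ext k U g (c *[free_space k S] f) = c *[U] free_ext k U g f" .
 qed
qed

lemma free_ext_gen:
 assumes "module k U" "g p <: U"
 shows "free_ext k U g (free_gen k p) = g p"
proof -
 interpret U: module k U by fact
 have "free_ext k U g (free_gen k p) = (\<Oplus>\<^bsub>U\<^esub>q\<in>{p}. free_gen k p q *[U] g q)"
  using assms(2) by (intro free_ext_superset[OF assms(1)]) (auto simp: free_gen_def)
 also have "... = g p" using assms(2) by (subst U.finsum_insert) (auto simp: free_gen_def)
 finally show ?thesis .
qed

lemma free_ext_free_gen:
 assumes "cring k" "f <: free_space k S"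
 shows "free_ext k (free_space k S) (free_gen k) f = f"
proof -
 interpret k: cring k by fact
 interpret F: module k "free_space k S" by (rule free_space_module[OF assms(1)])
 let ?A = "{p. f p \<noteq> \<zero>[k]}"
 have A: "finite ?A" "?A \<subseteq> S" and fk: "!!p. f p <: k" using assms by (auto simp: free_space_carrier)
 have *: "(\<Oplus>\<^bsub>free_space k S\<^esub>p\<in>B. f p *[free_space k S] free_gen k p) = (%q. if q \<in> B then f q else \<zero>[k])"
  if "B \<subseteq> ?A" for B
  using finite_subset[OF that A(1)] that
 proof (induction B rule: finite_induct)
  case empty
  then show ?case by (subst F.finsum_empty) auto
 next
  case (insert b B)
  have "(\<Oplus>\<^bsub>free_space k S\<^esub>p\<in>insert b B. f p *[free_space k S] free_gen k p) =
   (f b *[free_space k S] free_gen k b) +[free_space k S] (%q. if q \<in> B then f q else \<zero>[k])"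
   using insert A fk by (subst F.finsum_insert) (auto intro!: F.smult_closed free_gen_carrier assms simp del: free_space_simps)
  also have "... = (%q. if q \<in> insert b B then f q else \<zero>[k])"
   using insert fk by (auto simp: free_gen_def fun_eq_iff)
  finally show ?case .
 qed
 show ?thesis unfolding free_ext_def by (subst *) auto
qed

text \<open>Quotients of modules, in the form in which the tensor product is one.\<close>

definition quot_mod :: "('k, 'v, 'm) module_scheme \<Rightarrow> 'v set \<Rightarrow> ('k, 'v set) module" where
 "quot_mod F N = \<lparr>carrier = a_rcosets\<^bsub>F\<^esub> N, mult = (%_ _. undefined), one = undefined,
   zero = N, add = set_add F, smult = (%c K. \<Union>f\<in>K. N +>\<^bsub>F\<^esub> (c *[F] f))\<rparr>"

context
 fixes k :: "('k, 'r) ring_scheme" and F :: "('k, 'v, 'm) module_scheme" and N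
 assumes F: "module k F" and N: "submodule N k F"
begin

interpretation F: module k F by (rule F)
interpretation N: submodule N k F by (rule N)

lemma abelian_subgroup_N: "abelian_subgroup N F"
proof (rule abelian_subgroupI3)
 show "additive_subgroup N F" using N.subgroup_axioms by (simp add: additive_subgroup_def)
 show "abelian_group F" by unfold_locales
qed

interpretation N: abelian_subgroup N F by (rule abelian_subgroup_N)

lemma quot_mod_elem: "K <: quot_mod F N \<longleftrightarrow> (\<exists>f\<in>carrier F. K = N +>\<^bsub>F\<^esub> f)"
 by (auto simp: quot_mod_def A_RCOSETS_def')

lemma quot_mod_class: "[|K <: quot_mod F N; f \<in> K|] ==> f <: F \<and> K = N +>\<^bsub>F\<^esub> f"
 unfolding quot_mod_elem by (auto intro: N.a_elemrcos_carrier dest: N.a_repr_independence')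

lemma quot_mod_self: "f <: F ==> f \<in> N +>\<^bsub>F\<^esub> f"
 by (rule N.a_rcos_self)

lemma quot_mod_add: "[|f <: F; g <: F|] ==>
 (N +>\<^bsub>F\<^esub> f) +[quot_mod F N] (N +>\<^bsub>F\<^esub> g) = N +>\<^bsub>F\<^esub> (f +[F] g)"
 by (simp add: quot_mod_def N.a_rcos_sum)

lemma quot_mod_eqI:
 assumes "f <: F" "g <: F" "f \<ominus>\<^bsub>F\<^esub> g \<in> N"
 shows "N +>\<^bsub>F\<^esub> f = N +>\<^bsub>F\<^esub> g"
proof -
 have "(f \<ominus>\<^bsub>F\<^esub> g) +[F] g = f" using assms by (simp add: a_minus_def F.a_assoc F.l_neg)
 then have "f \<in> N +>\<^bsub>F\<^esub> g" using assms(3) by (force simp: a_r_coset_def')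
 then show ?thesis using assms by (intro N.a_repr_independence'[symmetric]) auto
qed

lemma quot_mod_smult: 
 assumes "c <: k" "f <: F"
 shows "c *[quot_mod F N] (N +>\<^bsub>F\<^esub> f) = N +>\<^bsub>F\<^esub> (c *[F] f)"
proof -
 have "N +>\<^bsub>F\<^esub> (c *[F] g) = N +>\<^bsub>F\<^esub> (c *[F] f)" if "g \<in> N +>\<^bsub>F\<^esub> f" for g
 proof -
  from that obtain n where n: "n \<in> N" "g = n +[F] f" by (auto simp: a_r_coset_def')
  have "c *[F] g = c *[F] n +[F] c *[F] f"
   using n assms N.a_subset by (auto simp: F.smult_r_distr)
  moreover have "c *[F] n \<in> N" using n assms by auto
  ultimately have "c *[F] g \<in> N +>\<^bsub>F\<^esub> (c *[F] f)" by (auto simp: a_r_coset_def')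
  then show ?thesis using assms by (intro N.a_repr_independence'[symmetric]) auto
 qed
 then have "(\<Union>g\<in>N +>\<^bsub>F\<^esub> f. N +>\<^bsub>F\<^esub> (c *[F] g)) = (\<Union>g\<in>N +>\<^bsub>F\<^esub> f. N +>\<^bsub>F\<^esub> (c *[F] f))"
  by (intro SUP_cong refl)
 also have "... = N +>\<^bsub>F\<^esub> (c *[F] f)" using quot_mod_self[OF assms(2)] by blast
 finally show ?thesis by (simp add: quot_mod_def)
qed

lemma quot_mod_module: "module k (quot_mod F N)"
proof (rule moduleI)
 show "cring k" by unfold_locales
 have z: "N +>\<^bsub>F\<^esub> \<zero>[F] = N" using F.a_coset_add_zero N.a_subset by blast
 show "abelian_group (quot_mod F N)"
 proof (rule abelian_groupI)
  show "\<zero>[quot_mod F N] <: quot_mod F N"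
   unfolding quot_mod_elem using z by (auto simp: quot_mod_def)
  fix x assume x: "x <: quot_mod F N"
  then obtain f where f: "f <: F" "x = N +>\<^bsub>F\<^esub> f" by (auto simp: quot_mod_elem)
  have z': "\<zero>[quot_mod F N] = N +>\<^bsub>F\<^esub> \<zero>[F]" using z by (simp add: quot_mod_def)
  show "\<zero>[quot_mod F N] +[quot_mod F N] x = x" unfolding z' using f by (simp add: quot_mod_add)
  show "\<exists>y\<in>carrier (quot_mod F N). y +[quot_mod F N] x = \<zero>[quot_mod F N]"
   unfolding z' using f by (intro bexI[of _ "N +>\<^bsub>F\<^esub> (\<ominus>\<^bsub>F\<^esub> f)"]) (auto simp: quot_mod_add quot_mod_elem F.l_neg)
  fix y assume y: "y <: quot_mod F N"
  then obtain g where g: "g <: F" "y = N +>\<^bsub>F\<^esub> g" by (auto simp: quot_mod_elem)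
  show "x +[quot_mod F N] y <: quot_mod F N"
   unfolding quot_mod_elem using f g by (auto simp: quot_mod_add)
  show "x +[quot_mod F N] y = y +[quot_mod F N] x"
   using f g by (simp add: quot_mod_add F.a_comm)
  fix z assume "z <: quot_mod F N"
  then obtain h where h: "h <: F" "z = N +>\<^bsub>F\<^esub> h" by (auto simp: quot_mod_elem)
  show "x +[quot_mod F N] y +[quot_mod F N] z = x +[quot_mod F N] (y +[quot_mod F N] z)"
   using f g h by (simp add: quot_mod_add F.a_assoc)
 qed
next
 fix a x assume a: "a <: k" and "x <: quot_mod F N"
 then obtain f where f: "f <: F" "x = N +>\<^bsub>F\<^esub> f" by (auto simp: quot_mod_elem)
 show "a *[quot_mod F N] x <: quot_mod F N"
  unfolding quot_mod_elem using f a by (auto simp: quot_mod_smult)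
 fix b assume b: "b <: k"
 show "(a +[k] b) *[quot_mod F N] x = a *[quot_mod F N] x +[quot_mod F N] b *[quot_mod F N] x"
  using f a b by (simp add: quot_mod_smult quot_mod_add F.smult_l_distr)
 show "(a \<otimes>[k] b) *[quot_mod F N] x = a *[quot_mod F N] (b *[quot_mod F N] x)"
  using f a b by (simp add: quot_mod_smult F.smult_assoc1)
next
 fix x assume "x <: quot_mod F N"
 then obtain f where f: "f <: F" "x = N +>\<^bsub>F\<^esub> f" by (auto simp: quot_mod_elem)
 then show "\<one>[k] *[quot_mod F N] x = x" by (simp add: quot_mod_smult)
next
 fix a x y assume a: "a <: k" and "x <: quot_mod F N" "y <: quot_mod F N"
 then obtain f g where f: "f <: F" "x = N +>\<^bsub>F\<^esub> f" "g <: F" "y = N +>\<^bsub>F\<^esub> g"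
  by (auto simp: quot_mod_elem)
 show "a *[quot_mod F N] (x +[quot_mod F N] y) = a *[quot_mod F N] x +[quot_mod F N] a *[quot_mod F N] y"
  using f a by (simp add: quot_mod_smult quot_mod_add F.smult_r_distr)
qed

lemma quot_mod_proj_lin: "(%f. N +>\<^bsub>F\<^esub> f) : lin_maps k F (quot_mod F N)"
 by (intro lin_mapsI) (auto simp: quot_mod_elem quot_mod_add quot_mod_smult)

end

lemma tensor_eq_quot_mod:
 "tensor k V W = quot_mod (free_space k (carrier V \<times> carrier W)) (relation_space k V W)"
 by (simp add: tensor_def quot_mod_def Let_def)

lemma bilinearity_relations_subset:
 assumes "module k V" "module k W"
 shows "bilinearity_relations k V W \<subseteq> carrier (free_space k (carrier V \<times> carrier W))"
proof -
 interpret V: module k V by fact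
 interpret W: module k W by fact
 have kr: "cring k" by unfold_locales
 interpret F: module k "free_space k (carrier V \<times> carrier W)" by (rule free_space_module[OF kr])
 show ?thesis
  unfolding bilinearity_relations_def Let_def
  by (auto simp del: free_space_simps intro!: F.minus_closed F.add.m_closed F.smult_closed free_gen_carrier kr)
qed

lemma relation_space_submodule:
 assumes "module k V" "module k W"
 shows "submodule (relation_space k V W) k (free_space k (carrier V \<times> carrier W))"
proof -
 interpret V: module k V by fact
 have kr: "cring k" by unfold_locales
 interpret F: module k "free_space k (carrier V \<times> carrier W)" by (rule free_space_module[OF kr])
 show ?thesis
 proof (rule F.submoduleI)
  show "relation_space k V W \<subseteq> carrier (free_space k (carrier V \<times> carrier W))"
   unfolding relation_space_def
   using F.carrier_is_submodule bilinearity_relations_subset[OF assms] by blast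
 qed (auto simp: relation_space_def simp del: free_space_simps dest: F.submoduleE(3-5)
   intro: subgroup.one_closed[of _ "add_monoid G" for G, simplified] submodule.axioms(1))
qed

lemma relation_space_contains: "bilinearity_relations k V W \<subseteq> relation_space k V W"
 by (auto simp: relation_space_def)

lemma relation_space_least:
 assumes "submodule N k (free_space k (carrier V \<times> carrier W))" "bilinearity_relations k V W \<subseteq> N"
 shows "relation_space k V W \<subseteq> N"
 using assms by (auto simp: relation_space_def)

context
 fixes k :: "('k, 'r) ring_scheme" and V :: "('k, 'v, 'm) module_scheme" and W :: "('k, 'w, 'n) module_scheme"
 assumes V: "module k V" and W: "module k W"
begin

interpretation V: module k V by (rule V)
interpretation W: module k W by (rule W)

abbreviation (input) "FS \<equiv> free_space k (carrier V \<times> carrier W)"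
abbreviation (input) "RS \<equiv> relation_space k V W"

lemma cring_base: "cring k" by unfold_locales

interpretation F: module k FS by (rule free_space_module[OF cring_base])

lemmas RS_sub = relation_space_submodule[OF V W]
lemmas FS_mod = F.module_axioms

lemma tensor_module: "module k (tensor k V W)"
 unfolding tensor_eq_quot_mod by (rule quot_mod_module[OF FS_mod RS_sub])

lemma pure_closed: "[|v <: V; w <: W|] ==> pure k V W v w <: tensor k V W"
 unfolding tensor_eq_quot_mod pure_def quot_mod_elem[OF FS_mod RS_sub]
 by (auto intro!: bexI[of _ "free_gen k (v, w)"] free_gen_carrier cring_base)

lemma relation_space_intros:
 "[|v <: V; v' <: V; w <: W|] ==>
  free_gen k (v +[V] v', w) \<ominus>\<^bsub>FS\<^esub> (free_gen k (v, w) +[FS] free_gen k (v', w)) \<in> RS"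
 "[|v <: V; w <: W; w' <: W|] ==>
  free_gen k (v, w +[W] w') \<ominus>\<^bsub>FS\<^esub> (free_gen k (v, w) +[FS] free_gen k (v, w')) \<in> RS"
 "[|c <: k; v <: V; w <: W|] ==>
  free_gen k (c *[V] v, w) \<ominus>\<^bsub>FS\<^esub> (c *[FS] free_gen k (v, w)) \<in> RS"
 "[|c <: k; v <: V; w <: W|] ==>
  free_gen k (v, c *[W] w) \<ominus>\<^bsub>FS\<^esub> (c *[FS] free_gen k (v, w)) \<in> RS"
proof -
 show "[|v <: V; v' <: V; w <: W|] ==>
  free_gen k (v +[V] v', w) \<ominus>\<^bsub>FS\<^esub> (free_gen k (v, w) +[FS] free_gen k (v', w)) \<in> RS"
  by (rule subsetD[OF relation_space_contains], unfold bilinearity_relations_def Let_def,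
   rule UnI1, rule UnI1, rule UnI1, blast)
 show "[|v <: V; w <: W; w' <: W|] ==>
  free_gen k (v, w +[W] w') \<ominus>\<^bsub>FS\<^esub> (free_gen k (v, w) +[FS] free_gen k (v, w')) \<in> RS"
  by (rule subsetD[OF relation_space_contains], unfold bilinearity_relations_def Let_def,
   rule UnI1, rule UnI1, rule UnI2, blast)
 show "[|c <: k; v <: V; w <: W|] ==>
  free_gen k (c *[V] v, w) \<ominus>\<^bsub>FS\<^esub> (c *[FS] free_gen k (v, w)) \<in> RS"
  by (rule subsetD[OF relation_space_contains], unfold bilinearity_relations_def Let_def,
   rule UnI1, rule UnI2, blast)
 show "[|c <: k; v <: V; w <: W|] ==>
  free_gen k (v, c *[W] w) \<ominus>\<^bsub>FS\<^esub> (c *[FS] free_gen k (v, w)) \<in> RS"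
  by (rule subsetD[OF relation_space_contains], unfold bilinearity_relations_def Let_def,
   rule UnI2, blast)
qed

lemma pure_lin_left:
 assumes "w <: W" shows "(%v. pure k V W v w) : lin_maps k V (tensor k V W)"
proof (intro lin_mapsI pure_closed assms)
 fix x y assume xy: "x <: V" "y <: V"
 have g: "free_gen k (x, w) <: FS" "free_gen k (y, w) <: FS" "free_gen k (x +[V] y, w) <: FS"
  using xy assms by (auto intro!: free_gen_carrier cring_base)
 have "free_gen k (x +[V] y, w) \<ominus>\<^bsub>FS\<^esub> (free_gen k (x, w) +[FS] free_gen k (y, w)) \<in> RS"
  using xy assms by (intro relation_space_intros(1))
 then have "RS +>\<^bsub>FS\<^esub> free_gen k (x +[V] y, w) = RS +>\<^bsub>FS\<^esub> (free_gen k (x, w) +[FS] free_gen k (y, w))"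
  using g by (intro quot_mod_eqI[OF FS_mod RS_sub]) (auto simp del: free_space_simps)
 then show "pure k V W (x +[V] y) w = pure k V W x w +[tensor k V W] pure k V W y w"
  unfolding pure_def tensor_eq_quot_mod using g by (simp add: quot_mod_add[OF FS_mod RS_sub] del: free_space_simps)
next
 fix c x assume xy: "c <: k" "x <: V"
 have g: "free_gen k (x, w) <: FS" "free_gen k (c *[V] x, w) <: FS"
  using xy assms by (auto intro!: free_gen_carrier cring_base)
 have "free_gen k (c *[V] x, w) \<ominus>\<^bsub>FS\<^esub> (c *[FS] free_gen k (x, w)) \<in> RS"
  using xy assms by (intro relation_space_intros(3))
 then have "RS +>\<^bsub>FS\<^esub> free_gen k (c *[V] x, w) = RS +>\<^bsub>FS\<^esub> (c *[FS] free_gen k (x, w))"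
  using g xy by (intro quot_mod_eqI[OF FS_mod RS_sub]) (auto simp del: free_space_simps)
 then show "pure k V W (c *[V] x) w = c *[tensor k V W] pure k V W x w"
  unfolding pure_def tensor_eq_quot_mod using g xy by (simp add: quot_mod_smult[OF FS_mod RS_sub] del: free_space_simps)
qed

lemma pure_lin_right:
 assumes "w <: V" shows "(%v. pure k V W w v) : lin_maps k W (tensor k V W)"
proof (intro lin_mapsI pure_closed assms)
 fix x y assume xy: "x <: W" "y <: W"
 have g: "free_gen k (w, x) <: FS" "free_gen k (w, y) <: FS" "free_gen k (w, x +[W] y) <: FS"
  using xy assms by (auto intro!: free_gen_carrier cring_base)
 have "free_gen k (w, x +[W] y) \<ominus>\<^bsub>FS\<^esub> (free_gen k (w, x) +[FS] free_gen k (w, y)) \<in> RS"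
  using xy assms by (intro relation_space_intros(2))
 then have "RS +>\<^bsub>FS\<^esub> free_gen k (w, x +[W] y) = RS +>\<^bsub>FS\<^esub> (free_gen k (w, x) +[FS] free_gen k (w, y))"
  using g by (intro quot_mod_eqI[OF FS_mod RS_sub]) (auto simp del: free_space_simps)
 then show "pure k V W w (x +[W] y) = pure k V W w x +[tensor k V W] pure k V W w y"
  unfolding pure_def tensor_eq_quot_mod using g by (simp add: quot_mod_add[OF FS_mod RS_sub] del: free_space_simps)
next
 fix c x assume xy: "c <: k" "x <: W"
 have g: "free_gen k (w, x) <: FS" "free_gen k (w, c *[W] x) <: FS"
  using xy assms by (auto intro!: free_gen_carrier cring_base)
 have "free_gen k (w, c *[W] x) \<ominus>\<^bsub>FS\<^esub> (c *[FS] free_gen k (w, x)) \<in> RS"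
  using xy assms by (intro relation_space_intros(4))
 then have "RS +>\<^bsub>FS\<^esub> free_gen k (w, c *[W] x) = RS +>\<^bsub>FS\<^esub> (c *[FS] free_gen k (w, x))"
  using g xy by (intro quot_mod_eqI[OF FS_mod RS_sub]) (auto simp del: free_space_simps)
 then show "pure k V W w (c *[W] x) = c *[tensor k V W] pure k V W w x"
  unfolding pure_def tensor_eq_quot_mod using g xy by (simp add: quot_mod_smult[OF FS_mod RS_sub] del: free_space_simps)
qed

text \<open>The linear extension of a bilinear map to the free space kills the relations, hence is constant
 on each element of the tensor product, seen as a coset.\<close>

lemma free_ext_relation_space:
 assumes U: "module k U" and \<beta>: "\<beta> : bilin_maps k V W U" and f: "f \<in> RS"
 shows "free_ext k U (%p. \<beta> (fst p) (snd p)) f = \<zero>[U]"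
proof -
 interpret U: module k U by (rule U)
 let ?e = "free_ext k U (%p. \<beta> (fst p) (snd p))"
 have b1: "\<beta> x : lin_maps k W U" if "x <: V" for x using \<beta> that by (auto simp: bilin_maps_def)
 have b2: "(%x. \<beta> x y) : lin_maps k V U" if "y <: W" for y using \<beta> that by (auto simp: bilin_maps_def)
 have c: "\<beta> x y <: U" if "x <: V" "y <: W" for x y
  using lin_closed[OF b1] that by auto
 have e: "?e : lin_maps k FS U" by (rule free_ext_lin[OF U]) (use c in auto)
 have eg: "?e (free_gen k (x, y)) = \<beta> x y" if "x <: V" "y <: W" for x y
  using free_ext_gen[OF U, of "%p. \<beta> (fst p) (snd p)" "(x, y)"] c that by simp
 have em: "?e (f \<ominus>\<^bsub>FS\<^esub> g) = ?e f \<ominus>\<^bsub>U\<^esub> ?e g" if "f <: FS" "g <: FS" for f g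
  using that unfolding a_minus_def
  by (subst lin_add[OF e]) (auto simp: lin_inv[OF FS_mod U e] simp del: free_space_simps)
 let ?N = "{f \<in> carrier FS. ?e f = \<zero>[U]}"
 have "submodule ?N k FS"
 proof (rule F.submoduleI)
  show "\<zero>[FS] \<in> ?N" using lin_zero[OF FS_mod U e] F.zero_closed by auto
 qed (auto simp: lin_add[OF e] lin_inv[OF FS_mod U e] lin_smult[OF e] simp del: free_space_simps)
 moreover have "bilinearity_relations k V W \<subseteq> ?N"
  unfolding bilinearity_relations_def Let_def
  by (auto simp del: free_space_simps simp: em lin_add[OF e] lin_smult[OF e] eg lin_add[OF b1] lin_smult[OF b1]
    lin_add[OF b2] lin_smult[OF b2] free_gen_carrier[OF cring_base] c U.r_neg a_minus_def[of U]
    intro!: F.minus_closed F.add.m_closed F.smult_closed)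
 ultimately have "RS \<subseteq> ?N" by (rule relation_space_least)
 then show ?thesis using f by auto
qed

text \<open>The representatives of a tensor, seen as a coset, are finitely supported functions on pairs, which is how
 formulas over representatives become available.\<close>

lemma tensor_elem:
 assumes "t <: tensor k V W"
 shows "(SOME f. f \<in> t) \<in> t"
  and "f \<in> t ==> f <: FS"
  and "f \<in> t ==> t = RS +>\<^bsub>FS\<^esub> f"
proof -
 obtain g where g: "g <: FS" "t = RS +>\<^bsub>FS\<^esub> g"
  using assms by (auto simp: tensor_eq_quot_mod quot_mod_elem[OF FS_mod RS_sub])
 then show "(SOME f. f \<in> t) \<in> t" using quot_mod_self[OF FS_mod RS_sub] by (metis someI)
 show "f \<in> t ==> f <: FS" "f \<in> t ==> t = RS +>\<^bsub>FS\<^esub> f"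
  using assms quot_mod_class[OF FS_mod RS_sub] by (auto simp: tensor_eq_quot_mod)
qed

lemma free_ext_coset:
 assumes U: "module k U" and \<beta>: "\<beta> : bilin_maps k V W U" and f: "f <: FS"
  and g: "g \<in> RS +>\<^bsub>FS\<^esub> f"
 shows "free_ext k U (%p. \<beta> (fst p) (snd p)) g = free_ext k U (%p. \<beta> (fst p) (snd p)) f"
proof -
 interpret U: module k U by (rule U)
 have c: "\<beta> x y <: U" if "x <: V" "y <: W" for x y
  using \<beta> that by (auto simp: bilin_maps_def dest: lin_closed)
 have e: "free_ext k U (%p. \<beta> (fst p) (snd p)) : lin_maps k FS U"
  by (rule free_ext_lin[OF U]) (use c in auto)
 obtain n where n: "n \<in> RS" "g = n +[FS] f" using g unfolding a_r_coset_def' by blast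
 have "n <: FS" using F.submoduleE(1)[OF RS_sub] n by blast
 then show ?thesis
  unfolding n(2) using f lin_closed[OF e f]
  by (subst lin_add[OF e]) (auto simp: free_ext_relation_space[OF U \<beta> n(1)])
qed

end

text \<open>The sum \<open>\<Sum>\<^sub>i \<beta> v\<^sub>i w\<^sub>i\<close> over one chosen expression of \<open>t\<close> as a sum of pure tensors. Contrary to
 \<^const>\<open>sweedler\<close> it makes sense for an arbitrary \<open>\<beta>\<close>, so that congruence, interchange of sums and
 linearity in \<open>\<beta>\<close> hold without any bilinearity condition.\<close>

definition tsum ::
 "('k, 'r) ring_scheme \<Rightarrow> ('k, 'u, 'l) module_scheme \<Rightarrow> ('v \<times> 'w \<Rightarrow> 'k) set \<Rightarrow> ('v \<Rightarrow> 'w \<Rightarrow> 'u) \<Rightarrow> 'u"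
where
 "tsum k U t \<beta> = free_ext k U (%p. \<beta> (fst p) (snd p)) (SOME f. f \<in> t)"

lemma bilin_mapsI:
 "[|!!x. x <: V ==> \<beta> x : lin_maps k W U; !!y. y <: W ==> (%x. \<beta> x y) : lin_maps k V U|]
  ==> \<beta> : bilin_maps k V W U"
 by (auto simp: bilin_maps_def)

lemma bilin_maps_right: "[|\<beta> : bilin_maps k V W U; x <: V|] ==> \<beta> x : lin_maps k W U"
 and bilin_maps_left: "[|\<beta> : bilin_maps k V W U; y <: W|] ==> (%x. \<beta> x y) : lin_maps k V U"
 by (auto simp: bilin_maps_def)

lemma bilin_closed: "[|\<beta> : bilin_maps k V W U; x <: V; y <: W|] ==> \<beta> x y <: U"
 by (auto simp: bilin_maps_def dest: lin_closed)

lemma pure_bilin: "[|module k V; module k W|] ==> pure k V W : bilin_maps k V W (tensor k V W)"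
 by (intro bilin_mapsI pure_lin_left pure_lin_right)

context
 fixes k :: "('k, 'r) ring_scheme" and V :: "('k, 'v, 'm) module_scheme" and W :: "('k, 'w, 'n) module_scheme"
  and t
 assumes V: "module k V" and W: "module k W" and t: "t <: tensor k V W"
begin

lemma tensor_rep:
 obtains A f where "finite A" "A \<subseteq> carrier V \<times> carrier W" "!!p. f p <: k"
  "(SOME f. f \<in> t) = f" "A = {p. f p \<noteq> \<zero>[k]}"
 using tensor_elem(2)[OF V W t tensor_elem(1)[OF V W t]] by (auto simp: free_space_carrier)

lemma tsum_closed:
 assumes U: "module k U" and \<beta>: "!!v w. [|v <: V; w <: W|] ==> \<beta> v w <: U"
 shows "tsum k U t \<beta> <: U"
proof -
 interpret U: module k U by (rule U)
 obtain A g where A: "finite A" "A \<subseteq> carrier V \<times> carrier W" "!!p. g p <: k"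
  "(SOME f. f \<in> t) = g" "A = {p. g p \<noteq> \<zero>[k]}" by (rule tensor_rep, rule that)
 have "(\<Oplus>\<^bsub>U\<^esub>p\<in>A. g p *[U] \<beta> (fst p) (snd p)) <: U"
  using A(2,3) by (intro U.finsum_closed) (auto intro!: U.smult_closed \<beta>)
 then show ?thesis by (simp add: tsum_def free_ext_def A)
qed

lemma tsum_cong:
 assumes "module k U"
  and "!!v w. [|v <: V; w <: W|] ==> \<beta> v w = \<gamma> v w"
  and "!!v w. [|v <: V; w <: W|] ==> \<gamma> v w <: U"
 shows "tsum k U t \<beta> = tsum k U t \<gamma>"
proof -
 interpret U: module k U by (rule assms(1))
 obtain A g where A: "finite A" "A \<subseteq> carrier V \<times> carrier W" "!!p. g p <: k"
  "(SOME f. f \<in> t) = g" "A = {p. g p \<noteq> \<zero>[k]}" by (rule tensor_rep, rule that)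
 have "(\<Oplus>\<^bsub>U\<^esub>p\<in>A. g p *[U] \<beta> (fst p) (snd p)) = (\<Oplus>\<^bsub>U\<^esub>p\<in>A. g p *[U] \<gamma> (fst p) (snd p))"
  using A(2,3) assms(2,3) by (intro U.finsum_cong') auto
 then show ?thesis by (simp add: tsum_def free_ext_def A)
qed

lemma lin_tsum:
 assumes U: "module k U" and U': "module k U'" and f: "f : lin_maps k U U'"
  and \<beta>: "!!v w. [|v <: V; w <: W|] ==> \<beta> v w <: U"
 shows "f (tsum k U t \<beta>) = tsum k U' t (%v w. f (\<beta> v w))"
proof -
 interpret U: module k U by (rule U)
 interpret U': module k U' by (rule U')
 obtain A g where A: "finite A" "A \<subseteq> carrier V \<times> carrier W" "!!p. g p <: k"
  "(SOME f. f \<in> t) = g" "A = {p. g p \<noteq> \<zero>[k]}" by (rule tensor_rep, rule that)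
 have b: "(v, w) \<in> A ==> \<beta> v w <: U" for v w using A(2) \<beta> by auto
 have "f (\<Oplus>\<^bsub>U\<^esub>p\<in>A. g p *[U] \<beta> (fst p) (snd p)) = (\<Oplus>\<^bsub>U'\<^esub>p\<in>A. f (g p *[U] \<beta> (fst p) (snd p)))"
  using A(1-3) by (intro lin_finsum[OF U U' f]) (auto simp: b)
 also have "... = (\<Oplus>\<^bsub>U'\<^esub>p\<in>A. g p *[U'] f (\<beta> (fst p) (snd p)))"
  using A(1-3) by (intro U'.finsum_cong') (auto simp: b lin_smult[OF f] lin_closed[OF f])
 finally show ?thesis by (simp add: tsum_def free_ext_def A)
qed

lemma tsum_plus:
 assumes U: "module k U"
  and "!!v w. [|v <: V; w <: W|] ==> \<beta> v w <: U"
  and "!!v w. [|v <: V; w <: W|] ==> \<gamma> v w <: U"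
 shows "tsum k U t (%v w. \<beta> v w +[U] \<gamma> v w) = tsum k U t \<beta> +[U] tsum k U t \<gamma>"
proof -
 interpret U: module k U by (rule U)
 obtain A g where A: "finite A" "A \<subseteq> carrier V \<times> carrier W" "!!p. g p <: k"
  "(SOME f. f \<in> t) = g" "A = {p. g p \<noteq> \<zero>[k]}" by (rule tensor_rep, rule that)
 have bc: "(v, w) \<in> A ==> \<beta> v w <: U" "(v, w) \<in> A ==> \<gamma> v w <: U" for v w
  using A(2) assms(2,3) by auto
 have "(\<Oplus>\<^bsub>U\<^esub>p\<in>A. g p *[U] (\<beta> (fst p) (snd p) +[U] \<gamma> (fst p) (snd p))) =
  (\<Oplus>\<^bsub>U\<^esub>p\<in>A. g p *[U] \<beta> (fst p) (snd p) +[U] g p *[U] \<gamma> (fst p) (snd p))"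
  using A(1,3) by (intro U.finsum_cong') (auto simp: bc U.smult_r_distr)
 also have "... = (\<Oplus>\<^bsub>U\<^esub>p\<in>A. g p *[U] \<beta> (fst p) (snd p)) +[U] (\<Oplus>\<^bsub>U\<^esub>p\<in>A. g p *[U] \<gamma> (fst p) (snd p))"
  using A(1,3) by (intro U.finsum_addf) (auto simp: bc)
 finally show ?thesis by (simp add: tsum_def free_ext_def A)
qed

lemma tsum_swap:
 assumes U: "module k U" and V': "module k V'" and W': "module k W'" and s: "s <: tensor k V' W'"
  and \<beta>: "!!v w v' w'. [|v <: V; w <: W; v' <: V'; w' <: W'|] ==> \<beta> v w v' w' <: U"
 shows "tsum k U t (%v w. tsum k U s (\<beta> v w)) = tsum k U s (%v' w'. tsum k U t (%v w. \<beta> v w v' w'))"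
proof -
 interpret U: module k U by (rule U)
 obtain A g where A: "finite A" "A \<subseteq> carrier V \<times> carrier W" "!!p. g p <: k"
  "(SOME f. f \<in> t) = g" "A = {p. g p \<noteq> \<zero>[k]}" by (rule tensor_rep, rule that)
 obtain B h where B: "finite B" "B \<subseteq> carrier V' \<times> carrier W'" "!!p. h p <: k"
  "(SOME f. f \<in> s) = h" "B = {p. h p \<noteq> \<zero>[k]}"
  using tensor_elem(2)[OF V' W' s tensor_elem(1)[OF V' W' s]] by (auto simp: free_space_carrier)
 let ?b = "%p q. \<beta> (fst p) (snd p) (fst q) (snd q)"
 have b: "\<beta> v w v' w' <: U" if "(v, w) \<in> A" "(v', w') \<in> B" for v w v' w'
  using that A(2) B(2) by (intro \<beta>) auto
 have "(\<Oplus>\<^bsub>U\<^esub>p\<in>A. g p *[U] (\<Oplus>\<^bsub>U\<^esub>q\<in>B. h q *[U] ?b p q)) = (\<Oplus>\<^bsub>U\<^esub>p\<in>A. \<Oplus>\<^bsub>U\<^esub>q\<in>B. g p *[U] (h q *[U] ?b p q))"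
  using A(3) B(3) b by (intro U.finsum_cong') (auto intro!: U.finsum_closed U.finsum_smult_ldistr B(1))
 also have "... = (\<Oplus>\<^bsub>U\<^esub>q\<in>B. \<Oplus>\<^bsub>U\<^esub>p\<in>A. g p *[U] (h q *[U] ?b p q))"
  using A(1,3) B(1,3) b by (intro finsum_swap) (auto intro!: U.abelian_monoid_axioms)
 also have "... = (\<Oplus>\<^bsub>U\<^esub>q\<in>B. \<Oplus>\<^bsub>U\<^esub>p\<in>A. h q *[U] (g p *[U] ?b p q))"
  using A(3) B(3) b by (intro U.finsum_cong' refl) (auto intro!: U.finsum_closed simp: U.m_comm simp flip: U.smult_assoc1)
 also have "... = (\<Oplus>\<^bsub>U\<^esub>q\<in>B. h q *[U] (\<Oplus>\<^bsub>U\<^esub>p\<in>A. g p *[U] ?b p q))"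
  using A(3) B(3) b
  by (intro U.finsum_cong' refl) (auto intro!: U.finsum_closed U.finsum_smult_ldistr[symmetric] A(1))
 finally show ?thesis by (simp add: tsum_def free_ext_def A B)
qed

lemma sweedler_eq_tsum:
 assumes "module k U" "\<beta> : bilin_maps k V W U"
 shows "sweedler k U t \<beta> = tsum k U t \<beta>"
proof -
 let ?e = "free_ext k U (%p. \<beta> (fst p) (snd p))"
 have "?e f = tsum k U t \<beta>" if "f \<in> t" for f
  using free_ext_coset[OF V W assms, of "SOME f. f \<in> t" f] tensor_elem[OF V W t] that
  by (simp add: tsum_def)
 then have "?e ` t = {tsum k U t \<beta>}" using tensor_elem(1)[OF V W t] by (auto simp: image_iff)
 then show ?thesis by (simp add: sweedler_def free_ext_def)
qed

end

lemma tsum_eq_free_ext: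
 assumes "module k V" "module k W" "module k U" "\<beta> : bilin_maps k V W U"
  and f: "f <: (free_space k (carrier V \<times> carrier W))"
 shows "tsum k U (relation_space k V W +>\<^bsub>free_space k (carrier V \<times> carrier W)\<^esub> f) \<beta> =
  free_ext k U (%p. \<beta> (fst p) (snd p)) f"
proof -
 let ?t = "relation_space k V W +>\<^bsub>free_space k (carrier V \<times> carrier W)\<^esub> f"
 have "(SOME f. f \<in> ?t) \<in> ?t"
  using quot_mod_self[OF FS_mod[OF assms(1,2)] RS_sub[OF assms(1,2)] f] by (metis someI)
 then show ?thesis unfolding tsum_def by (rule free_ext_coset[OF assms])
qed

lemma tsum_lin:
 assumes "module k V" "module k W" "module k U" "\<beta> : bilin_maps k V W U"
 shows "(%t. tsum k U t \<beta>) : lin_maps k (tensor k V W) U"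
proof -
 let ?F = "free_space k (carrier V \<times> carrier W)" and ?N = "relation_space k V W"
 note FN = FS_mod[OF assms(1,2)] RS_sub[OF assms(1,2)]
 interpret F: module k ?F by (rule FN)
 have e: "free_ext k U (%p. \<beta> (fst p) (snd p)) : lin_maps k ?F U"
  by (rule free_ext_lin[OF assms(3)]) (use bilin_closed[OF assms(4)] in auto)
 show ?thesis
 proof (rule lin_mapsI)
  fix s assume "s <: tensor k V W"
  then obtain f where f: "f <: ?F" "s = ?N +>\<^bsub>?F\<^esub> f"
   by (auto simp: tensor_eq_quot_mod quot_mod_elem[OF FN])
  then show "tsum k U s \<beta> <: U" by (simp add: tsum_eq_free_ext[OF assms] lin_closed[OF e])
  fix t assume "t <: tensor k V W"
  then obtain g where g: "g <: ?F" "t = ?N +>\<^bsub>?F\<^esub> g"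
   by (auto simp: tensor_eq_quot_mod quot_mod_elem[OF FN])
  show "tsum k U (s +[tensor k V W] t) \<beta> = tsum k U s \<beta> +[U] tsum k U t \<beta>"
   unfolding f(2) g(2) tensor_eq_quot_mod using f(1) g(1)
   by (simp add: quot_mod_add[OF FN] tsum_eq_free_ext[OF assms] lin_add[OF e] F.add.m_closed del: free_space_simps)
 next
  fix c s assume c: "c <: k" and "s <: tensor k V W"
  then obtain f where f: "f <: ?F" "s = ?N +>\<^bsub>?F\<^esub> f"
   by (auto simp: tensor_eq_quot_mod quot_mod_elem[OF FN])
  show "tsum k U (c *[tensor k V W] s) \<beta> = c *[U] tsum k U s \<beta>"
   unfolding f(2) tensor_eq_quot_mod using f(1) c
   by (simp add: quot_mod_smult[OF FN] tsum_eq_free_ext[OF assms] lin_smult[OF e] del: free_space_simps)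
 qed
qed

lemma tsum_pure:
 assumes "module k V" "module k W" "module k U" "\<beta> : bilin_maps k V W U" "v <: V" "w <: W"
 shows "tsum k U (pure k V W v w) \<beta> = \<beta> v w"
 unfolding pure_def using assms
 by (subst tsum_eq_free_ext) (auto simp: free_ext_gen[OF assms(3)] bilin_closed[OF assms(4)]
   intro!: free_gen_carrier cring_base[OF assms(1,2)])

lemma tsum_self:
 assumes V: "module k V" and W: "module k W" and t: "t <: tensor k V W"
 shows "tsum k (tensor k V W) t (pure k V W) = t"
proof -
 let ?F = "free_space k (carrier V \<times> carrier W)" and ?N = "relation_space k V W"
 note FN = FS_mod[OF V W] RS_sub[OF V W]
 interpret F: module k ?F by (rule FN)
 interpret T: module k "tensor k V W" by (rule tensor_module[OF V W])
 let ?f = "SOME f. f \<in> t"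
 have f: "?f <: ?F" "t = ?N +>\<^bsub>?F\<^esub> ?f" using tensor_elem[OF V W t] by auto
 have q: "(%f. ?N +>\<^bsub>?F\<^esub> f) : lin_maps k ?F (tensor k V W)"
  unfolding tensor_eq_quot_mod by (rule quot_mod_proj_lin[OF FN])
 let ?A = "{p. ?f p \<noteq> \<zero>[k]}"
 have A: "finite ?A" "?A \<subseteq> carrier V \<times> carrier W" "!!p. ?f p <: k" using f(1) by (auto simp: free_space_carrier)
 have gen: "free_gen k p <: ?F" if "p \<in> ?A" for p
  using A(2) that by (intro free_gen_carrier cring_base[OF V W]) auto
 have "t = ?N +>\<^bsub>?F\<^esub> (free_ext k ?F (free_gen k) ?f)"
  using f free_ext_free_gen[OF cring_base[OF V W] f(1)] by simp
 also have "... = (\<Oplus>\<^bsub>tensor k V W\<^esub>p\<in>?A. ?N +>\<^bsub>?F\<^esub> (?f p *[?F] free_gen k p))"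
  unfolding free_ext_def using A gen
  by (intro lin_finsum[OF FN(1) T.module_axioms q]) (auto simp del: free_space_simps)
 also have "... = (\<Oplus>\<^bsub>tensor k V W\<^esub>p\<in>?A. ?f p *[tensor k V W] pure k V W (fst p) (snd p))"
 proof (intro T.finsum_cong' refl)
  show "(%p. ?f p *[tensor k V W] pure k V W (fst p) (snd p)) \<in> ?A \<rightarrow> carrier (tensor k V W)"
   using A by (auto intro!: T.smult_closed pure_closed[OF V W])
  show "?N +>\<^bsub>?F\<^esub> (?f p *[?F] free_gen k p) = ?f p *[tensor k V W] pure k V W (fst p) (snd p)" if "p \<in> ?A" for p
   using lin_smult[OF q A(3) gen[OF that], of p] by (simp add: pure_def)
 qed
 finally show ?thesis by (simp add: tsum_def free_ext_def)
qed

text \<open>A tensor product is generated by its pure tensors.\<close>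

lemma lin_tensor_eq:
 assumes V: "module k V" and W: "module k W" and U: "module k U"
  and f: "f : lin_maps k (tensor k V W) U" and g: "g : lin_maps k (tensor k V W) U"
  and eq: "!!v w. [|v <: V; w <: W|] ==> f (pure k V W v w) = g (pure k V W v w)"
  and t: "t <: tensor k V W"
 shows "f t = g t"
proof -
 note T = tensor_module[OF V W]
 have "f (tsum k (tensor k V W) t (pure k V W)) = tsum k U t (%v w. f (pure k V W v w))"
  by (rule lin_tsum[OF V W t T U f pure_closed[OF V W]])
 also have "... = tsum k U t (%v w. g (pure k V W v w))"
  by (rule tsum_cong[OF V W t U eq lin_closed[OF g pure_closed[OF V W]]])
 also have "... = g (tsum k (tensor k V W) t (pure k V W))"
  by (rule lin_tsum[OF V W t T U g pure_closed[OF V W], symmetric])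
 finally show ?thesis by (simp add: tsum_self[OF V W t])
qed

section \<open>Calculus of multilinear expressions\<close>

lemma foldSetD_cong:
 assumes "(A, y) \<in> foldSetD D f e" "!!x. x \<in> A ==> f x = g x"
 shows "(A, y) \<in> foldSetD D g e"
 using assms
proof (induction rule: foldSetD.induct)
 case (insertI x A y)
 then show ?case by (metis foldSetD.insertI insertCI)
qed (auto intro: foldSetD.intros)

lemma finsum_cong_total:
 assumes "!!x. x \<in> A ==> f x = g x"
 shows "finsum G f A = finsum G g A"
proof -
 have "(A, y) \<in> foldSetD (carrier G) ((\<oplus>\<^bsub>G\<^esub>) \<circ> f) \<zero>[G] \<longleftrightarrow> (A, y) \<in> foldSetD (carrier G) ((\<oplus>\<^bsub>G\<^esub>) \<circ> g) \<zero>[G]" for y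
  using foldSetD_cong[of A y _ "(\<oplus>\<^bsub>G\<^esub>) \<circ> f" _ "(\<oplus>\<^bsub>G\<^esub>) \<circ> g"] foldSetD_cong[of A y _ "(\<oplus>\<^bsub>G\<^esub>) \<circ> g" _ "(\<oplus>\<^bsub>G\<^esub>) \<circ> f"] assms
  by (metis comp_apply)
 then show ?thesis by (simp add: finsum_def finprod_def foldD_def comp_def)
qed

lemma tsum_cong':
 assumes "module k V" "module k W" "t <: tensor k V W"
  and "!!v w. [|v <: V; w <: W|] ==> \<beta> v w = \<gamma> v w"
 shows "tsum k U t \<beta> = tsum k U t \<gamma>"
proof (rule tensor_rep[OF assms(1-3)])
 fix A f assume A: "A \<subseteq> carrier V \<times> carrier W" "(SOME f. f \<in> t) = f" "A = {p. f p \<noteq> \<zero>[k]}"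
 have "(\<Oplus>\<^bsub>U\<^esub>p\<in>A. f p *[U] \<beta> (fst p) (snd p)) = (\<Oplus>\<^bsub>U\<^esub>p\<in>A. f p *[U] \<gamma> (fst p) (snd p))"
  using A(1) assms(4) by (intro finsum_cong_total) auto
 then show ?thesis by (simp add: tsum_def free_ext_def A)
qed

text \<open>The rules of this collection decompose a goal that an expression is linear in a variable, or lies in a carrier,
 along the structure of the expression; a bilinear map is one that is linear in each argument.\<close>

named_theorems mlin

lemmas [mlin] = lin_id bilin_mapsI tensor_module pure_closed

lemma mlin_pure [mlin]:
 "[|module k V; module k W; E : lin_maps k A V; c <: W|] ==> (%x. pure k V W (E x) c) : lin_maps k A (tensor k V W)"
 "[|module k V; module k W; F : lin_maps k A W; d <: V|] ==> (%x. pure k V W d (F x)) : lin_maps k A (tensor k V W)"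
 by (rule lin_comp[OF pure_lin_left]; assumption) (rule lin_comp[OF pure_lin_right]; assumption)

lemma mlin_smult [mlin]:
 "[|module k U; c <: k; E : lin_maps k A U|] ==> (%x. c *[U] E x) : lin_maps k A U"
proof -
 assume U: "module k U" and c: "c <: k" and E: "E : lin_maps k A U"
 interpret U: module k U by (rule U)
 have "(%x. c *[U] x) : lin_maps k U U"
  using c by (intro lin_mapsI) (auto simp: U.smult_r_distr U.m_comm simp flip: U.smult_assoc1)
 then show ?thesis by (rule lin_comp[OF _ E])
qed

lemma base_algebra_simps [simp]:
 "carrier (base_algebra k) = carrier k" "x +[base_algebra k] y = x +[k] y" "\<zero>[base_algebra k] = \<zero>[k]"
 "x \<otimes>[base_algebra k] y = x \<otimes>[k] y" "\<one>[base_algebra k] = \<one>[k]" "x *[base_algebra k] y = x \<otimes>[k] y"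
 by (simp_all add: base_algebra_def)

lemma base_algebra_module: "cring k ==> module k (base_algebra k)"
proof -
 assume "cring k"
 interpret k: cring k by fact
 have "!!x. x <: k ==> \<exists>y\<in>carrier k. y +[k] x = \<zero>[k]" using k.l_neg by blast
 then show ?thesis
  by (intro moduleI abelian_groupI k.cring_axioms) (auto simp: k.a_ac k.m_assoc k.l_distr k.r_distr)
qed

lemma mlin_smult_left [mlin]:
 "[|module k U; c <: U; E : lin_maps k A (base_algebra k)|] ==> (%x. E x *[U] c) : lin_maps k A U"
proof -
 assume U: "module k U" and c: "c <: U" and E: "E : lin_maps k A (base_algebra k)"
 interpret U: module k U by (rule U)
 have "(%x. x *[U] c) : lin_maps k (base_algebra k) U"
  using c by (intro lin_mapsI) (auto simp: U.smult_l_distr U.smult_assoc1)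
 then show ?thesis by (rule lin_comp[OF _ E])
qed

lemma mlin_smult_closed:
 "[|module k U; c <: k; x <: U|] ==> c *[U] x <: U"
 by (rule module.smult_closed)

lemmas [mlin] = lin_plus

lemma mlin_add_closed:
 assumes "module k U" "x <: U" "y <: U" shows "x +[U] y <: U"
proof -
 interpret module k U by fact
 show ?thesis using assms by simp
qed

text \<open>Linearity of \<open>x \<mapsto> \<Sum> \<beta> x v\<^sub>i w\<^sub>i\<close>, and of \<open>x \<mapsto> \<Sum> \<beta> v\<^sub>i w\<^sub>i\<close> where \<open>\<Sum> v\<^sub>i \<otimes> w\<^sub>i\<close> depends linearly on \<open>x\<close>.\<close>

lemma lin_tsum_arg:
 assumes V: "module k V" and W: "module k W" and t: "t <: tensor k V W" and U: "module k U"
  and \<beta>: "!!v w. [|v <: V; w <: W|] ==> (%x. \<beta> x v w) : lin_maps k A U"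
 shows "(%x. tsum k U t (\<beta> x)) : lin_maps k A U"
proof (rule lin_mapsI)
 fix x assume x: "x <: A"
 have bx: "\<beta> x v w <: U" if "v <: V" "w <: W" for v w using lin_closed[OF \<beta>[OF that]] x by simp
 show "tsum k U t (\<beta> x) <: U" by (rule tsum_closed[OF V W t U bx])
 fix y assume y: "y <: A"
 have by': "\<beta> y v w <: U" if "v <: V" "w <: W" for v w using lin_closed[OF \<beta>[OF that]] y by simp
 show "tsum k U t (\<beta> (x +[A] y)) = tsum k U t (\<beta> x) +[U] tsum k U t (\<beta> y)"
  by (rule trans[OF tsum_cong'[OF V W t] tsum_plus[OF V W t U bx by']]) (use lin_add[OF \<beta>] x y in auto)
next
 fix c x assume c: "c <: k" and x: "x <: A"
 have bx: "\<beta> x v w <: U" if "v <: V" "w <: W" for v w using lin_closed[OF \<beta>[OF that]] x by simp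
 show "tsum k U t (\<beta> (c *[A] x)) = c *[U] tsum k U t (\<beta> x)"
  by (rule trans[OF tsum_cong'[OF V W t] lin_tsum[OF V W t U U mlin_smult[OF U c lin_id] bx, symmetric]])
   (use lin_smult[OF \<beta>] c x in auto)
qed

lemma lin_tsum_tensor:
 assumes V: "module k V" and W: "module k W" and T: "T : lin_maps k A (tensor k V W)" and U: "module k U"
  and \<beta>: "\<beta> : bilin_maps k V W U"
 shows "(%x. tsum k U (T x) \<beta>) : lin_maps k A U"
 by (rule lin_comp[OF tsum_lin[OF V W U \<beta>] T])

text \<open>Evaluating a tensor that is itself given by a sum; with the interchange of sums this is the work-horse of all
 later computations.\<close>

lemma tsum_tsum:
 assumes V: "module k V" and W: "module k W" and t: "t <: tensor k V W" and U: "module k U"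
  and V': "module k V'" and W': "module k W'"
  and \<gamma>: "!!v w. [|v <: V; w <: W|] ==> \<gamma> v w <: tensor k V' W'"
  and \<beta>: "\<beta> : bilin_maps k V' W' U"
 shows "tsum k U (tsum k (tensor k V' W') t \<gamma>) \<beta> = tsum k U t (%v w. tsum k U (\<gamma> v w) \<beta>)"
 by (rule lin_tsum[OF V W t tensor_module[OF V' W'] U tsum_lin[OF V' W' U \<beta>] \<gamma>])

lemma smult_tsum:
 assumes V: "module k V" and W: "module k W" and t: "t <: tensor k V W" and U: "module k U"
  and c: "c <: k" and \<beta>: "!!v w. [|v <: V; w <: W|] ==> \<beta> v w <: U"
 shows "tsum k U t (%v w. c *[U] \<beta> v w) = c *[U] tsum k U t \<beta>"
 by (rule lin_tsum[OF V W t U U mlin_smult[OF U c lin_id] \<beta>, symmetric])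

text \<open>The structure maps of iterated tensor products, as sums over pure tensors.\<close>

lemma tensor_map_eq:
 assumes V: "module k V" and W: "module k W" and V': "module k V'" and W': "module k W'"
  and f: "f : lin_maps k V V'" and g: "g : lin_maps k W W'" and t: "t <: tensor k V W"
 shows "tensor_map k V' W' f g t = tsum k (tensor k V' W') t (%v w. pure k V' W' (f v) (g w))"
 unfolding tensor_map_def
 by (rule sweedler_eq_tsum[OF V W t tensor_module[OF V' W']])
  (intro bilin_mapsI mlin_pure V' W' lin_closed[OF f] lin_closed[OF g] f g)

lemma tensor_map_lin:
 assumes V: "module k V" and W: "module k W" and V': "module k V'" and W': "module k W'"
  and f: "f : lin_maps k V V'" and g: "g : lin_maps k W W'"
 shows "tensor_map k V' W' f g : lin_maps k (tensor k V W) (tensor k V' W')"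
 by (rule lin_cong[OF _ tensor_module[OF V W] tensor_map_eq[OF V W V' W' f g, symmetric]], rule tsum_lin[OF V W tensor_module[OF V' W']])
  (intro bilin_mapsI mlin_pure V' W' lin_closed[OF f] lin_closed[OF g] f g)

lemma tsum_tensor_map:
 assumes V: "module k V" and W: "module k W" and V': "module k V'" and W': "module k W'" and U: "module k U"
  and f: "f : lin_maps k V V'" and g: "g : lin_maps k W W'" and t: "t <: tensor k V W"
  and \<beta>: "\<beta> : bilin_maps k V' W' U"
 shows "tsum k U (tensor_map k V' W' f g t) \<beta> = tsum k U t (%v w. \<beta> (f v) (g w))"
proof -
 have "tsum k U (tensor_map k V' W' f g t) \<beta> = tsum k U t (%v w. tsum k U (pure k V' W' (f v) (g w)) \<beta>)"
  unfolding tensor_map_eq[OF V W V' W' f g t]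
  by (rule tsum_tsum[OF V W t U V' W' _ \<beta>]) (intro pure_closed V' W' lin_closed[OF f] lin_closed[OF g])
 also have "... = tsum k U t (%v w. \<beta> (f v) (g w))"
  by (rule tsum_cong'[OF V W t], rule tsum_pure[OF V' W' U \<beta>]) (intro lin_closed[OF f] lin_closed[OF g], assumption)+
 finally show ?thesis .
qed

lemma tensor_assoc_eq:
 assumes A: "module k A" and V: "module k V" and W: "module k W" and t: "t <: tensor k (tensor k A V) W"
 shows "tensor_assoc k A V W t = tsum k (tensor k A (tensor k V W)) t
  (%s w. tsum k (tensor k A (tensor k V W)) s (%u v. pure k A (tensor k V W) u (pure k V W v w)))"
proof -
 let ?T = "tensor k A (tensor k V W)"
 note m = tensor_module[OF A tensor_module[OF V W]]
 have b: "(%u v. pure k A (tensor k V W) u (pure k V W v w)) : bilin_maps k A V ?T" if "w <: W" for w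
  by (intro mlin A V W that)
 have "tensor_assoc k A V W t = sweedler k ?T t
  (%s w. sweedler k ?T s (%u v. pure k A (tensor k V W) u (pure k V W v w)))"
  by (simp add: tensor_assoc_def Let_def)
 also have "... = tsum k ?T t (%s w. sweedler k ?T s (%u v. pure k A (tensor k V W) u (pure k V W v w)))"
 proof (rule sweedler_eq_tsum[OF tensor_module[OF A V] W t m], rule bilin_mapsI)
  fix s assume s: "s <: tensor k A V"
  show "(%w. sweedler k ?T s (%u v. pure k A (tensor k V W) u (pure k V W v w))) : lin_maps k W ?T"
  proof (rule lin_cong[OF _ W])
   show "(%w. tsum k ?T s (%u v. pure k A (tensor k V W) u (pure k V W v w))) : lin_maps k W ?T"
    by (rule lin_tsum_arg[OF A V s m]) (intro mlin A V W)
  qed (rule sweedler_eq_tsum[OF A V s m b, symmetric])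
 next
  fix w assume w: "w <: W"
  show "(%s. sweedler k ?T s (%u v. pure k A (tensor k V W) u (pure k V W v w))) : lin_maps k (tensor k A V) ?T"
   by (rule lin_cong[OF tsum_lin[OF A V m b[OF w]] tensor_module[OF A V]])
    (rule sweedler_eq_tsum[OF A V _ m b[OF w], symmetric])
 qed
 also have "... = tsum k ?T t (%s w. tsum k ?T s (%u v. pure k A (tensor k V W) u (pure k V W v w)))"
  by (rule tsum_cong'[OF tensor_module[OF A V] W t]) (rule sweedler_eq_tsum[OF A V _ m b])
 finally show ?thesis .
qed

lemma trilin_tensor_left:
 assumes A: "module k A" and V: "module k V" and W: "module k W" and U: "module k U"
  and \<beta>: "!!b c. [|b <: V; c <: W|] ==> (%a. \<beta> a b c) : lin_maps k A U"
   "!!a c. [|a <: A; c <: W|] ==> (%b. \<beta> a b c) : lin_maps k V U"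
   "!!a b. [|a <: A; b <: V|] ==> \<beta> a b : lin_maps k W U"
 shows "(%s w. tsum k U s (%u v. \<beta> u v w)) : bilin_maps k (tensor k A V) W U"
 by (rule bilin_mapsI, rule lin_tsum_arg[OF A V _ U], assumption, rule \<beta>(3), assumption+, rule tsum_lin[OF A V U])
  (rule bilin_mapsI[OF \<beta>(2) \<beta>(1)])

lemma trilin_tensor_right:
 assumes A: "module k A" and V: "module k V" and W: "module k W" and U: "module k U"
  and \<beta>: "!!b c. [|b <: V; c <: W|] ==> (%a. \<beta> a b c) : lin_maps k A U"
   "!!a c. [|a <: A; c <: W|] ==> (%b. \<beta> a b c) : lin_maps k V U"
   "!!a b. [|a <: A; b <: V|] ==> \<beta> a b : lin_maps k W U"
 shows "(%u s. tsum k U s (\<beta> u)) : bilin_maps k A (tensor k V W) U"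
 by (rule bilin_mapsI, rule tsum_lin[OF V W U], rule bilin_mapsI[OF \<beta>(3) \<beta>(2)], assumption+, rule lin_tsum_arg[OF V W _ U])
  (assumption, rule \<beta>(1))

lemma tsum_tensor_assoc:
 assumes A: "module k A" and V: "module k V" and W: "module k W" and U: "module k U"
  and t: "t <: tensor k (tensor k A V) W"
  and \<beta>: "!!b c. [|b <: V; c <: W|] ==> (%a. \<beta> a b c) : lin_maps k A U"
   "!!a c. [|a <: A; c <: W|] ==> (%b. \<beta> a b c) : lin_maps k V U"
   "!!a b. [|a <: A; b <: V|] ==> \<beta> a b : lin_maps k W U"
 shows "tsum k U (tensor_assoc k A V W t) (%u s. tsum k U s (\<beta> u)) =
  tsum k U t (%s w. tsum k U s (%u v. \<beta> u v w))"
proof -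
 let ?T = "tensor k A (tensor k V W)"
 note VW = tensor_module[OF V W] note AV = tensor_module[OF A V] note m = tensor_module[OF A VW]
 have r: "(%u s. tsum k U s (\<beta> u)) : bilin_maps k A (tensor k V W) U"
  by (rule trilin_tensor_right[OF A V W U]) (rule \<beta>, assumption+)+
 have "tsum k U (tensor_assoc k A V W t) (%u s. tsum k U s (\<beta> u)) =
  tsum k U t (%s w. tsum k U (tsum k ?T s (%u v. pure k A (tensor k V W) u (pure k V W v w))) (%u s. tsum k U s (\<beta> u)))"
  unfolding tensor_assoc_eq[OF A V W t]
  by (rule tsum_tsum[OF AV W t U A VW _ r]) (intro tsum_closed[OF A V _ m] pure_closed A V W VW)
 also have "... = tsum k U t (%s w. tsum k U s (%u v. tsum k U (pure k A (tensor k V W) u (pure k V W v w)) (%u s. tsum k U s (\<beta> u))))"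
  by (rule tsum_cong'[OF AV W t], rule tsum_tsum[OF A V _ U A VW _ r]) (assumption|intro pure_closed A V W VW)+
 also have "... = tsum k U t (%s w. tsum k U s (%u v. \<beta> u v w))"
 proof (rule tsum_cong'[OF AV W t], rule tsum_cong'[OF A V])
  fix s w u v assume h: "u <: A" "v <: V" "w <: W"
  have "tsum k U (pure k A (tensor k V W) u (pure k V W v w)) (%u s. tsum k U s (\<beta> u)) = tsum k U (pure k V W v w) (\<beta> u)"
   by (rule tsum_pure[OF A VW U r]) (intro h pure_closed V W)+
  also have "... = \<beta> u v w" by (rule tsum_pure[OF V W U bilin_mapsI h(2,3)]) (rule \<beta>, (assumption | rule h)+)+
  finally show "tsum k U (pure k A (tensor k V W) u (pure k V W v w)) (%u s. tsum k U s (\<beta> u)) = \<beta> u v w" .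
 qed
 finally show ?thesis .
qed

text \<open>Coassociativity conditions in Sweedler form: both sides of an equation
 \<open>(f \<otimes> 1) t = (1 \<otimes> g) t'\<close>, up to the associator, evaluated against a trilinear map.\<close>

lemma tsum_assoc_map_left:
 assumes A: "module k A" and V: "module k V" and W: "module k W" and U: "module k U" and P: "module k P"
  and f: "f : lin_maps k P (tensor k A V)" and t: "t <: tensor k P W"
  and \<beta>: "!!b c. [|b <: V; c <: W|] ==> (%a. \<beta> a b c) : lin_maps k A U"
   "!!a c. [|a <: A; c <: W|] ==> (%b. \<beta> a b c) : lin_maps k V U"
   "!!a b. [|a <: A; b <: V|] ==> \<beta> a b : lin_maps k W U"
 shows "tsum k U (tensor_assoc k A V W (tensor_map k (tensor k A V) W f (%w. w) t)) (%u s. tsum k U s (\<beta> u)) =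
  tsum k U t (%p w. tsum k U (f p) (%u v. \<beta> u v w))"
proof -
 have l: "(%s w. tsum k U s (%u v. \<beta> u v w)) : bilin_maps k (tensor k A V) W U"
  by (rule trilin_tensor_left[OF A V W U]) (rule \<beta>, assumption+)+
 have "tsum k U (tensor_assoc k A V W (tensor_map k (tensor k A V) W f (%w. w) t)) (%u s. tsum k U s (\<beta> u)) =
  tsum k U (tensor_map k (tensor k A V) W f (%w. w) t) (%s w. tsum k U s (%u v. \<beta> u v w))"
  by (rule tsum_tensor_assoc[OF A V W U lin_closed[OF tensor_map_lin[OF P W tensor_module[OF A V] W f lin_id] t]])
   (rule \<beta>, assumption+)+
 also have "... = tsum k U t (%p w. tsum k U (f p) (%u v. \<beta> u v w))"
  by (rule tsum_tensor_map[OF P W tensor_module[OF A V] W U f lin_id t l])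
 finally show ?thesis .
qed

lemma tsum_map_right:
 assumes A: "module k A" and V: "module k V" and W: "module k W" and U: "module k U" and P: "module k P"
  and g: "g : lin_maps k P (tensor k V W)" and t: "t <: tensor k A P"
  and \<beta>: "!!b c. [|b <: V; c <: W|] ==> (%a. \<beta> a b c) : lin_maps k A U"
   "!!a c. [|a <: A; c <: W|] ==> (%b. \<beta> a b c) : lin_maps k V U"
   "!!a b. [|a <: A; b <: V|] ==> \<beta> a b : lin_maps k W U"
 shows "tsum k U (tensor_map k A (tensor k V W) (%a. a) g t) (%u s. tsum k U s (\<beta> u)) =
  tsum k U t (%a p. tsum k U (g p) (%v w. \<beta> a v w))"
 by (rule tsum_tensor_map[OF A P A tensor_module[OF V W] U lin_id g t], rule trilin_tensor_right[OF A V W U])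
  (rule \<beta>, assumption+)+

text \<open>Conversely, an element of \<open>A \<otimes> (V \<otimes> W)\<close> is recovered from the trilinear map \<open>(u, v, w) \<mapsto> u \<otimes> (v \<otimes> w)\<close>.\<close>

lemma tsum_self_right:
 assumes A: "module k A" and V: "module k V" and W: "module k W" and t: "t <: tensor k A (tensor k V W)"
 shows "tsum k (tensor k A (tensor k V W)) t
  (%u s. tsum k (tensor k A (tensor k V W)) s (%v w. pure k A (tensor k V W) u (pure k V W v w))) = t"
proof -
 let ?T = "tensor k A (tensor k V W)"
 note VW = tensor_module[OF V W] note m = tensor_module[OF A VW]
 have "tsum k ?T t (%u s. tsum k ?T s (%v w. pure k A (tensor k V W) u (pure k V W v w))) = tsum k ?T t (pure k A (tensor k V W))"
 proof (rule tsum_cong'[OF A VW t])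
  fix u s assume u: "u <: A" and s: "s <: tensor k V W"
  show "tsum k ?T s (%v w. pure k A (tensor k V W) u (pure k V W v w)) = pure k A (tensor k V W) u s"
   using lin_tsum[OF V W s VW m pure_lin_right[OF A VW u], of "pure k V W"] pure_closed[OF V W] tsum_self[OF V W s] by simp
 qed
 then show ?thesis using tsum_self[OF A VW t] by simp
qed

section \<open>Algebras\<close>

lemma assoc_algebra_mlin [mlin]:
 "[|assoc_algebra k A; E : lin_maps k V A; c <: A|] ==> (%x. E x \<otimes>[A] c) : lin_maps k V A"
 "[|assoc_algebra k A; E : lin_maps k V A; c <: A|] ==> (%x. c \<otimes>[A] E x) : lin_maps k V A"
proof -
 assume A: "assoc_algebra k A" and E: "E : lin_maps k V A" and c: "c <: A"
 interpret A: assoc_algebra k A by (rule A)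
 have "(%x. x \<otimes>[A] c) : lin_maps k A A" "(%x. c \<otimes>[A] x) : lin_maps k A A"
  using c by (auto intro!: lin_mapsI simp: A.l_distr A.r_distr A.smult_mult_left A.smult_mult_right)
 then show "(%x. E x \<otimes>[A] c) : lin_maps k V A" "(%x. c \<otimes>[A] E x) : lin_maps k V A"
  using lin_comp[OF _ E] by auto
qed

lemma assoc_algebra_mult_closed: "[|assoc_algebra k A; x <: A; y <: A|] ==> x \<otimes>[A] y <: A"
 and assoc_algebra_one_closed: "assoc_algebra k A ==> \<one>[A] <: A"
 and assoc_algebra_l_one: "[|assoc_algebra k A; x <: A|] ==> \<one>[A] \<otimes>[A] x = x"
 and assoc_algebra_r_one: "[|assoc_algebra k A; x <: A|] ==> x \<otimes>[A] \<one>[A] = x"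
 and assoc_algebra_assoc: "[|assoc_algebra k A; x <: A; y <: A; z <: A|] ==>
  x \<otimes>[A] y \<otimes>[A] z = x \<otimes>[A] (y \<otimes>[A] z)"
 and assoc_algebra_smult_left: "[|assoc_algebra k A; c <: k; x <: A; y <: A|] ==>
  (c *[A] x) \<otimes>[A] y = c *[A] (x \<otimes>[A] y)"
 and assoc_algebra_smult_right: "[|assoc_algebra k A; c <: k; x <: A; y <: A|] ==>
  x \<otimes>[A] (c *[A] y) = c *[A] (x \<otimes>[A] y)"
 and assoc_algebra_module: "assoc_algebra k A ==> module k A"
proof -
 assume A: "assoc_algebra k A"
 interpret A: assoc_algebra k A by (rule A)
 show "\<one>[A] <: A" by simp
 show "module k A" by unfold_locales
 fix x assume x: "x <: A"
 show "\<one>[A] \<otimes>[A] x = x" "x \<otimes>[A] \<one>[A] = x" using x by simp_all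
 fix y assume y: "y <: A"
 show "x \<otimes>[A] y <: A" using x y by simp
 show "(c *[A] x) \<otimes>[A] y = c *[A] (x \<otimes>[A] y)" "x \<otimes>[A] (c *[A] y) = c *[A] (x \<otimes>[A] y)" if "c <: k" for c
  using that x y by (simp_all add: A.smult_mult_left A.smult_mult_right)
 show "x \<otimes>[A] y \<otimes>[A] z = x \<otimes>[A] (y \<otimes>[A] z)" if "z <: A" for z
  using that x y by (simp add: A.m_assoc)
qed

definition trilin_maps where
 "trilin_maps k A V W U = {\<beta>. (\<forall>a\<in>carrier A. \<beta> a : bilin_maps k V W U) \<and>
   (\<forall>b\<in>carrier V. \<forall>c\<in>carrier W. (%a. \<beta> a b c) : lin_maps k A U)}"

definition quadrilin_maps where
 "quadrilin_maps k A V W X U = {\<beta>. (\<forall>a\<in>carrier A. \<beta> a : trilin_maps k V W X U) \<and>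
   (\<forall>b\<in>carrier V. \<forall>c\<in>carrier W. \<forall>d\<in>carrier X. (%a. \<beta> a b c d) : lin_maps k A U)}"

lemma trilin_mapsI [mlin]:
 "[|!!a. a <: A ==> \<beta> a : bilin_maps k V W U;
  !!b c. [|b <: V; c <: W|] ==> (%a. \<beta> a b c) : lin_maps k A U|] ==> \<beta> : trilin_maps k A V W U"
 by (auto simp: trilin_maps_def)

lemma quadrilin_mapsI [mlin]:
 "[|!!a. a <: A ==> \<beta> a : trilin_maps k V W X U;
  !!b c d. [|b <: V; c <: W; d <: X|] ==> (%a. \<beta> a b c d) : lin_maps k A U|]
  ==> \<beta> : quadrilin_maps k A V W X U"
 by (auto simp: quadrilin_maps_def)

lemma trilin_mapsD:
 assumes "\<beta> : trilin_maps k A V W U"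
 shows "[|b <: V; c <: W|] ==> (%a. \<beta> a b c) : lin_maps k A U"
  and "[|a <: A; c <: W|] ==> (%b. \<beta> a b c) : lin_maps k V U"
  and "[|a <: A; b <: V|] ==> \<beta> a b : lin_maps k W U"
  and "[|a <: A; b <: V; c <: W|] ==> \<beta> a b c <: U"
 using assms by (auto simp: trilin_maps_def bilin_maps_def dest: lin_closed)

lemma quadrilin_mapsD:
 assumes "\<beta> : quadrilin_maps k A V W X U"
 shows "[|b <: V; c <: W; d <: X|] ==> (%a. \<beta> a b c d) : lin_maps k A U"
  and "[|a <: A; c <: W; d <: X|] ==> (%b. \<beta> a b c d) : lin_maps k V U"
  and "[|a <: A; b <: V; d <: X|] ==> (%c. \<beta> a b c d) : lin_maps k W U"
  and "[|a <: A; b <: V; c <: W|] ==> \<beta> a b c : lin_maps k X U"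
  and "[|a <: A; b <: V; c <: W; d <: X|] ==> \<beta> a b c d <: U"
 using assms by (auto simp: quadrilin_maps_def trilin_maps_def bilin_maps_def dest: lin_closed)


section \<open>Sweedler calculus in a cogroupoid\<close>

context cogroupoid
begin

lemmas [mlin] = mlin_smult_closed[of k] mlin_add_closed[of k]

lemma alg_assoc_algebra [mlin]: "[|X : ob C; Y : ob C|] ==> assoc_algebra k (alg C X Y)"
 by (rule alg_algebra)

lemma alg_module [mlin]: "[|X : ob C; Y : ob C|] ==> module k (alg C X Y)"
 by (rule assoc_algebra_module[OF alg_algebra])

lemma alg_mult_closed [mlin]: "[|X : ob C; Y : ob C; x <: alg C X Y; y <: alg C X Y|] ==>
  x \<otimes>[alg C X Y] y <: alg C X Y"
 and alg_one_closed [mlin]: "[|X : ob C; Y : ob C|] ==> \<one>[alg C X Y] <: alg C X Y"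
 by (rule assoc_algebra_mult_closed[OF alg_algebra] assoc_algebra_one_closed[OF alg_algebra]; assumption)+

lemma cocomp_lin: "[|X : ob C; Y : ob C; Z : ob C|] ==>
  cocomp C X Y Z : lin_maps k (alg C X Y) (tensor k (alg C X Z) (alg C Z Y))"
 using cocomp_alg_map[of X Y Z] by (simp add: alg_maps_def tensor_algebra_def lin_maps_def)

lemma cocomp_mlin [mlin]: "[|X : ob C; Y : ob C; Z : ob C; E : lin_maps k A (alg C X Y)|] ==>
  (%x. cocomp C X Y Z (E x)) : lin_maps k A (tensor k (alg C X Z) (alg C Z Y))"
 by (rule lin_comp[OF cocomp_lin])

lemma cocomp_closed [mlin]: "[|X : ob C; Y : ob C; Z : ob C; x <: alg C X Y|] ==>
  cocomp C X Y Z x <: tensor k (alg C X Z) (alg C Z Y)"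
 by (rule lin_closed[OF cocomp_lin])

lemma coun_lin: "X : ob C ==> coun C X : lin_maps k (alg C X X) (base_algebra k)"
 using coun_alg_map[of X] by (simp add: alg_maps_def)

lemma coun_mlin [mlin]: "[|X : ob C; E : lin_maps k A (alg C X X)|] ==>
  (%x. coun C X (E x)) : lin_maps k A (base_algebra k)"
 by (rule lin_comp[OF coun_lin])

lemma coun_closed [mlin]: "[|X : ob C; x <: alg C X X|] ==> coun C X x <: k"
 using lin_closed[OF coun_lin] by simp

lemma coun_mult: "[|X : ob C; x <: alg C X X; y <: alg C X X|] ==>
  coun C X (x \<otimes>[alg C X X] y) = coun C X x \<otimes>[k] coun C X y"
 and coun_one: "X : ob C ==> coun C X \<one>[alg C X X] = \<one>[k]"
 using coun_alg_map[of X] by (auto simp: alg_maps_def ring_hom_def)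

lemma anti_mlin [mlin]: "[|X : ob C; Y : ob C; E : lin_maps k A (alg C X Y)|] ==>
  (%x. anti C X Y (E x)) : lin_maps k A (alg C Y X)"
 by (rule lin_comp[OF anti_lin])

lemma anti_closed [mlin]: "[|X : ob C; Y : ob C; x <: alg C X Y|] ==> anti C X Y x <: alg C Y X"
 by (rule lin_closed[OF anti_lin])

text \<open>\<open>Sw2 U X Z Y x \<beta>\<close> is \<open>\<Sum> \<beta> x\<^sub>1 x\<^sub>2\<close> with \<open>x\<^sub>1 \<in> \<C>(X,Z)\<close> and \<open>x\<^sub>2 \<in> \<C>(Z,Y)\<close>; in the longer versions
 the objects are again listed in the order in which the components of \<open>x\<close> run through them.\<close>

abbreviation Sw2 where "Sw2 U X Z Y x \<beta> \<equiv> tsum k U (cocomp C X Y Z x) \<beta>"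
abbreviation Sw3 where "Sw3 U X Z T Y x \<beta> \<equiv> Sw2 U X Z Y x (%a b. Sw2 U Z T Y b (\<beta> a))"
abbreviation Sw4 where "Sw4 U X Z T W Y x \<beta> \<equiv> Sw2 U X Z Y x (%a b. Sw3 U Z T W Y b (\<beta> a))"

lemma sw_cong:
 "[|X : ob C; Y : ob C; Z : ob C; x <: alg C X Y;
  !!a b. [|a <: alg C X Z; b <: alg C Z Y|] ==> \<beta> a b = \<gamma> a b|] ==> Sw2 U X Z Y x \<beta> = Sw2 U X Z Y x \<gamma>"
 by (rule tsum_cong'[OF alg_module alg_module cocomp_closed])

lemma sw_closed [mlin]:
 "[|X : ob C; Y : ob C; Z : ob C; x <: alg C X Y; module k U;
  !!a b. [|a <: alg C X Z; b <: alg C Z Y|] ==> \<beta> a b <: U|] ==> Sw2 U X Z Y x \<beta> <: U"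
 by (rule tsum_closed[OF alg_module alg_module cocomp_closed])

lemma sw_lin_arg [mlin]:
 "[|X : ob C; Y : ob C; Z : ob C; x <: alg C X Y; module k U;
  !!a b. [|a <: alg C X Z; b <: alg C Z Y|] ==> (%v. \<beta> v a b) : lin_maps k V U|] ==>
  (%v. Sw2 U X Z Y x (\<beta> v)) : lin_maps k V U"
 by (rule lin_tsum_arg[OF alg_module alg_module cocomp_closed])

lemma sw_lin [mlin]:
 "[|X : ob C; Y : ob C; Z : ob C; module k U; E : lin_maps k V (alg C X Y);
  \<beta> : bilin_maps k (alg C X Z) (alg C Z Y) U|] ==> (%v. Sw2 U X Z Y (E v) \<beta>) : lin_maps k V U"
 by (rule lin_tsum_tensor[OF alg_module alg_module cocomp_mlin])

lemma sw_swap: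
 "[|X : ob C; Y : ob C; Z : ob C; X' : ob C; Y' : ob C; Z' : ob C; module k U;
  x <: alg C X Y; y <: alg C X' Y';
  !!a b c d. [|a <: alg C X Z; b <: alg C Z Y; c <: alg C X' Z'; d <: alg C Z' Y'|]
   ==> \<beta> a b c d <: U|] ==>
  Sw2 U X Z Y x (%a b. Sw2 U X' Z' Y' y (\<beta> a b)) = Sw2 U X' Z' Y' y (%c d. Sw2 U X Z Y x (%a b. \<beta> a b c d))"
 by (rule tsum_swap[OF alg_module alg_module cocomp_closed _ alg_module alg_module cocomp_closed])

lemma sw_coassoc:
 assumes ob: "X : ob C" "Y : ob C" "Z : ob C" "T : ob C" and x: "x <: alg C X Y" and U: "module k U"
  and \<beta>: "\<beta> : trilin_maps k (alg C X T) (alg C T Z) (alg C Z Y) U"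
 shows "Sw2 U X Z Y x (%p c. Sw2 U X T Z p (%a b. \<beta> a b c)) = Sw3 U X T Z Y x \<beta>"
proof -
 note D = trilin_mapsD(1-3)[OF \<beta>]
 have "Sw2 U X Z Y x (%p c. Sw2 U X T Z p (%a b. \<beta> a b c)) =
  tsum k U (tensor_assoc k (alg C X T) (alg C T Z) (alg C Z Y)
    (tensor_map k (tensor k (alg C X T) (alg C T Z)) (alg C Z Y) (cocomp C X Z T) (%b. b) (cocomp C X Y Z x)))
   (%u s. tsum k U s (\<beta> u))"
  by (rule tsum_assoc_map_left[of k "alg C X T" "alg C T Z" "alg C Z Y" U "alg C X Z", symmetric]) (assumption|intro mlin cocomp_lin ob x U D)+
 also have "... = tsum k U (tensor_map k (alg C X T) (tensor k (alg C T Z) (alg C Z Y))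
      (%b. b) (cocomp C T Y Z) (cocomp C X Y T x)) (%u s. tsum k U s (\<beta> u))"
  by (simp add: coassoc[OF ob x])
 also have "... = Sw3 U X T Z Y x \<beta>"
  by (rule tsum_map_right[of k "alg C X T" "alg C T Z" "alg C Z Y" U "alg C T Y"]) (assumption|intro mlin cocomp_lin ob x U D)+
 finally show ?thesis .
qed

lemma sw_coun_right:
 assumes ob: "X : ob C" "Y : ob C" and x: "x <: alg C X Y" and U: "module k U"
  and \<beta>: "\<beta> : lin_maps k (alg C X Y) U"
 shows "Sw2 U X Y Y x (%a b. coun C Y b *[U] \<beta> a) = \<beta> x"
proof -
 let ?A = "alg C X Y"
 have "\<beta> x = \<beta> (sweedler k ?A (cocomp C X Y Y x) (%b c. coun C Y c *[?A] b))"
  by (simp add: coun_right[OF ob x])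
 also have "... = \<beta> (Sw2 ?A X Y Y x (%b c. coun C Y c *[?A] b))"
  by (subst sweedler_eq_tsum[of k "alg C X Y" "alg C Y Y"]) (assumption | rule refl | intro mlin ob x)+
 also have "... = Sw2 U X Y Y x (%b c. \<beta> (coun C Y c *[?A] b))"
  by (rule lin_tsum[OF alg_module alg_module cocomp_closed _ U \<beta>]) (assumption|intro mlin ob x)+
 also have "... = Sw2 U X Y Y x (%a b. coun C Y b *[U] \<beta> a)"
  by (rule sw_cong) (assumption|intro ob x lin_smult[OF \<beta>] mlin)+
 finally show ?thesis by simp
qed

lemma sw_coun_left:
 assumes ob: "X : ob C" "Y : ob C" and x: "x <: alg C X Y" and U: "module k U"
  and \<beta>: "\<beta> : lin_maps k (alg C X Y) U"
 shows "Sw2 U X X Y x (%a b. coun C X a *[U] \<beta> b) = \<beta> x"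
proof -
 let ?A = "alg C X Y"
 have "\<beta> x = \<beta> (sweedler k ?A (cocomp C X Y X x) (%b c. coun C X b *[?A] c))"
  by (simp add: coun_left[OF ob x])
 also have "... = \<beta> (Sw2 ?A X X Y x (%b c. coun C X b *[?A] c))"
  by (subst sweedler_eq_tsum[of k "alg C X X" "alg C X Y"]) (assumption | rule refl | intro mlin ob x)+
 also have "... = Sw2 U X X Y x (%b c. \<beta> (coun C X b *[?A] c))"
  by (rule lin_tsum[OF alg_module alg_module cocomp_closed _ U \<beta>]) (assumption|intro mlin ob x)+
 also have "... = Sw2 U X X Y x (%a b. coun C X a *[U] \<beta> b)"
  by (rule sw_cong) (assumption|intro ob x lin_smult[OF \<beta>] mlin)+
 finally show ?thesis by simp
qed

lemma sw_anti_right: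
 assumes ob: "X : ob C" "Y : ob C" and x: "x <: alg C X X" and U: "module k U"
  and \<beta>: "\<beta> : lin_maps k (alg C X Y) U"
 shows "Sw2 U X Y X x (%a b. \<beta> (a \<otimes>[alg C X Y] anti C Y X b)) = coun C X x *[U] \<beta> \<one>[alg C X Y]"
proof -
 let ?A = "alg C X Y"
 have "coun C X x *[U] \<beta> \<one>[?A] = \<beta> (coun C X x *[?A] \<one>[?A])"
  by (rule lin_smult[OF \<beta>, symmetric]) (intro mlin ob x)+
 also have "... = \<beta> (sweedler k ?A (cocomp C X X Y x) (%b c. b \<otimes>[?A] anti C Y X c))"
  by (simp add: anti_right[OF ob x])
 also have "... = \<beta> (Sw2 ?A X Y X x (%b c. b \<otimes>[?A] anti C Y X c))"
  by (subst sweedler_eq_tsum[of k "alg C X Y" "alg C Y X"]) (assumption | rule refl | intro mlin ob x)+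
 also have "... = Sw2 U X Y X x (%b c. \<beta> (b \<otimes>[?A] anti C Y X c))"
  by (rule lin_tsum[OF alg_module alg_module cocomp_closed _ U \<beta>]) (assumption|intro mlin ob x)+
 finally show ?thesis by simp
qed

lemma sw_anti_left:
 assumes ob: "X : ob C" "Y : ob C" and x: "x <: alg C X X" and U: "module k U"
  and \<beta>: "\<beta> : lin_maps k (alg C Y X) U"
 shows "Sw2 U X Y X x (%a b. \<beta> (anti C X Y a \<otimes>[alg C Y X] b)) = coun C X x *[U] \<beta> \<one>[alg C Y X]"
proof -
 let ?A = "alg C Y X"
 have "coun C X x *[U] \<beta> \<one>[?A] = \<beta> (coun C X x *[?A] \<one>[?A])"
  by (rule lin_smult[OF \<beta>, symmetric]) (intro mlin ob x)+
 also have "... = \<beta> (sweedler k ?A (cocomp C X X Y x) (%b c. anti C X Y b \<otimes>[?A] c))"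
  by (simp add: anti_left[OF ob x])
 also have "... = \<beta> (Sw2 ?A X Y X x (%b c. anti C X Y b \<otimes>[?A] c))"
  by (subst sweedler_eq_tsum[of k "alg C X Y" "alg C Y X"]) (assumption | rule refl | intro mlin ob x)+
 also have "... = Sw2 U X Y X x (%b c. \<beta> (anti C X Y b \<otimes>[?A] c))"
  by (rule lin_tsum[OF alg_module alg_module cocomp_closed _ U \<beta>]) (assumption|intro mlin ob x)+
 finally show ?thesis by simp
qed

lemma sw_one:
 assumes ob: "X : ob C" "Y : ob C" "Z : ob C" and U: "module k U"
  and \<beta>: "\<beta> : bilin_maps k (alg C X Z) (alg C Z Y) U"
 shows "Sw2 U X Z Y \<one>[alg C X Y] \<beta> = \<beta> \<one>[alg C X Z] \<one>[alg C Z Y]"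
proof -
 have "cocomp C X Y Z \<one>[alg C X Y] = pure k (alg C X Z) (alg C Z Y) \<one>[alg C X Z] \<one>[alg C Z Y]"
  using cocomp_alg_map[OF ob] by (simp add: alg_maps_def ring_hom_def tensor_algebra_def)
 then show ?thesis by (simp, intro tsum_pure mlin ob U \<beta>)
qed

lemma sw_mult:
 assumes ob: "X : ob C" "Y : ob C" "Z : ob C" and U: "module k U"
  and \<beta>: "\<beta> : bilin_maps k (alg C X Z) (alg C Z Y) U"
  and x: "x <: alg C X Y" and y: "y <: alg C X Y"
 shows "Sw2 U X Z Y (x \<otimes>[alg C X Y] y) \<beta> =
  Sw2 U X Z Y x (%a b. Sw2 U X Z Y y (%c d. \<beta> (a \<otimes>[alg C X Z] c) (b \<otimes>[alg C Z Y] d)))"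
proof -
 let ?A = "alg C X Z" and ?B = "alg C Z Y"
 let ?T = "tensor k ?A ?B" and ?p = "%a b c d. pure k (alg C X Z) (alg C Z Y) (a \<otimes>[alg C X Z] c) (b \<otimes>[alg C Z Y] d)"
 have T: "module k ?T" by (intro mlin ob)
 have s: "sweedler k ?T (cocomp C X Y Z y) (?p a b) = Sw2 ?T X Z Y y (?p a b)" if "a <: ?A" "b <: ?B" for a b
  by (rule sweedler_eq_tsum[of k ?A ?B]) (assumption|intro mlin ob that y)+
 have "cocomp C X Y Z (x \<otimes>[alg C X Y] y) =
  sweedler k ?T (cocomp C X Y Z x) (%a b. sweedler k ?T (cocomp C X Y Z y) (?p a b))"
  using cocomp_alg_map[OF ob] x y by (simp add: alg_maps_def ring_hom_def tensor_algebra_def)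
 also have "... = Sw2 ?T X Z Y x (%a b. sweedler k ?T (cocomp C X Y Z y) (?p a b))"
 proof (rule sweedler_eq_tsum[of k ?A ?B])
  show "(%a b. sweedler k ?T (cocomp C X Y Z y) (?p a b)) : bilin_maps k ?A ?B ?T"
  proof (rule bilin_mapsI)
   fix a assume a: "a <: ?A"
   have "(%b. Sw2 ?T X Z Y y (?p a b)) : lin_maps k ?B ?T" by (intro mlin ob a y)
   then show "(%b. sweedler k ?T (cocomp C X Y Z y) (?p a b)) : lin_maps k ?B ?T"
    by (rule lin_cong) (intro mlin ob, rule s[OF a, symmetric])
  next
   fix b assume b: "b <: ?B"
   have "(%a. Sw2 ?T X Z Y y (?p a b)) : lin_maps k ?A ?T" by (intro mlin ob b y)
   then show "(%a. sweedler k ?T (cocomp C X Y Z y) (?p a b)) : lin_maps k ?A ?T"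
    by (rule lin_cong) (intro mlin ob, rule s[OF _ b, symmetric])
  qed
 qed (intro mlin ob x)+
 also have "... = Sw2 ?T X Z Y x (%a b. Sw2 ?T X Z Y y (?p a b))"
  by (rule sw_cong[OF ob x s])
 finally have "Sw2 U X Z Y (x \<otimes>[alg C X Y] y) \<beta> = tsum k U (Sw2 ?T X Z Y x (%a b. Sw2 ?T X Z Y y (?p a b))) \<beta>"
  by simp
 also have "... = Sw2 U X Z Y x (%a b. tsum k U (Sw2 ?T X Z Y y (?p a b)) \<beta>)"
  by (rule tsum_tsum[of k ?A ?B]) (assumption|intro mlin ob x y U \<beta>)+
 also have "... = Sw2 U X Z Y x (%a b. Sw2 U X Z Y y (%c d. \<beta> (a \<otimes>[?A] c) (b \<otimes>[?B] d)))"
 proof (rule sw_cong[OF ob x])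
  fix a b assume ab: "a <: ?A" "b <: ?B"
  have "tsum k U (Sw2 ?T X Z Y y (?p a b)) \<beta> = Sw2 U X Z Y y (%c d. tsum k U (?p a b c d) \<beta>)"
   by (rule tsum_tsum[of k ?A ?B]) (assumption|intro mlin ob y ab U \<beta>)+
  also have "... = Sw2 U X Z Y y (%c d. \<beta> (a \<otimes>[?A] c) (b \<otimes>[?B] d))"
   by (rule sw_cong[OF ob y], rule tsum_pure) (assumption|intro mlin ob y ab U \<beta>)+
  finally show "tsum k U (Sw2 ?T X Z Y y (?p a b)) \<beta> = ..." .
 qed
 finally show ?thesis .
qed

lemma sw_split31:
 assumes ob: "X : ob C" "Z : ob C" "Z' : ob C" "Y : ob C" "W : ob C" and x: "x <: alg C X Y" and U: "module k U"
  and \<beta>: "\<beta> : quadrilin_maps k (alg C X W) (alg C W Z) (alg C Z Z') (alg C Z' Y) U"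
 shows "Sw3 U X Z Z' Y x (%p c d. Sw2 U X W Z p (%a b. \<beta> a b c d)) = Sw4 U X W Z Z' Y x \<beta>"
proof -
 note D = quadrilin_mapsD[OF \<beta>]
 have "Sw3 U X Z Z' Y x (%p c d. Sw2 U X W Z p (%a b. \<beta> a b c d)) =
  Sw2 U X Z Y x (%p r. Sw2 U X W Z p (%a b. Sw2 U Z Z' Y r (%c d. \<beta> a b c d)))"
  by (rule sw_cong, (intro ob x)+, rule sw_swap) (assumption|intro ob U D)+
 also have "... = Sw4 U X W Z Z' Y x \<beta>"
  by (rule sw_coassoc) (assumption|intro mlin D ob x U)+
 finally show ?thesis .
qed

text \<open>Cancellation of neighbouring components against the antipode.\<close>

lemma sw_cancel_right:
 assumes ob: "X : ob C" "Y : ob C" "Z : ob C" and x: "x <: alg C X Y" and U: "module k U"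
  and \<beta>: "\<beta> : bilin_maps k (alg C X Z) (alg C X Y) U"
 shows "Sw3 U X Z X Y x (%a b c. \<beta> (a \<otimes>[alg C X Z] anti C Z X b) c) = \<beta> \<one>[alg C X Z] x"
proof -
 note D = bilin_maps_left[OF \<beta>] bilin_maps_right[OF \<beta>]
 have "Sw3 U X Z X Y x (%a b c. \<beta> (a \<otimes>[alg C X Z] anti C Z X b) c) =
  Sw2 U X X Y x (%p c. Sw2 U X Z X p (%a b. \<beta> (a \<otimes>[alg C X Z] anti C Z X b) c))"
  by (rule sw_coassoc[symmetric])
   (assumption|intro ob x U | rule D lin_comp[OF D(1)] | intro mlin)+
 also have "... = Sw2 U X X Y x (%p c. coun C X p *[U] \<beta> \<one>[alg C X Z] c)"
  by (rule sw_cong, (intro ob x)+, rule sw_anti_right) (assumption|intro ob U D)+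
 also have "... = \<beta> \<one>[alg C X Z] x"
  by (rule sw_coun_left) (assumption|intro ob x U D mlin)+
 finally show ?thesis .
qed

lemma sw_cancel_right_end:
 assumes ob: "X : ob C" "Y : ob C" "Z : ob C" and x: "x <: alg C X Y" and U: "module k U"
  and \<beta>: "\<beta> : bilin_maps k (alg C X Y) (alg C Y Z) U"
 shows "Sw3 U X Y Z Y x (%a b c. \<beta> a (b \<otimes>[alg C Y Z] anti C Z Y c)) = \<beta> x \<one>[alg C Y Z]"
proof -
 note D = bilin_maps_left[OF \<beta>] bilin_maps_right[OF \<beta>]
 have "Sw3 U X Y Z Y x (%a b c. \<beta> a (b \<otimes>[alg C Y Z] anti C Z Y c)) =
  Sw2 U X Y Y x (%a q. coun C Y q *[U] \<beta> a \<one>[alg C Y Z])"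
  by (rule sw_cong, (intro ob x)+, rule sw_anti_right) (assumption|intro ob U D)+
 also have "... = \<beta> x \<one>[alg C Y Z]"
  by (rule sw_coun_right) (assumption|intro ob x U D mlin)+
 finally show ?thesis .
qed

end

section \<open>The antipode of a cogroupoid\<close>

context cogroupoid
begin

lemma alg_assoc: "[|X : ob C; Y : ob C; x <: alg C X Y; y <: alg C X Y; z <: alg C X Y|] ==>
  x \<otimes>[alg C X Y] y \<otimes>[alg C X Y] z = x \<otimes>[alg C X Y] (y \<otimes>[alg C X Y] z)"
 and alg_l_one: "[|X : ob C; Y : ob C; x <: alg C X Y|] ==> \<one>[alg C X Y] \<otimes>[alg C X Y] x = x"
 and alg_r_one: "[|X : ob C; Y : ob C; x <: alg C X Y|] ==> x \<otimes>[alg C X Y] \<one>[alg C X Y] = x"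
 by (rule assoc_algebra_assoc[OF alg_algebra] assoc_algebra_l_one[OF alg_algebra] assoc_algebra_r_one[OF alg_algebra]; assumption)+

lemmas alg_simps = alg_assoc alg_l_one alg_r_one alg_mult_closed alg_one_closed anti_closed

lemma base_cring: "X : ob C ==> cring k"
proof -
 assume "X : ob C"
 then interpret module k "alg C X X" by (intro mlin)
 show ?thesis by unfold_locales
qed

lemma smult_smult:
 assumes "module k U" "c <: k" "d <: k" "x <: U"
 shows "c *[U] (d *[U] x) = (c \<otimes>[k] d) *[U] x"
  and "(c \<otimes>[k] d) *[U] x = d *[U] (c *[U] x)"
  and "\<one>[k] *[U] x = x"
proof -
 interpret module k U by fact
 show "c *[U] (d *[U] x) = (c \<otimes>[k] d) *[U] x" using assms by (simp add: smult_assoc1)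
 show "(c \<otimes>[k] d) *[U] x = d *[U] (c *[U] x)" using assms by (simp add: R.m_comm[of c d] smult_assoc1)
 show "\<one>[k] *[U] x = x" using assms by simp
qed

lemma sw_smult:
 assumes "X : ob C" "Y : ob C" "Z : ob C" "x <: alg C X Y" "module k U" "c <: k"
  "!!a b. [|a <: alg C X Z; b <: alg C Z Y|] ==> \<beta> a b <: U"
 shows "Sw2 U X Z Y x (%a b. c *[U] \<beta> a b) = c *[U] Sw2 U X Z Y x \<beta>"
 by (rule smult_tsum[of k "alg C X Z" "alg C Z Y"]) (assumption|intro mlin assms)+

lemma anti_one:
 assumes ob: "X : ob C" "Y : ob C"
 shows "anti C X Y \<one>[alg C X Y] = \<one>[alg C Y X]"
proof -
 let ?B = "alg C Y X"
 have "anti C X Y \<one>[alg C X Y] = anti C X Y \<one>[alg C X Y] \<otimes>[?B] \<one>[?B]"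
  by (simp add: alg_simps ob)
 also have "... = Sw2 ?B X Y X \<one>[alg C X X] (%a b. anti C X Y a \<otimes>[?B] b)"
  by (rule sw_one[symmetric]) (assumption|intro ob mlin)+
 also have "... = coun C X \<one>[alg C X X] *[?B] \<one>[?B]"
  by (rule sw_anti_left[where \<beta> = "%x. x"]) (assumption|intro ob mlin)+
 also have "... = \<one>[?B]" using ob by (simp add: coun_one alg_simps module.smult_one[OF alg_module])
 finally show ?thesis .
qed

text \<open>As for Hopf algebras, \<open>S(ab)\<close> and \<open>S(b) S(a)\<close> are both convolution inverse to the product: the
 sum of the \<open>S(a\<^sub>1 b\<^sub>1) a\<^sub>2 b\<^sub>2 S(b\<^sub>3) S(a\<^sub>3)\<close>, with middle components in \<open>\<C>(Y,X)\<close>, equals either of them.\<close>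

lemma anti_mult:
 assumes ob: "X : ob C" "Y : ob C" and a: "a <: alg C X Y" and b: "b <: alg C X Y"
 shows "anti C X Y (a \<otimes>[alg C X Y] b) = anti C X Y b \<otimes>[alg C Y X] anti C X Y a"
proof -
 let ?B = "alg C Y X" and ?S = "anti C X Y"
 have B: "module k ?B" by (intro mlin ob)
 define E where "E = Sw2 ?B X X Y a (%p a3. Sw2 ?B X X Y b (%q b3.
  Sw2 ?B X Y X (p \<otimes>[alg C X X] q) (%u v. ?S u \<otimes>[?B] (v \<otimes>[?B] (?S b3 \<otimes>[?B] ?S a3)))))"
 have "E = Sw2 ?B X X Y a (%p a3. Sw2 ?B X X Y b (%q b3. coun C X q *[?B] (coun C X p *[?B] (?S b3 \<otimes>[?B] ?S a3))))"
  unfolding E_def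
 proof (rule sw_cong, (intro ob a)+, rule sw_cong, (intro ob b)+)
  fix p a3 q b3 assume m: "p <: alg C X X" "a3 <: alg C X Y" "q <: alg C X X" "b3 <: alg C X Y"
  have "Sw2 ?B X Y X (p \<otimes>[alg C X X] q) (%u v. ?S u \<otimes>[?B] (v \<otimes>[?B] (?S b3 \<otimes>[?B] ?S a3))) =
   Sw2 ?B X Y X (p \<otimes>[alg C X X] q) (%u v. (?S u \<otimes>[?B] v) \<otimes>[?B] (?S b3 \<otimes>[?B] ?S a3))"
   by (rule sw_cong, (intro ob m mlin)+) (simp add: alg_simps ob m)
  also have "... = coun C X (p \<otimes>[alg C X X] q) *[?B] (\<one>\<^bsub>?B\<^esub> \<otimes>[?B] (?S b3 \<otimes>[?B] ?S a3))"
   by (rule sw_anti_left[where \<beta> = "%y. y \<otimes>[?B] (?S b3 \<otimes>[?B] ?S a3)"]) (assumption|intro ob m mlin)+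
  also have "... = coun C X q *[?B] (coun C X p *[?B] (?S b3 \<otimes>[?B] ?S a3))"
   using ob m by (simp add: coun_mult alg_simps smult_smult(2)[OF B] coun_closed)
  finally show "Sw2 ?B X Y X (p \<otimes>[alg C X X] q) (%u v. ?S u \<otimes>[?B] (v \<otimes>[?B] (?S b3 \<otimes>[?B] ?S a3))) = ..." .
 qed
 also have "... = Sw2 ?B X X Y a (%p a3. coun C X p *[?B] (?S b \<otimes>[?B] ?S a3))"
  by (rule sw_cong, (intro ob a)+, rule sw_coun_left) (assumption|intro ob b mlin)+
 also have "... = ?S b \<otimes>[?B] ?S a"
  by (rule sw_coun_left) (assumption|intro ob a b mlin)+
 finally have 1: "E = ?S b \<otimes>[?B] ?S a" .
 have "E = Sw2 ?B X X Y a (%p a3. Sw2 ?B X Y X p (%a1 a2. ?S (a1 \<otimes>[alg C X Y] b) \<otimes>[?B] (a2 \<otimes>[?B] ?S a3)))"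
  unfolding E_def
 proof (rule sw_cong, (intro ob a)+)
  fix p a3 assume m: "p <: alg C X X" "a3 <: alg C X Y"
  let ?G = "%a1 a2 b1 b2 b3. ?S (a1 \<otimes>[alg C X Y] b1) \<otimes>[?B] ((a2 \<otimes>[?B] (b2 \<otimes>[?B] ?S b3)) \<otimes>[?B] ?S a3)"
  have "Sw2 ?B X X Y b (%q b3. Sw2 ?B X Y X (p \<otimes>[alg C X X] q) (%u v. ?S u \<otimes>[?B] (v \<otimes>[?B] (?S b3 \<otimes>[?B] ?S a3)))) =
   Sw2 ?B X X Y b (%q b3. Sw2 ?B X Y X p (%a1 a2. Sw2 ?B X Y X q (%b1 b2. ?G a1 a2 b1 b2 b3)))"
  proof (rule sw_cong, (intro ob b)+)
   fix q b3 assume n: "q <: alg C X X" "b3 <: alg C X Y"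
   have "Sw2 ?B X Y X (p \<otimes>[alg C X X] q) (%u v. ?S u \<otimes>[?B] (v \<otimes>[?B] (?S b3 \<otimes>[?B] ?S a3))) =
    Sw2 ?B X Y X p (%a1 a2. Sw2 ?B X Y X q (%b1 b2. ?S (a1 \<otimes>[alg C X Y] b1) \<otimes>[?B] ((a2 \<otimes>[?B] b2) \<otimes>[?B] (?S b3 \<otimes>[?B] ?S a3))))"
    by (rule sw_mult) (assumption|intro ob m n mlin)+
   also have "... = Sw2 ?B X Y X p (%a1 a2. Sw2 ?B X Y X q (%b1 b2. ?G a1 a2 b1 b2 b3))"
    by (rule sw_cong, (intro ob m)+, rule sw_cong, (intro ob n)+) (simp add: alg_simps ob m n)
   finally show "Sw2 ?B X Y X (p \<otimes>[alg C X X] q) (%u v. ?S u \<otimes>[?B] (v \<otimes>[?B] (?S b3 \<otimes>[?B] ?S a3))) = ..." .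
  qed
  also have "... = Sw2 ?B X Y X p (%a1 a2. Sw2 ?B X X Y b (%q b3. Sw2 ?B X Y X q (%b1 b2. ?G a1 a2 b1 b2 b3)))"
   by (rule sw_swap) (assumption|intro ob m b mlin)+
  also have "... = Sw2 ?B X Y X p (%a1 a2. Sw3 ?B X Y X Y b (%b1 b2 b3. ?G a1 a2 b1 b2 b3))"
   by (rule sw_cong, (intro ob m)+, rule sw_coassoc) (assumption|intro ob m b mlin)+
  also have "... = Sw2 ?B X Y X p (%a1 a2. ?S (a1 \<otimes>[alg C X Y] b) \<otimes>[?B] ((a2 \<otimes>[?B] \<one>[?B]) \<otimes>[?B] ?S a3))"
  proof (rule sw_cong, (intro ob m)+)
   fix a1 a2 assume n: "a1 <: alg C X Y" "a2 <: alg C Y X"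
   show "Sw3 ?B X Y X Y b (%b1 b2 b3. ?G a1 a2 b1 b2 b3) = ?S (a1 \<otimes>[alg C X Y] b) \<otimes>[?B] ((a2 \<otimes>[?B] \<one>[?B]) \<otimes>[?B] ?S a3)"
    by (rule sw_cancel_right_end[where \<beta> = "%b1 y. ?S (a1 \<otimes>[alg C X Y] b1) \<otimes>[?B] ((a2 \<otimes>[?B] y) \<otimes>[?B] ?S a3)"])
     (assumption|intro ob m n b mlin)+
  qed
  also have "... = Sw2 ?B X Y X p (%a1 a2. ?S (a1 \<otimes>[alg C X Y] b) \<otimes>[?B] (a2 \<otimes>[?B] ?S a3))"
   by (rule sw_cong, (intro ob m)+) (simp add: alg_simps ob m)
  finally show "Sw2 ?B X X Y b (%q b3. Sw2 ?B X Y X (p \<otimes>[alg C X X] q) (%u v. ?S u \<otimes>[?B] (v \<otimes>[?B] (?S b3 \<otimes>[?B] ?S a3)))) = ..." .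
 qed
 also have "... = Sw3 ?B X Y X Y a (%a1 a2 a3. ?S (a1 \<otimes>[alg C X Y] b) \<otimes>[?B] (a2 \<otimes>[?B] ?S a3))"
  by (rule sw_coassoc) (assumption|intro ob a b mlin)+
 also have "... = ?S (a \<otimes>[alg C X Y] b) \<otimes>[?B] \<one>[?B]"
  by (rule sw_cancel_right_end[where \<beta> = "%a1 y. ?S (a1 \<otimes>[alg C X Y] b) \<otimes>[?B] y"]) (assumption|intro ob a b mlin)+
 also have "... = ?S (a \<otimes>[alg C X Y] b)" by (simp add: alg_simps ob a b)
 finally show ?thesis using 1 by simp
qed

text \<open>The coalgebra counterpart, by the same argument: comultiplying \<open>S(a\<^sub>1) a\<^sub>2\<close> and multiplying by \<open>S(a\<^sub>4) \<otimes> S(a\<^sub>3)\<close> can be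
 collapsed from either end.\<close>

lemma anti_comult:
 assumes ob: "X : ob C" "Y : ob C" "Z : ob C" and a: "a <: alg C X Y" and U: "module k U"
  and \<beta>: "\<beta> : bilin_maps k (alg C Y Z) (alg C Z X) U"
 shows "Sw2 U Y Z X (anti C X Y a) \<beta> = Sw2 U X Z Y a (%b c. \<beta> (anti C Z Y c) (anti C X Z b))"
proof -
 note D = bilin_maps_left[OF \<beta>] bilin_maps_right[OF \<beta>] lin_comp[OF bilin_maps_left[OF \<beta>]] lin_comp[OF bilin_maps_right[OF \<beta>]]
  bilin_closed[OF \<beta>]
 let ?M = "mult (alg C Y Z)" and ?N = "mult (alg C Z X)"
 let ?B = "%s s' t t' d e. \<beta> (?M (?M s t) (anti C Z Y e)) (?N (?N s' t') (anti C X Z d))"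
 let ?\<phi> = "%d e y. Sw2 U Y Z X y (%u u'. \<beta> (?M u (anti C Z Y e)) (?N u' (anti C X Z d)))"
 (* both sides of the claim are values of this sum: collapse S(a1) a2, or split it and collapse the outer factors *)
 define H where "H = Sw2 U X X Y a (%p c. Sw2 U X Z Y c (%d e. Sw2 U X Y X p (%a1 a2. ?\<phi> d e (anti C X Y a1 \<otimes>[alg C Y X] a2))))"
 have "H = Sw2 U X X Y a (%p c. coun C X p *[U] Sw2 U X Z Y c (%d e. \<beta> (anti C Z Y e) (anti C X Z d)))"
  unfolding H_def
 proof (rule sw_cong, (intro ob a)+)
  fix p c assume m: "p <: alg C X X" "c <: alg C X Y"
  have "Sw2 U X Z Y c (%d e. Sw2 U X Y X p (%a1 a2. ?\<phi> d e (anti C X Y a1 \<otimes>[alg C Y X] a2))) =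
   Sw2 U X Z Y c (%d e. coun C X p *[U] \<beta> (anti C Z Y e) (anti C X Z d))"
  proof (rule sw_cong, (intro ob m)+)
   fix d e assume n: "d <: alg C X Z" "e <: alg C Z Y"
   have "Sw2 U X Y X p (%a1 a2. ?\<phi> d e (anti C X Y a1 \<otimes>[alg C Y X] a2)) = coun C X p *[U] ?\<phi> d e \<one>[alg C Y X]"
    by (rule sw_anti_left) (assumption|intro ob m n U mlin D)+
   also have "?\<phi> d e \<one>[alg C Y X] = \<beta> (?M \<one>[alg C Y Z] (anti C Z Y e)) (?N \<one>[alg C Z X] (anti C X Z d))"
    by (rule sw_one) (assumption|intro ob m n U mlin D)+
   finally show "Sw2 U X Y X p (%a1 a2. ?\<phi> d e (anti C X Y a1 \<otimes>[alg C Y X] a2)) =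
    coun C X p *[U] \<beta> (anti C Z Y e) (anti C X Z d)" by (simp add: alg_simps ob n)
  qed
  also have "... = coun C X p *[U] Sw2 U X Z Y c (%d e. \<beta> (anti C Z Y e) (anti C X Z d))"
   by (rule sw_smult) (assumption|intro ob m U mlin D)+
  finally show "Sw2 U X Z Y c (%d e. Sw2 U X Y X p (%a1 a2. ?\<phi> d e (anti C X Y a1 \<otimes>[alg C Y X] a2))) = ..." .
 qed
 also have "... = Sw2 U X Z Y a (%b c. \<beta> (anti C Z Y c) (anti C X Z b))"
  by (rule sw_coun_left) (assumption|intro ob a U mlin D)+
 finally have 1: "H = Sw2 U X Z Y a (%b c. \<beta> (anti C Z Y c) (anti C X Z b))" .
 have L: "Sw2 U Y X Y r (%a2 c. Sw2 U Y Z X a2 (%t t'. Sw2 U X Z Y c (%d e. ?B s s' t t' d e))) = coun C Y r *[U] \<beta> s s'"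
  if m: "r <: alg C Y Y" "s <: alg C Y Z" "s' <: alg C Z X" for r s s'
 proof -
  have "Sw2 U Y X Y r (%a2 c. Sw2 U Y Z X a2 (%t t'. Sw2 U X Z Y c (%d e. ?B s s' t t' d e))) =
   Sw3 U Y Z X Y r (%t t' c. Sw2 U X Z Y c (%d e. ?B s s' t t' d e))"
   by (rule sw_coassoc) (assumption|intro ob m U mlin D)+
  also have "... = Sw2 U Y Z Y r (%t q. \<beta> (?M s (?M t (anti C Z Y q))) s')"
  proof (rule sw_cong, (intro ob m)+)
   fix t q assume n: "t <: alg C Y Z" "q <: alg C Z Y"
   have "Sw3 U Z X Z Y q (%t' d e. ?B s s' t t' d e) =
    Sw3 U Z X Z Y q (%t' d e. \<beta> (?M (?M s t) (anti C Z Y e)) (?N s' (?N t' (anti C X Z d))))"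
    by (rule sw_cong, (intro ob n)+, rule sw_cong, (assumption|intro ob)+) (simp add: alg_simps ob m n)
   also have "... = \<beta> (?M (?M s t) (anti C Z Y q)) (?N s' \<one>[alg C Z X])"
    by (rule sw_cancel_right[where \<beta> = "%y e. \<beta> (?M (?M s t) (anti C Z Y e)) (?N s' y)"])
     (assumption|intro ob m n U mlin D)+
   finally show "Sw3 U Z X Z Y q (%t' d e. ?B s s' t t' d e) = \<beta> (?M s (?M t (anti C Z Y q))) s'"
    by (simp add: alg_simps ob m n)
  qed
  also have "... = coun C Y r *[U] \<beta> (?M s \<one>[alg C Y Z]) s'"
   by (rule sw_anti_right[where \<beta> = "%y. \<beta> (?M s y) s'"]) (assumption|intro ob m U mlin D)+
  finally show ?thesis by (simp add: alg_simps ob m)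
 qed
 have "H = Sw2 U X X Y a (%p c. Sw2 U X Y X p (%a1 a2. Sw2 U X Z Y c (%d e. ?\<phi> d e (anti C X Y a1 \<otimes>[alg C Y X] a2))))"
  unfolding H_def by (rule sw_cong, (intro ob a)+, rule sw_swap) (assumption|intro ob U mlin D)+
 also have "... = Sw3 U X Y X Y a (%a1 a2 c. Sw2 U X Z Y c (%d e. ?\<phi> d e (anti C X Y a1 \<otimes>[alg C Y X] a2)))"
  by (rule sw_coassoc) (assumption|intro ob a U mlin D)+
 also have "... = Sw2 U X Y Y a (%a1 r. coun C Y r *[U] Sw2 U Y Z X (anti C X Y a1) \<beta>)"
 proof (rule sw_cong, (intro ob a)+)
  fix a1 r assume m: "a1 <: alg C X Y" "r <: alg C Y Y"
  have "Sw2 U Y X Y r (%a2 c. Sw2 U X Z Y c (%d e. ?\<phi> d e (anti C X Y a1 \<otimes>[alg C Y X] a2))) =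
   Sw2 U Y X Y r (%a2 c. Sw2 U Y Z X (anti C X Y a1) (%s s'. Sw2 U Y Z X a2 (%t t'. Sw2 U X Z Y c (%d e. ?B s s' t t' d e))))"
  proof (rule sw_cong, (intro ob m)+)
   fix a2 c assume n: "a2 <: alg C Y X" "c <: alg C X Y"
   have "Sw2 U X Z Y c (%d e. ?\<phi> d e (anti C X Y a1 \<otimes>[alg C Y X] a2)) =
    Sw2 U X Z Y c (%d e. Sw2 U Y Z X (anti C X Y a1) (%s s'. Sw2 U Y Z X a2 (%t t'. ?B s s' t t' d e)))"
    by (rule sw_cong, (intro ob n)+, rule sw_mult) (assumption|intro ob m n U mlin D)+
   also have "... = Sw2 U Y Z X (anti C X Y a1) (%s s'. Sw2 U X Z Y c (%d e. Sw2 U Y Z X a2 (%t t'. ?B s s' t t' d e)))"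
    by (rule sw_swap) (assumption|intro ob m n U mlin D)+
   also have "... = Sw2 U Y Z X (anti C X Y a1) (%s s'. Sw2 U Y Z X a2 (%t t'. Sw2 U X Z Y c (%d e. ?B s s' t t' d e)))"
    by (rule sw_cong, (intro ob m mlin)+, rule sw_swap) (assumption|intro ob m n U mlin D)+
   finally show "Sw2 U X Z Y c (%d e. ?\<phi> d e (anti C X Y a1 \<otimes>[alg C Y X] a2)) = ..." .
  qed
  also have "... = Sw2 U Y Z X (anti C X Y a1) (%s s'. Sw2 U Y X Y r (%a2 c. Sw2 U Y Z X a2 (%t t'. Sw2 U X Z Y c (%d e. ?B s s' t t' d e))))"
   by (rule sw_swap) (assumption|intro ob m U mlin D)+
  also have "... = Sw2 U Y Z X (anti C X Y a1) (%s s'. coun C Y r *[U] \<beta> s s')"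
   by (rule sw_cong, (intro ob m mlin)+, rule L) (assumption|intro m)+
  also have "... = coun C Y r *[U] Sw2 U Y Z X (anti C X Y a1) \<beta>"
   by (rule sw_smult) (assumption|intro ob m U mlin D)+
  finally show "Sw2 U Y X Y r (%a2 c. Sw2 U X Z Y c (%d e. ?\<phi> d e (anti C X Y a1 \<otimes>[alg C Y X] a2))) = ..." .
 qed
 also have "... = Sw2 U Y Z X (anti C X Y a) \<beta>"
  by (rule sw_coun_right) (assumption|intro ob a U mlin D \<beta>)+
 finally show ?thesis using 1 by simp
qed

text \<open>The product of two adjacent \<open>x\<^sub>3 S(x\<^sub>4)\<close> in the sixfold comultiplication of \<open>x\<close> cancels. This is
 why actions of the form \<open>S(x\<^sub>1) - x\<^sub>3\<close> are compatible with products.\<close>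

lemma sw_adjoint_cancel:
 assumes ob: "X : ob C" "Y : ob C" and x: "x <: alg C Y Y" and U: "module k U"
  and \<beta>1: "!!b y c d. [|b <: alg C X X; y <: alg C X Y; c <: alg C X X; d <: alg C X Y|]
    ==> (%a. \<beta> a b y c d) : lin_maps k (alg C Y X) U"
  and \<beta>2: "!!a. a <: alg C Y X ==> \<beta> a : quadrilin_maps k (alg C X X) (alg C X Y) (alg C X X) (alg C X Y) U"
 shows "Sw2 U Y Y Y x (%p q. Sw3 U Y X X Y p (%a b c. Sw3 U Y X X Y q (%d e f. \<beta> a b (c \<otimes>[alg C X Y] anti C Y X d) e f))) =
  Sw4 U Y X X X Y x (%a b e f. \<beta> a b \<one>[alg C X Y] e f)"
proof -
 note D = \<beta>1 quadrilin_mapsD[OF \<beta>2]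
 note DC = lin_comp[OF D(3)]
 have "Sw2 U Y Y Y x (%p q. Sw3 U Y X X Y p (%a b c. Sw3 U Y X X Y q (%d e f. \<beta> a b (c \<otimes>[alg C X Y] anti C Y X d) e f))) =
  Sw3 U Y X Y Y x (%a r q. Sw2 U X X Y r (%b c. Sw3 U Y X X Y q (%d e f. \<beta> a b (c \<otimes>[alg C X Y] anti C Y X d) e f)))"
  by (rule sw_coassoc) (assumption|intro ob x U mlin | rule D DC)+
 also have "... = Sw2 U Y X Y x (%a s. Sw3 U X X Y Y s (%b c q. Sw3 U Y X X Y q (%d e f. \<beta> a b (c \<otimes>[alg C X Y] anti C Y X d) e f)))"
  by (rule sw_cong, (intro ob x)+, rule sw_coassoc) (assumption|intro ob x U mlin | rule D DC)+
 also have "... = Sw4 U Y X X X Y x (%a b e f. \<beta> a b \<one>[alg C X Y] e f)"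
 proof (rule sw_cong, (intro ob x)+, rule sw_cong, (assumption|intro ob)+)
  fix a s b t assume m: "a <: alg C Y X" "b <: alg C X X" "t <: alg C X Y"
  show "Sw2 U X Y Y t (%c q. Sw3 U Y X X Y q (%d e f. \<beta> a b (c \<otimes>[alg C X Y] anti C Y X d) e f)) =
   Sw2 U X X Y t (%e f. \<beta> a b \<one>[alg C X Y] e f)"
   by (rule sw_cancel_right[where \<beta> = "%y w. Sw2 U X X Y w (%e f. \<beta> a b y e f)"])
    (assumption|intro ob m U mlin | rule D DC)+
 qed
 finally show ?thesis .
qed

text \<open>\<open>\<Delta>\<close> is multiplicative and \<open>\<Delta> (S(b\<^sub>1))\<close> has the factors \<open>S(b\<^sub>2)\<close> and \<open>S(b\<^sub>1)\<close> in this order, so that the two pieces of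
 \<open>S(b\<^sub>1) y b\<^sub>3\<close> nest around the middle component. This gives the Yetter--Drinfeld condition for cotensor products.\<close>

lemma sw_adjoint_comult:
 assumes ob: "X : ob C" "Y : ob C" "Z : ob C" and b: "b <: alg C Y Y" and y: "y <: alg C X Y"
  and U: "module k U" and \<beta>: "\<beta> : trilin_maps k (alg C X X) (alg C X Z) (alg C Z Y) U"
 shows "Sw3 U Y X X Y b (%b1 b2 b3. Sw2 U X Z Y (anti C Y X b1 \<otimes>[alg C X Y] y \<otimes>[alg C X Y] b3) (%p q. \<beta> b2 p q)) =
  Sw2 U Y Z Y b (%b1 r. Sw4 U Z X X Z Y r (%b2 b3 b4 b5. Sw2 U X Z Y y (%y1 y2.
   \<beta> b3 (anti C Z X b2 \<otimes>[alg C X Z] y1 \<otimes>[alg C X Z] b4) (anti C Y Z b1 \<otimes>[alg C Z Y] y2 \<otimes>[alg C Z Y] b5))))"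
proof -
 note D0 = trilin_mapsD[OF \<beta>]
 note D = D0 lin_comp[OF D0(2)] lin_comp[OF D0(3)]
 let ?F = "%b1 b2 b3 b4 b5 y1 y2. \<beta> b3 (anti C Z X b2 \<otimes>[alg C X Z] y1 \<otimes>[alg C X Z] b4) (anti C Y Z b1 \<otimes>[alg C Z Y] y2 \<otimes>[alg C Z Y] b5)"
 have "Sw3 U Y X X Y b (%b1 b2 b3. Sw2 U X Z Y (anti C Y X b1 \<otimes>[alg C X Y] y \<otimes>[alg C X Y] b3) (%p q. \<beta> b2 p q)) =
  Sw3 U Y X X Y b (%b1 b2 b3. Sw2 U Y Z X b1 (%c d. Sw2 U X Z Y b3 (%b4 b5. Sw2 U X Z Y y (%y1 y2. ?F c d b2 b4 b5 y1 y2))))"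
 proof (rule sw_cong, (intro ob b)+, rule sw_cong, (assumption|intro ob)+)
  fix b1 r b2 b3 assume m: "b1 <: alg C Y X" "b2 <: alg C X X" "b3 <: alg C X Y"
  have "Sw2 U X Z Y (anti C Y X b1 \<otimes>[alg C X Y] y \<otimes>[alg C X Y] b3) (%p q. \<beta> b2 p q) =
   Sw2 U X Z Y (anti C Y X b1 \<otimes>[alg C X Y] y) (%p q. Sw2 U X Z Y b3 (%b4 b5. \<beta> b2 (p \<otimes>[alg C X Z] b4) (q \<otimes>[alg C Z Y] b5)))"
   by (rule sw_mult) (assumption|intro ob y m U mlin | rule D)+
  also have "... = Sw2 U X Z Y (anti C Y X b1) (%c d. Sw2 U X Z Y y (%y1 y2. Sw2 U X Z Y b3 (%b4 b5.
    \<beta> b2 (c \<otimes>[alg C X Z] y1 \<otimes>[alg C X Z] b4) (d \<otimes>[alg C Z Y] y2 \<otimes>[alg C Z Y] b5))))"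
   by (rule sw_mult) (assumption|intro ob y m U mlin | rule D)+
  also have "... = Sw2 U Y Z X b1 (%c d. Sw2 U X Z Y y (%y1 y2. Sw2 U X Z Y b3 (%b4 b5. ?F c d b2 b4 b5 y1 y2)))"
   by (rule anti_comult) (assumption|intro ob y m U mlin | rule D)+
  also have "... = Sw2 U Y Z X b1 (%c d. Sw2 U X Z Y b3 (%b4 b5. Sw2 U X Z Y y (%y1 y2. ?F c d b2 b4 b5 y1 y2)))"
   by (rule sw_cong, (intro ob m)+, rule sw_swap) (assumption|intro ob y m U mlin | rule D)+
  finally show "Sw2 U X Z Y (anti C Y X b1 \<otimes>[alg C X Y] y \<otimes>[alg C X Y] b3) (%p q. \<beta> b2 p q) = ..." .
 qed
 also have "... = Sw4 U Y Z X X Y b (%b1 b2 b3 r. Sw2 U X Z Y r (%b4 b5. Sw2 U X Z Y y (%y1 y2. ?F b1 b2 b3 b4 b5 y1 y2)))"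
  by (rule sw_split31) (assumption|intro ob y b U mlin | rule D)+
 finally show ?thesis .
qed

end

section \<open>Splitting linear maps over a field\<close>

lemma (in abelian_group) eq_if_diff_zero:
 assumes "a \<oplus> \<ominus> b = \<zero>" "a <: G" "b <: G" shows "a = b"
 using assms minus_equality[of a "\<ominus> b"] by simp

lemma (in abelian_group) diff_eq_diff:
 assumes "a \<oplus> r = b \<oplus> s" "a <: G" "b <: G" "r <: G" "s <: G"
 shows "a \<oplus> \<ominus> b = s \<oplus> \<ominus> r"
proof -
 have "a \<oplus> \<ominus> b = (a \<oplus> \<ominus> b) \<oplus> (r \<oplus> \<ominus> r)" using assms by (simp add: r_neg)
 also have "... = (a \<oplus> r) \<oplus> (\<ominus> b \<oplus> \<ominus> r)" using assms(2-) by (simp add: a_ac)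
 also have "... = (b \<oplus> s) \<oplus> (\<ominus> b \<oplus> \<ominus> r)" by (simp only: assms(1))
 also have "... = (b \<oplus> \<ominus> b) \<oplus> (s \<oplus> \<ominus> r)" using assms(2-) by (simp add: a_ac)
 also have "... = s \<oplus> \<ominus> r" using assms by (simp add: r_neg)
 finally show ?thesis .
qed

lemma (in abelian_group) add_diff_cancel_mid:
 assumes "a <: G" "b <: G" shows "a \<oplus> (b \<oplus> \<ominus> a) = b"
 using assms a_lcomm[of a b "\<ominus> a"] by (simp add: r_neg)

lemma (in abelian_group) add_cancel_right:
 assumes "a \<oplus> c = b \<oplus> c" "a <: G" "b <: G" "c <: G" shows "a = b"
 by (rule eq_if_diff_zero[OF trans[OF diff_eq_diff[OF assms(1,2,3,4,4)] r_neg[OF assms(4)]] assms(2,3)])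

text \<open>By Zorn's lemma there is a maximal submodule meeting \<open>M\<close> in zero; if its sum with \<open>M\<close> missed a vector \<open>p\<close>, then
 adjoining \<open>p\<close> would enlarge it, as coefficients can be inverted.\<close>

lemma complement_exists:
 assumes k: "field k" and P: "module k P" and M: "submodule M k P"
 obtains N where "submodule N k P" "M \<inter> N = {\<zero>[P]}" "!!p. p <: P ==> \<exists>m\<in>M. \<exists>n\<in>N. p = m +[P] n"
proof -
 interpret k: field k by (rule k)
 interpret P: module k P by (rule P)
 note ME = P.submoduleE[OF M]
 have zM: "\<zero>[P] \<in> N" if "submodule N k P" for N
  using subgroup.one_closed[OF submodule.axioms(1)[OF that]] by simp
 let ?A = "{N. submodule N k P \<and> M \<inter> N = {\<zero>[P]}}"
 have "\<exists>N\<in>?A. \<forall>X\<in>?A. N \<subseteq> X \<longrightarrow> X = N"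
 proof (rule subset_Zorn_nonempty)
  have "submodule {\<zero>[P]} k P" by (rule P.submoduleI) auto
  then show "?A \<noteq> {}" using zM[OF M] by auto
  fix \<C> assume ne: "\<C> \<noteq> {}" and ch: "subset.chain ?A \<C>"
  have sub: "submodule N k P" "M \<inter> N = {\<zero>[P]}" if "N \<in> \<C>" for N using that ch by (auto simp: subset.chain_def)
  have two: "\<exists>N\<in>\<C>. a \<in> N \<and> b \<in> N" if "a \<in> \<Union>\<C>" "b \<in> \<Union>\<C>" for a b
  proof -
   from that obtain N N' where N: "N \<in> \<C>" "a \<in> N" "N' \<in> \<C>" "b \<in> N'" by blast
   then have "N \<subseteq> N' \<or> N' \<subseteq> N" using ch unfolding subset_chain_def by blast
   with N show ?thesis by blast
  qed
  have "submodule (\<Union>\<C>) k P"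
  proof (rule P.submoduleI)
   show "\<Union>\<C> \<subseteq> carrier P" using P.submoduleE(1)[OF sub(1)] by blast
   show "\<zero>[P] \<in> \<Union>\<C>" using ne zM[OF sub(1)] by blast
   show "\<ominus>\<^bsub>P\<^esub> a \<in> \<Union>\<C>" if "a \<in> \<Union>\<C>" for a using P.submoduleE(3)[OF sub(1)] that by blast
   show "a +[P] b \<in> \<Union>\<C>" if "a \<in> \<Union>\<C>" "b \<in> \<Union>\<C>" for a b
    using two[OF that] P.submoduleE(5)[OF sub(1)] by blast
   show "c *[P] a \<in> \<Union>\<C>" if "c <: k" "a \<in> \<Union>\<C>" for c a using P.submoduleE(4)[OF sub(1)] that by blast
  qed
  moreover have "M \<inter> \<Union>\<C> = {\<zero>[P]}" using ne sub(2) by blast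
  ultimately show "\<Union>\<C> \<in> ?A" by blast
 qed
 then obtain N where N0: "N \<in> ?A" and max0: "\<forall>X\<in>?A. N \<subseteq> X \<longrightarrow> X = N" by (rule bexE)
 have N: "submodule N k P" "M \<inter> N = {\<zero>[P]}" using N0 by simp_all
 have max: "X = N" if "submodule X k P" "M \<inter> X = {\<zero>[P]}" "N \<subseteq> X" for X
  using max0 that by simp
 note NE = P.submoduleE[OF N(1)]
 have "\<exists>m\<in>M. \<exists>n\<in>N. p = m +[P] n" if p: "p <: P" for p
 proof (rule ccontr)
  assume neg: "\<not> ?thesis"
  let ?N' = "{n +[P] c *[P] p | n c. n \<in> N \<and> c <: k}"
  have NP: "n <: P" if "n \<in> N" for n using NE(1) that by blast
  have MP: "n <: P" if "n \<in> M" for n using ME(1) that by blast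
  have "submodule ?N' k P"
  proof (rule P.submoduleI)
   show "?N' \<subseteq> carrier P" using NP p by auto
   show "\<zero>[P] \<in> ?N'"
    by (rule CollectI, intro exI[of _ "\<zero>[P]"] exI[of _ "\<zero>[k]"]) (use zM[OF N(1)] p in auto)
   fix a assume "a \<in> ?N'"
   then obtain n c where a: "a = n +[P] c *[P] p" "n \<in> N" "c <: k" by blast
   have "\<ominus>\<^bsub>P\<^esub> a = \<ominus>\<^bsub>P\<^esub> n +[P] (\<ominus>\<^bsub>k\<^esub> c) *[P] p"
    using a NP p by (simp add: P.minus_add P.smult_l_minus)
   then show "\<ominus>\<^bsub>P\<^esub> a \<in> ?N'" using a NE(3) by blast
   fix b assume "b \<in> ?N'"
   then obtain n' c' where b: "b = n' +[P] c' *[P] p" "n' \<in> N" "c' <: k" by blast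
   have "a +[P] b = (n +[P] n') +[P] (c +[k] c') *[P] p"
    using a b NP p by (simp add: P.smult_l_distr P.a_ac)
   then show "a +[P] b \<in> ?N'" using a b NE(5) by blast
  next
   fix d a assume d: "d <: k" and "a \<in> ?N'"
   then obtain n c where a: "a = n +[P] c *[P] p" "n \<in> N" "c <: k" by blast
   have "d *[P] a = d *[P] n +[P] (d \<otimes>[k] c) *[P] p"
    using a NP p d by (simp add: P.smult_r_distr P.smult_assoc1)
   then show "d *[P] a \<in> ?N'" using a NE(4) d by blast
  qed
  moreover have "M \<inter> ?N' = {\<zero>[P]}"
  proof -
   have "m = \<zero>[P]" if m: "m \<in> M" "m = n +[P] c *[P] p" "n \<in> N" "c <: k" for m n c
   proof (cases "c = \<zero>[k]")
    case True
    then have "m = n" using m NP p by simp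
    then show ?thesis using m N(2) by blast
   next
    case False
    let ?i = "inv\<^bsub>k\<^esub> c"
    have i: "?i <: k" "?i \<otimes>[k] c = \<one>[k]" using False m(4) k.field_Units k.Units_l_inv k.Units_inv_closed by auto
    have "c *[P] p = \<ominus>\<^bsub>P\<^esub> n +[P] m"
     using m NP p by (simp add: P.r_neg1)
    then have "?i *[P] (c *[P] p) = ?i *[P] (m +[P] \<ominus>\<^bsub>P\<^esub> n)" using m NP MP by (simp add: P.a_comm)
    then have "p = ?i *[P] m +[P] ?i *[P] (\<ominus>\<^bsub>P\<^esub> n)"
     using i p m MP[OF m(1)] NP[OF m(3)] by (simp add: P.smult_r_distr flip: P.smult_assoc1)
    then show ?thesis using neg i m ME(4) NE(3,4) by blast
   qed
   moreover have "\<zero>[P] \<in> ?N'"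
    by (rule CollectI, intro exI[of _ "\<zero>[P]"] exI[of _ "\<zero>[k]"]) (use zM[OF N(1)] p in auto)
   ultimately show ?thesis using zM[OF M] by blast
  qed
  moreover have "N \<subseteq> ?N'"
  proof
   fix n assume n: "n \<in> N"
   then show "n \<in> ?N'" using NP[OF n] p by (intro CollectI exI[of _ n] exI[of _ "\<zero>[k]"]) auto
  qed
  ultimately have "?N' = N" by (rule max)
  moreover have "p \<in> ?N'"
   using p zM[OF N(1)] by (intro CollectI exI[of _ "\<zero>[P]"] exI[of _ "\<one>[k]"]) auto
  ultimately have "p \<in> N" by simp
  then show False using neg zM[OF M] p by (metis P.l_zero)
 qed
 with N show ?thesis using that by blast
qed

lemma lin_kernel_submodule:
 assumes P: "module k P" and Q: "module k Q" and f: "f : lin_maps k P Q"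
 shows "submodule {p \<in> carrier P. f p = \<zero>[Q]} k P"
proof -
 interpret P: module k P by (rule P)
 interpret Q: module k Q by (rule Q)
 show ?thesis
  by (rule P.submoduleI) (auto simp: lin_zero[OF P Q f] lin_inv[OF P Q f] lin_add[OF f] lin_smult[OF f])
qed

lemma lin_image_submodule:
 assumes P: "module k P" and Q: "module k Q" and f: "f : lin_maps k P Q"
 shows "submodule (f ` carrier P) k Q"
proof -
 interpret P: module k P by (rule P)
 interpret Q: module k Q by (rule Q)
 show ?thesis
 proof (rule Q.submoduleI)
  show "\<zero>[Q] \<in> f ` carrier P" by (rule image_eqI[of _ _ "\<zero>[P]"]) (simp_all add: lin_zero[OF P Q f])
  show "\<ominus>\<^bsub>Q\<^esub> a \<in> f ` carrier P" if "a \<in> f ` carrier P" for a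
   using that by (auto simp flip: lin_inv[OF P Q f])
  show "a +[Q] b \<in> f ` carrier P" if "a \<in> f ` carrier P" "b \<in> f ` carrier P" for a b
   using that by (auto simp flip: lin_add[OF f])
  show "c *[Q] a \<in> f ` carrier P" if "c <: k" "a \<in> f ` carrier P" for c a
   using that by (auto simp flip: lin_smult[OF f])
 qed (auto dest: lin_closed[OF f])
qed

text \<open>Every linear map over a field has a generalised inverse: choose complements of its kernel and of
 its image.\<close>

lemma generalised_inverse:
 assumes k: "field k" and P: "module k P" and Q: "module k Q" and f: "f : lin_maps k P Q"
 obtains g where "g : lin_maps k Q P" "!!p. p <: P ==> f (g (f p)) = f p"
proof -
 interpret P: module k P by (rule P)
 interpret Q: module k Q by (rule Q)
 note f' = lin_closed[OF f] lin_add[OF f] lin_smult[OF f] lin_zero[OF P Q f] lin_inv[OF P Q f]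
 obtain N where N: "submodule N k P" "{p \<in> carrier P. f p = \<zero>[Q]} \<inter> N = {\<zero>[P]}"
  "!!p. p <: P ==> \<exists>m\<in>{p \<in> carrier P. f p = \<zero>[Q]}. \<exists>n\<in>N. p = m +[P] n"
  by (rule complement_exists[OF k P lin_kernel_submodule[OF P Q f]], rule that)
 obtain R where R: "submodule R k Q" "f ` carrier P \<inter> R = {\<zero>[Q]}"
  "!!q. q <: Q ==> \<exists>m\<in>f ` carrier P. \<exists>r\<in>R. q = m +[Q] r"
  by (rule complement_exists[OF k Q lin_image_submodule[OF P Q f]], rule that)
 note NE = P.submoduleE[OF N(1)] and RE = Q.submoduleE[OF R(1)]
 have NP: "n <: P" if "n \<in> N" for n using NE(1) that by blast
 have RQ: "n <: Q" if "n \<in> R" for n using RE(1) that by blast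
 have fN: "\<exists>n\<in>N. f p = f n" if p: "p <: P" for p
 proof -
  obtain m n where mn: "m <: P" "f m = \<zero>[Q]" "n \<in> N" "p = m +[P] n" using N(3)[OF p] by blast
  then have "f p = f n" using NP by (simp add: f')
  with mn show ?thesis by blast
 qed
 define D where "D q n \<longleftrightarrow> n \<in> N \<and> (\<exists>r\<in>R. q = f n +[Q] r)" for q n
 have ex: "\<exists>n. D q n" if q: "q <: Q" for q
 proof -
  obtain p r where pr: "p <: P" "r \<in> R" "q = f p +[Q] r" using R(3)[OF q] by auto
  obtain n where "n \<in> N" "f p = f n" using fN[OF pr(1)] by auto
  with pr show ?thesis unfolding D_def by auto
 qed
 have uniq: "n = n'" if dd: "D q n" "D q n'" for q n n'
 proof -
  obtain r r' where r: "n \<in> N" "n' \<in> N" "r \<in> R" "r' \<in> R" "f n +[Q] r = f n' +[Q] r'"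
   using dd unfolding D_def by metis
  note c = NP[OF r(1)] NP[OF r(2)] RQ[OF r(3)] RQ[OF r(4)]
  let ?d = "n +[P] \<ominus>\<^bsub>P\<^esub> n'"
  have d: "?d \<in> N" using r NE by blast
  have "f ?d = f n +[Q] \<ominus>\<^bsub>Q\<^esub> f n'" using c by (simp add: f')
  also have "... = r' +[Q] \<ominus>\<^bsub>Q\<^esub> r" using c by (intro Q.diff_eq_diff r(5)) (auto simp: f')
  finally have fd: "f ?d = r' +[Q] \<ominus>\<^bsub>Q\<^esub> r" .
  have "r' +[Q] \<ominus>\<^bsub>Q\<^esub> r \<in> R" using r(3,4) RE(3,5) by blast
  moreover have "f ?d \<in> f ` carrier P" using c by (intro imageI) simp
  ultimately have "f ?d \<in> f ` carrier P \<inter> R" using fd by (metis IntI)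
  then have "f ?d = \<zero>[Q]" using R(2) by blast
  then have "?d = \<zero>[P]" using N(2) d c by blast
  then show ?thesis using c P.eq_if_diff_zero by blast
 qed
 define g where "g q = (THE n. D q n)" for q
 have g: "D q (g q)" if "q <: Q" for q
  unfolding g_def using ex[OF that] uniq by (metis theI)
 have gI: "g q = n" if "D q n" "q <: Q" for q n using uniq[OF g[OF that(2)] that(1)] .
 have gl: "g : lin_maps k Q P"
 proof (rule lin_mapsI)
  fix q assume q: "q <: Q"
  show "g q <: P" using g[OF q] NP by (simp add: D_def)
  fix q' assume q': "q' <: Q"
  obtain r r' where r: "g q \<in> N" "r \<in> R" "q = f (g q) +[Q] r" "g q' \<in> N" "r' \<in> R" "q' = f (g q') +[Q] r'"
   using g[OF q] g[OF q'] unfolding D_def by blast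
  show "g (q +[Q] q') = g q +[P] g q'"
  proof (rule gI)
   have "q +[Q] q' = (f (g q) +[Q] r) +[Q] (f (g q') +[Q] r')" using r by simp
   also have "... = f (g q +[P] g q') +[Q] (r +[Q] r')"
    using NP[OF r(1)] NP[OF r(4)] RQ[OF r(2)] RQ[OF r(5)] by (simp add: f' Q.a_ac)
   finally show "D (q +[Q] q') (g q +[P] g q')" unfolding D_def using r NE(5) RE(5) by blast
  qed (use q q' in simp)
 next
  fix c q assume c: "c <: k" and q: "q <: Q"
  obtain r where r: "g q \<in> N" "r \<in> R" "q = f (g q) +[Q] r" using g[OF q] unfolding D_def by blast
  show "g (c *[Q] q) = c *[P] g q"
  proof (rule gI)
   have "c *[Q] q = c *[Q] (f (g q) +[Q] r)" using r by simp
   also have "... = f (c *[P] g q) +[Q] c *[Q] r"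
    using NP[OF r(1)] RQ[OF r(2)] c by (simp add: f' Q.smult_r_distr)
   finally show "D (c *[Q] q) (c *[P] g q)" unfolding D_def using r NE(4) RE(4) c by blast
  qed (use q c in simp)
 qed
 have "f (g (f p)) = f p" if p: "p <: P" for p
 proof -
  obtain n where n: "n \<in> N" "f p = f n" using fN[OF p] by blast
  have "\<zero>[Q] \<in> R" using R(2) by blast
  moreover have "f p = f n +[Q] \<zero>[Q]" using n NP by (simp add: f')
  ultimately have "D (f p) n" unfolding D_def using n by blast
  then have "g (f p) = n" using p by (intro gI) (simp_all add: f')
  then show ?thesis using n by simp
 qed
 with gl show ?thesis using that by blast
qed

text \<open>Linear projection onto the equaliser of two linear maps. The last equation, a form of
 \<open>r = 1 - \<psi> (\<phi>\<^sub>1 - \<phi>\<^sub>2)\<close> without subtraction, survives tensoring with another space; it makes \<open>r \<otimes> 1\<close> a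
 projection onto the equaliser of the \<open>\<phi>\<^sub>i \<otimes> 1\<close>.\<close>

definition equaliser_projection where
 "equaliser_projection k P Q \<phi>1 \<phi>2 r \<psi> \<longleftrightarrow> r : lin_maps k P P \<and> \<psi> : lin_maps k Q P \<and>
   (\<forall>p\<in>carrier P. \<phi>1 (r p) = \<phi>2 (r p)) \<and> (\<forall>p\<in>carrier P. \<phi>1 p = \<phi>2 p \<longrightarrow> r p = p) \<and>
   (\<forall>p\<in>carrier P. r p +[P] \<psi> (\<phi>1 p) = p +[P] \<psi> (\<phi>2 p))"

text \<open>With a generalised inverse \<open>g\<close> of \<open>\<phi>\<^sub>1 - \<phi>\<^sub>2\<close>, take \<open>\<psi> = g\<close> and \<open>r = 1 - g (\<phi>\<^sub>1 - \<phi>\<^sub>2)\<close>.\<close>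

lemma equaliser_projection_exists:
 assumes k: "field k" and P: "module k P" and Q: "module k Q"
  and \<phi>1: "\<phi>1 : lin_maps k P Q" and \<phi>2: "\<phi>2 : lin_maps k P Q"
 shows "\<exists>r \<psi>. equaliser_projection k P Q \<phi>1 \<phi>2 r \<psi>"
proof -
 interpret P: module k P by (rule P)
 interpret Q: module k Q by (rule Q)
 note c1 = lin_closed[OF \<phi>1] and c2 = lin_closed[OF \<phi>2]
 define \<phi> where "\<phi> p = \<phi>1 p +[Q] (\<ominus>\<^bsub>k\<^esub> \<one>[k]) *[Q] \<phi>2 p" for p
 have \<phi>: "\<phi> : lin_maps k P Q" unfolding \<phi>_def
  by (intro lin_plus mlin_smult Q \<phi>1 \<phi>2) simp
 have \<phi>': "\<phi> p = \<phi>1 p +[Q] \<ominus>\<^bsub>Q\<^esub> \<phi>2 p" if "p <: P" for p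
  using that c2 by (simp add: \<phi>_def Q.smult_l_minus)
 obtain \<psi> where \<psi>: "\<psi> : lin_maps k Q P" "!!p. p <: P ==> \<phi> (\<psi> (\<phi> p)) = \<phi> p"
  by (rule generalised_inverse[OF k P Q \<phi>], rule that)
 note c = lin_closed[OF \<phi>] lin_closed[OF \<psi>(1)]
 define r where "r p = p +[P] (\<ominus>\<^bsub>k\<^esub> \<one>[k]) *[P] \<psi> (\<phi> p)" for p
 have r: "r : lin_maps k P P" unfolding r_def
  by (intro lin_plus mlin_smult P lin_id lin_comp[OF \<psi>(1) \<phi>]) simp
 have r': "r p = p +[P] \<ominus>\<^bsub>P\<^esub> \<psi> (\<phi> p)" if "p <: P" for p
  using that c by (simp add: r_def P.smult_l_minus)
 have "\<phi>1 (r p) = \<phi>2 (r p)" if p: "p <: P" for p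
 proof -
  have "\<phi> (r p) = \<phi> p +[Q] \<ominus>\<^bsub>Q\<^esub> \<phi> (\<psi> (\<phi> p))"
   using p c by (simp add: r' lin_add[OF \<phi>] lin_inv[OF P Q \<phi>])
  then have "\<phi>1 (r p) +[Q] \<ominus>\<^bsub>Q\<^esub> \<phi>2 (r p) = \<zero>[Q]"
   using p c \<psi>(2) lin_closed[OF r] by (simp add: Q.r_neg \<phi>')
  then show ?thesis by (rule Q.eq_if_diff_zero[OF _ c1[OF lin_closed[OF r p]] c2[OF lin_closed[OF r p]]])
 qed
 moreover have "r p = p" if "p <: P" "\<phi>1 p = \<phi>2 p" for p
  using that c2[of p] by (simp add: r' \<phi>' Q.r_neg lin_zero[OF Q P \<psi>(1)])
 moreover have "r p +[P] \<psi> (\<phi>1 p) = p +[P] \<psi> (\<phi>2 p)" if p: "p <: P" for p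
 proof -
  have "\<psi> (\<phi> p) = \<psi> (\<phi>1 p) +[P] \<ominus>\<^bsub>P\<^esub> \<psi> (\<phi>2 p)"
   using p c1 c2 by (simp add: \<phi>' lin_add[OF \<psi>(1)] lin_inv[OF Q P \<psi>(1)])
  then show ?thesis using p c(2)[OF c1[OF p]] c(2)[OF c2[OF p]]
   by (simp add: r' P.minus_add P.a_ac P.add_diff_cancel_mid)
 qed
 ultimately show ?thesis unfolding equaliser_projection_def using r \<psi>(1) by blast
qed

text \<open>The defining equation of \<open>r\<close> replaces \<open>r p\<close> by \<open>p\<close> at the cost of the terms \<open>\<psi> (\<phi>\<^sub>1 p)\<close> and \<open>\<psi> (\<phi>\<^sub>2 p)\<close>, whose sums
 over the given tensor agree. So the projection can be inserted or dropped in every summand at once.\<close>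

lemma tsum_equaliser_projection:
 assumes e: "equaliser_projection k P Q \<phi>1 \<phi>2 r \<psi>" and P: "module k P" and Q: "module k Q" and V: "module k V" and W: "module k W"
  and U: "module k U" and \<phi>: "\<phi>1 : lin_maps k P Q" "\<phi>2 : lin_maps k P Q"
  and t: "t <: tensor k V W" and B: "module k B"
  and f: "!!v w. [|v <: V; w <: W|] ==> f v w <: P"
  and h: "!!v w. [|v <: V; w <: W|] ==> h v w <: B"
  and eq: "tsum k (tensor k Q B) t (%v w. pure k Q B (\<phi>1 (f v w)) (h v w)) = tsum k (tensor k Q B) t (%v w. pure k Q B (\<phi>2 (f v w)) (h v w))"
  and \<beta>: "\<beta> : bilin_maps k P B U"
 shows "tsum k U t (%v w. \<beta> (r (f v w)) (h v w)) = tsum k U t (%v w. \<beta> (f v w) (h v w))"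
proof -
 interpret U: module k U by (rule U)
 have r: "r : lin_maps k P P" and \<psi>: "\<psi> : lin_maps k Q P"
  and re: "!!p. p <: P ==> r p +[P] \<psi> (\<phi>1 p) = p +[P] \<psi> (\<phi>2 p)"
  using e by (auto simp: equaliser_projection_def)
 have \<beta>\<psi>: "(%q b. \<beta> (\<psi> q) b) : bilin_maps k Q B U"
  by (intro bilin_mapsI lin_comp[OF bilin_maps_left[OF \<beta>] \<psi>] bilin_maps_right[OF \<beta>] lin_closed[OF \<psi>])
 note c = bilin_closed[OF \<beta>] lin_closed[OF r] lin_closed[OF \<psi>] lin_closed[OF \<phi>(1)] lin_closed[OF \<phi>(2)] f h
 have *: "tsum k U t (%v w. \<beta> (\<psi> (\<phi>' (f v w))) (h v w)) = tsum k U (tsum k (tensor k Q B) t (%v w. pure k Q B (\<phi>' (f v w)) (h v w))) (%q b. \<beta> (\<psi> q) b)"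
  if "\<phi>' : lin_maps k P Q" for \<phi>'
 proof -
  have "tsum k U (tsum k (tensor k Q B) t (%v w. pure k Q B (\<phi>' (f v w)) (h v w))) (%q b. \<beta> (\<psi> q) b) =
   tsum k U t (%v w. tsum k U (pure k Q B (\<phi>' (f v w)) (h v w)) (%q b. \<beta> (\<psi> q) b))"
   by (rule tsum_tsum[OF V W t U Q B _ \<beta>\<psi>]) (intro pure_closed Q B c lin_closed[OF that])
  also have "... = tsum k U t (%v w. \<beta> (\<psi> (\<phi>' (f v w))) (h v w))"
   by (rule tsum_cong'[OF V W t], rule tsum_pure[OF Q B U \<beta>\<psi>]) (intro c lin_closed[OF that], assumption+)+
  finally show ?thesis by simp
 qed
 have "tsum k U t (%v w. \<beta> (r (f v w)) (h v w)) +[U] tsum k U t (%v w. \<beta> (\<psi> (\<phi>1 (f v w))) (h v w)) =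
  tsum k U t (%v w. \<beta> (r (f v w)) (h v w) +[U] \<beta> (\<psi> (\<phi>1 (f v w))) (h v w))"
  by (rule tsum_plus[OF V W t U, symmetric]) (intro c, assumption+)+
 also have "... = tsum k U t (%v w. \<beta> (f v w) (h v w) +[U] \<beta> (\<psi> (\<phi>2 (f v w))) (h v w))"
 proof (rule tsum_cong'[OF V W t])
  fix v w assume m: "v <: V" "w <: W"
  note l = lin_add[OF bilin_maps_left[OF \<beta> h[OF m]]]
  show "\<beta> (r (f v w)) (h v w) +[U] \<beta> (\<psi> (\<phi>1 (f v w))) (h v w) = \<beta> (f v w) (h v w) +[U] \<beta> (\<psi> (\<phi>2 (f v w))) (h v w)"
   using m c by (simp flip: l add: re)
 qed
 also have "... = tsum k U t (%v w. \<beta> (f v w) (h v w)) +[U] tsum k U t (%v w. \<beta> (\<psi> (\<phi>2 (f v w))) (h v w))"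
  by (rule tsum_plus[OF V W t U]) (intro c, assumption+)+
 also have "tsum k U t (%v w. \<beta> (\<psi> (\<phi>2 (f v w))) (h v w)) = tsum k U t (%v w. \<beta> (\<psi> (\<phi>1 (f v w))) (h v w))"
  by (simp add: *[OF \<phi>(1)] *[OF \<phi>(2)] eq)
 finally show ?thesis
  by (rule U.add_cancel_right) (intro tsum_closed[OF V W t U] c, assumption+)+
qed

text \<open>Apply a generalised inverse of \<open>c \<mapsto> c 1\<close>, which is injective when the unit is not zero.\<close>

lemma unit_functional_exists:
 assumes k: "field k" and A: "assoc_algebra k A" and ne: "carrier A \<noteq> {\<zero>[A]}"
 shows "\<exists>\<omega>. \<omega> : lin_maps k A (base_algebra k) \<and> \<omega> \<one>[A] = \<one>[k]"
proof -
 interpret k: field k by (rule k)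
 interpret A: assoc_algebra k A by (rule A)
 have B: "module k (base_algebra k)" by (rule base_algebra_module) (rule k.cring_axioms)
 have f: "(%c. c *[A] \<one>[A]) : lin_maps k (base_algebra k) A"
  by (rule mlin_smult_left[OF A.module_axioms _ lin_id]) simp
 have ne1: "\<one>[A] \<noteq> \<zero>[A]" using ne A.carrier_one_zero by blast
 obtain \<omega> where \<omega>: "\<omega> : lin_maps k A (base_algebra k)" "!!c. c <: k ==> \<omega> (c *[A] \<one>[A]) *[A] \<one>[A] = c *[A] \<one>[A]"
  by (rule generalised_inverse[OF k B A.module_axioms f], rule that) simp_all
 have w: "\<omega> \<one>[A] <: k" using lin_closed[OF \<omega>(1)] by simp
 have e: "\<omega> \<one>[A] *[A] \<one>[A] = \<one>[A]" using \<omega>(2)[of "\<one>[k]"] by simp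
 let ?d = "\<omega> \<one>[A] +[k] \<ominus>\<^bsub>k\<^esub> \<one>[k]"
 have d: "?d <: k" "?d *[A] \<one>[A] = \<zero>[A]"
  using w e by (simp_all add: A.smult_l_distr A.smult_l_minus A.r_neg)
 have "?d = \<zero>[k]"
 proof (rule ccontr)
  assume nz: "?d \<noteq> \<zero>[k]"
  then have i: "inv\<^bsub>k\<^esub> ?d <: k" "inv\<^bsub>k\<^esub> ?d \<otimes>[k] ?d = \<one>[k]"
   using d(1) k.field_Units k.Units_l_inv k.Units_inv_closed by auto
  have "\<one>[A] = (inv\<^bsub>k\<^esub> ?d \<otimes>[k] ?d) *[A] \<one>[A]" unfolding i by simp
  also have "... = inv\<^bsub>k\<^esub> ?d *[A] (?d *[A] \<one>[A])" using i(1) d(1) by (intro A.smult_assoc1) auto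
  also have "... = \<zero>[A]" unfolding d(2) using i(1) by (rule A.smult_r_null)
  finally show False using ne1 by simp
 qed
 then have "\<omega> \<one>[A] = \<one>[k]"
  by (rule k.eq_if_diff_zero[OF _ w k.one_closed])
 with \<omega>(1) show ?thesis by blast
qed

section \<open>Elements of threefold tensor products\<close>

lemma assoc_map_eq:
 assumes A: "module k A" and V: "module k V" and W: "module k W" and P: "module k P"
  and f: "f : lin_maps k P (tensor k A V)" and t: "t <: tensor k P W"
 shows "tensor_assoc k A V W (tensor_map k (tensor k A V) W f (%w. w) t) =
  tsum k (tensor k A (tensor k V W)) t (%p w. tsum k (tensor k A (tensor k V W)) (f p) (%u v. pure k A (tensor k V W) u (pure k V W v w)))"
proof -
 note T = tensor_module[OF A tensor_module[OF V W]]
 have c: "tensor_assoc k A V W t' <: tensor k A (tensor k V W)" if t': "t' <: tensor k (tensor k A V) W" for t'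
  unfolding tensor_assoc_eq[OF A V W t']
  by (rule tsum_closed[OF tensor_module[OF A V] W t' T], rule tsum_closed[OF A V _ T]) (assumption|intro A V W mlin)+
 show ?thesis
  by (subst tsum_self_right[OF A V W c, symmetric],
    rule lin_closed[OF tensor_map_lin[OF P W tensor_module[OF A V] W f lin_id] t],
    rule tsum_assoc_map_left[OF A V W T P f t])
   (assumption|intro A V W mlin)+
qed

lemma map_right_eq:
 assumes A: "module k A" and V: "module k V" and W: "module k W" and P: "module k P"
  and g: "g : lin_maps k P (tensor k V W)" and t: "t <: tensor k A P"
 shows "tensor_map k A (tensor k V W) (%a. a) g t =
  tsum k (tensor k A (tensor k V W)) t (%a p. tsum k (tensor k A (tensor k V W)) (g p) (%v w. pure k A (tensor k V W) a (pure k V W v w)))"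
 by (subst tsum_self_right[OF A V W lin_closed[OF tensor_map_lin[OF A P A tensor_module[OF V W] lin_id g] t], symmetric],
    rule tsum_map_right[OF A V W tensor_module[OF A tensor_module[OF V W]] P g t])
  (assumption|intro A V W mlin)+

text \<open>Two elements of \<open>A \<otimes> (V \<otimes> W)\<close> given in this form agree under every trilinear map.\<close>

lemma tsum_trilin_eq:
 assumes A: "module k A" and V: "module k V" and W: "module k W" and P: "module k P" and Q: "module k Q" and U: "module k U"
  and f: "f : lin_maps k P (tensor k A V)" and t: "t <: tensor k P W"
  and g: "g : lin_maps k Q (tensor k V W)" and s: "s <: tensor k A Q"
  and eq: "tensor_assoc k A V W (tensor_map k (tensor k A V) W f (%w. w) t) = tensor_map k A (tensor k V W) (%a. a) g s"
  and \<beta>: "\<beta> : trilin_maps k A V W U"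
 shows "tsum k U t (%p w. tsum k U (f p) (%u v. \<beta> u v w)) = tsum k U s (%a q. tsum k U (g q) (\<beta> a))"
proof -
 note D = trilin_mapsD[OF \<beta>]
 have "tsum k U t (%p w. tsum k U (f p) (%u v. \<beta> u v w)) =
  tsum k U (tensor_assoc k A V W (tensor_map k (tensor k A V) W f (%w. w) t)) (%u s. tsum k U s (\<beta> u))"
  by (rule tsum_assoc_map_left[OF A V W U P f t, symmetric]) (rule D, assumption+)+
 also have "... = tsum k U (tensor_map k A (tensor k V W) (%a. a) g s) (%u s. tsum k U s (\<beta> u))"
  by (simp only: eq)
 also have "... = tsum k U s (%a q. tsum k U (g q) (\<beta> a))"
  by (rule tsum_map_right[OF A V W U Q g s]) (rule D, assumption+)+
 finally show ?thesis .
qed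


section \<open>Yetter--Drinfeld modules over a cogroupoid\<close>

text \<open>Only the linear structure of its factors enters a tensor product.\<close>

definition same_module :: "('k, 'v, 'm) module_scheme \<Rightarrow> ('k, 'v, 'n) module_scheme \<Rightarrow> bool" where
 "same_module V W \<longleftrightarrow> carrier V = carrier W \<and> \<zero>[V] = \<zero>[W] \<and> (\<oplus>\<^bsub>V\<^esub>) = (\<oplus>\<^bsub>W\<^esub>) \<and> (\<odot>\<^bsub>V\<^esub>) = (\<odot>\<^bsub>W\<^esub>)"

lemma same_module_module:
 assumes s: "same_module V W" and W: "module k W" shows "module k V"
proof -
 interpret W: module k W by (rule W)
 have e: "carrier V = carrier W" "\<zero>[V] = \<zero>[W]" "(\<oplus>\<^bsub>V\<^esub>) = (\<oplus>\<^bsub>W\<^esub>)" "(\<odot>\<^bsub>V\<^esub>) = (\<odot>\<^bsub>W\<^esub>)"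
  using s by (auto simp: same_module_def)
 have "\<exists>y\<in>carrier W. y +[W] x = \<zero>[W]" if "x <: W" for x
  using that by (intro bexI[of _ "\<ominus>\<^bsub>W\<^esub> x"]) (auto simp: W.l_neg)
 then show ?thesis
  by (intro moduleI abelian_groupI W.cring_axioms)
   (simp_all add: e W.a_ac W.smult_l_distr W.smult_r_distr W.smult_assoc1)
qed

lemma same_module_lin_maps:
 assumes "same_module V V'" "same_module W W'" shows "lin_maps k V W = lin_maps k V' W'"
 using assms by (simp add: lin_maps_def same_module_def)

lemma same_module_tensor:
 assumes "same_module V V'" "same_module W W'"
 shows "tensor k V W = tensor k V' W'" "pure k V W = pure k V' W'"
proof -
 have "relation_space k V W = relation_space k V' W'"
  using assms by (simp add: relation_space_def bilinearity_relations_def same_module_def)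
 moreover have "carrier V = carrier V'" "carrier W = carrier W'" using assms by (auto simp: same_module_def)
 ultimately show "tensor k V W = tensor k V' W'" "pure k V W = pure k V' W'"
  by (simp_all add: tensor_def pure_def fun_eq_iff)
qed

lemma same_module_refl [simp]: "same_module V V"
 by (simp add: same_module_def)

lemma same_module_extend [simp]: "same_module (module.extend M E) M"
 by (simp add: same_module_def module.defs)

lemma hopf_at_simps [simp]:
 "carrier (hopf_at C X) = carrier (alg C X X)" "x \<otimes>[hopf_at C X] y = x \<otimes>[alg C X X] y"
 "\<one>[hopf_at C X] = \<one>[alg C X X]" "comul (hopf_at C X) = cocomp C X X X"
 "counit (hopf_at C X) = coun C X" "antipode (hopf_at C X) = anti C X X"
 by (simp_all add: hopf_at_def module.defs)

lemma hopf_at_same: "same_module (hopf_at C X) (alg C X X)"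
 unfolding hopf_at_def by simp

lemma hopf_at_tensor [simp]:
 "tensor k V (hopf_at C X) = tensor k V (alg C X X)" "pure k V (hopf_at C X) = pure k V (alg C X X)"
 "tensor k (hopf_at C X) W = tensor k (alg C X X) W" "pure k (hopf_at C X) W = pure k (alg C X X) W"
 "bilin_maps k V (hopf_at C X) U = bilin_maps k V (alg C X X) U"
 "tensor_map k V' (hopf_at C X) f g s = tensor_map k V' (alg C X X) f g s"
 "tensor_assoc k V (hopf_at C X) (hopf_at C X) t = tensor_assoc k V (alg C X X) (alg C X X) t"
proof -
 note e = same_module_tensor[OF same_module_refl hopf_at_same] same_module_tensor[OF hopf_at_same same_module_refl]
  same_module_lin_maps[OF hopf_at_same same_module_refl] same_module_tensor[OF hopf_at_same hopf_at_same]
 have c: "carrier (hopf_at C X) = carrier (alg C X X)" by simp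
 show "tensor k V (hopf_at C X) = tensor k V (alg C X X)" "pure k V (hopf_at C X) = pure k V (alg C X X)"
  "tensor k (hopf_at C X) W = tensor k (alg C X X) W" "pure k (hopf_at C X) W = pure k (alg C X X) W"
  by (rule e)+
 show "bilin_maps k V (hopf_at C X) U = bilin_maps k V (alg C X X) U"
  by (simp only: bilin_maps_def e c)
 show "tensor_map k V' (hopf_at C X) f g s = tensor_map k V' (alg C X X) f g s"
  by (simp only: tensor_map_def e)
 show "tensor_assoc k V (hopf_at C X) (hopf_at C X) t = tensor_assoc k V (alg C X X) (alg C X X) t"
  by (simp only: tensor_assoc_def Let_def e)
qed

lemma sweedler_eq_tsum_cong:
 assumes V: "module k V" and W: "module k W" and t: "t <: tensor k V W" and U: "module k U"
  and eq: "!!v w. [|v <: V; w <: W|] ==> \<gamma> v w = \<beta> v w" and \<beta>: "\<beta> : bilin_maps k V W U"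
 shows "sweedler k U t \<gamma> = tsum k U t \<beta>"
proof -
 have "\<gamma> : bilin_maps k V W U"
  by (rule bilin_mapsI; rule lin_cong[OF bilin_maps_right[OF \<beta>] W] lin_cong[OF bilin_maps_left[OF \<beta>] V]) (simp_all add: eq)
 then show ?thesis by (simp add: sweedler_eq_tsum[OF V W t U] tsum_cong'[OF V W t eq])
qed

context cogroupoid
begin

text \<open>The Yetter--Drinfeld structure of a module, as rules for expressions in Sweedler notation.\<close>

context
 fixes X and V :: "('k, 'a, 'v) yd_data"
 assumes X: "X : ob C" and V: "yd_module k (hopf_at C X) V"
begin

lemma yd_mod: "module k V"
 using V by (simp add: yd_module_def)

lemma ract_mlin:
 "[|v <: V; x <: alg C X X|] ==> ract V v x <: V"
 "[|E : lin_maps k A V; x <: alg C X X|] ==> (%z. ract V (E z) x) : lin_maps k A V"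
 "[|v <: V; F : lin_maps k A (alg C X X)|] ==> (%z. ract V v (F z)) : lin_maps k A V"
proof -
 have b: "ract V : bilin_maps k V (alg C X X) V" using yd_module.ract_bilin[OF V] by simp
 show "[|v <: V; x <: alg C X X|] ==> ract V v x <: V" by (rule bilin_closed[OF b])
 show "[|E : lin_maps k A V; x <: alg C X X|] ==> (%z. ract V (E z) x) : lin_maps k A V"
  by (rule lin_comp[OF bilin_maps_left[OF b]])
 show "[|v <: V; F : lin_maps k A (alg C X X)|] ==> (%z. ract V v (F z)) : lin_maps k A V"
  by (rule lin_comp[OF bilin_maps_right[OF b]])
qed

lemma yd_coact_lin: "coact V : lin_maps k V (tensor k V (alg C X X))"
 using yd_module.coact_lin[OF V] by simp

lemma coact_mlin:
 "v <: V ==> coact V v <: tensor k V (alg C X X)"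
 "E : lin_maps k A V ==> (%z. coact V (E z)) : lin_maps k A (tensor k V (alg C X X))"
 by (rule lin_closed[OF yd_coact_lin], assumption) (rule lin_comp[OF yd_coact_lin])

lemma co_closed:
 "[|v <: V; module k U; !!a b. [|a <: V; b <: alg C X X|] ==> \<beta> a b <: U|] ==>
  tsum k U (coact V v) \<beta> <: U"
 by (rule tsum_closed[OF yd_mod alg_module[OF X X] coact_mlin(1)])

lemma co_lin_arg:
 "[|v <: V; module k U;
  !!a b. [|a <: V; b <: alg C X X|] ==> (%z. \<beta> z a b) : lin_maps k A U|] ==>
  (%z. tsum k U (coact V v) (\<beta> z)) : lin_maps k A U"
 by (rule lin_tsum_arg[OF yd_mod alg_module[OF X X] coact_mlin(1)])

lemma co_lin:
 "[|module k U; E : lin_maps k A V; \<beta> : bilin_maps k V (alg C X X) U|] ==>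
  (%z. tsum k U (coact V (E z)) \<beta>) : lin_maps k A U"
 by (rule lin_tsum_tensor[OF yd_mod alg_module[OF X X] coact_mlin(2)])

lemma co_cong:
 "[|v <: V; !!a b. [|a <: V; b <: alg C X X|] ==> \<beta> a b = \<gamma> a b|] ==>
  tsum k U (coact V v) \<beta> = tsum k U (coact V v) \<gamma>"
 by (rule tsum_cong'[OF yd_mod alg_module[OF X X] coact_mlin(1)])

lemma co_sw_swap:
 "[|Y : ob C; Z : ob C; T : ob C; module k U; v <: V; y <: alg C Y T;
  !!a b c d. [|a <: V; b <: alg C X X; c <: alg C Y Z; d <: alg C Z T|]
   ==> \<beta> a b c d <: U|] ==>
  tsum k U (coact V v) (%a b. Sw2 U Y Z T y (\<beta> a b)) = Sw2 U Y Z T y (%c d. tsum k U (coact V v) (%a b. \<beta> a b c d))"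
 by (rule tsum_swap[OF yd_mod alg_module[OF X X] coact_mlin(1) _ alg_module alg_module cocomp_closed])

lemma co_coassoc:
 assumes v: "v <: V" and U: "module k U" and \<beta>: "\<beta> : trilin_maps k V (alg C X X) (alg C X X) U"
 shows "tsum k U (coact V v) (%p h. tsum k U (coact V p) (%v0 g. \<beta> v0 g h)) =
  tsum k U (coact V v) (%v0 q. Sw2 U X X X q (\<beta> v0))"
 using yd_module.coact_coassoc[OF V v]
 by (intro tsum_trilin_eq[OF yd_mod alg_module[OF X X] alg_module[OF X X] yd_mod alg_module[OF X X] U
    yd_coact_lin coact_mlin(1)[OF v] cocomp_lin[OF X X X] coact_mlin(1)[OF v] _ \<beta>]) simp

lemma co_counit:
 assumes v: "v <: V" and U: "module k U" and \<beta>: "\<beta> : lin_maps k V U"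
 shows "tsum k U (coact V v) (%v0 h. coun C X h *[U] \<beta> v0) = \<beta> v"
proof -
 have "\<beta> v = \<beta> (sweedler k V (coact V v) (%v0 h. coun C X h *[V] v0))"
  using yd_module.coact_counit[OF V v] by simp
 also have "... = \<beta> (tsum k V (coact V v) (%v0 h. coun C X h *[V] v0))"
  by (subst sweedler_eq_tsum[OF yd_mod alg_module[OF X X] coact_mlin(1)[OF v]]) (assumption | rule refl | intro mlin X yd_mod)+
 also have "... = tsum k U (coact V v) (%v0 h. \<beta> (coun C X h *[V] v0))"
  by (rule lin_tsum[OF yd_mod alg_module[OF X X] coact_mlin(1)[OF v] yd_mod U \<beta>]) (assumption|intro mlin X yd_mod)+
 also have "... = tsum k U (coact V v) (%v0 h. coun C X h *[U] \<beta> v0)"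
  by (rule co_cong[OF v]) (assumption|intro lin_smult[OF \<beta>] mlin X)+
 finally show ?thesis by simp
qed

lemma yd_sweedler_cond:
 assumes v: "v <: V" and x: "x <: alg C X X"
 shows "sweedler k (tensor k V (alg C X X)) (coact V v) (%v0 v1.
    sweedler k (tensor k V (alg C X X)) (cocomp C X X X x) (%x1 x'.
     sweedler k (tensor k V (alg C X X)) (cocomp C X X X x') (%x2 x3.
      pure k V (alg C X X) (ract V v0 x2) (anti C X X x1 \<otimes>[alg C X X] v1 \<otimes>[alg C X X] x3)))) =
  tsum k (tensor k V (alg C X X)) (coact V v) (%v0 h. Sw3 (tensor k V (alg C X X)) X X X X x (%x1 x2 x3.
   pure k V (alg C X X) (ract V v0 x2) (anti C X X x1 \<otimes>[alg C X X] h \<otimes>[alg C X X] x3)))"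
 by (rule sweedler_eq_tsum_cong[of k V "alg C X X"] | rule sweedler_eq_tsum_cong[of k "alg C X X" "alg C X X"] | assumption | rule refl |
   intro mlin X yd_mod v x ract_mlin coact_mlin co_lin_arg co_lin)+

lemma co_ract:
 assumes v: "v <: V" and x: "x <: alg C X X" and U: "module k U"
  and \<beta>: "\<beta> : bilin_maps k V (alg C X X) U"
 shows "tsum k U (coact V (ract V v x)) \<beta> = tsum k U (coact V v) (%v0 h. Sw3 U X X X X x (%x1 x2 x3.
   \<beta> (ract V v0 x2) (anti C X X x1 \<otimes>[alg C X X] h \<otimes>[alg C X X] x3)))"
proof -
 let ?T = "tensor k V (alg C X X)" and ?p = "pure k V (alg C X X)"
 let ?F = "%v0 h x1 x2 x3. ?p (ract V v0 x2) (anti C X X x1 \<otimes>[alg C X X] h \<otimes>[alg C X X] x3)"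
 note A = alg_module[OF X X]
 have "tsum k U (coact V (ract V v x)) \<beta> =
  tsum k U (tsum k ?T (coact V v) (%v0 h. Sw3 ?T X X X X x (?F v0 h))) \<beta>"
  using yd_module.yd_condition[OF V v] x by (simp add: yd_sweedler_cond[OF v x])
 also have "... = tsum k U (coact V v) (%v0 h. tsum k U (Sw3 ?T X X X X x (?F v0 h)) \<beta>)"
  by (rule tsum_tsum[OF yd_mod A coact_mlin(1)[OF v] U yd_mod A _ \<beta>]) (assumption|intro mlin X yd_mod v x ract_mlin)+
 also have "... = tsum k U (coact V v) (%v0 h. Sw3 U X X X X x (%x1 x2 x3. \<beta> (ract V v0 x2) (anti C X X x1 \<otimes>[alg C X X] h \<otimes>[alg C X X] x3)))"
 proof (rule co_cong[OF v])
  fix v0 h assume m: "v0 <: V" "h <: alg C X X"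
  have "tsum k U (Sw3 ?T X X X X x (?F v0 h)) \<beta> = Sw2 U X X X x (%x1 r. tsum k U (Sw2 ?T X X X r (?F v0 h x1)) \<beta>)"
   by (rule tsum_tsum[OF A A _ U yd_mod A _ \<beta>]) (assumption|intro mlin X yd_mod m x ract_mlin)+
  also have "... = Sw3 U X X X X x (%x1 x2 x3. tsum k U (?F v0 h x1 x2 x3) \<beta>)"
   by (rule sw_cong, (intro X x)+, rule tsum_tsum[OF A A _ U yd_mod A _ \<beta>]) (assumption|intro mlin X yd_mod m ract_mlin)+
  also have "... = Sw3 U X X X X x (%x1 x2 x3. \<beta> (ract V v0 x2) (anti C X X x1 \<otimes>[alg C X X] h \<otimes>[alg C X X] x3))"
   by (rule sw_cong, (intro X x)+, rule sw_cong, (assumption|intro X)+, rule tsum_pure[OF yd_mod A U \<beta>]) (assumption|intro mlin X m ract_mlin)+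
  finally show "tsum k U (Sw3 ?T X X X X x (?F v0 h)) \<beta> = ..." .
 qed
 finally show ?thesis .
qed

end

lemmas yd_mlin = yd_mod ract_mlin coact_mlin co_closed co_lin_arg co_lin

text \<open>Conversely, these rules suffice to define a Yetter--Drinfeld module.\<close>

lemma yd_moduleI:
 fixes V :: "('k, 'a, 'v) yd_data"
 assumes X: "X : ob C" and mV: "module k V"
  and r: "ract V : bilin_maps k V (alg C X X) V"
  and one: "!!v. v <: V ==> ract V v \<one>[alg C X X] = v"
  and mult: "!!v x y. [|v <: V; x <: alg C X X; y <: alg C X X|] ==>
   ract V v (x \<otimes>[alg C X X] y) = ract V (ract V v x) y"
  and co: "coact V : lin_maps k V (tensor k V (alg C X X))"
  and coassoc: "!!v. v <: V ==> let A = alg C X X; T = tensor k V (tensor k A A) in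
   tsum k T (coact V v) (%p h. tsum k T (coact V p) (%v0 g. pure k V (tensor k A A) v0 (pure k A A g h))) =
   tsum k T (coact V v) (%v0 q. Sw2 T X X X q (%g h. pure k V (tensor k A A) v0 (pure k A A g h)))"
  and counit: "!!v. v <: V ==> tsum k V (coact V v) (%v0 h. coun C X h *[V] v0) = v"
  and yd: "!!v x. [|v <: V; x <: alg C X X|] ==> let T = tensor k V (alg C X X) in
   coact V (ract V v x) = tsum k T (coact V v) (%v0 h. Sw3 T X X X X x (%x1 x2 x3.
   pure k V (alg C X X) (ract V v0 x2) (anti C X X x1 \<otimes>[alg C X X] h \<otimes>[alg C X X] x3)))"
 shows "yd_module k (hopf_at C X) V"
proof (rule yd_module.intro[OF mV], rule yd_module_axioms.intro)
 note A = alg_module[OF X X] note AA = tensor_module[OF A A]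
 have r1: "[|v <: V; x <: alg C X X|] ==> ract V v x <: V" for v x by (rule bilin_closed[OF r])
 note rl = r1 lin_comp[OF bilin_maps_left[OF r]] lin_comp[OF bilin_maps_right[OF r]]
 note cv = lin_closed[OF co]
 show "ract V : bilin_maps k V (hopf_at C X) V" using r by simp
 show "coact V : lin_maps k V (tensor k V (hopf_at C X))" using co by simp
 fix v assume v: "v <: V"
 show "ract V v \<one>[hopf_at C X] = v" using one[OF v] by simp
 show "tensor_assoc k V (hopf_at C X) (hopf_at C X) (tensor_map k (tensor k V (hopf_at C X)) (hopf_at C X) (coact V) (%x. x) (coact V v)) =
  tensor_map k V (tensor k (hopf_at C X) (hopf_at C X)) (%u. u) (comul (hopf_at C X)) (coact V v)"
  using coassoc[OF v] by (simp add: Let_def assoc_map_eq[OF mV A A mV co cv[OF v]] map_right_eq[OF mV A A A cocomp_lin[OF X X X] cv[OF v]])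
 have "sweedler k V (coact V v) (%v0 h. coun C X h *[V] v0) = tsum k V (coact V v) (%v0 h. coun C X h *[V] v0)"
  by (rule sweedler_eq_tsum[OF mV A cv[OF v] mV]) (assumption|intro mlin mV X)+
 then show "sweedler k V (coact V v) (%v0 v1. counit (hopf_at C X) v1 *[V] v0) = v" using counit[OF v] by simp
 fix x assume x': "x <: hopf_at C X"
 then have x: "x <: alg C X X" by simp
 show "ract V v (x \<otimes>[hopf_at C X] y) = ract V (ract V v x) y" if "y <: hopf_at C X" for y
  using mult[OF v x] that by simp
 have "sweedler k (tensor k V (alg C X X)) (coact V v) (%v0 v1.
    sweedler k (tensor k V (alg C X X)) (cocomp C X X X x) (%x1 x'.
     sweedler k (tensor k V (alg C X X)) (cocomp C X X X x') (%x2 x3.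
      pure k V (alg C X X) (ract V v0 x2) (anti C X X x1 \<otimes>[alg C X X] v1 \<otimes>[alg C X X] x3)))) =
  tsum k (tensor k V (alg C X X)) (coact V v) (%v0 h. Sw3 (tensor k V (alg C X X)) X X X X x (%x1 x2 x3.
   pure k V (alg C X X) (ract V v0 x2) (anti C X X x1 \<otimes>[alg C X X] h \<otimes>[alg C X X] x3)))"
  by (rule sweedler_eq_tsum_cong[of k V "alg C X X"] | rule sweedler_eq_tsum_cong[of k "alg C X X" "alg C X X"] | assumption | rule refl |
   intro mlin X mV v x rl cv[OF v])+
 then show "coact V (ract V v x) = sweedler k (tensor k V (hopf_at C X)) (coact V v) (%v0 v1.
    sweedler k (tensor k V (hopf_at C X)) (comul (hopf_at C X) x) (%x1 x'.
     sweedler k (tensor k V (hopf_at C X)) (comul (hopf_at C X) x') (%x2 x3.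
      pure k V (hopf_at C X) (ract V v0 x2) (antipode (hopf_at C X) x1 \<otimes>[hopf_at C X] v1 \<otimes>[hopf_at C X] x3))))"
  using yd[OF v x] by (simp add: Let_def)
qed

end

lemma same_module_tsum:
 assumes "same_module U U'" shows "tsum k U = tsum k U'"
proof -
 have e: "carrier U = carrier U'" "\<zero>[U] = \<zero>[U']" "(\<oplus>\<^bsub>U\<^esub>) = (\<oplus>\<^bsub>U'\<^esub>)" "(\<odot>\<^bsub>U\<^esub>) = (\<odot>\<^bsub>U'\<^esub>)"
  using assms by (auto simp: same_module_def)
 show ?thesis by (intro ext) (simp only: tsum_def free_ext_def finsum_def finprod_def e partial_object.simps monoid.simps)
qed

lemma same_module_bilin_maps:
 assumes "same_module V V'" "same_module W W'" "same_module U U'"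
 shows "bilin_maps k V W U = bilin_maps k V' W' U'"
 using same_module_lin_maps[OF assms(1,3), of k] same_module_lin_maps[OF assms(2,3), of k] assms(1,2)
 by (simp add: bilin_maps_def same_module_def)

context cogroupoid
begin

abbreviation (input) mm where "mm X Y a b \<equiv> a \<otimes>[alg C X Y] b"
abbreviation (input) Co where "Co U V v \<beta> \<equiv> tsum k U (coact V v) \<beta>"
abbreviation (input) YDm where "YDm X V \<equiv> yd_module k (hopf_at C X) V"

lemma yd_moduleI_same:
 fixes V :: "('k, 'a, 'v) yd_data"
 assumes X: "X : ob C" and s: "same_module V T" and mT: "module k T"
  and r: "ract V : bilin_maps k T (alg C X X) T"
  and one: "!!v. v <: T ==> ract V v \<one>[alg C X X] = v"
  and mult: "!!v x y. [|v <: T; x <: alg C X X; y <: alg C X X|] ==>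
   ract V v (mm X X x y) = ract V (ract V v x) y"
  and co: "coact V : lin_maps k T (tensor k T (alg C X X))"
  and coassoc: "!!v. v <: T ==> let A = alg C X X; T' = tensor k T (tensor k A A) in
   Co T' V v (%p h. Co T' V p (%v0 g. pure k T (tensor k A A) v0 (pure k A A g h))) =
   Co T' V v (%v0 q. Sw2 T' X X X q (%g h. pure k T (tensor k A A) v0 (pure k A A g h)))"
  and counit: "!!v. v <: T ==> Co T V v (%v0 h. coun C X h *[T] v0) = v"
  and yd: "!!v x. [|v <: T; x <: alg C X X|] ==> let T' = tensor k T (alg C X X) in
   coact V (ract V v x) = Co T' V v (%v0 h. Sw3 T' X X X X x (%x1 x2 x3.
   pure k T (alg C X X) (ract V v0 x2) (mm X X (mm X X (anti C X X x1) h) x3)))"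
 shows "YDm X V"
proof (rule yd_moduleI[OF X])
 note e = same_module_tensor[OF s same_module_refl] same_module_tsum[OF s] same_module_lin_maps[OF s same_module_refl]
  same_module_bilin_maps[OF s same_module_refl s]
 have c: "carrier V = carrier T" "(\<odot>\<^bsub>V\<^esub>) = (\<odot>\<^bsub>T\<^esub>)" using s by (auto simp: same_module_def)
 show "module k V" by (rule same_module_module[OF s mT])
qed (use assms in \<open>simp_all only: Let_def same_module_tensor[OF s same_module_refl] same_module_tsum[OF s]
  same_module_lin_maps[OF s same_module_refl] same_module_bilin_maps[OF s same_module_refl s]
  same_module_def\<close>)

lemma co_co_swap:
 assumes X: "X : ob C" and Y: "Y : ob C" and V: "YDm X V" and W: "YDm Y W" and v: "v <: V" and w: "w <: W"
  and U: "module k U" and \<beta>: "!!a b c d. [|a <: V; b <: alg C X X; c <: W; d <: alg C Y Y|] ==> \<beta> a b c d <: U"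
 shows "Co U V v (%a b. Co U W w (\<beta> a b)) = Co U W w (%c d. Co U V v (%a b. \<beta> a b c d))"
 by (rule tsum_swap[OF yd_mod[OF X V] alg_module[OF X X] coact_mlin(1)[OF X V v] U yd_mod[OF Y W] alg_module[OF Y Y] coact_mlin(1)[OF Y W w] \<beta>])

subsection \<open>The unit object\<close>

lemma yd_unit_yd:
 assumes X: "X : ob C"
 shows "YDm X (yd_unit k (hopf_at C X))"
proof -
 let ?B = "base_algebra k" and ?A = "alg C X X" and ?V = "yd_unit k (hopf_at C X)"
 note kr = base_cring[OF X]
 interpret k: cring k by (rule kr)
 have B: "module k ?B" by (rule base_algebra_module[OF kr])
 note A = alg_module[OF X X]
 have same: "same_module ?V ?B" by (simp add: yd_unit_def)
 have ra: "ract ?V c x = coun C X x *[?B] c" if "c <: k" "x <: ?A" for c x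
  using that X by (simp add: yd_unit_def yd_data.defs module.defs k.m_comm coun_closed)
 have ca: "coact ?V c = pure k ?B ?A c \<one>[?A]" for c by (simp add: yd_unit_def yd_data.defs module.defs)
 have tp: "tsum k U (pure k ?B ?A c \<one>[?A]) \<beta> = \<beta> c \<one>[?A]" if "module k U" "c <: k" "\<beta> : bilin_maps k ?B ?A U" for U c \<beta>
  by (rule tsum_pure[OF B A that(1,3)]) (use that X in \<open>auto intro: mlin\<close>)
 note bc = base_algebra_simps(1)[of k]
 show ?thesis
 proof (rule yd_moduleI_same[OF X same B], unfold ca Let_def)
  have "(%c x. coun C X x *[?B] c) : bilin_maps k ?B ?A ?B"
   by (assumption|intro mlin B X | simp only: bc)+
  then show "ract ?V : bilin_maps k ?B ?A ?B"
   by (intro bilin_mapsI; (rule lin_cong[OF bilin_maps_right A] lin_cong[OF bilin_maps_left B])) (simp_all add: ra)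
  show "(%c. pure k ?B ?A c \<one>[?A]) : lin_maps k ?B (tensor k ?B ?A)"
   by (intro mlin B A X)
  fix c assume "c <: ?B"
  then have c: "c <: k" by simp
  have tpc: "pure k ?B ?A c \<one>[?A] <: tensor k ?B ?A"
   by (rule pure_closed[OF B A]) (use c X in \<open>auto intro: mlin\<close>)
  show "ract ?V c \<one>[?A] = c" using c X by (simp add: ra coun_one mlin)
  show "ract ?V c (mm X X x y) = ract ?V (ract ?V c x) y" if "x <: ?A" "y <: ?A" for x y
   using c X that by (simp add: ra coun_mult mlin coun_closed k.m_ac)
  let ?T = "tensor k ?B (tensor k ?A ?A)"
  have "tsum k ?T (pure k ?B ?A c \<one>[?A]) (%p h. tsum k ?T (pure k ?B ?A p \<one>[?A]) (%v0 g. pure k ?B (tensor k ?A ?A) v0 (pure k ?A ?A g h))) =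
   tsum k ?T (pure k ?B ?A c \<one>[?A]) (%p h. pure k ?B (tensor k ?A ?A) p (pure k ?A ?A \<one>[?A] h))"
   by (rule tsum_cong'[OF B A tpc], rule tp) (assumption|intro mlin B A X | simp only: bc)+
  also have "... = pure k ?B (tensor k ?A ?A) c (pure k ?A ?A \<one>[?A] \<one>[?A])"
   by (rule tp) (assumption|intro mlin B A X c | simp only: bc)+
  also have "... = Sw2 ?T X X X \<one>[?A] (%g h. pure k ?B (tensor k ?A ?A) c (pure k ?A ?A g h))"
   by (rule sw_one[symmetric]) (assumption|intro mlin B A X c | simp only: bc)+
  also have "... = tsum k ?T (pure k ?B ?A c \<one>[?A]) (%v0 q. Sw2 ?T X X X q (%g h. pure k ?B (tensor k ?A ?A) v0 (pure k ?A ?A g h)))"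
   by (rule tp[symmetric]) (assumption|intro mlin B A X c | simp only: bc)+
  finally show "tsum k ?T (pure k ?B ?A c \<one>[?A]) (%p h. tsum k ?T (pure k ?B ?A p \<one>[?A]) (%v0 g. pure k ?B (tensor k ?A ?A) v0 (pure k ?A ?A g h))) = ..." .
  have "tsum k ?B (pure k ?B ?A c \<one>[?A]) (%v0 h. coun C X h *[?B] v0) = coun C X \<one>[?A] *[?B] c"
   by (rule tp) (assumption|intro mlin B A X c | simp only: bc)+
  then show "tsum k ?B (pure k ?B ?A c \<one>[?A]) (%v0 h. coun C X h *[?B] v0) = c"
   using X c by (simp add: coun_one)
  fix x assume x: "x <: ?A"
  let ?T = "tensor k ?B ?A" and ?S = "anti C X X"
  have T: "module k ?T" by (intro mlin B A)
  let ?F = "%v0 h x1 x2 x3. pure k ?B ?A (coun C X x2 *[?B] v0) (mm X X (mm X X (?S x1) h) x3)"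
  have "tsum k ?T (pure k ?B ?A c \<one>[?A]) (%v0 h. Sw3 ?T X X X X x (%x1 x2 x3.
    pure k ?B ?A (ract ?V v0 x2) (mm X X (mm X X (?S x1) h) x3))) =
   tsum k ?T (pure k ?B ?A c \<one>[?A]) (%v0 h. Sw3 ?T X X X X x (?F v0 h))"
   by (rule tsum_cong'[OF B A tpc], rule sw_cong, (intro X x)+, rule sw_cong, (assumption|intro X)+)
    (simp only: bc ra)
  also have "... = Sw3 ?T X X X X x (?F c \<one>[?A])"
   by (rule tp) (assumption|intro mlin B A X c x T | simp only: bc)+
  also have "... = Sw3 ?T X X X X x (%x1 x2 x3. coun C X x2 *[?T] pure k ?B ?A c (mm X X (?S x1) x3))"
   by (rule sw_cong, (intro X x)+, rule sw_cong, (assumption|intro X)+)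
    (simp add: alg_simps X lin_smult[OF pure_lin_left[OF B A]] coun_closed c del: base_algebra_simps(6))
  also have "... = Sw2 ?T X X X x (%x1 r. pure k ?B ?A c (mm X X (?S x1) r))"
   by (rule sw_cong, (intro X x)+, rule sw_coun_left) (assumption|intro mlin B A X c x T | simp only: bc c)+
  also have "... = coun C X x *[?T] pure k ?B ?A c \<one>[?A]"
   by (rule sw_anti_left) (assumption|intro mlin B A X c x T | simp only: bc c)+
  also have "... = pure k ?B ?A (ract ?V c x) \<one>[?A]"
   using X x c by (simp add: ra lin_smult[OF pure_lin_left[OF B A]] coun_closed alg_simps del: base_algebra_simps(6))
  finally show "pure k ?B ?A (ract ?V c x) \<one>[?A] = tsum k ?T (pure k ?B ?A c \<one>[?A]) (%v0 h. Sw3 ?T X X X X x (%x1 x2 x3.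
    pure k ?B ?A (ract ?V v0 x2) (mm X X (mm X X (?S x1) h) x3)))" by simp
 qed
qed

subsection \<open>Tensor products\<close>

context
 fixes X and V :: "('k, 'a, 'v) yd_data" and W :: "('k, 'a, 'w) yd_data"
 assumes X: "X : ob C" and V: "YDm X V" and W: "YDm X W"
begin

abbreviation (input) "VW \<equiv> yd_tensor k (hopf_at C X) V W"
abbreviation (input) "TVW \<equiv> tensor k V W"

lemmas tr = yd_mlin[OF X V] yd_mlin[OF X W] mlin X

lemma yd_tensor_same: "same_module VW TVW"
 by (simp add: yd_tensor_def)

lemma yd_tensor_mod: "module k TVW"
 by (intro tr)

lemma yd_tensor_ract:
 assumes t: "t <: TVW" and x: "x <: alg C X X"
 shows "ract VW t x = Sw2 TVW X X X x (%x1 x2. tsum k TVW t (%v w. pure k V W (ract V v x1) (ract W w x2)))"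
proof -
 have "ract VW t x = sweedler k TVW (cocomp C X X X x) (%x1 x2. tensor_map k V W (%v. ract V v x1) (%w. ract W w x2) t)"
  by (simp add: yd_tensor_def yd_data.defs module.defs)
 also have "... = Sw2 TVW X X X x (%x1 x2. tsum k TVW t (%v w. pure k V W (ract V v x1) (ract W w x2)))"
 proof (rule sweedler_eq_tsum_cong[of k "alg C X X" "alg C X X"])
  show "tensor_map k V W (%v. ract V v x1) (%w. ract W w x2) t = tsum k TVW t (%v w. pure k V W (ract V v x1) (ract W w x2))"
   if "x1 <: alg C X X" "x2 <: alg C X X" for x1 x2
   by (rule tensor_map_eq[of k V W]) (assumption|intro tr t that)+
  show "(%x1 x2. tsum k TVW t (%v w. pure k V W (ract V v x1) (ract W w x2))) : bilin_maps k (alg C X X) (alg C X X) TVW"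
   by (rule bilin_mapsI; rule lin_tsum_arg[of k V W]) (assumption|intro tr t)+
 qed (intro tr x)+
 finally show ?thesis .
qed

lemma yd_tensor_ract_lin: "ract VW : bilin_maps k TVW (alg C X X) TVW"
proof -
 let ?r = "%t x. Sw2 TVW X X X x (%x1 x2. tsum k TVW t (%v w. pure k V W (ract V v x1) (ract W w x2)))"
 have 1: "?r t : lin_maps k (alg C X X) TVW" if "t <: TVW" for t
  by (intro tr; rule lin_tsum_arg[of k V W]) (assumption|intro tr that)+
 have 2: "(%t. ?r t x) : lin_maps k TVW TVW" if "x <: alg C X X" for x
  by (intro tr that; rule tsum_lin[of k V W]) (assumption|intro tr)+
 show ?thesis
 proof (rule bilin_mapsI)
  show "ract VW t : lin_maps k (alg C X X) TVW" if "t <: TVW" for t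
   by (rule lin_cong[OF 1[OF that]]) (intro tr, rule yd_tensor_ract[OF that, symmetric])
  show "(%t. ract VW t x) : lin_maps k TVW TVW" if "x <: alg C X X" for x
   by (rule lin_cong[OF 2[OF that]]) (intro tr, rule yd_tensor_ract[OF _ that, symmetric])
 qed
qed

lemma yd_tensor_ract_pure:
 assumes v: "v <: V" and w: "w <: W" and x: "x <: alg C X X"
 shows "ract VW (pure k V W v w) x = Sw2 TVW X X X x (%x1 x2. pure k V W (ract V v x1) (ract W w x2))"
 by (subst yd_tensor_ract, intro tr v w, intro x, rule sw_cong, (intro tr x)+, rule tsum_pure) (assumption|intro tr v w)+

lemma yd_tensor_coact:
 assumes t: "t <: TVW"
 shows "coact VW t = tsum k (tensor k TVW (alg C X X)) t (%v w. Co (tensor k TVW (alg C X X)) V v (%v0 g.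
  Co (tensor k TVW (alg C X X)) W w (%w0 h. pure k TVW (alg C X X) (pure k V W v0 w0) (mm X X g h))))"
proof -
 let ?T = "tensor k TVW (alg C X X)"
 have "coact VW t = sweedler k ?T t (%v w. sweedler k ?T (coact V v) (%v0 g. sweedler k ?T (coact W w) (%w0 h.
   pure k TVW (alg C X X) (pure k V W v0 w0) (mm X X g h))))"
  by (simp add: yd_tensor_def yd_data.defs module.defs Let_def)
 also have "... = tsum k ?T t (%v w. Co ?T V v (%v0 g. Co ?T W w (%w0 h. pure k TVW (alg C X X) (pure k V W v0 w0) (mm X X g h))))"
  by (rule sweedler_eq_tsum_cong[of k V W], (intro tr t)+, rule sweedler_eq_tsum_cong[of k V "alg C X X"], (assumption|intro tr)+,
   rule sweedler_eq_tsum_cong[of k W "alg C X X"]) (assumption | rule refl | intro tr)+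
 finally show ?thesis .
qed

lemma yd_tensor_coact_lin: "coact VW : lin_maps k TVW (tensor k TVW (alg C X X))"
 by (rule lin_cong[OF _ _ yd_tensor_coact[symmetric]], rule tsum_lin[of k V W]) (assumption|intro tr)+

lemma yd_tensor_co:
 assumes v: "v <: V" and w: "w <: W" and U: "module k U" and \<beta>: "\<beta> : bilin_maps k TVW (alg C X X) U"
 shows "Co U VW (pure k V W v w) \<beta> = Co U V v (%v0 g. Co U W w (%w0 h. \<beta> (pure k V W v0 w0) (mm X X g h)))"
proof -
 let ?T = "tensor k TVW (alg C X X)" and ?A = "alg C X X"
 note mods = yd_mod[OF X V] yd_mod[OF X W] alg_module[OF X X] yd_tensor_mod
 have "Co U VW (pure k V W v w) \<beta> = tsum k U (Co ?T V v (%v0 g. Co ?T W w (%w0 h. pure k TVW ?A (pure k V W v0 w0) (mm X X g h)))) \<beta>"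
  by (subst yd_tensor_coact, intro tr v w, subst tsum_pure[of k V W]) (assumption | rule refl | intro tr v w)+
 also have "... = Co U V v (%v0 g. tsum k U (Co ?T W w (%w0 h. pure k TVW ?A (pure k V W v0 w0) (mm X X g h))) \<beta>)"
  by (rule tsum_tsum[OF mods(1,3) _ U mods(4,3) _ \<beta>]) (assumption|intro tr v w)+
 also have "... = Co U V v (%v0 g. Co U W w (%w0 h. tsum k U (pure k TVW ?A (pure k V W v0 w0) (mm X X g h)) \<beta>))"
  by (rule co_cong[OF X V v], rule tsum_tsum[OF mods(2,3) _ U mods(4,3) _ \<beta>]) (assumption|intro tr v w)+
 also have "... = Co U V v (%v0 g. Co U W w (%w0 h. \<beta> (pure k V W v0 w0) (mm X X g h)))"
  by (rule co_cong[OF X V v], rule co_cong[OF X W w], rule tsum_pure[OF mods(4,3) U \<beta>]) (assumption|intro tr)+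
 finally show ?thesis .
qed

text \<open>Coaction and action of a tensor product are determined on pure tensors. There the compatibility condition for
 \<open>V \<otimes> W\<close> is those for \<open>V\<close> and \<open>W\<close>, after the inner factor \<open>x\<^sub>3 S(x\<^sub>4)\<close> between \<open>v\<^sub>1\<close> and \<open>w\<^sub>1\<close> has cancelled.\<close>

lemma yd_tensor_yd: "YDm X VW"
proof -
 let ?A = "alg C X X" and ?T = "tensor k V W"
 note mods = yd_mod[OF X V] yd_mod[OF X W]
 note R = yd_tensor_ract_lin and L = yd_tensor_coact_lin
 have rr: "[|t <: ?T; x <: ?A|] ==> ract VW t x <: ?T"
  "[|E : lin_maps k P ?T; x <: ?A|] ==> (%z. ract VW (E z) x) : lin_maps k P ?T"
  "[|t <: ?T; F : lin_maps k P ?A|] ==> (%z. ract VW t (F z)) : lin_maps k P ?T" for t x and E :: "'p \<Rightarrow> ('v \<times> 'w \<Rightarrow> 'k) set" and F and P :: "('k, 'p) module"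
  by (rule bilin_closed[OF R] lin_comp[OF bilin_maps_left[OF R]] lin_comp[OF bilin_maps_right[OF R]]; assumption)+
 have rr2: "[|E : lin_maps k P ?T; x <: ?A|] ==> (%z. ract VW (E z) x) : lin_maps k P ?T"
   for x and E and P :: "('k, ('v \<times> 'w \<Rightarrow> 'k) set) module"
  by (rule lin_comp[OF bilin_maps_left[OF R]])
 have cl: "coact VW t <: tensor k ?T ?A" if "t <: ?T" for t by (rule lin_closed[OF L that])
 have co_lin': "(%t. Co U VW t \<beta>) : lin_maps k ?T U" if "module k U" "\<beta> : bilin_maps k ?T ?A U" for U :: "('k, 'p) module" and \<beta>
  by (rule lin_tsum_tensor[OF yd_tensor_mod alg_module[OF X X] L that])
 show ?thesis
 proof (rule yd_moduleI_same[OF X yd_tensor_same yd_tensor_mod R], unfold Let_def)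
  show "coact VW : lin_maps k ?T (tensor k ?T ?A)" by (rule L)
  fix t assume t: "t <: ?T"
  show "ract VW t \<one>[?A] = t"
  proof (rule lin_tensor_eq[OF mods yd_tensor_mod _ lin_id _ t])
   show "ract VW (pure k V W v w) \<one>[?A] = pure k V W v w" if m: "v <: V" "w <: W" for v w
   proof -
    have "ract VW (pure k V W v w) \<one>[?A] = pure k V W (ract V v \<one>[?A]) (ract W w \<one>[?A])"
     by (subst yd_tensor_ract_pure[OF m], intro tr, rule sw_one) (assumption|intro tr m)+
    then show ?thesis using yd_module.ract_one[OF V m(1)] yd_module.ract_one[OF W m(2)] by simp
   qed
  qed (rule bilin_maps_left[OF R], intro tr)
  show "ract VW t (mm X X x y) = ract VW (ract VW t x) y" if x: "x <: ?A" "y <: ?A" for x y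
  proof (rule lin_tensor_eq[OF mods yd_tensor_mod _ _ _ t])
   show "(%t. ract VW t (mm X X x y)) : lin_maps k ?T ?T" by (rule bilin_maps_left[OF R], intro tr x)
   show "(%t. ract VW (ract VW t x) y) : lin_maps k ?T ?T"
    by (rule lin_comp[OF bilin_maps_left[OF R x(2)] bilin_maps_left[OF R x(1)]])
   fix v w assume m: "v <: V" "w <: W"
   have "ract VW (pure k V W v w) (mm X X x y) = Sw2 ?T X X X (mm X X x y) (%x1 x2. pure k V W (ract V v x1) (ract W w x2))"
    by (rule yd_tensor_ract_pure[OF m]) (intro tr x)
   also have "... = Sw2 ?T X X X x (%x1 x2. Sw2 ?T X X X y (%y1 y2. pure k V W (ract V v (mm X X x1 y1)) (ract W w (mm X X x2 y2))))"
    by (rule sw_mult) (assumption|intro tr m x)+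
   also have "... = Sw2 ?T X X X x (%x1 x2. ract VW (pure k V W (ract V v x1) (ract W w x2)) y)"
   proof (rule sw_cong, (intro tr x)+)
    fix x1 x2 assume n: "x1 <: ?A" "x2 <: ?A"
    have "Sw2 ?T X X X y (%y1 y2. pure k V W (ract V v (mm X X x1 y1)) (ract W w (mm X X x2 y2))) =
     Sw2 ?T X X X y (%y1 y2. pure k V W (ract V (ract V v x1) y1) (ract W (ract W w x2) y2))"
     using yd_module.ract_mult[OF V m(1)] yd_module.ract_mult[OF W m(2)] n by (intro sw_cong X x) simp
    also have "... = ract VW (pure k V W (ract V v x1) (ract W w x2)) y"
     by (rule yd_tensor_ract_pure[symmetric]) (intro tr m n x)+
    finally show "Sw2 ?T X X X y (%y1 y2. pure k V W (ract V v (mm X X x1 y1)) (ract W w (mm X X x2 y2))) = ..." .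
   qed
   also have "... = ract VW (Sw2 ?T X X X x (%x1 x2. pure k V W (ract V v x1) (ract W w x2))) y"
    by (rule lin_tsum[of k ?A ?A, symmetric]) (assumption | rule bilin_maps_left[OF R] | intro tr m x)+
   finally show "ract VW (pure k V W v w) (mm X X x y) = ract VW (ract VW (pure k V W v w) x) y"
    by (simp only: yd_tensor_ract_pure[OF m x(1)])
  qed
  let ?U = "tensor k ?T (tensor k ?A ?A)"
  have U: "module k ?U" by (intro tr)
  let ?P = "%p g h. pure k ?T (tensor k ?A ?A) p (pure k ?A ?A g h)"
  show "Co ?U VW t (%p h. Co ?U VW p (%v0 g. ?P v0 g h)) = Co ?U VW t (%v0 q. Sw2 ?U X X X q (?P v0))"
  proof (rule lin_tensor_eq[OF mods U _ _ _ t])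
   have b1: "(%p h. Co ?U VW p (%v0 g. ?P v0 g h)) : bilin_maps k ?T ?A ?U"
    by (rule bilin_mapsI, rule lin_tsum_arg[OF yd_tensor_mod alg_module[OF X X] cl U])
     (assumption | rule lin_tsum_tensor[OF yd_tensor_mod alg_module[OF X X] L U] | intro tr)+
   have b2: "(%v0 q. Sw2 ?U X X X q (?P v0)) : bilin_maps k ?T ?A ?U"
    by (assumption|intro tr)+
   show "(%t. Co ?U VW t (%p h. Co ?U VW p (%v0 g. ?P v0 g h))) : lin_maps k ?T ?U"
    by (rule lin_tsum_tensor[OF yd_tensor_mod alg_module[OF X X] L U b1])
   show "(%t. Co ?U VW t (%v0 q. Sw2 ?U X X X q (?P v0))) : lin_maps k ?T ?U"
    by (rule lin_tsum_tensor[OF yd_tensor_mod alg_module[OF X X] L U b2])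
   fix v w assume m: "v <: V" "w <: W"
   let ?G = "%v w g' h' g h. ?P (pure k V W v w) (mm X X g' h') (mm X X g h)"
   have "Co ?U VW (pure k V W v w) (%p h. Co ?U VW p (%v0 g. ?P v0 g h)) =
    Co ?U V v (%v0 g. Co ?U W w (%w0 h. Co ?U VW (pure k V W v0 w0) (%u g'. ?P u g' (mm X X g h))))"
    by (rule yd_tensor_co[OF m U b1])
   also have "... = Co ?U V v (%v0 g. Co ?U W w (%w0 h. Co ?U V v0 (%v1 g'. Co ?U W w0 (%w1 h'. ?G v1 w1 g' h' g h))))"
    by (rule co_cong[OF X V m(1)], rule co_cong[OF X W m(2)], rule yd_tensor_co) (assumption|intro tr m)+
   also have "... = Co ?U V v (%v0 g. Co ?U V v0 (%v1 g'. Co ?U W w (%w0 h. Co ?U W w0 (%w1 h'. ?G v1 w1 g' h' g h))))"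
    by (rule co_cong[OF X V m(1)], rule co_co_swap[OF X X W V]) (assumption|intro tr m)+
   also have "... = Co ?U V v (%v0 g. Co ?U V v0 (%v1 g'. Co ?U W w (%w0 r. Sw2 ?U X X X r (%h' h. ?G v1 w0 g' h' g h))))"
    by (rule co_cong[OF X V m(1)], rule co_cong[OF X V], assumption, rule co_coassoc[OF X W m(2)]) (assumption|intro tr m)+
   also have "... = Co ?U V v (%v0 q. Sw2 ?U X X X q (%g' g. Co ?U W w (%w0 r. Sw2 ?U X X X r (%h' h. ?G v0 w0 g' h' g h))))"
    by (rule co_coassoc[OF X V m(1)]) (assumption|intro tr m)+
   also have "... = Co ?U V v (%v0 q. Co ?U W w (%w0 r. Sw2 ?U X X X q (%g' g. Sw2 ?U X X X r (%h' h. ?G v0 w0 g' h' g h))))"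
    by (rule co_cong[OF X V m(1)], rule co_sw_swap[OF X W, symmetric]) (assumption|intro tr m)+
   also have "... = Co ?U V v (%v0 q. Co ?U W w (%w0 r. Sw2 ?U X X X (mm X X q r) (?P (pure k V W v0 w0))))"
    by (rule co_cong[OF X V m(1)], rule co_cong[OF X W m(2)], rule sw_mult[symmetric]) (assumption|intro tr m)+
   also have "... = Co ?U VW (pure k V W v w) (%v0 q. Sw2 ?U X X X q (?P v0))"
    by (rule yd_tensor_co[OF m U b2, symmetric])
   finally show "Co ?U VW (pure k V W v w) (%p h. Co ?U VW p (%v0 g. ?P v0 g h)) = ..." .
  qed
  show "Co ?T VW t (%v0 h. coun C X h *[?T] v0) = t"
  proof (rule lin_tensor_eq[OF mods yd_tensor_mod _ lin_id _ t])
   have b: "(%v0 h. coun C X h *[?T] v0) : bilin_maps k ?T ?A ?T" by (assumption|intro tr)+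
   show "(%t. Co ?T VW t (%v0 h. coun C X h *[?T] v0)) : lin_maps k ?T ?T"
    by (rule lin_tsum_tensor[OF yd_tensor_mod alg_module[OF X X] L yd_tensor_mod b])
   fix v w assume m: "v <: V" "w <: W"
   have "Co ?T VW (pure k V W v w) (%v0 h. coun C X h *[?T] v0) =
    Co ?T V v (%v0 g. Co ?T W w (%w0 h. coun C X (mm X X g h) *[?T] pure k V W v0 w0))"
    by (rule yd_tensor_co[OF m yd_tensor_mod b])
   also have "... = Co ?T V v (%v0 g. Co ?T W w (%w0 h. coun C X h *[?T] (coun C X g *[?T] pure k V W v0 w0)))"
    by (rule co_cong[OF X V m(1)], rule co_cong[OF X W m(2)]) (simp add: X coun_mult smult_smult(2)[OF yd_tensor_mod] coun_closed pure_closed[OF mods])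
   also have "... = Co ?T V v (%v0 g. coun C X g *[?T] pure k V W v0 w)"
    by (rule co_cong[OF X V m(1)], rule co_counit[OF X W m(2)]) (assumption|intro tr m)+
   also have "... = pure k V W v w"
    by (rule co_counit[OF X V m(1)]) (assumption|intro tr m)+
   finally show "Co ?T VW (pure k V W v w) (%v0 h. coun C X h *[?T] v0) = pure k V W v w" .
  qed
  fix x assume x: "x <: ?A"
  let ?U = "tensor k ?T ?A" and ?S = "anti C X X"
  have U: "module k ?U" by (intro tr)
  let ?F = "%t0 h x1 x2 x3. pure k ?T ?A (ract VW t0 x2) (mm X X (mm X X (?S x1) h) x3)"
  show "coact VW (ract VW t x) = Co ?U VW t (%t0 h. Sw3 ?U X X X X x (?F t0 h))"
  proof (rule lin_tensor_eq[OF mods U _ _ _ t])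
   have b: "(%t0 h. Sw3 ?U X X X X x (?F t0 h)) : bilin_maps k ?T ?A ?U"
    by (assumption|intro tr x | rule rr2 rr lin_comp[OF bilin_maps_right[OF R]])+
   show "(%t. coact VW (ract VW t x)) : lin_maps k ?T ?U" by (rule lin_comp[OF L bilin_maps_left[OF R x]])
   show "(%t. Co ?U VW t (%t0 h. Sw3 ?U X X X X x (?F t0 h))) : lin_maps k ?T ?U"
    by (rule lin_tsum_tensor[OF yd_tensor_mod alg_module[OF X X] L U b])
   fix v w assume m: "v <: V" "w <: W"
   let ?P = "%p q z. pure k ?T ?A (pure k V W p q) z"
   let ?Q = "%v0 w0 g h a b y e f. ?P (ract V v0 b) (ract W w0 e) (mm X X (mm X X (?S a) g) (mm X X y (mm X X h f)))"
   have "coact VW (ract VW (pure k V W v w) x) = Sw2 ?U X X X x (%x1 x2. coact VW (pure k V W (ract V v x1) (ract W w x2)))"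
    unfolding yd_tensor_ract_pure[OF m x]
    by (rule lin_tsum[of k ?A ?A]) (assumption | rule L | intro tr m x)+
   also have "... = Sw2 ?U X X X x (%x1 x2. Co ?U V (ract V v x1) (%p g. Co ?U W (ract W w x2) (%q h. ?P p q (mm X X g h))))"
    by (rule sw_cong, (intro tr x)+, subst yd_tensor_coact, (assumption|intro tr m)+, rule tsum_pure[OF mods]) (assumption|intro tr m)+
   also have "... = Sw2 ?U X X X x (%x1 x2. Co ?U W w (%w0 h. Co ?U V v (%v0 g.
     Sw3 ?U X X X X x1 (%a b c. Sw3 ?U X X X X x2 (%d e f. ?Q v0 w0 g h a b (mm X X c (?S d)) e f)))))"
   proof (rule sw_cong, (intro tr x)+)
    fix x1 x2 assume n: "x1 <: ?A" "x2 <: ?A"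
    have "Co ?U V (ract V v x1) (%p g. Co ?U W (ract W w x2) (%q h. ?P p q (mm X X g h))) =
     Co ?U V (ract V v x1) (%p g. Co ?U W w (%w0 h. Sw3 ?U X X X X x2 (%d e f. ?P p (ract W w0 e) (mm X X g (mm X X (mm X X (?S d) h) f)))))"
     by (rule co_cong[OF X V], intro tr m n, rule co_ract[OF X W]) (assumption|intro tr m n)+
    also have "... = Co ?U W w (%w0 h. Co ?U V (ract V v x1) (%p g. Sw3 ?U X X X X x2 (%d e f. ?P p (ract W w0 e) (mm X X g (mm X X (mm X X (?S d) h) f)))))"
     by (rule co_co_swap[OF X X V W]) (assumption|intro tr m n)+
    also have "... = Co ?U W w (%w0 h. Co ?U V v (%v0 g. Sw3 ?U X X X X x1 (%a b c. Sw3 ?U X X X X x2 (%d e f.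
      ?P (ract V v0 b) (ract W w0 e) (mm X X (mm X X (mm X X (?S a) g) c) (mm X X (mm X X (?S d) h) f))))))"
     by (rule co_cong[OF X W m(2)], rule co_ract[OF X V]) (assumption|intro tr m n)+
    also have "... = Co ?U W w (%w0 h. Co ?U V v (%v0 g.
     Sw3 ?U X X X X x1 (%a b c. Sw3 ?U X X X X x2 (%d e f. ?Q v0 w0 g h a b (mm X X c (?S d)) e f))))"
     by (rule co_cong[OF X W m(2)], rule co_cong[OF X V m(1)], rule sw_cong, (intro X n)+, rule sw_cong, (assumption|intro X)+,
       rule sw_cong, (intro X n)+, rule sw_cong, (assumption|intro X)+) (simp add: alg_simps X)
    finally show "Co ?U V (ract V v x1) (%p g. Co ?U W (ract W w x2) (%q h. ?P p q (mm X X g h))) = ..." .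
   qed
   also have "... = Co ?U W w (%w0 h. Sw2 ?U X X X x (%x1 x2. Co ?U V v (%v0 g.
     Sw3 ?U X X X X x1 (%a b c. Sw3 ?U X X X X x2 (%d e f. ?Q v0 w0 g h a b (mm X X c (?S d)) e f)))))"
    by (rule co_sw_swap[OF X W, symmetric]) (assumption|intro tr m x)+
   also have "... = Co ?U W w (%w0 h. Co ?U V v (%v0 g. Sw2 ?U X X X x (%x1 x2.
     Sw3 ?U X X X X x1 (%a b c. Sw3 ?U X X X X x2 (%d e f. ?Q v0 w0 g h a b (mm X X c (?S d)) e f)))))"
    by (rule co_cong[OF X W m(2)], rule co_sw_swap[OF X V, symmetric]) (assumption|intro tr m x)+
   also have "... = Co ?U W w (%w0 h. Co ?U V v (%v0 g. Sw4 ?U X X X X X x (%a b e f. ?Q v0 w0 g h a b \<one>[?A] e f)))"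
   proof (rule co_cong[OF X W m(2)], rule co_cong[OF X V m(1)])
    fix w0 h v0 g assume n: "w0 <: W" "h <: ?A" "v0 <: V" "g <: ?A"
    show "Sw2 ?U X X X x (%x1 x2. Sw3 ?U X X X X x1 (%a b c. Sw3 ?U X X X X x2 (%d e f. ?Q v0 w0 g h a b (mm X X c (?S d)) e f))) =
     Sw4 ?U X X X X X x (%a b e f. ?Q v0 w0 g h a b \<one>[?A] e f)"
     by (rule sw_adjoint_cancel[where \<beta> = "?Q v0 w0 g h"]) (assumption|intro tr n x)+
   qed
   also have "... = Co ?U V v (%v0 g. Co ?U W w (%w0 h. Sw4 ?U X X X X X x (%a b e f. ?Q v0 w0 g h a b \<one>[?A] e f)))"
    by (rule co_co_swap[OF X X W V]) (assumption|intro tr m x)+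
   also have "... = Co ?U V v (%v0 g. Co ?U W w (%w0 h. Sw3 ?U X X X X x (?F (pure k V W v0 w0) (mm X X g h))))"
   proof (rule co_cong[OF X V m(1)], rule co_cong[OF X W m(2)])
    fix v0 g w0 h assume n: "w0 <: W" "h <: ?A" "v0 <: V" "g <: ?A"
    let ?N = "%x1 b e x3. ?P (ract V v0 b) (ract W w0 e) (mm X X (mm X X (?S x1) (mm X X g h)) x3)"
    have "Sw3 ?U X X X X x (?F (pure k V W v0 w0) (mm X X g h)) = Sw3 ?U X X X X x (%x1 x2 x3. Sw2 ?U X X X x2 (%b e. ?N x1 b e x3))"
    proof (rule sw_cong, (intro X x)+, rule sw_cong, (assumption|intro X)+)
     fix x1 r x2 x3 assume o: "x1 <: ?A" "x2 <: ?A" "x3 <: ?A"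
     show "?F (pure k V W v0 w0) (mm X X g h) x1 x2 x3 = Sw2 ?U X X X x2 (%b e. ?N x1 b e x3)"
      unfolding yd_tensor_ract_pure[OF n(3,1) o(2)]
      by (rule lin_tsum[of k ?A ?A]) (assumption|intro tr n o)+
    qed
    also have "... = Sw2 ?U X X X x (%x1 r. Sw3 ?U X X X X r (?N x1))"
     by (rule sw_cong, (intro X x)+, rule sw_coassoc) (assumption|intro tr n)+
    also have "... = Sw4 ?U X X X X X x (%a b e f. ?Q v0 w0 g h a b \<one>[?A] e f)"
     by (rule sw_cong, (intro X x)+, rule sw_cong, (assumption|intro X)+, rule sw_cong, (assumption|intro X)+)
      (simp add: alg_simps X n)
    finally show "Sw4 ?U X X X X X x (%a b e f. ?Q v0 w0 g h a b \<one>[?A] e f) = Sw3 ?U X X X X x (?F (pure k V W v0 w0) (mm X X g h))" by simp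
   qed
   also have "... = Co ?U VW (pure k V W v w) (%t0 h. Sw3 ?U X X X X x (?F t0 h))"
    by (rule yd_tensor_co[OF m U b, symmetric])
   finally show "coact VW (ract VW (pure k V W v w) x) = ..." .
  qed
 qed
qed

end

end

section \<open>Transport to the universe\<close>

lemma lepoll_card: "A \<lesssim> B \<longleftrightarrow> |A| \<le>o |B|"
 by (simp add: lepoll_def card_of_ordLeq)

text \<open>A tensor is determined by a finitely supported function, hence by a finite set of pairs and coefficients, and an
 infinite type has as many finite subsets as elements.\<close>

lemma tensor_lepoll:
 assumes inf: "infinite (UNIV :: 'u set)" and k: "carrier k \<lesssim> (UNIV :: 'u set)"
  and V: "carrier V \<lesssim> (UNIV :: 'u set)" and W: "carrier W \<lesssim> (UNIV :: 'u set)"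
  and mV: "module k V" and mW: "module k W"
 shows "carrier (tensor k V W) \<lesssim> (UNIV :: 'u set)"
proof -
 let ?S = "carrier V \<times> carrier W" let ?F = "{f. f ` ?S \<subseteq> carrier k \<and> {x. f x \<noteq> \<zero>[k]} \<subseteq> ?S \<and> finite {x. f x \<noteq> \<zero>[k]}}"
 note e = tensor_elem[OF mV mW]
 have "inj_on (%t. SOME f. f \<in> t) (carrier (tensor k V W))"
 proof (rule inj_onI)
  fix s t assume st: "s <: tensor k V W" "t <: tensor k V W" "(SOME f. f \<in> s) = (SOME f. f \<in> t)"
  then show "s = t" using e(3)[OF st(1) e(1)[OF st(1)]] e(3)[OF st(2) e(1)[OF st(2)]] by simp
 qed
 moreover have "(%t. SOME f. f \<in> t) ` carrier (tensor k V W) \<subseteq> ?F"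
  using e(2)[OF _ e(1)] by (auto simp: free_space_carrier)
 ultimately have "carrier (tensor k V W) \<lesssim> ?F" unfolding lepoll_def by blast
 also have "?F \<lesssim> Fpow (?S \<times> carrier k)" using lepoll_restricted_funspace[of ?S "carrier k" "%_. \<zero>[k]"] by simp
 also have "Fpow (?S \<times> carrier k) \<lesssim> (UNIV :: 'u set)"
 proof -
  have t: "|A \<times> B| \<le>o |UNIV :: 'u set|" if "|A| \<le>o |UNIV :: 'u set|" "|B| \<le>o |UNIV :: 'u set|" for A :: "'p set" and B :: "'q set"
   using card_of_Times_ordLeq_infinite_Field[of "|UNIV :: 'u set|" A B] inf that by (simp add: Field_card_of)
  have "|?S \<times> carrier k| \<le>o |UNIV :: 'u set|" using t t k V W unfolding lepoll_card by blast
  then obtain g where g: "inj_on g (?S \<times> carrier k)" "g ` (?S \<times> carrier k) \<subseteq> (UNIV :: 'u set)"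
   unfolding card_of_ordLeq[symmetric] by blast
  have "inj_on (image g) (Fpow (?S \<times> carrier k))"
   by (rule inj_on_subset[OF inj_on_image_Pow[OF g(1)]]) (auto simp: Fpow_def)
  moreover have "image g ` Fpow (?S \<times> carrier k) \<subseteq> Fpow (UNIV :: 'u set)" by (auto simp: Fpow_def)
  ultimately have "|Fpow (?S \<times> carrier k)| \<le>o |Fpow (UNIV :: 'u set)|" unfolding card_of_ordLeq[symmetric] by blast
  moreover have "|Fpow (UNIV :: 'u set)| =o |UNIV :: 'u set|" by (rule card_of_Fpow_infinite[OF inf])
  ultimately show ?thesis unfolding lepoll_card by (rule ordLeq_ordIso_trans)
 qed
 finally show ?thesis .
qed

context cogroupoid
begin

lemma yd_mapsI:
 assumes X: "X : ob C" and V: "YDm X V" and W: "YDm X W" and f: "f : lin_maps k V W"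
  and r: "!!v x. [|v <: V; x <: alg C X X|] ==> f (ract V v x) = ract W (f v) x"
  and c: "!!v. v <: V ==> coact W (f v) = Co (tensor k W (alg C X X)) V v (%v0 h. pure k W (alg C X X) (f v0) h)"
 shows "f : yd_maps k (hopf_at C X) V W"
proof -
 have "tensor_map k W (alg C X X) f (%x. x) (coact V v) = Co (tensor k W (alg C X X)) V v (%v0 h. pure k W (alg C X X) (f v0) h)"
  if "v <: V" for v
  by (rule tensor_map_eq[of k V "alg C X X"]) (intro yd_mlin[OF X V] yd_mlin[OF X W] mlin X that f)+
 then show ?thesis using f r c by (simp add: yd_maps_def)
qed

lemma yd_maps_lin: "f : yd_maps k H V W ==> f : lin_maps k V W"
 by (simp add: yd_maps_def)

lemma yd_maps_ract: "[|f : yd_maps k (hopf_at C X) V W; v <: V; x <: alg C X X|] ==> f (ract V v x) = ract W (f v) x"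
 by (simp add: yd_maps_def)

lemma yd_maps_co:
 assumes X: "X : ob C" and V: "YDm X V" and W: "YDm X W" and f: "f : yd_maps k (hopf_at C X) V W" and v: "v <: V"
  and U: "module k U" and \<beta>: "\<beta> : bilin_maps k W (alg C X X) U"
 shows "Co U W (f v) \<beta> = Co U V v (%v0 h. \<beta> (f v0) h)"
proof -
 have "coact W (f v) = tensor_map k W (alg C X X) f (%x. x) (coact V v)" using f v by (simp add: yd_maps_def)
 then show ?thesis
  using tsum_tensor_map[OF yd_mod[OF X V] alg_module[OF X X] yd_mod[OF X W] alg_module[OF X X] U yd_maps_lin[OF f] lin_id coact_mlin(1)[OF X V v] \<beta>]
  by simp
qed

text \<open>With this, colinearity of a map is checked by evaluating coactions against bilinear maps.\<close>

lemma co_pure: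
 assumes X: "X : ob C" and W: "YDm X W" and w: "w <: W"
 shows "Co (tensor k W (alg C X X)) W w (pure k W (alg C X X)) = coact W w"
 by (rule tsum_self[OF yd_mod[OF X W] alg_module[OF X X] coact_mlin(1)[OF X W w]])

lemma yd_maps_cong:
 assumes X: "X : ob C" and V: "YDm X V" and W: "YDm X W" and f: "f : yd_maps k (hopf_at C X) V W"
  and e: "!!v. v <: V ==> g v = f v"
 shows "g : yd_maps k (hopf_at C X) V W"
proof (rule yd_mapsI[OF X V W])
 show "g : lin_maps k V W" by (rule lin_cong[OF yd_maps_lin[OF f] yd_mod[OF X V]]) (simp add: e)
 fix v assume v: "v <: V"
 show "g (ract V v x) = ract W (g v) x" if "x <: alg C X X" for x
  using yd_maps_ract[OF f v that] ract_mlin(1)[OF X V v that] v by (simp add: e)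
 have "coact W (g v) = Co (tensor k W (alg C X X)) W (f v) (pure k W (alg C X X))"
  using co_pure[OF X W lin_closed[OF yd_maps_lin[OF f] v]] v by (simp add: e)
 also have "... = Co (tensor k W (alg C X X)) V v (%v0 h. pure k W (alg C X X) (f v0) h)"
  by (rule yd_maps_co[OF X V W f v]) (assumption|intro yd_mlin[OF X W] mlin X)+
 also have "... = Co (tensor k W (alg C X X)) V v (%v0 h. pure k W (alg C X X) (g v0) h)"
  by (rule co_cong[OF X V v]) (simp add: e)
 finally show "coact W (g v) = ..." .
qed

lemma yd_maps_comp:
 assumes X: "X : ob C" and V: "YDm X V" and W: "YDm X W" and Z: "YDm X Z"
  and f: "f : yd_maps k (hopf_at C X) V W" and g: "g : yd_maps k (hopf_at C X) W Z"
 shows "(%v. g (f v)) : yd_maps k (hopf_at C X) V Z"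
proof (rule yd_mapsI[OF X V Z])
 note fl = yd_maps_lin[OF f] and gl = yd_maps_lin[OF g]
 show "(%v. g (f v)) : lin_maps k V Z" by (rule lin_comp[OF gl fl])
 fix v assume v: "v <: V"
 note fv = lin_closed[OF fl v]
 show "g (f (ract V v x)) = ract Z (g (f v)) x" if "x <: alg C X X" for x
  by (simp add: yd_maps_ract[OF f v that] yd_maps_ract[OF g fv that])
 let ?T = "tensor k Z (alg C X X)" and ?p = "pure k Z (alg C X X)"
 have "coact Z (g (f v)) = Co ?T Z (g (f v)) ?p" by (rule co_pure[OF X Z lin_closed[OF gl fv], symmetric])
 also have "... = Co ?T W (f v) (%w h. ?p (g w) h)"
  by (rule yd_maps_co[OF X W Z g fv]) (assumption|intro yd_mlin[OF X Z] mlin X)+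
 also have "... = Co ?T V v (%w h. ?p (g (f w)) h)"
  by (rule yd_maps_co[OF X V W f v]) (assumption|intro yd_mlin[OF X Z] mlin X gl lin_closed[OF gl])+
 finally show "coact Z (g (f v)) = ..." .
qed

text \<open>A bijective morphism is an isomorphism.\<close>

lemma yd_maps_inverse:
 assumes X: "X : ob C" and V: "YDm X V" and W: "YDm X W" and f: "f : yd_maps k (hopf_at C X) V W"
  and g: "!!w. w <: W ==> g w <: V" and gf: "!!v. v <: V ==> g (f v) = v" and fg: "!!w. w <: W ==> f (g w) = w"
 shows "g : yd_maps k (hopf_at C X) W V"
proof (rule yd_mapsI[OF X W V])
 interpret V: module k V by (rule yd_mod[OF X V])
 note fl = yd_maps_lin[OF f]
 show gl: "g : lin_maps k W V"
 proof (rule lin_mapsI)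
  show "g (x +[W] y) = g x +[V] g y" if "x <: W" "y <: W" for x y
   using gf[of "g x +[V] g y"] that by (simp add: lin_add[OF fl] g fg)
  show "g (c *[W] x) = c *[V] g x" if "c <: k" "x <: W" for c x
   using gf[of "c *[V] g x"] that by (simp add: lin_smult[OF fl] g fg)
 qed (rule g)
 fix w assume w: "w <: W"
 show "g (ract W w x) = ract V (g w) x" if "x <: alg C X X" for x
  using gf[OF ract_mlin(1)[OF X V g[OF w] that]] yd_maps_ract[OF f g[OF w] that] by (simp add: fg[OF w])
 let ?T = "tensor k V (alg C X X)" and ?p = "pure k V (alg C X X)"
 have "Co ?T W (f (g w)) (%v h. ?p (g v) h) = Co ?T V (g w) (%v h. ?p (g (f v)) h)"
  by (rule yd_maps_co[OF X V W f g[OF w]]) (assumption|intro yd_mlin[OF X V] mlin X gl g)+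
 also have "... = Co ?T V (g w) ?p" by (rule co_cong[OF X V g[OF w]]) (simp add: gf)
 also have "... = coact V (g w)" by (rule co_pure[OF X V g[OF w]])
 finally show "coact V (g w) = Co ?T W w (%v h. ?p (g v) h)" by (simp add: fg[OF w])
qed

subsection \<open>Packed Yetter--Drinfeld modules\<close>

context
 fixes X and M :: "('k, 'a, 'x) yd_data" and N :: "('k, 'a, 'u) yd_data"
 assumes X: "X : ob C" and M: "YDm X M" and sz: "carrier M \<lesssim> (UNIV :: 'u set)"
 defines "N \<equiv> pack k (hopf_at C X) M"
begin

abbreviation (input) "en \<equiv> enc M :: 'x \<Rightarrow> 'u"
abbreviation (input) "de \<equiv> dec M :: 'u \<Rightarrow> 'x"

lemma enc_inj: "inj_on en (carrier M)"
 using sz unfolding enc_def lepoll_def by (metis (mono_tags, lifting) someI)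

lemma dec_enc: "m <: M ==> de (en m) = m"
 unfolding dec_def by (rule inv_into_f_f[OF enc_inj])

lemma pack_simps:
 "carrier N = en ` carrier M" "\<zero>[N] = en \<zero>[M]" "x +[N] y = en (de x +[M] de y)" "c *[N] x = en (c *[M] de x)"
 "ract N x h = en (ract M (de x) h)"
 by (simp_all add: N_def pack_def Let_def module.defs yd_data.defs)

lemma pack_coact: "coact N x = tensor_map k N (alg C X X) en (%h. h) (coact M (de x))"
proof -
 let ?P = "\<lparr>carrier = en ` carrier M, mult = (%_ _. undefined), one = undefined,
       zero = en \<zero>[M], add = (%x y. en (de x +[M] de y)),
       smult = (%c x. en (c *[M] de x))\<rparr>"
 have s: "same_module ?P N" by (simp add: same_module_def pack_simps fun_eq_iff)
 have "coact N x = tensor_map k ?P (alg C X X) en (%h. h) (coact M (de x))"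
  by (simp add: N_def pack_def Let_def module.defs yd_data.defs)
 then show ?thesis by (simp only: tensor_map_def same_module_tensor[OF s same_module_refl])
qed

lemma dec_closed: "x <: N ==> de x <: M"
 and enc_dec: "x <: N ==> en (de x) = x"
 and enc_closed: "m <: M ==> en m <: N"
 by (auto simp: pack_simps dec_enc)

lemma pack_module: "module k N"
proof -
 interpret M: module k M by (rule yd_mod[OF X M])
 have "\<exists>y\<in>carrier M. en (y +[M] x) = en \<zero>[M]" if "x <: M" for x
  using that by (intro bexI[of _ "\<ominus>\<^bsub>M\<^esub> x"]) (auto simp: M.l_neg)
 then show ?thesis
  by (intro moduleI abelian_groupI M.cring_axioms)
   (auto simp: pack_simps dec_enc M.a_ac M.smult_l_distr M.smult_r_distr M.smult_assoc1)
qed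

lemma enc_lin: "en : lin_maps k M N"
 by (auto simp: lin_maps_def pack_simps dec_enc)

lemma dec_lin: "de : lin_maps k N M"
proof -
 interpret M: module k M by (rule yd_mod[OF X M])
 show ?thesis by (auto simp: lin_maps_def pack_simps dec_enc)
qed

lemma dec_mlin: "E : lin_maps k A N ==> (%z. de (E z)) : lin_maps k A M"
 and enc_mlin: "F : lin_maps k A M ==> (%z. en (F z)) : lin_maps k A N"
 by (rule lin_comp[OF dec_lin], assumption) (rule lin_comp[OF enc_lin])

lemmas pk = yd_mlin[OF X M] mlin X pack_module dec_mlin enc_mlin dec_closed enc_closed

lemma pack_co:
 assumes x: "x <: N" and U: "module k U" and \<beta>: "\<beta> : bilin_maps k N (alg C X X) U"
 shows "Co U N x \<beta> = Co U M (de x) (%m h. \<beta> (en m) h)"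
 unfolding pack_coact
 by (rule tsum_tensor_map[OF yd_mod[OF X M] alg_module[OF X X] pack_module alg_module[OF X X] U enc_lin lin_id _ \<beta>]) (intro pk x)

lemma pack_coact_lin: "coact N : lin_maps k N (tensor k N (alg C X X))"
 by (rule lin_cong[OF _ pack_module pack_coact[symmetric]],
   rule lin_comp[OF tensor_map_lin[OF yd_mod[OF X M] alg_module[OF X X] pack_module alg_module[OF X X] enc_lin lin_id]]) (intro pk)

lemma pack_yd: "YDm X N"
proof (rule yd_moduleI[OF X pack_module], unfold Let_def)
 let ?A = "alg C X X"
 have "(%x h. en (ract M (de x) h)) : bilin_maps k N ?A N" by (assumption|intro pk)+
 then show "ract N : bilin_maps k N ?A N" by (simp add: pack_simps(5)[abs_def])
 show cl: "coact N : lin_maps k N (tensor k N ?A)" by (rule pack_coact_lin)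
 have cc: "coact N x <: tensor k N ?A" if "x <: N" for x by (rule lin_closed[OF cl that])
 have col: "(%z. Co U N (E z) \<beta>) : lin_maps k B U" if "module k U" "E : lin_maps k B N" "\<beta> : bilin_maps k N ?A U"
  for U :: "('k, 'y) module" and E and \<beta> and B :: "('k, 'u, 'z) module_scheme"
  by (rule lin_tsum_tensor[OF pack_module alg_module[OF X X] lin_comp[OF cl that(2)] that(1,3)])
 fix v assume v: "v <: N"
 note d = dec_closed[OF v]
 show "ract N v \<one>[?A] = v" using yd_module.ract_one[OF M d] by (simp add: pack_simps enc_dec[OF v])
 show "ract N v (mm X X x y) = ract N (ract N v x) y" if "x <: ?A" "y <: ?A" for x y
  using yd_module.ract_mult[OF M d] that by (simp add: pack_simps dec_enc ract_mlin(1)[OF X M d])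
 let ?T = "tensor k N (tensor k ?A ?A)" let ?P = "%p g h. pure k N (tensor k ?A ?A) p (pure k ?A ?A g h)"
 have T: "module k ?T" by (intro pk)
 have b: "(%p h. Co ?T N p (%v0 g. ?P v0 g h)) : bilin_maps k N ?A ?T"
  by (rule bilin_mapsI, rule lin_tsum_arg[OF pack_module alg_module[OF X X] cc T]) (assumption|intro pk | rule col[OF T])+
 have "Co ?T N v (%p h. Co ?T N p (%v0 g. ?P v0 g h)) = Co ?T M (de v) (%p h. Co ?T N (en p) (%v0 g. ?P v0 g h))"
  by (rule pack_co[OF v T b])
 also have "... = Co ?T M (de v) (%p h. Co ?T M p (%v0 g. ?P (en v0) g h))"
  by (rule co_cong[OF X M d], subst pack_co) (assumption | rule T | intro pk | simp only: dec_enc)+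
 also have "... = Co ?T M (de v) (%v0 q. Sw2 ?T X X X q (%g h. ?P (en v0) g h))"
  by (rule co_coassoc[OF X M d]) (assumption|intro pk)+
 also have "... = Co ?T N v (%v0 q. Sw2 ?T X X X q (%g h. ?P v0 g h))"
  by (rule pack_co[OF v T, symmetric]) (assumption|intro pk)+
 finally show "Co ?T N v (%p h. Co ?T N p (%v0 g. ?P v0 g h)) = ..." .
 have "Co N N v (%v0 h. coun C X h *[N] v0) = Co N M (de v) (%v0 h. coun C X h *[N] en v0)"
  by (rule pack_co[OF v pack_module]) (assumption|intro pk)+
 also have "... = en (de v)" by (rule co_counit[OF X M d]) (intro pk)+
 finally show "Co N N v (%v0 h. coun C X h *[N] v0) = v" by (simp add: enc_dec[OF v])
 fix x assume x: "x <: ?A"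
 let ?T = "tensor k N ?A" and ?S = "anti C X X"
 have T: "module k ?T" by (intro pk)
 have "coact N (ract N v x) = Co ?T N (ract N v x) (pure k N ?A)"
  by (rule tsum_self[OF pack_module alg_module[OF X X] cc, symmetric]) (simp only: pack_simps(5), intro pk v x)
 also have "... = Co ?T M (ract M (de v) x) (%m h. pure k N ?A (en m) h)"
  by (subst pack_co) (assumption | rule refl T | simp only: pack_simps(5) dec_enc ract_mlin(1)[OF X M d x] | intro pk v x)+
 also have "... = Co ?T M (de v) (%v0 h. Sw3 ?T X X X X x (%x1 x2 x3. pure k N ?A (en (ract M v0 x2)) (mm X X (mm X X (?S x1) h) x3)))"
  by (rule co_ract[OF X M d x]) (assumption|intro pk)+
 also have "... = Co ?T M (de v) (%v0 h. Sw3 ?T X X X X x (%x1 x2 x3. pure k N ?A (ract N (en v0) x2) (mm X X (mm X X (?S x1) h) x3)))"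
  by (rule co_cong[OF X M d]) (simp add: pack_simps(5) dec_enc)
 also have "... = Co ?T N v (%v0 h. Sw3 ?T X X X X x (%x1 x2 x3. pure k N ?A (ract N v0 x2) (mm X X (mm X X (?S x1) h) x3)))"
  by (rule pack_co[OF v T, symmetric], unfold pack_simps(5)) (assumption|intro pk x)+
 finally show "coact N (ract N v x) = ..." .
qed

lemma enc_yd_map: "en : yd_maps k (hopf_at C X) M N"
proof (rule yd_mapsI[OF X M pack_yd enc_lin])
 fix m assume m: "m <: M"
 show "en (ract M m x) = ract N (en m) x" for x by (simp add: pack_simps dec_enc m)
 have "coact N (en m) = Co (tensor k N (alg C X X)) N (en m) (pure k N (alg C X X))"
  by (rule co_pure[OF X pack_yd enc_closed[OF m], symmetric])
 also have "... = Co (tensor k N (alg C X X)) M m (%v0 h. pure k N (alg C X X) (en v0) h)"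
  by (subst pack_co) (assumption | rule refl | simp only: dec_enc[OF m] | intro pk m)+
 finally show "coact N (en m) = ..." .
qed

lemma dec_yd_map: "de : yd_maps k (hopf_at C X) N M"
 by (rule yd_maps_inverse[OF X M pack_yd enc_yd_map dec_closed dec_enc enc_dec])

end

end

section \<open>The monoidal category of Yetter--Drinfeld modules\<close>

text \<open>The conditions under which tensor and cotensor products fit into the universe.\<close>

locale cogroupoid_universe = cogroupoid k C
 for k :: "('k, 'r) ring_scheme" and C :: "('k, 'a, 'o) cogroupoid_data" +
 fixes univ :: "'u itself"
 assumes base_field: "field k" and infinite_univ: "infinite (UNIV :: 'u set)"
  and base_lepoll: "carrier k \<lesssim> (UNIV :: 'u set)"
  and alg_lepoll: "[|X : ob C; Y : ob C|] ==> carrier (alg C X Y) \<lesssim> (UNIV :: 'u set)"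
begin

lemma univ_lepoll: "(A :: 'u set) \<lesssim> (UNIV :: 'u set)"
 by (rule subset_imp_lepoll) simp

lemma compose_lin: "[|f : lin_maps k V W; g : lin_maps k W Z; module k V|] ==> compose (carrier V) g f : lin_maps k V Z"
 by (rule lin_cong[OF lin_comp[of g k W Z f V]]) (auto simp: compose_def)

lemma restrict_lin: "[|f : lin_maps k V W; module k V|] ==> restrict f (carrier V) : lin_maps k V W"
 by (rule lin_cong) auto

lemma lin_ext_eq:
 assumes "f \<in> extensional (carrier V)" "g \<in> extensional (carrier V)" "!!x. x <: V ==> f x = g x"
 shows "f = g"
 using assms by (metis extensionalityI)

context
 fixes X assumes X: "X : ob C"
begin

abbreviation (input) "H \<equiv> hopf_at C X"
abbreviation (input) "A \<equiv> alg C X X"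
abbreviation (input) Ob :: "('k, 'a, 'u) yd_data \<Rightarrow> bool" where "Ob V \<equiv> yd_module k H V"
abbreviation (input) TO :: "('k, 'a, 'u) yd_data \<Rightarrow> ('k, 'a, 'u) yd_data \<Rightarrow> ('k, 'a, 'u) yd_data" where "TO \<equiv> yd_tobj k H"
abbreviation (input) P :: "('k, 'a, 'u) yd_data \<Rightarrow> ('k, 'a, 'u) yd_data \<Rightarrow> 'u \<Rightarrow> 'u \<Rightarrow> 'u" where "P \<equiv> yd_pure k H"
abbreviation (input) D :: "('k, ('k, 'a, 'u) yd_data, 'u \<Rightarrow> 'u) moncat_data" where "D \<equiv> YD k H"
abbreviation (input) I0 :: "('k, 'a, 'u) yd_data" where "I0 \<equiv> yd_tunit k H"

lemma Ob_mod [mlin]: "Ob V ==> module k V" by (rule yd_mod[OF X])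

context
 fixes V W :: "('k, 'a, 'u) yd_data"
 assumes V: "Ob V" and W: "Ob W"
begin

lemma tob_size: "carrier (yd_tensor k H V W) \<lesssim> (UNIV :: 'u set)"
 using tensor_lepoll[OF infinite_univ base_lepoll univ_lepoll univ_lepoll Ob_mod[OF V] Ob_mod[OF W]]
  yd_tensor_same[OF X V W] by (simp add: same_module_def)

lemmas pkV = X yd_tensor_yd[OF X V W] tob_size

lemma tob_yd: "Ob (TO V W)"
 unfolding yd_tobj_def by (rule pack_yd[OF pkV])

lemma tob_enc_lin: "enc (yd_tensor k H V W) : lin_maps k (tensor k V W) (TO V W)"
 using enc_lin[OF pkV] by (simp add: yd_tobj_def same_module_lin_maps[OF yd_tensor_same[OF X V W] same_module_refl])

lemma tob_dec_lin: "dec (yd_tensor k H V W) : lin_maps k (TO V W) (tensor k V W)"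
 using dec_lin[OF pkV] by (simp add: yd_tobj_def same_module_lin_maps[OF same_module_refl yd_tensor_same[OF X V W]])

lemma tob_dec_enc: "t <: tensor k V W ==> dec (yd_tensor k H V W) (enc (yd_tensor k H V W) t :: 'u) = t"
 using dec_enc[OF pkV] yd_tensor_same[OF X V W] by (simp add: same_module_def)

lemma tob_enc_dec: "x <: TO V W ==> enc (yd_tensor k H V W) (dec (yd_tensor k H V W) x) = x"
 using enc_dec[OF pkV] by (simp add: yd_tobj_def)

lemma tp_mlin:
 "[|v <: V; w <: W|] ==> P V W v w <: TO V W"
 "[|E : lin_maps k B V; w <: W|] ==> (%z. P V W (E z) w) : lin_maps k B (TO V W)"
 "[|E : lin_maps k B W; v <: V|] ==> (%z. P V W v (E z)) : lin_maps k B (TO V W)"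
 unfolding yd_pure_def
 by (rule lin_closed[OF tob_enc_lin] lin_comp[OF tob_enc_lin], intro mlin V W; assumption)+

lemma tsw_eq:
 "[|x <: TO V W; module k U; \<beta> : bilin_maps k V W U|] ==>
  yd_sweedler k H V W U x \<beta> = tsum k U (dec (yd_tensor k H V W) x) \<beta>"
 unfolding yd_sweedler_def by (rule sweedler_eq_tsum[OF Ob_mod[OF V] Ob_mod[OF W] lin_closed[OF tob_dec_lin]])

lemma tsw_lin:
 assumes "module k U" "\<beta> : bilin_maps k V W U"
 shows "(%x. yd_sweedler k H V W U x \<beta>) : lin_maps k (TO V W) U"
 by (rule lin_cong[OF lin_comp[OF tsum_lin[OF Ob_mod[OF V] Ob_mod[OF W] assms] tob_dec_lin] Ob_mod[OF tob_yd]])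
  (rule tsw_eq[OF _ assms, symmetric])

lemma tsw_pure:
 assumes "module k U" "\<beta> : bilin_maps k V W U" "v <: V" "w <: W"
 shows "yd_sweedler k H V W U (P V W v w) \<beta> = \<beta> v w"
 using tsum_pure[OF Ob_mod[OF V] Ob_mod[OF W] assms] tp_mlin(1)[OF assms(3,4)] pure_closed[OF Ob_mod[OF V] Ob_mod[OF W] assms(3,4)]
 by (simp add: tsw_eq[OF _ assms(1,2)]) (simp add: yd_pure_def tob_dec_enc)

text \<open>Together with the description of the action and the coaction on pure tensors, this reduces all equations between
 morphisms out of a tensor product, and in particular the coherence conditions, to pure tensors.\<close>

lemma tob_eq:
 assumes U: "module k U" and f: "f : lin_maps k (TO V W) U" and g: "g : lin_maps k (TO V W) U"
  and e: "!!v w. [|v <: V; w <: W|] ==> f (P V W v w) = g (P V W v w)" and x: "x <: TO V W"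
 shows "f x = g x"
 using lin_tensor_eq[OF Ob_mod[OF V] Ob_mod[OF W] U lin_comp[OF f tob_enc_lin] lin_comp[OF g tob_enc_lin] _ lin_closed[OF tob_dec_lin x]]
  e unfolding yd_pure_def tob_enc_dec[OF x] by blast

lemma tob_ract:
 assumes v: "v <: V" and w: "w <: W" and x: "x <: A"
 shows "ract (TO V W) (P V W v w) x = Sw2 (TO V W) X X X x (%x1 x2. P V W (ract V v x1) (ract W w x2))"
proof -
 note t = pure_closed[OF Ob_mod[OF V] Ob_mod[OF W] v w]
 have "ract (TO V W) (P V W v w) x = enc (yd_tensor k H V W) (ract (yd_tensor k H V W) (pure k V W v w) x)"
  unfolding yd_tobj_def using pack_simps(5)[OF pkV] tob_dec_enc[OF t] by (simp add: yd_pure_def)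
 also have "... = Sw2 (TO V W) X X X x (%x1 x2. P V W (ract V v x1) (ract W w x2))"
  unfolding yd_tensor_ract_pure[OF X V W v w x] yd_pure_def
  by (rule lin_tsum[OF alg_module[OF X X] alg_module[OF X X] cocomp_closed[OF X X X x] tensor_module[OF Ob_mod[OF V] Ob_mod[OF W]] Ob_mod[OF tob_yd] tob_enc_lin])
   (assumption|intro mlin V W X yd_mlin[OF X V] yd_mlin[OF X W] v w)+
 finally show ?thesis .
qed

lemma tob_co:
 assumes v: "v <: V" and w: "w <: W" and U: "module k U" and \<beta>: "\<beta> : bilin_maps k (TO V W) A U"
 shows "Co U (TO V W) (P V W v w) \<beta> = Co U V v (%v0 g. Co U W w (%w0 h. \<beta> (P V W v0 w0) (mm X X g h)))"
proof -
 have "Co U (TO V W) (P V W v w) \<beta> = Co U (yd_tensor k H V W) (pure k V W v w) (%t h. \<beta> (enc (yd_tensor k H V W) t) h)"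
  using pack_co[OF pkV tp_mlin(1)[OF v w, unfolded yd_tobj_def] U \<beta>[unfolded yd_tobj_def]]
   tob_dec_enc[OF pure_closed[OF Ob_mod[OF V] Ob_mod[OF W] v w]] unfolding yd_tobj_def yd_pure_def by simp
 also have "... = Co U V v (%v0 g. Co U W w (%w0 h. \<beta> (P V W v0 w0) (mm X X g h)))"
  unfolding yd_pure_def
  by (rule yd_tensor_co[OF X V W v w U])
   (intro bilin_mapsI lin_comp[OF bilin_maps_left[OF \<beta>] tob_enc_lin] bilin_maps_right[OF \<beta>] lin_closed[OF tob_enc_lin])
 finally show ?thesis .
qed

end

lemmas [mlin] = tob_yd tp_mlin

lemma tob_ydI:
 assumes V: "Ob V" and W: "Ob W" and Z: "YDm X Z" and f: "f : lin_maps k (TO V W) Z"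
  and r: "!!v w x. [|v <: V; w <: W; x <: A|] ==>
   Sw2 Z X X X x (%x1 x2. f (P V W (ract V v x1) (ract W w x2))) = ract Z (f (P V W v w)) x"
  and c: "!!v w. [|v <: V; w <: W|] ==> let T = tensor k Z A in
   Co T V v (%v0 g. Co T W w (%w0 h. pure k Z A (f (P V W v0 w0)) (mm X X g h))) = coact Z (f (P V W v w))"
 shows "f : yd_maps k H (TO V W) Z"
proof (rule yd_mapsI[OF X tob_yd[OF V W] Z f])
 note i = yd_mlin[OF X V] yd_mlin[OF X W] yd_mlin[OF X Z] yd_mlin[OF X tob_yd[OF V W]] mlin X V W lin_comp[OF f] lin_closed[OF f]
 fix t assume t: "t <: TO V W"
 show "f (ract (TO V W) t x) = ract Z (f t) x" if x: "x <: A" for x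
 proof (rule tob_eq[OF V W yd_mod[OF X Z] _ _ _ t])
  show "f (ract (TO V W) (P V W v w) x) = ract Z (f (P V W v w)) x" if m: "v <: V" "w <: W" for v w
   unfolding tob_ract[OF V W m x]
   by (rule trans[OF lin_tsum[OF alg_module[OF X X] alg_module[OF X X] cocomp_closed[OF X X X x] Ob_mod[OF tob_yd[OF V W]] yd_mod[OF X Z] f] r[OF m x]])
    (assumption|intro i m)+
 qed (assumption|intro i x)+
 show "coact Z (f t) = Co (tensor k Z A) (TO V W) t (%v0 h. pure k Z A (f v0) h)"
 proof (rule tob_eq[OF V W tensor_module[OF yd_mod[OF X Z] alg_module[OF X X]] _ _ _ t])
  show "coact Z (f (P V W v w)) = Co (tensor k Z A) (TO V W) (P V W v w) (%v0 h. pure k Z A (f v0) h)" if m: "v <: V" "w <: W" for v w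
   unfolding c[OF m, unfolded Let_def, symmetric]
   by (rule tob_co[OF V W m, symmetric]) (assumption|intro i)+
 qed (assumption|intro i)+
qed

lemma tob3_ydI:
 assumes B: "Ob B" and V: "Ob V" and W: "Ob W" and Z: "YDm X Z" and f: "f : lin_maps k (TO (TO B V) W) Z"
  and r: "!!u v w x. [|u <: B; v <: V; w <: W; x <: A|] ==>
   Sw3 Z X X X X x (%x1 x2 x3. f (P (TO B V) W (P B V (ract B u x1) (ract V v x2)) (ract W w x3))) = ract Z (f (P (TO B V) W (P B V u v) w)) x"
  and c: "!!u v w. [|u <: B; v <: V; w <: W|] ==> let T = tensor k Z A in
   Co T B u (%u0 g. Co T V v (%v0 h. Co T W w (%w0 l. pure k Z A (f (P (TO B V) W (P B V u0 v0) w0)) (mm X X (mm X X g h) l)))) =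
   coact Z (f (P (TO B V) W (P B V u v) w))"
 shows "f : yd_maps k H (TO (TO B V) W) Z"
proof (rule tob_ydI[OF tob_yd[OF B V] W Z f], unfold Let_def)
 note i = yd_mlin[OF X B] yd_mlin[OF X V] yd_mlin[OF X W] yd_mlin[OF X Z] yd_mlin[OF X tob_yd[OF B V]] mlin X B V W lin_comp[OF f] lin_closed[OF f]
 fix s w assume s: "s <: TO B V" and w: "w <: W"
 show "Sw2 Z X X X x (%x1 x2. f (P (TO B V) W (ract (TO B V) s x1) (ract W w x2))) = ract Z (f (P (TO B V) W s w)) x" if x: "x <: A" for x
 proof (rule tob_eq[OF B V yd_mod[OF X Z] _ _ _ s])
  fix u v assume m: "u <: B" "v <: V"
  have "Sw2 Z X X X x (%x1 x2. f (P (TO B V) W (ract (TO B V) (P B V u v) x1) (ract W w x2))) =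
   Sw2 Z X X X x (%p x3. Sw2 Z X X X p (%x1 x2. f (P (TO B V) W (P B V (ract B u x1) (ract V v x2)) (ract W w x3))))"
  proof (rule sw_cong, (intro X x)+)
   fix p x3 assume n: "p <: A" "x3 <: A"
   show "f (P (TO B V) W (ract (TO B V) (P B V u v) p) (ract W w x3)) =
    Sw2 Z X X X p (%x1 x2. f (P (TO B V) W (P B V (ract B u x1) (ract V v x2)) (ract W w x3)))"
    unfolding tob_ract[OF B V m n(1)]
    by (rule lin_tsum[where f = "%y. f (P (TO B V) W y (ract W w x3))", OF alg_module[OF X X] alg_module[OF X X] cocomp_closed[OF X X X n(1)] Ob_mod[OF tob_yd[OF B V]] yd_mod[OF X Z]])
     (assumption|intro i m n w)+
  qed
  also have "... = Sw3 Z X X X X x (%x1 x2 x3. f (P (TO B V) W (P B V (ract B u x1) (ract V v x2)) (ract W w x3)))"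
   by (rule sw_coassoc) (assumption|intro i m w x)+
  finally show "Sw2 Z X X X x (%x1 x2. f (P (TO B V) W (ract (TO B V) (P B V u v) x1) (ract W w x2))) = ract Z (f (P (TO B V) W (P B V u v) w)) x"
   by (simp only: r[OF m w x])
 qed (assumption|intro i w x)+
 let ?T = "tensor k Z A"
 show "Co ?T (TO B V) s (%s0 g. Co ?T W w (%w0 h. pure k Z A (f (P (TO B V) W s0 w0)) (mm X X g h))) = coact Z (f (P (TO B V) W s w))"
 proof (rule tob_eq[OF B V tensor_module[OF yd_mod[OF X Z] alg_module[OF X X]] _ _ _ s])
  fix u v assume m: "u <: B" "v <: V"
  show "Co ?T (TO B V) (P B V u v) (%s0 g. Co ?T W w (%w0 h. pure k Z A (f (P (TO B V) W s0 w0)) (mm X X g h))) = coact Z (f (P (TO B V) W (P B V u v) w))"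
   unfolding c[OF m w, unfolded Let_def, symmetric]
   by (rule tob_co[OF B V m]) (assumption|intro i w)+
 qed (assumption|intro i w)+
qed

lemma unit_size: "carrier (yd_unit k H) \<lesssim> (UNIV :: 'u set)"
 using base_lepoll by (simp add: yd_unit_def module.defs)

lemmas pkI = X yd_unit_yd[OF X] unit_size

lemma unit_yd [mlin]: "Ob I0"
 unfolding yd_tunit_def by (rule pack_yd[OF pkI])

abbreviation (input) dI :: "'u \<Rightarrow> 'k" where "dI \<equiv> dec (yd_unit k H)"
abbreviation (input) eI :: "'k \<Rightarrow> 'u" where "eI \<equiv> enc (yd_unit k H)"

lemma unit_same: "same_module (yd_unit k H) (base_algebra k)"
 by (simp add: yd_unit_def)

lemma unit_dec_mlin [mlin]: "E : lin_maps k B I0 ==> (%z. dI (E z)) : lin_maps k B (base_algebra k)"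
 using lin_comp[OF dec_lin[OF pkI]] by (simp add: yd_tunit_def same_module_lin_maps[OF same_module_refl unit_same])

lemma unit_enc_lin: "eI : lin_maps k (base_algebra k) I0"
 using enc_lin[OF pkI] by (simp add: yd_tunit_def same_module_lin_maps[OF unit_same same_module_refl])

lemma unit_dec_closed [mlin]: "c <: I0 ==> dI c <: k"
 using lin_closed[OF unit_dec_mlin[OF lin_id]] by simp

lemma unit_enc_closed [mlin]: "c <: k ==> eI c <: I0"
 using lin_closed[OF unit_enc_lin] by simp

lemma unit_dec_enc: "c <: k ==> dI (eI c) = c"
 using dec_enc[OF pkI] by (simp add: yd_unit_def module.defs)

lemma unit_enc_dec: "c <: I0 ==> eI (dI c) = c"
 using enc_dec[OF pkI] by (simp add: yd_tunit_def)

lemma unit_elem: "c <: I0 ==> dI c *[I0] eI \<one>[k] = c"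
proof -
 assume c: "c <: I0"
 interpret k: cring k by (rule base_cring[OF X])
 have "eI (dI c *[base_algebra k] \<one>[k]) = dI c *[I0] eI \<one>[k]"
  by (rule lin_smult[OF unit_enc_lin]) (simp_all add: unit_dec_closed c)
 then show ?thesis using c by (simp add: unit_dec_closed unit_enc_dec)
qed

lemma unit_ract: "[|c <: I0; x <: A|] ==> dI (ract I0 c x) = dI c \<otimes>[k] coun C X x"
proof -
 assume c: "c <: I0" and x: "x <: A"
 interpret k: cring k by (rule base_cring[OF X])
 have "ract I0 c x = eI (dI c \<otimes>[k] coun C X x)"
  unfolding yd_tunit_def using pack_simps(5)[OF pkI] by (simp add: yd_unit_def yd_data.defs module.defs)
 then show ?thesis using c x X by (simp add: unit_dec_enc unit_dec_closed coun_closed)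
qed

lemma unit_co:
 assumes c: "c <: I0" and U: "module k U" and \<beta>: "\<beta> : bilin_maps k I0 A U"
 shows "Co U I0 c \<beta> = \<beta> c \<one>[A]"
proof -
 note B = base_algebra_module[OF base_cring[OF X]]
 have "Co U I0 c \<beta> = Co U (yd_unit k H) (dI c) (%m h. \<beta> (eI m) h)"
  using pack_co[OF pkI c[unfolded yd_tunit_def] U \<beta>[unfolded yd_tunit_def]] by (simp only: yd_tunit_def)
 also have "... = tsum k U (pure k (base_algebra k) A (dI c) \<one>[A]) (%m h. \<beta> (eI m) h)"
  by (simp add: yd_unit_def yd_data.defs module.defs)
 also have "... = \<beta> (eI (dI c)) \<one>[A]"
  by (rule tsum_pure[OF B alg_module[OF X X] U])
   (intro bilin_mapsI lin_comp[OF bilin_maps_left[OF \<beta>] unit_enc_lin] bilin_maps_right[OF \<beta>] lin_closed[OF unit_enc_lin] mlin X, simp_all add: c unit_dec_closed alg_one_closed X)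
 finally show ?thesis by (simp add: unit_enc_dec c)
qed

subsection \<open>Structure of the category\<close>

lemma D_simps [simp]:
 "objs D = {V. Ob V}" "homs D V W = yd_maps k H V W \<inter> extensional (carrier V)"
 "ident D V = (\<lambda>v\<in>carrier V. v)" "mcomp D V W Z g f = compose (carrier V) g f"
 "tunit D = I0" "tobj D = TO"
 by (simp_all add: YD_def yd_hom_space_def)

lemma hom_sp_simps:
 "hom_sp D V W = yd_hom_space k H V W" "carrier (yd_hom_space k H V W) = yd_maps k H V W \<inter> extensional (carrier V)"
 "\<zero>[yd_hom_space k H V W] = (\<lambda>v\<in>carrier V. \<zero>[W])"
 "f +[yd_hom_space k H V W] g = (\<lambda>v\<in>carrier V. f v +[W] g v)"
 "c *[yd_hom_space k H V W] f = (\<lambda>v\<in>carrier V. c *[W] f v)"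
 by (simp_all add: YD_def yd_hom_space_def)

lemma restrict_hom: "[|f : yd_maps k H V W; Ob V; Ob W|] ==> restrict f (carrier V) \<in> homs D V W"
 using yd_maps_cong[OF X, of V W f "restrict f (carrier V)"] by auto

lemma yd_maps_add:
 assumes V: "Ob V" and W: "Ob W" and f: "f : yd_maps k H V W" and g: "g : yd_maps k H V W"
 shows "(%v. f v +[W] g v) : yd_maps k H V W"
proof (rule yd_mapsI[OF X V W])
 note fl = yd_maps_lin[OF f] and gl = yd_maps_lin[OF g]
 note i = yd_mlin[OF X V] yd_mlin[OF X W] mlin X V W fl gl lin_closed[OF fl] lin_closed[OF gl]
 show "(%v. f v +[W] g v) : lin_maps k V W" by (intro i)
 fix v assume v: "v <: V"
 show "f (ract V v x) +[W] g (ract V v x) = ract W (f v +[W] g v) x" if x: "x <: A" for x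
  by (simp add: yd_maps_ract[OF f v x] yd_maps_ract[OF g v x] lin_add[OF ract_mlin(2)[OF X W lin_id x]] lin_closed[OF fl v] lin_closed[OF gl v])
 let ?T = "tensor k W A" and ?p = "pure k W A"
 have "coact W (f v +[W] g v) = coact W (f v) +[?T] coact W (g v)"
  by (rule lin_add[OF yd_coact_lin[OF X W] lin_closed[OF fl v] lin_closed[OF gl v]])
 also have "... = Co ?T W (f v) ?p +[?T] Co ?T W (g v) ?p" by (simp only: co_pure[OF X W] lin_closed[OF fl v] lin_closed[OF gl v])
 also have "... = Co ?T V v (%w h. ?p (f w) h) +[?T] Co ?T V v (%w h. ?p (g w) h)"
  by (rule arg_cong2[where f = "(\<oplus>\<^bsub>?T\<^esub>)"]; rule yd_maps_co[OF X V W _ v]) (assumption | rule f g | intro i)+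
 also have "... = Co ?T V v (%w h. ?p (f w) h +[?T] ?p (g w) h)"
  by (rule tsum_plus[of k V A, symmetric]) (assumption|intro i v)+
 also have "... = Co ?T V v (%w h. ?p (f w +[W] g w) h)"
  by (rule co_cong[OF X V v]) (simp add: lin_add[OF pure_lin_left[OF Ob_mod[OF W] alg_module[OF X X]]] lin_closed[OF fl] lin_closed[OF gl])
 finally show "coact W (f v +[W] g v) = ..." .
qed

lemma yd_maps_smult:
 assumes V: "Ob V" and W: "Ob W" and f: "f : yd_maps k H V W" and c: "c <: k"
 shows "(%v. c *[W] f v) : yd_maps k H V W"
proof (rule yd_mapsI[OF X V W])
 note fl = yd_maps_lin[OF f]
 note i = yd_mlin[OF X V] yd_mlin[OF X W] mlin X V W fl lin_closed[OF fl] c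
 show "(%v. c *[W] f v) : lin_maps k V W" by (intro i)
 fix v assume v: "v <: V"
 show "c *[W] f (ract V v x) = ract W (c *[W] f v) x" if x: "x <: A" for x
  by (simp add: yd_maps_ract[OF f v x] lin_smult[OF ract_mlin(2)[OF X W lin_id x]] lin_closed[OF fl v] c)
 let ?T = "tensor k W A" and ?p = "pure k W A"
 have "coact W (c *[W] f v) = c *[?T] Co ?T W (f v) ?p"
  by (simp only: lin_smult[OF yd_coact_lin[OF X W] c lin_closed[OF fl v]] co_pure[OF X W lin_closed[OF fl v]])
 also have "... = c *[?T] Co ?T V v (%w h. ?p (f w) h)"
  by (rule arg_cong[where f = "%x. c *[?T] x"], rule yd_maps_co[OF X V W f v]) (assumption|intro i)+
 also have "... = Co ?T V v (%w h. c *[?T] ?p (f w) h)"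
  by (rule smult_tsum[of k V A, symmetric]) (assumption|intro i v)+
 also have "... = Co ?T V v (%w h. ?p (c *[W] f w) h)"
  by (rule co_cong[OF X V v]) (simp add: lin_smult[OF pure_lin_left[OF Ob_mod[OF W] alg_module[OF X X]]] lin_closed[OF fl] c)
 finally show "coact W (c *[W] f v) = ..." .
qed

lemma yd_maps_zero:
 assumes V: "Ob V" and W: "Ob W" shows "(%v. \<zero>[W]) : yd_maps k H V W"
proof (rule yd_mapsI[OF X V W])
 interpret W: module k W by (rule Ob_mod[OF W])
 note i = yd_mlin[OF X V] yd_mlin[OF X W] mlin X V W
 show "(%v. \<zero>[W]) : lin_maps k V W" by (rule lin_mapsI) auto
 fix v assume v: "v <: V"
 show "\<zero>[W] = ract W \<zero>[W] x" if x: "x <: A" for x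
  using lin_zero[OF W.module_axioms W.module_axioms ract_mlin(2)[OF X W lin_id x]] by simp
 let ?T = "tensor k W A" and ?p = "pure k W A"
 interpret T: module k ?T by (intro i)
 have "Co ?T V v (%v0 h. ?p \<zero>[W] h) = Co ?T V v (%v0 h. \<zero>[k] *[?T] ?p \<zero>[W] h)"
  using lin_zero[OF W.module_axioms T.module_axioms pure_lin_left[OF W.module_axioms alg_module[OF X X]]]
  by (intro co_cong[OF X V v]) simp
 also have "... = \<zero>[k] *[?T] Co ?T V v (%v0 h. ?p \<zero>[W] h)"
  by (rule smult_tsum[of k V A]) (assumption | rule W.R.zero_closed W.zero_closed | intro i v)+
 also have "... = \<zero>[?T]"
  by (rule T.smult_l_null) (assumption | rule W.zero_closed | intro i v)+
 finally show "coact W \<zero>[W] = Co ?T V v (%v0 h. ?p \<zero>[W] h)"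
  using lin_zero[OF W.module_axioms T.module_axioms yd_coact_lin[OF X W]] by simp
qed

lemma yd_hom_module:
 assumes V: "Ob V" and W: "Ob W" shows "module k (yd_hom_space k H V W)"
proof -
 interpret W: module k W by (rule Ob_mod[OF W])
 have c: "f v <: W" if "f : yd_maps k H V W" "v <: V" for f v
  using lin_closed[OF yd_maps_lin[OF that(1)] that(2)] .
 note r = restrict_hom[OF _ V W, unfolded D_simps] note r' = IntD1[OF r]
 show ?thesis
 proof (intro moduleI abelian_groupI W.cring_axioms, unfold hom_sp_simps)
  fix f assume f: "f : yd_maps k H V W \<inter> extensional (carrier V)"
  show "\<exists>g\<in>yd_maps k H V W \<inter> extensional (carrier V). (\<lambda>v\<in>carrier V. g v +[W] f v) = (\<lambda>v\<in>carrier V. \<zero>[W])"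
   by (rule bexI[OF _ r[OF yd_maps_smult[OF V W, of f "\<ominus>\<^bsub>k\<^esub> \<one>[k]"]]])
    (use f c in \<open>auto simp: fun_eq_iff restrict_def W.smult_l_minus W.l_neg\<close>)
 qed (use c in \<open>auto intro!: r' yd_maps_add[OF V W] yd_maps_smult[OF V W] yd_maps_zero[OF V W] restrict_ext
   simp: W.a_ac W.smult_l_distr W.smult_r_distr W.smult_assoc1 extensional_restrict
   cong: restrict_cong\<close>)
qed

lemma YD_klinear: "klinear_category k D"
proof (rule klinear_category.intro)
 fix V W Z :: "('k, 'a, 'u) yd_data"
 assume "V \<in> objs D" "W \<in> objs D"
 then have V: "Ob V" and W: "Ob W" by auto
 show "module k (hom_sp D V W)" unfolding hom_sp_simps by (rule yd_hom_module[OF V W])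
 have "(%v. v) : yd_maps k H V V"
  by (rule yd_mapsI[OF X V V lin_id]) (simp_all add: co_pure[OF X V])
 then show "ident D V \<in> homs D V V" using restrict_hom[OF _ V V] by simp
 show "mcomp D V W W (ident D W) f = f" "mcomp D V V W f (ident D V) = f" if "f \<in> homs D V W" for f
  using that lin_closed[OF yd_maps_lin[of f H V W]]
  by (auto simp: compose_def fun_eq_iff restrict_def extensional_def)
 assume "Z \<in> objs D"
 then have Z: "Ob Z" by auto
 have comp: "compose (carrier V) g f \<in> homs D V Z" if "g \<in> homs D W Z" "f \<in> homs D V W" for f g
  using restrict_hom[OF yd_maps_comp[OF X V W Z] V Z, of f g] that by (simp add: compose_def)
 show "mcomp D V W Z : bilin_maps k (hom_sp D W Z) (hom_sp D V W) (hom_sp D V Z)"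
 proof (rule bilin_mapsI; rule lin_mapsI; unfold hom_sp_simps)
  fix g f f' c assume g: "g : yd_maps k H W Z \<inter> extensional (carrier W)" and f: "f : yd_maps k H V W \<inter> extensional (carrier V)"
  note gl = yd_maps_lin[OF IntD1[OF g]] and fl = yd_maps_lin[OF IntD1[OF f]]
  show "mcomp D V W Z g f : yd_maps k H V Z \<inter> extensional (carrier V)" using comp f g by simp
  then show "mcomp D V W Z g f : yd_maps k H V Z \<inter> extensional (carrier V)" .
  { assume c: "c <: k"
   show "mcomp D V W Z g (\<lambda>v\<in>carrier V. c *[W] f v) = (\<lambda>v\<in>carrier V. c *[Z] mcomp D V W Z g f v)"
    "mcomp D V W Z (\<lambda>v\<in>carrier W. c *[Z] g v) f = (\<lambda>v\<in>carrier V. c *[Z] mcomp D V W Z g f v)"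
    using c lin_closed[OF fl] by (auto simp: compose_def fun_eq_iff restrict_def lin_smult[OF gl]) }
  { assume f': "f' : yd_maps k H V W \<inter> extensional (carrier V)"
   show "mcomp D V W Z g (\<lambda>v\<in>carrier V. f v +[W] f' v) = (\<lambda>v\<in>carrier V. mcomp D V W Z g f v +[Z] mcomp D V W Z g f' v)"
    using lin_closed[OF fl] lin_closed[OF yd_maps_lin[OF IntD1[OF f']]] by (auto simp: compose_def fun_eq_iff restrict_def lin_add[OF gl]) }
  fix g' assume "g' : yd_maps k H W Z \<inter> extensional (carrier W)"
  show "mcomp D V W Z (\<lambda>v\<in>carrier W. g v +[Z] g' v) f = (\<lambda>v\<in>carrier V. mcomp D V W Z g f v +[Z] mcomp D V W Z g' f v)"
   using lin_closed[OF fl] by (auto simp: compose_def fun_eq_iff restrict_def)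
 qed
 fix G f g h assume "G \<in> objs D" and h: "f \<in> homs D V W" "g \<in> homs D W Z" "h \<in> homs D Z G"
 show "mcomp D V Z G h (mcomp D V W Z g f) = mcomp D V W G (mcomp D W Z G h g) f"
  using h lin_closed[OF yd_maps_lin[of f H V W]] by (auto simp: compose_def fun_eq_iff restrict_def)
qed

lemma iso_morI:
 assumes V: "Ob V" and W: "Ob W" and f: "f \<in> homs D V W" and g: "!!w. w <: W ==> g w <: V"
  and gf: "!!v. v <: V ==> g (f v) = v" and fg: "!!w. w <: W ==> f (g w) = w"
 shows "iso_mor D V W f"
proof -
 have fy: "f : yd_maps k H V W" using f by simp
 have "restrict g (carrier W) \<in> homs D W V" by (rule restrict_hom[OF yd_maps_inverse[OF X V W fy g gf fg] W V])
 moreover have "compose (carrier V) (restrict g (carrier W)) f = (\<lambda>v\<in>carrier V. v)"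
  "compose (carrier W) f (restrict g (carrier W)) = (\<lambda>v\<in>carrier W. v)"
  using gf fg lin_closed[OF yd_maps_lin[OF fy]] by (auto simp: compose_def fun_eq_iff restrict_def)
 ultimately show ?thesis using f by (auto simp: iso_mor_def)
qed

end

end

context cogroupoid_universe
begin

(* outside the context these rules mention an undetermined object and match too many goals *)
lemmas [mlin del] = Ob_mod tob_yd tp_mlin unit_yd unit_dec_mlin unit_dec_closed unit_enc_closed

lemma tmor_app: "x <: TO X V W ==> tmor (D X) V V' W W' f g x =
  yd_sweedler k (H X) V W (TO X V' W') x (%v w. P X V' W' (f v) (g w))"
 and tmor_ext: "tmor (D X) V V' W W' f g \<in> extensional (carrier (TO X V W))"
 and assoc_app: "x <: TO X (TO X U V) W ==> assoc (D X) U V W x =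
  yd_sweedler k (H X) (TO X U V) W (TO X U (TO X V W)) x (%s w. yd_sweedler k (H X) U V (TO X U (TO X V W)) s
   (%u v. P X U (TO X V W) u (P X V W v w)))"
 and assoc_ext: "assoc (D X) U V W \<in> extensional (carrier (TO X (TO X U V) W))"
 and lunit_app: "x <: TO X (I0 X) V ==> lunit (D X) V x = yd_sweedler k (H X) (I0 X) V V x (%c v. dI X c *[V] v)"
 and lunit_ext: "lunit (D X) V \<in> extensional (carrier (TO X (I0 X) V))"
 and runit_app: "x <: TO X V (I0 X) ==> runit (D X) V x = yd_sweedler k (H X) V (I0 X) V x (%v c. dI X c *[V] v)"
 and runit_ext: "runit (D X) V \<in> extensional (carrier (TO X V (I0 X)))"
 by (simp_all add: YD_def Let_def)

context
 fixes X assumes X: "X : ob C"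
begin

lemmas [mlin] = Ob_mod[OF X] tob_yd[OF X] tp_mlin[OF X] unit_yd[OF X] unit_dec_mlin[OF X] unit_dec_closed[OF X] unit_enc_closed[OF X]

lemma ident_lin [mlin]: "Ob X V ==> (\<lambda>v\<in>carrier V. v) : lin_maps k V V"
 by (rule restrict_lin[OF lin_id Ob_mod[OF X]])

lemma tob_eq2:
 assumes V: "Ob X V" and W: "Ob X W" and U: "module k U"
  and f: "f : lin_maps k (TO X V W) U" "f \<in> extensional (carrier (TO X V W))"
  and g: "g : lin_maps k (TO X V W) U" "g \<in> extensional (carrier (TO X V W))"
  and e: "!!v w. [|v <: V; w <: W|] ==> f (P X V W v w) = g (P X V W v w)"
 shows "f = g"
 by (rule lin_ext_eq[OF f(2) g(2)], rule tob_eq[OF X V W U f(1) g(1) e])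

lemma tob_eq3:
 assumes V: "Ob X V" and W: "Ob X W" and Z: "Ob X Z" and U: "module k U"
  and f: "f : lin_maps k (TO X (TO X V W) Z) U" "f \<in> extensional (carrier (TO X (TO X V W) Z))"
  and g: "g : lin_maps k (TO X (TO X V W) Z) U" "g \<in> extensional (carrier (TO X (TO X V W) Z))"
  and e: "!!v w z. [|v <: V; w <: W; z <: Z|] ==>
   f (P X (TO X V W) Z (P X V W v w) z) = g (P X (TO X V W) Z (P X V W v w) z)"
 shows "f = g"
proof (rule tob_eq2[OF tob_yd[OF X V W] Z U f g])
 fix s z assume s: "s <: TO X V W" and z: "z <: Z"
 show "f (P X (TO X V W) Z s z) = g (P X (TO X V W) Z s z)"
 proof (rule tob_eq[OF X V W U _ _ _ s])
  show "(%s. f (P X (TO X V W) Z s z)) : lin_maps k (TO X V W) U" by (rule lin_comp[OF f(1)]) (intro mlin V W Z z)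
  show "(%s. g (P X (TO X V W) Z s z)) : lin_maps k (TO X V W) U" by (rule lin_comp[OF g(1)]) (intro mlin V W Z z)
 qed (rule e[OF _ _ z])
qed

lemma tob_eq4:
 assumes V: "Ob X V" and W: "Ob X W" and Z: "Ob X Z" and Y: "Ob X Y" and U: "module k U"
  and f: "f : lin_maps k (TO X (TO X (TO X V W) Z) Y) U" "f \<in> extensional (carrier (TO X (TO X (TO X V W) Z) Y))"
  and g: "g : lin_maps k (TO X (TO X (TO X V W) Z) Y) U" "g \<in> extensional (carrier (TO X (TO X (TO X V W) Z) Y))"
  and e: "!!v w z y. [|v <: V; w <: W; z <: Z; y <: Y|] ==>
   f (P X (TO X (TO X V W) Z) Y (P X (TO X V W) Z (P X V W v w) z) y) = g (P X (TO X (TO X V W) Z) Y (P X (TO X V W) Z (P X V W v w) z) y)"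
 shows "f = g"
proof (rule tob_eq3[OF tob_yd[OF X V W] Z Y U f g])
 fix s z y assume s: "s <: TO X V W" and z: "z <: Z" and y: "y <: Y"
 show "f (P X (TO X (TO X V W) Z) Y (P X (TO X V W) Z s z) y) = g (P X (TO X (TO X V W) Z) Y (P X (TO X V W) Z s z) y)"
 proof (rule tob_eq[OF X V W U _ _ _ s])
  show "(%s. f (P X (TO X (TO X V W) Z) Y (P X (TO X V W) Z s z) y)) : lin_maps k (TO X V W) U" by (rule lin_comp[OF f(1)]) (intro mlin V W Z Y z y)
  show "(%s. g (P X (TO X (TO X V W) Z) Y (P X (TO X V W) Z s z) y)) : lin_maps k (TO X V W) U" by (rule lin_comp[OF g(1)]) (intro mlin V W Z Y z y)
 qed (rule e[OF _ _ z y])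
qed

context
 fixes V V' W W' f g
 assumes V: "Ob X V" and V': "Ob X V'" and W: "Ob X W" and W': "Ob X W'"
  and f: "f : lin_maps k V V'" and g: "g : lin_maps k W W'"
begin

lemma tmor_bilin_maps: "(%v w. P X V' W' (f v) (g w)) : bilin_maps k V W (TO X V' W')"
 by (intro mlin V' W' f g lin_closed[OF f] lin_closed[OF g])

lemma tmor_lin: "tmor (D X) V V' W W' f g : lin_maps k (TO X V W) (TO X V' W')"
 by (rule lin_cong[OF tsw_lin[OF X V W _ tmor_bilin_maps] Ob_mod[OF X tob_yd[OF X V W]]])
  (intro mlin V' W', rule tmor_app[symmetric])

lemma tmor_pure: "[|v <: V; w <: W|] ==>
  tmor (D X) V V' W W' f g (P X V W v w) = P X V' W' (f v) (g w)"
 by (subst tmor_app, intro mlin V W, assumption+, rule tsw_pure[OF X V W _ tmor_bilin_maps]) (assumption|intro mlin V' W')+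

end

lemma tmor_hom:
 assumes V: "Ob X V" and V': "Ob X V'" and W: "Ob X W" and W': "Ob X W'"
  and f: "f \<in> homs (D X) V V'" and g: "g \<in> homs (D X) W W'"
 shows "tmor (D X) V V' W W' f g \<in> homs (D X) (TO X V W) (TO X V' W')"
proof -
 have fy: "f : yd_maps k (H X) V V'" and gy: "g : yd_maps k (H X) W W'"
  using f g by (simp_all add: D_simps[OF X])
 note fl = yd_maps_lin[OF fy] and gl = yd_maps_lin[OF gy]
 note tp = tmor_pure[OF V V' W W' fl gl] and cl = lin_closed[OF fl] lin_closed[OF gl]
 note i = yd_mlin[OF X V] yd_mlin[OF X W] yd_mlin[OF X V'] yd_mlin[OF X W'] mlin X V W V' W' fl gl cl
 have "tmor (D X) V V' W W' f g : yd_maps k (H X) (TO X V W) (TO X V' W')"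
 proof (rule tob_ydI[OF X V W tob_yd[OF X V' W'] tmor_lin[OF V V' W W' fl gl]], unfold Let_def)
  fix v w assume m: "v <: V" "w <: W"
  let ?Z = "TO X V' W'"
  show "Sw2 ?Z X X X x (%x1 x2. tmor (D X) V V' W W' f g (P X V W (ract V v x1) (ract W w x2))) = ract ?Z (tmor (D X) V V' W W' f g (P X V W v w)) x"
   if x: "x <: A X" for x
   unfolding tp[OF m] tob_ract[OF X V' W' cl(1)[OF m(1)] cl(2)[OF m(2)] x]
   by (rule sw_cong[OF X X X x]) (simp add: tp ract_mlin(1)[OF X V m(1)] ract_mlin(1)[OF X W m(2)] yd_maps_ract[OF fy m(1)] yd_maps_ract[OF gy m(2)])
  let ?T = "tensor k ?Z (A X)" and ?p = "pure k ?Z (A X)"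
  have "Co ?T V v (%v0 g'. Co ?T W w (%w0 h. ?p (tmor (D X) V V' W W' f g (P X V W v0 w0)) (mm X X g' h))) =
   Co ?T V v (%v0 g'. Co ?T W w (%w0 h. ?p (P X V' W' (f v0) (g w0)) (mm X X g' h)))"
   by (rule co_cong[OF X V m(1)], rule co_cong[OF X W m(2)]) (simp add: tp)
  also have "... = Co ?T V v (%v0 g'. Co ?T W' (g w) (%w0 h. ?p (P X V' W' (f v0) w0) (mm X X g' h)))"
   by (rule co_cong[OF X V m(1)], rule yd_maps_co[OF X W W' gy m(2), symmetric]) (assumption|intro i)+
  also have "... = Co ?T V' (f v) (%v0 g'. Co ?T W' (g w) (%w0 h. ?p (P X V' W' v0 w0) (mm X X g' h)))"
   by (rule yd_maps_co[OF X V V' fy m(1), symmetric]) (assumption|intro i m)+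
  also have "... = Co ?T ?Z (P X V' W' (f v) (g w)) ?p"
   by (rule tob_co[OF X V' W', symmetric]) (assumption|intro i m)+
  also have "... = coact ?Z (P X V' W' (f v) (g w))" by (rule co_pure[OF X tob_yd[OF X V' W']]) (intro i m)+
  finally show "Co ?T V v (%v0 g'. Co ?T W w (%w0 h. ?p (tmor (D X) V V' W W' f g (P X V W v0 w0)) (mm X X g' h))) =
   coact ?Z (tmor (D X) V V' W W' f g (P X V W v w))" by (simp only: tp[OF m])
 qed
 then show ?thesis by (simp add: D_simps[OF X] tmor_ext)
qed

context
 fixes U V W
 assumes U: "Ob X U" and V: "Ob X V" and W: "Ob X W"
begin

lemma assoc_inner: "[|w <: W; u <: U; v <: V|] ==>
  yd_sweedler k (H X) U V (TO X U (TO X V W)) (P X U V u v) (%u v. P X U (TO X V W) u (P X V W v w)) = P X U (TO X V W) u (P X V W v w)"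
 by (rule tsw_pure[OF X U V]) (assumption|intro mlin U V W)+

lemma assoc_bilin: "(%s w. yd_sweedler k (H X) U V (TO X U (TO X V W)) s (%u v. P X U (TO X V W) u (P X V W v w)))
  : bilin_maps k (TO X U V) W (TO X U (TO X V W))"
proof (rule bilin_mapsI)
 fix w assume w: "w <: W"
 show "(%s. yd_sweedler k (H X) U V (TO X U (TO X V W)) s (%u v. P X U (TO X V W) u (P X V W v w))) : lin_maps k (TO X U V) (TO X U (TO X V W))"
  by (rule tsw_lin[OF X U V]) (assumption|intro mlin U V W w)+
next
 fix s assume s: "s <: TO X U V"
 show "(%w. yd_sweedler k (H X) U V (TO X U (TO X V W)) s (%u v. P X U (TO X V W) u (P X V W v w))) : lin_maps k W (TO X U (TO X V W))"
  by (rule lin_cong[OF lin_tsum_arg[OF Ob_mod[OF X U] Ob_mod[OF X V] lin_closed[OF tob_dec_lin[OF X U V] s]] Ob_mod[OF X W] tsw_eq[OF X U V s, symmetric]])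
   (assumption|intro mlin U V W)+
qed

lemma assoc_lin: "assoc (D X) U V W : lin_maps k (TO X (TO X U V) W) (TO X U (TO X V W))"
 by (rule lin_cong[OF tsw_lin[OF X tob_yd[OF X U V] W _ assoc_bilin] Ob_mod[OF X] assoc_app[symmetric]])
  (assumption|intro mlin U V W)+

lemma assoc_pure: "[|u <: U; v <: V; w <: W|] ==>
  assoc (D X) U V W (P X (TO X U V) W (P X U V u v) w) = P X U (TO X V W) u (P X V W v w)"
 by (subst assoc_app, intro mlin U V W, assumption+, subst tsw_pure[OF X tob_yd[OF X U V] W _ assoc_bilin])
  (assumption|intro mlin U V W assoc_inner)+

lemma assoc_hom: "assoc (D X) U V W \<in> homs (D X) (TO X (TO X U V) W) (TO X U (TO X V W))"
proof -
 let ?Z = "TO X U (TO X V W)" note VW = tob_yd[OF X V W] note Z = tob_yd[OF X U VW]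
 note i = yd_mlin[OF X U] yd_mlin[OF X V] yd_mlin[OF X W] yd_mlin[OF X VW] yd_mlin[OF X Z] mlin X U V W
 have "assoc (D X) U V W : yd_maps k (H X) (TO X (TO X U V) W) ?Z"
 proof (rule tob3_ydI[OF X U V W Z assoc_lin], unfold Let_def)
  fix u v w assume m: "u <: U" "v <: V" "w <: W"
  note pvw = tp_mlin(1)[OF X V W m(2,3)]
  show "Sw3 ?Z X X X X x (%x1 x2 x3. assoc (D X) U V W (P X (TO X U V) W (P X U V (ract U u x1) (ract V v x2)) (ract W w x3))) =
   ract ?Z (assoc (D X) U V W (P X (TO X U V) W (P X U V u v) w)) x" if x: "x <: A X" for x
   unfolding assoc_pure[OF m] tob_ract[OF X U VW m(1) pvw x]
  proof (rule sw_cong[OF X X X x])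
   fix x1 r assume n: "x1 <: A X" "r <: A X"
   have "Sw2 ?Z X X X r (%x2 x3. assoc (D X) U V W (P X (TO X U V) W (P X U V (ract U u x1) (ract V v x2)) (ract W w x3))) =
    Sw2 ?Z X X X r (%x2 x3. P X U (TO X V W) (ract U u x1) (P X V W (ract V v x2) (ract W w x3)))"
    by (rule sw_cong[OF X X X n(2)], rule assoc_pure) (assumption|intro i m n)+
   also have "... = P X U (TO X V W) (ract U u x1) (ract (TO X V W) (P X V W v w) r)"
    unfolding tob_ract[OF X V W m(2,3) n(2)]
    by (rule lin_tsum[OF alg_module[OF X X] alg_module[OF X X] cocomp_closed[OF X X X n(2)] Ob_mod[OF X VW] Ob_mod[OF X Z], symmetric])
     (assumption|intro i m n)+
   finally show "Sw2 ?Z X X X r (%x2 x3. assoc (D X) U V W (P X (TO X U V) W (P X U V (ract U u x1) (ract V v x2)) (ract W w x3))) = ..." .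
  qed
  let ?T = "tensor k ?Z (A X)" and ?p = "pure k ?Z (A X)"
  have "Co ?T U u (%u0 g. Co ?T V v (%v0 h. Co ?T W w (%w0 l. ?p (assoc (D X) U V W (P X (TO X U V) W (P X U V u0 v0) w0)) (mm X X (mm X X g h) l)))) =
   Co ?T U u (%u0 g. Co ?T V v (%v0 h. Co ?T W w (%w0 l. ?p (P X U (TO X V W) u0 (P X V W v0 w0)) (mm X X g (mm X X h l)))))"
   by (rule co_cong[OF X U m(1)], rule co_cong[OF X V m(2)], rule co_cong[OF X W m(3)]) (simp add: assoc_pure alg_assoc X)
  also have "... = Co ?T U u (%u0 g. Co ?T (TO X V W) (P X V W v w) (%t l. ?p (P X U (TO X V W) u0 t) (mm X X g l)))"
   by (rule co_cong[OF X U m(1)], rule tob_co[OF X V W m(2,3), symmetric]) (assumption|intro i)+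
  also have "... = Co ?T ?Z (P X U (TO X V W) u (P X V W v w)) ?p"
   by (rule tob_co[OF X U VW m(1) pvw, symmetric]) (assumption|intro i)+
  also have "... = coact ?Z (P X U (TO X V W) u (P X V W v w))" by (rule co_pure[OF X Z]) (intro i m)+
  finally show "Co ?T U u (%u0 g. Co ?T V v (%v0 h. Co ?T W w (%w0 l. ?p (assoc (D X) U V W (P X (TO X U V) W (P X U V u0 v0) w0)) (mm X X (mm X X g h) l)))) =
   coact ?Z (assoc (D X) U V W (P X (TO X U V) W (P X U V u v) w))" by (simp only: assoc_pure[OF m])
 qed
 then show ?thesis by (simp add: D_simps[OF X] assoc_ext)
qed

lemma assoc_iso: "iso_mor (D X) (TO X (TO X U V) W) (TO X U (TO X V W)) (assoc (D X) U V W)"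
proof -
 let ?S = "TO X (TO X U V) W" and ?Z = "TO X U (TO X V W)" note VW = tob_yd[OF X V W] note UV = tob_yd[OF X U V]
 note i = mlin X U V W
 let ?q = "%u t. yd_sweedler k (H X) V W ?S t (%v w. P X (TO X U V) W (P X U V u v) w)"
 have b0: "(%v w. P X (TO X U V) W (P X U V u v) w) : bilin_maps k V W ?S" if "u <: U" for u
  by (intro i that)
 have q: "?q : bilin_maps k U (TO X V W) ?S"
 proof (rule bilin_mapsI)
  show "?q u : lin_maps k (TO X V W) ?S" if "u <: U" for u
   by (rule tsw_lin[OF X V W _ b0[OF that]]) (intro i)
  show "(%u. ?q u t) : lin_maps k U ?S" if t: "t <: TO X V W" for t
   by (rule lin_cong[OF lin_tsum_arg[OF Ob_mod[OF X V] Ob_mod[OF X W] lin_closed[OF tob_dec_lin[OF X V W] t]] Ob_mod[OF X U] tsw_eq[OF X V W t _ b0, symmetric]])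
    (assumption|intro i)+
 qed
 have qp: "?q u (P X V W v w) = P X (TO X U V) W (P X U V u v) w" if "u <: U" "v <: V" "w <: W" for u v w
  by (rule tsw_pure[OF X V W _ b0]) (assumption|intro i that)+
 let ?b = "%x. yd_sweedler k (H X) U (TO X V W) ?S x ?q"
 have S: "module k ?S" and Z: "module k ?Z" by (intro i)+
 have bl: "?b : lin_maps k ?Z ?S" by (rule tsw_lin[OF X U VW S q])
 have bp: "?b (P X U (TO X V W) u t) = ?q u t" if "u <: U" "t <: TO X V W" for u t
  by (rule tsw_pure[OF X U VW S q that])
 have 1: "?b (assoc (D X) U V W x) = x" if x: "x <: ?S" for x
 proof -
  have "compose (carrier ?S) ?b (assoc (D X) U V W) = (\<lambda>x\<in>carrier ?S. x)"
   by (rule tob_eq3[OF U V W S compose_lin[OF assoc_lin bl S] _ restrict_lin[OF lin_id S]])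
    (simp_all add: compose_eq tp_mlin(1)[OF X] UV U V W assoc_pure bp qp)
  from fun_cong[OF this, of x] x show ?thesis by (simp add: compose_eq)
 qed
 have 2: "assoc (D X) U V W (?b x) = x" if x: "x <: ?Z" for x
 proof (rule tob_eq[OF X U VW Z lin_comp[OF assoc_lin bl] lin_id _ x])
  fix u t assume u: "u <: U" and t: "t <: TO X V W"
  show "assoc (D X) U V W (?b (P X U (TO X V W) u t)) = P X U (TO X V W) u t"
   unfolding bp[OF u t]
   by (rule tob_eq[OF X V W Z lin_comp[OF assoc_lin bilin_maps_right[OF q u]] _ _ t]) (intro i u, simp add: qp[OF u] assoc_pure[OF u])
 qed
 show ?thesis by (rule iso_morI[OF X tob_yd[OF X UV W] tob_yd[OF X U VW] assoc_hom lin_closed[OF bl] 1 2])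
qed

end

context
 fixes V assumes V: "Ob X V"
begin

lemma lunit_bilin: "(%c v. dI X c *[V] v) : bilin_maps k (I0 X) V V"
 and runit_bilin: "(%v c. dI X c *[V] v) : bilin_maps k V (I0 X) V"
 by (assumption|intro mlin V)+

lemma lunit_lin: "lunit (D X) V : lin_maps k (TO X (I0 X) V) V"
 by (rule lin_cong[OF tsw_lin[OF X unit_yd[OF X] V _ lunit_bilin] Ob_mod[OF X] lunit_app[symmetric]]) (assumption|intro mlin V)+

lemma runit_lin: "runit (D X) V : lin_maps k (TO X V (I0 X)) V"
 by (rule lin_cong[OF tsw_lin[OF X V unit_yd[OF X] _ runit_bilin] Ob_mod[OF X] runit_app[symmetric]]) (assumption|intro mlin V)+

lemma lunit_pure: "[|c <: I0 X; v <: V|] ==> lunit (D X) V (P X (I0 X) V c v) = dI X c *[V] v"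
 by (subst lunit_app, intro mlin V, assumption+, rule tsw_pure[OF X unit_yd[OF X] V _ lunit_bilin]) (assumption|intro mlin V)+

lemma runit_pure: "[|c <: I0 X; v <: V|] ==> runit (D X) V (P X V (I0 X) v c) = dI X c *[V] v"
 by (subst runit_app, intro mlin V, assumption+, rule tsw_pure[OF X V unit_yd[OF X] _ runit_bilin]) (assumption|intro mlin V)+

lemma unit_homs:
 shows lunit_hom: "lunit (D X) V \<in> homs (D X) (TO X (I0 X) V) V" and runit_hom: "runit (D X) V \<in> homs (D X) (TO X V (I0 X)) V"
proof -
 note I = unit_yd[OF X]
 note i = yd_mlin[OF X V] yd_mlin[OF X I] mlin X V
 let ?T = "tensor k V (A X)" and ?p = "pure k V (A X)"
 have T: "module k ?T" by (intro i)
 have r: "(dI X c \<otimes>[k] coun C X x1) *[V] v = coun C X x1 *[V] (dI X c *[V] v)"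
  if "c <: I0 X" "x1 <: A X" "v <: V" for c x1 v
  using that smult_smult(2)[OF Ob_mod[OF X V]] unit_dec_closed[OF X] coun_closed[OF X] by simp
 have rr: "dI X c *[V] ract V v x = ract V (dI X c *[V] v) x" if "c <: I0 X" "x <: A X" "v <: V" for c x v
  by (rule lin_smult[OF ract_mlin(2)[OF X V lin_id that(2)], symmetric]) (intro i that)+
 have ll: "Co ?T V v (%v0 h. ?p (dI X c *[V] v0) h) = coact V (dI X c *[V] v)" if c: "c <: I0 X" and v: "v <: V" for c v
 proof -
  note dc = unit_dec_closed[OF X c]
  have "Co ?T V v (%v0 h. ?p (dI X c *[V] v0) h) = Co ?T V v (%v0 h. dI X c *[?T] ?p v0 h)"
   by (rule co_cong[OF X V v]) (simp add: lin_smult[OF pure_lin_left[OF Ob_mod[OF X V] alg_module[OF X X]] dc])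
  also have "... = dI X c *[?T] Co ?T V v ?p" by (rule smult_tsum[of k V "A X"]) (assumption|intro i v c)+
  also have "... = coact V (dI X c *[V] v)" by (simp only: co_pure[OF X V v] lin_smult[OF yd_coact_lin[OF X V] dc v])
  finally show ?thesis .
 qed
 have "lunit (D X) V : yd_maps k (H X) (TO X (I0 X) V) V"
 proof (rule tob_ydI[OF X I V V lunit_lin], unfold Let_def)
  fix c v assume m: "c <: I0 X" "v <: V"
  show "Sw2 V X X X x (%x1 x2. lunit (D X) V (P X (I0 X) V (ract (I0 X) c x1) (ract V v x2))) = ract V (lunit (D X) V (P X (I0 X) V c v)) x"
   if x: "x <: A X" for x
  proof -
   have "Sw2 V X X X x (%x1 x2. lunit (D X) V (P X (I0 X) V (ract (I0 X) c x1) (ract V v x2))) =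
    Sw2 V X X X x (%x1 x2. coun C X x1 *[V] (dI X c *[V] ract V v x2))"
    by (rule sw_cong[OF X X X x]) (simp add: lunit_pure ract_mlin(1)[OF X I m(1)] ract_mlin(1)[OF X V m(2)] unit_ract[OF X m(1)] r[OF m(1)])
   also have "... = dI X c *[V] ract V v x" by (rule sw_coun_left) (assumption|intro i m x)+
   finally show ?thesis by (simp add: lunit_pure m rr x)
  qed
  have "Co ?T (I0 X) c (%c0 g. Co ?T V v (%v0 h. ?p (lunit (D X) V (P X (I0 X) V c0 v0)) (mm X X g h))) =
   Co ?T (I0 X) c (%c0 g. Co ?T V v (%v0 h. ?p (dI X c0 *[V] v0) (mm X X g h)))"
   by (rule co_cong[OF X I m(1)], rule co_cong[OF X V m(2)]) (simp add: lunit_pure)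
  also have "... = Co ?T V v (%v0 h. ?p (dI X c *[V] v0) (mm X X \<one>[A X] h))"
   by (rule unit_co[OF X m(1) T]) (assumption|intro i m)+
  also have "... = Co ?T V v (%v0 h. ?p (dI X c *[V] v0) h)"
   by (rule co_cong[OF X V m(2)]) (simp add: alg_simps X)
  finally show "Co ?T (I0 X) c (%c0 g. Co ?T V v (%v0 h. ?p (lunit (D X) V (P X (I0 X) V c0 v0)) (mm X X g h))) =
   coact V (lunit (D X) V (P X (I0 X) V c v))" by (simp add: lunit_pure m ll)
 qed
 then show "lunit (D X) V \<in> homs (D X) (TO X (I0 X) V) V" by (simp add: D_simps[OF X] lunit_ext)
 have "runit (D X) V : yd_maps k (H X) (TO X V (I0 X)) V"
 proof (rule tob_ydI[OF X V I V runit_lin], unfold Let_def)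
  fix v c assume m: "v <: V" "c <: I0 X"
  show "Sw2 V X X X x (%x1 x2. runit (D X) V (P X V (I0 X) (ract V v x1) (ract (I0 X) c x2))) = ract V (runit (D X) V (P X V (I0 X) v c)) x"
   if x: "x <: A X" for x
  proof -
   have "Sw2 V X X X x (%x1 x2. runit (D X) V (P X V (I0 X) (ract V v x1) (ract (I0 X) c x2))) =
    Sw2 V X X X x (%x1 x2. coun C X x2 *[V] (dI X c *[V] ract V v x1))"
    by (rule sw_cong[OF X X X x]) (simp add: runit_pure ract_mlin(1)[OF X I m(2)] ract_mlin(1)[OF X V m(1)] unit_ract[OF X m(2)] r[OF m(2)])
   also have "... = dI X c *[V] ract V v x" by (rule sw_coun_right) (assumption|intro i m x)+
   finally show ?thesis by (simp add: runit_pure m rr x)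
  qed
  have "Co ?T V v (%v0 h. Co ?T (I0 X) c (%c0 g. ?p (runit (D X) V (P X V (I0 X) v0 c0)) (mm X X h g))) =
   Co ?T V v (%v0 h. Co ?T (I0 X) c (%c0 g. ?p (dI X c0 *[V] v0) (mm X X h g)))"
   by (rule co_cong[OF X V m(1)], rule co_cong[OF X I m(2)]) (simp add: runit_pure)
  also have "... = Co ?T V v (%v0 h. ?p (dI X c *[V] v0) (mm X X h \<one>[A X]))"
   by (rule co_cong[OF X V m(1)], rule unit_co[OF X m(2) T]) (assumption|intro i m)+
  also have "... = Co ?T V v (%v0 h. ?p (dI X c *[V] v0) h)"
   by (rule co_cong[OF X V m(1)]) (simp add: alg_simps X)
  finally show "Co ?T V v (%v0 h. Co ?T (I0 X) c (%c0 g. ?p (runit (D X) V (P X V (I0 X) v0 c0)) (mm X X h g))) =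
   coact V (runit (D X) V (P X V (I0 X) v c))" by (simp add: runit_pure m ll)
 qed
 then show "runit (D X) V \<in> homs (D X) (TO X V (I0 X)) V" by (simp add: D_simps[OF X] runit_ext)
qed

lemma unit_isos:
 shows lunit_iso: "iso_mor (D X) (TO X (I0 X) V) V (lunit (D X) V)" and runit_iso: "iso_mor (D X) (TO X V (I0 X)) V (runit (D X) V)"
proof -
 note I = unit_yd[OF X] note i = mlin X V
 interpret V: module k V by (rule Ob_mod[OF X V])
 let ?e = "eI X \<one>[k]"
 have e: "?e <: I0 X" by (rule unit_enc_closed[OF X]) simp
 have L: "(%v. P X (I0 X) V ?e v) : lin_maps k V (TO X (I0 X) V)" and R: "(%v. P X V (I0 X) v ?e) : lin_maps k V (TO X V (I0 X))"
  by (intro i e)+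
 have ce: "dI X c *[I0 X] ?e = c" if "c <: I0 X" for c by (rule unit_elem[OF X that])
 have 1: "lunit (D X) V (P X (I0 X) V ?e v) = v" "runit (D X) V (P X V (I0 X) v ?e) = v" if v: "v <: V" for v
  using v e by (simp_all add: lunit_pure runit_pure unit_dec_enc[OF X])
 have 2: "P X (I0 X) V ?e (lunit (D X) V x) = x" if x: "x <: TO X (I0 X) V" for x
 proof (rule tob_eq[OF X I V _ lin_comp[OF L lunit_lin] lin_id _ x])
  fix c v assume m: "c <: I0 X" "v <: V"
  note d = unit_dec_closed[OF X m(1)]
  show "P X (I0 X) V ?e (lunit (D X) V (P X (I0 X) V c v)) = P X (I0 X) V c v"
   by (simp only: lunit_pure[OF m] lin_smult[OF L d m(2)] lin_smult[OF tp_mlin(2)[OF X I V lin_id m(2)] d e, symmetric] ce[OF m(1)])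
 qed (intro i)
 have 3: "P X V (I0 X) (runit (D X) V x) ?e = x" if x: "x <: TO X V (I0 X)" for x
 proof (rule tob_eq[OF X V I _ lin_comp[OF R runit_lin] lin_id _ x])
  fix v c assume m: "v <: V" "c <: I0 X"
  note d = unit_dec_closed[OF X m(2)]
  show "P X V (I0 X) (runit (D X) V (P X V (I0 X) v c)) ?e = P X V (I0 X) v c"
   by (simp only: runit_pure[OF m(2,1)] lin_smult[OF R d m(1)] lin_smult[OF tp_mlin(3)[OF X V I lin_id m(1)] d e, symmetric] ce[OF m(2)])
 qed (intro i)
 show "iso_mor (D X) (TO X (I0 X) V) V (lunit (D X) V)"
  by (rule iso_morI[OF X tob_yd[OF X I V] V lunit_hom lin_closed[OF L] 2 1(1)])
 show "iso_mor (D X) (TO X V (I0 X)) V (runit (D X) V)"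
  by (rule iso_morI[OF X tob_yd[OF X V I] V runit_hom lin_closed[OF R] 3 1(2)])
qed

end

lemmas cat_lin = tmor_lin assoc_lin lunit_lin runit_lin ident_lin compose_lin
lemmas cat_eval = tmor_pure assoc_pure lunit_pure runit_pure compose_eq
lemmas cat_ext = tmor_ext assoc_ext lunit_ext runit_ext compose_extensional restrict_extensional

text \<open>The coherence axioms compare linear maps out of tensor products that are given by the same formula on pure
 tensors.\<close>

lemma YD_monoidal: "klinear_monoidal_category k (D X)"
proof (rule klinear_monoidal_category.intro[OF YD_klinear[OF X]], rule klinear_monoidal_category_axioms.intro)
 note [simp] = D_simps[OF X]
 note cm = tp_mlin(1)[OF X] tob_yd[OF X] unit_yd[OF X] Ob_mod[OF X]
 have hl: "f \<in> homs (D X) V W ==> f : lin_maps k V W" for f V W using yd_maps_lin[of f "H X" V W] by simp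
 have hc: "f \<in> homs (D X) V W ==> v <: V ==> f v <: W" for f V W v by (rule lin_closed[OF hl])
 show "tunit (D X) \<in> objs (D X)" using unit_yd[OF X] by simp
 fix V W assume "V \<in> objs (D X)" "W \<in> objs (D X)"
 then have V: "Ob X V" and W: "Ob X W" by auto
 note VW = tob_yd[OF X V W]
 show "tobj (D X) V W \<in> objs (D X)" using VW by simp
 show "tmor (D X) V V W W (ident (D X) V) (ident (D X) W) = ident (D X) (tobj (D X) V W)"
  unfolding D_simps[OF X]
  by (rule tob_eq2[OF V W Ob_mod[OF X VW]]) (intro cat_lin cat_ext mlin V W | simp add: cat_eval ident_lin cm V W)+
 show "iso_mor (D X) (tobj (D X) (tunit (D X)) V) V (lunit (D X) V)" "iso_mor (D X) (tobj (D X) V (tunit (D X))) V (runit (D X) V)"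
  using lunit_iso[OF V] runit_iso[OF V] by simp_all
 show "mcomp (D X) (tobj (D X) (tobj (D X) V (tunit (D X))) W) (tobj (D X) V (tobj (D X) (tunit (D X)) W)) (tobj (D X) V W)
    (tmor (D X) V V (tobj (D X) (tunit (D X)) W) W (ident (D X) V) (lunit (D X) W)) (assoc (D X) V (tunit (D X)) W) =
   tmor (D X) (tobj (D X) V (tunit (D X))) V W W (runit (D X) V) (ident (D X) W)"
  unfolding D_simps[OF X]
 proof (rule tob_eq3[OF V unit_yd[OF X] W Ob_mod[OF X VW]])
  fix v c w assume m: "v <: V" "c <: I0 X" "w <: W"
  note d = unit_dec_closed[OF X m(2)]
  have "P X V W v (dI X c *[W] w) = P X V W (dI X c *[V] v) w"
   using lin_smult[OF tp_mlin(3)[OF X V W lin_id m(1)] d m(3)] lin_smult[OF tp_mlin(2)[OF X V W lin_id m(3)] d m(1)] by simp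
  then show "compose (carrier (TO X (TO X V (I0 X)) W)) (tmor (D X) V V (TO X (I0 X) W) W (\<lambda>v\<in>carrier V. v) (lunit (D X) W)) (assoc (D X) V (I0 X) W)
    (P X (TO X V (I0 X)) W (P X V (I0 X) v c) w) =
   tmor (D X) (TO X V (I0 X)) V W W (runit (D X) V) (\<lambda>v\<in>carrier W. v) (P X (TO X V (I0 X)) W (P X V (I0 X) v c) w)"
   using m by (simp add: cat_eval cat_lin cm V W)
 qed (rule compose_lin tmor_lin assoc_lin lunit_lin runit_lin ident_lin tob_yd[OF X] unit_yd[OF X] V W | intro cat_ext mlin V W)+
 { fix V' W' assume "V' \<in> objs (D X)" "W' \<in> objs (D X)"
  then have V': "Ob X V'" and W': "Ob X W'" by auto
  note VW' = tob_yd[OF X V' W']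
  interpret T: module k "TO X V' W'" by (rule Ob_mod[OF X VW'])
  note M = hom_sp_simps[OF X]
  show "tmor (D X) V V' W W' : bilin_maps k (hom_sp (D X) V V') (hom_sp (D X) W W') (hom_sp (D X) (tobj (D X) V W) (tobj (D X) V' W'))"
  proof (rule bilin_mapsI; rule lin_mapsI; unfold M D_simps[OF X])
   fix f g c assume f: "f : yd_maps k (H X) V V' \<inter> extensional (carrier V)" and g: "g : yd_maps k (H X) W W' \<inter> extensional (carrier W)"
   note fl = yd_maps_lin[OF IntD1[OF f]] and gl = yd_maps_lin[OF IntD1[OF g]]
   show "tmor (D X) V V' W W' f g : yd_maps k (H X) (TO X V W) (TO X V' W') \<inter> extensional (carrier (TO X V W))"
    using tmor_hom[OF V V' W W', of f g] f g by simp
   then show "tmor (D X) V V' W W' f g : yd_maps k (H X) (TO X V W) (TO X V' W') \<inter> extensional (carrier (TO X V W))" .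
   note cl = lin_closed[OF fl] lin_closed[OF gl]
   note i = cat_ext tmor_lin restrict_lin mlin V W V' W' fl gl
   { assume c: "c <: k"
    have p: "P X V' W' (c *[V'] f v) (g w) = c *[TO X V' W'] P X V' W' (f v) (g w)"
     "P X V' W' (f v) (c *[W'] g w) = c *[TO X V' W'] P X V' W' (f v) (g w)" if "v <: V" "w <: W" for v w
     using lin_smult[OF tp_mlin(2)[OF X V' W' lin_id] c] lin_smult[OF tp_mlin(3)[OF X V' W' lin_id] c] cl that by simp_all
    have cf: "(\<lambda>v\<in>carrier V. c *[V'] f v) : lin_maps k V V'" and cg: "(\<lambda>v\<in>carrier W. c *[W'] g v) : lin_maps k W W'" by (intro i c)+
    show "tmor (D X) V V' W W' f (\<lambda>v\<in>carrier W. c *[W'] g v) = (\<lambda>v\<in>carrier (TO X V W). c *[TO X V' W'] tmor (D X) V V' W W' f g v)"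
     by (rule tob_eq2[OF V W T.module_axioms]) (intro i c cg | simp add: tmor_pure[OF V V' W W'] fl gl cg p cm V W)+
    show "tmor (D X) V V' W W' (\<lambda>v\<in>carrier V. c *[V'] f v) g = (\<lambda>v\<in>carrier (TO X V W). c *[TO X V' W'] tmor (D X) V V' W W' f g v)"
     by (rule tob_eq2[OF V W T.module_axioms]) (intro i c cf | simp add: tmor_pure[OF V V' W W'] fl gl cf p cm V W)+ }
   { fix g' assume "g' : yd_maps k (H X) W W' \<inter> extensional (carrier W)"
    then have gl': "g' : lin_maps k W W'" using yd_maps_lin by blast
    have cg: "(\<lambda>v\<in>carrier W. g v +[W'] g' v) : lin_maps k W W'" by (intro i gl')
    have p: "P X V' W' (f v) (g w +[W'] g' w) = P X V' W' (f v) (g w) +[TO X V' W'] P X V' W' (f v) (g' w)" if "v <: V" "w <: W" for v w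
     using lin_add[OF tp_mlin(3)[OF X V' W' lin_id]] cl lin_closed[OF gl'] that by simp
    show "tmor (D X) V V' W W' f (\<lambda>v\<in>carrier W. g v +[W'] g' v) =
     (\<lambda>v\<in>carrier (TO X V W). tmor (D X) V V' W W' f g v +[TO X V' W'] tmor (D X) V V' W W' f g' v)"
     by (rule tob_eq2[OF V W T.module_axioms]) (intro i gl' cg | simp add: tmor_pure[OF V V' W W'] fl gl gl' cg p cm V W)+ }
   fix f' assume "f' : yd_maps k (H X) V V' \<inter> extensional (carrier V)"
   then have fl': "f' : lin_maps k V V'" using yd_maps_lin by blast
   have cf: "(\<lambda>v\<in>carrier V. f v +[V'] f' v) : lin_maps k V V'" by (intro i fl')
   have p: "P X V' W' (f v +[V'] f' v) (g w) = P X V' W' (f v) (g w) +[TO X V' W'] P X V' W' (f' v) (g w)" if "v <: V" "w <: W" for v w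
    using lin_add[OF tp_mlin(2)[OF X V' W' lin_id]] cl lin_closed[OF fl'] that by simp
   show "tmor (D X) V V' W W' (\<lambda>v\<in>carrier V. f v +[V'] f' v) g =
    (\<lambda>v\<in>carrier (TO X V W). tmor (D X) V V' W W' f g v +[TO X V' W'] tmor (D X) V V' W W' f' g v)"
    by (rule tob_eq2[OF V W T.module_axioms]) (intro i fl' cf | simp add: tmor_pure[OF V V' W W'] fl gl fl' cf p cm V W)+
  qed
  { fix V'' W'' f f' g g' assume "V'' \<in> objs (D X)" "W'' \<in> objs (D X)" and h: "f \<in> homs (D X) V V'" "f' \<in> homs (D X) V' V''" "g \<in> homs (D X) W W'" "g' \<in> homs (D X) W' W''"
   then have V'': "Ob X V''" and W'': "Ob X W''" by auto
   note l0 = hl[OF h(1)] hl[OF h(2)] hl[OF h(3)] hl[OF h(4)] and c = hc[OF h(1)] hc[OF h(3)]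
   note l = l0 compose_lin[OF l0(1,2) Ob_mod[OF X V]] compose_lin[OF l0(3,4) Ob_mod[OF X W]]
   show "tmor (D X) V V'' W W'' (mcomp (D X) V V' V'' f' f) (mcomp (D X) W W' W'' g' g) =
    mcomp (D X) (tobj (D X) V W) (tobj (D X) V' W') (tobj (D X) V'' W'') (tmor (D X) V' V'' W' W'' f' g') (tmor (D X) V V' W W' f g)"
    unfolding D_simps[OF X]
    by (rule tob_eq2[OF V W Ob_mod[OF X tob_yd[OF X V'' W'']]])
     (rule compose_lin tmor_lin V W V' W' V'' W'' l | intro cat_ext mlin V W | simp add: cat_eval cat_lin l c cm V W V' W' V'' W'' )+ }
  { fix Z Z' f g h assume "Z \<in> objs (D X)" "Z' \<in> objs (D X)" and h: "f \<in> homs (D X) V V'" "g \<in> homs (D X) W W'" "h \<in> homs (D X) Z Z'"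
   then have Z: "Ob X Z" and Z': "Ob X Z'" by auto
   note l = hl[OF h(1)] hl[OF h(2)] hl[OF h(3)] and c = hc[OF h(1)] hc[OF h(2)] hc[OF h(3)]
   show "mcomp (D X) (tobj (D X) (tobj (D X) V W) Z) (tobj (D X) (tobj (D X) V' W') Z') (tobj (D X) V' (tobj (D X) W' Z'))
    (assoc (D X) V' W' Z') (tmor (D X) (tobj (D X) V W) (tobj (D X) V' W') Z Z' (tmor (D X) V V' W W' f g) h) =
   mcomp (D X) (tobj (D X) (tobj (D X) V W) Z) (tobj (D X) V (tobj (D X) W Z)) (tobj (D X) V' (tobj (D X) W' Z'))
    (tmor (D X) V V' (tobj (D X) W Z) (tobj (D X) W' Z') f (tmor (D X) W W' Z Z' g h)) (assoc (D X) V W Z)"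
    unfolding D_simps[OF X]
    by (rule tob_eq3[OF V W Z Ob_mod[OF X tob_yd[OF X V' tob_yd[OF X W' Z']]]])
     (rule compose_lin tmor_lin assoc_lin tob_yd[OF X] V W Z V' W' Z' l | intro cat_ext mlin V W Z | simp add: cat_eval cat_lin l c cm V W V' W' Z Z')+ } }
 { fix f assume h: "f \<in> homs (D X) V W"
  note l = hl[OF h] and c = hc[OF h]
  have s: "dI X c *[W] f v = f (dI X c *[V] v)" if "c <: I0 X" "v <: V" for c v
   using lin_smult[OF l unit_dec_closed[OF X that(1)] that(2)] by simp
  show "mcomp (D X) (tobj (D X) (tunit (D X)) V) (tobj (D X) (tunit (D X)) W) W (lunit (D X) W) (tmor (D X) (tunit (D X)) (tunit (D X)) V W (ident (D X) (tunit (D X))) f) =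
   mcomp (D X) (tobj (D X) (tunit (D X)) V) V W f (lunit (D X) V)"
   unfolding D_simps[OF X]
   by (rule tob_eq2[OF unit_yd[OF X] V Ob_mod[OF X W]])
    (rule compose_lin tmor_lin lunit_lin ident_lin unit_yd[OF X] V W l | intro cat_ext mlin V W | simp add: cat_eval cat_lin l c cm s V W)+
  show "mcomp (D X) (tobj (D X) V (tunit (D X))) (tobj (D X) W (tunit (D X))) W (runit (D X) W) (tmor (D X) V W (tunit (D X)) (tunit (D X)) f (ident (D X) (tunit (D X)))) =
   mcomp (D X) (tobj (D X) V (tunit (D X))) V W f (runit (D X) V)"
   unfolding D_simps[OF X]
   by (rule tob_eq2[OF V unit_yd[OF X] Ob_mod[OF X W]])
    (rule compose_lin tmor_lin runit_lin ident_lin unit_yd[OF X] V W l | intro cat_ext mlin V W | simp add: cat_eval cat_lin l c cm s V W)+ }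
 fix Z assume "Z \<in> objs (D X)"
 then have Z: "Ob X Z" by auto
 show "iso_mor (D X) (tobj (D X) (tobj (D X) V W) Z) (tobj (D X) V (tobj (D X) W Z)) (assoc (D X) V W Z)"
  using assoc_iso[OF V W Z] by simp
 fix G assume "G \<in> objs (D X)"
 then have G: "Ob X G" by auto
 show "mcomp (D X) (tobj (D X) (tobj (D X) (tobj (D X) V W) Z) G) (tobj (D X) (tobj (D X) V W) (tobj (D X) Z G)) (tobj (D X) V (tobj (D X) W (tobj (D X) Z G)))
    (assoc (D X) V W (tobj (D X) Z G)) (assoc (D X) (tobj (D X) V W) Z G) =
   mcomp (D X) (tobj (D X) (tobj (D X) (tobj (D X) V W) Z) G) (tobj (D X) V (tobj (D X) (tobj (D X) W Z) G)) (tobj (D X) V (tobj (D X) W (tobj (D X) Z G)))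
    (tmor (D X) V V (tobj (D X) (tobj (D X) W Z) G) (tobj (D X) W (tobj (D X) Z G)) (ident (D X) V) (assoc (D X) W Z G))
    (mcomp (D X) (tobj (D X) (tobj (D X) (tobj (D X) V W) Z) G) (tobj (D X) (tobj (D X) V (tobj (D X) W Z)) G) (tobj (D X) V (tobj (D X) (tobj (D X) W Z) G))
     (assoc (D X) V (tobj (D X) W Z) G)
     (tmor (D X) (tobj (D X) (tobj (D X) V W) Z) (tobj (D X) V (tobj (D X) W Z)) G G (assoc (D X) V W Z) (ident (D X) G)))"
  unfolding D_simps[OF X]
  by (rule tob_eq4[OF V W Z G Ob_mod[OF X tob_yd[OF X V tob_yd[OF X W tob_yd[OF X Z G]]]]])
   (rule compose_lin tmor_lin assoc_lin ident_lin tob_yd[OF X] V W Z G | intro cat_ext mlin V W Z G | simp add: cat_eval cat_lin cm V W Z G)+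
qed

end

end

section \<open>The cotensor product with \<open>\<C>(X,Y)\<close>\<close>

context cogroupoid
begin

lemma lin_sw: "[|X : ob C; Y : ob C; Z : ob C; x <: alg C X Y; module k U; module k U'; f : lin_maps k U U';
  !!a b. [|a <: alg C X Z; b <: alg C Z Y|] ==> \<beta> a b <: U|] ==>
  f (Sw2 U X Z Y x \<beta>) = Sw2 U' X Z Y x (%a b. f (\<beta> a b))"
 by (rule lin_tsum[OF alg_module alg_module cocomp_closed])

lemma lin_sw3:
 assumes ob: "X : ob C" "Z : ob C" "Z' : ob C" "Y : ob C" and x: "x <: alg C X Y" and U: "module k U" "module k U'"
  and f: "f : lin_maps k U U'"
  and \<beta>: "!!a b c. [|a <: alg C X Z; b <: alg C Z Z'; c <: alg C Z' Y|] ==> \<beta> a b c <: U"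
 shows "f (Sw3 U X Z Z' Y x \<beta>) = Sw3 U' X Z Z' Y x (%a b c. f (\<beta> a b c))"
proof -
 have "f (Sw3 U X Z Z' Y x \<beta>) = Sw2 U' X Z Y x (%a r. f (Sw2 U Z Z' Y r (\<beta> a)))"
  by (rule lin_sw) (assumption|intro ob x U f sw_closed \<beta>)+
 also have "... = Sw3 U' X Z Z' Y x (%a b c. f (\<beta> a b c))"
  by (rule sw_cong, (intro ob x)+, rule lin_sw) (assumption|intro ob U f \<beta>)+
 finally show ?thesis .
qed

text \<open>The sum over \<open>a\<close> enters the nested sums one at a time.\<close>

lemma sw_swap_six:
 assumes ob: "P : ob C" "Q : ob C" "R : ob C" "X : ob C" "Y : ob C" "S : ob C" "T : ob C" "K : ob C" "L : ob C"
  and a: "a <: alg C P R" and x: "x <: alg C X T" and U: "module k U"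
  and \<beta>: "!!b c d e f p q. [|b <: alg C X Y; c <: alg C Y S; d <: alg C S K; e <: alg C K L; f <: alg C L T;
   p <: alg C P Q; q <: alg C Q R|] ==> \<beta> b c d e f p q <: U"
 shows "Sw2 U P Q R a (%p q. Sw2 U X Y T x (%b r. Sw4 U Y S K L T r (%c d e f. \<beta> b c d e f p q))) =
  Sw2 U X Y T x (%b r. Sw4 U Y S K L T r (%c d e f. Sw2 U P Q R a (%p q. \<beta> b c d e f p q)))"
proof -
 note i = sw_closed ob a x U \<beta>
 have "Sw2 U P Q R a (%p q. Sw2 U X Y T x (%b r. Sw4 U Y S K L T r (%c d e f. \<beta> b c d e f p q))) =
  Sw2 U X Y T x (%b r. Sw2 U P Q R a (%p q. Sw4 U Y S K L T r (%c d e f. \<beta> b c d e f p q)))"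
  by (rule sw_swap) (assumption|intro i)+
 also have "... = Sw2 U X Y T x (%b r. Sw2 U Y S T r (%c r. Sw2 U P Q R a (%p q. Sw3 U S K L T r (%d e f. \<beta> b c d e f p q))))"
  by (rule sw_cong, (intro ob x)+, rule sw_swap) (assumption|intro i)+
 also have "... = Sw2 U X Y T x (%b r. Sw3 U Y S K T r (%c d r. Sw2 U P Q R a (%p q. Sw2 U K L T r (%e f. \<beta> b c d e f p q))))"
  by (rule sw_cong, (intro ob x)+, rule sw_cong, (assumption|intro ob)+, rule sw_swap) (assumption|intro i)+
 also have "... = Sw2 U X Y T x (%b r. Sw4 U Y S K L T r (%c d e f. Sw2 U P Q R a (%p q. \<beta> b c d e f p q)))"
  by (rule sw_cong, (intro ob x)+, rule sw_cong, (assumption|intro ob)+, rule sw_cong, (assumption|intro ob)+, rule sw_swap) (assumption|intro i)+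
 finally show ?thesis .
qed

lemma sw_split_first3:
 assumes ob: "Z1 : ob C" "Z2 : ob C" "Z3 : ob C" "Z4 : ob C" "Y : ob C" and s: "s <: alg C Z1 Y" and U: "module k U"
  and \<gamma>: "\<gamma> : quadrilin_maps k (alg C Z1 Z2) (alg C Z2 Z3) (alg C Z3 Z4) (alg C Z4 Y) U"
 shows "Sw2 U Z1 Z4 Y s (%p f. Sw3 U Z1 Z2 Z3 Z4 p (%c d e. \<gamma> c d e f)) = Sw4 U Z1 Z2 Z3 Z4 Y s \<gamma>"
proof -
 note G = quadrilin_mapsD[OF \<gamma>]
 have "Sw2 U Z1 Z4 Y s (%p f. Sw3 U Z1 Z2 Z3 Z4 p (%c d e. \<gamma> c d e f)) =
  Sw3 U Z1 Z2 Z4 Y s (%c q f. Sw2 U Z2 Z3 Z4 q (%d e. \<gamma> c d e f))"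
  by (rule sw_coassoc) (assumption|intro ob s U mlin | rule G)+
 also have "... = Sw4 U Z1 Z2 Z3 Z4 Y s \<gamma>"
  by (rule sw_cong, (intro ob s)+, rule sw_coassoc) (assumption|intro ob U mlin | rule G)+
 finally show ?thesis .
qed

end

context cogroupoid_universe
begin

lemmas [mlin del] = Ob_mod tob_yd tp_mlin unit_yd unit_dec_mlin unit_dec_closed unit_enc_closed ident_lin

end

text \<open>The cotensor product \<open>V \<box> \<C>(X,Y)\<close>, for which the following abbreviations are used: \<open>cM\<close> is its space, inside
 \<open>cT = V \<otimes> \<C>(X,Y)\<close>, and \<open>cQ = V \<otimes> (\<C>(X,X) \<otimes> \<C>(X,Y))\<close> receives the two maps whose equaliser it is; \<open>cN\<close> is the
 Yetter--Drinfeld module over \<open>\<C>(Y,Y)\<close>.\<close>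

locale cotensor_product = cogroupoid_universe k C univ
 for k :: "('k, 'r) ring_scheme" and C :: "('k, 'a, 'o) cogroupoid_data" and univ :: "'u itself" +
 fixes X Y and V :: "('k, 'a, 'u) yd_data"
 assumes X: "X : ob C" and Y: "Y : ob C" and V: "Ob X V"
begin

abbreviation (input) "cA \<equiv> alg C X Y"
abbreviation (input) "cT \<equiv> tensor k V (alg C X Y)"
abbreviation (input) "cQ \<equiv> tensor k V (tensor k (alg C X X) (alg C X Y))"
abbreviation (input) "cM \<equiv> cotensor k (alg C X X) V (coact V) (alg C X Y) (cocomp C X Y X)"

lemmas cm = yd_mlin[OF X V] mlin X Y
lemmas cmods = yd_mod[OF X V] alg_module[OF X Y]

lemma cT_mod: "module k cT" and cQ_mod: "module k cQ"
 by (intro cm)+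

lemma ct_closed: "[|t <: cT; module k U; !!a b. [|a <: V; b <: cA|] ==> \<beta> a b <: U|] ==> tsum k U t \<beta> <: U"
 by (rule tsum_closed[OF cmods])
lemma ct_lin_arg: "[|t <: cT; module k U; !!a b. [|a <: V; b <: cA|] ==> (%z. \<beta> z a b) : lin_maps k B U|] ==>
  (%z. tsum k U t (\<beta> z)) : lin_maps k B U"
 by (rule lin_tsum_arg[OF cmods])
lemma ct_lin: "[|module k U; E : lin_maps k B cT; \<beta> : bilin_maps k V cA U|] ==> (%z. tsum k U (E z) \<beta>) : lin_maps k B U"
 by (rule lin_tsum_tensor[OF cmods])
lemma ct_cong: "[|t <: cT; !!a b. [|a <: V; b <: cA|] ==> \<beta> a b = \<gamma> a b|] ==> tsum k U t \<beta> = tsum k U t \<gamma>"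
 by (rule tsum_cong'[OF cmods])
lemma ct_sw_swap: "[|t <: cT; Z : ob C; Z' : ob C; Z'' : ob C; module k U; y <: alg C Z Z'';
  !!a b c d. [|a <: V; b <: cA; c <: alg C Z Z'; d <: alg C Z' Z''|] ==> \<beta> a b c d <: U|] ==>
  tsum k U t (%a b. Sw2 U Z Z' Z'' y (\<beta> a b)) = Sw2 U Z Z' Z'' y (%c d. tsum k U t (%a b. \<beta> a b c d))"
 by (rule tsum_swap[OF cmods _ _ alg_module alg_module cocomp_closed])
lemma ct_ct: "[|t <: cT; module k U; !!a b. [|a <: V; b <: cA|] ==> \<gamma> a b <: cT; \<beta> : bilin_maps k V cA U|] ==>
  tsum k U (tsum k cT t \<gamma>) \<beta> = tsum k U t (%a b. tsum k U (\<gamma> a b) \<beta>)"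
 by (rule tsum_tsum[OF cmods _ _ cmods])
lemma ct_pure: "[|module k U; \<beta> : bilin_maps k V cA U; v <: V; a <: cA|] ==> tsum k U (pure k V cA v a) \<beta> = \<beta> v a"
 by (rule tsum_pure[OF cmods])
lemma ct_self: "t <: cT ==> tsum k cT t (pure k V cA) = t"
 by (rule tsum_self[OF cmods])
lemma ct_comp: "[|t <: cT; module k U; f : lin_maps k cT U|] ==> f t = tsum k U t (%v a. f (pure k V cA v a))"
 using lin_tsum[OF cmods, of t cT U f "pure k V cA"] pure_closed[OF cmods] by (simp add: ct_self cT_mod)

lemmas cr = cm ct_closed ct_lin_arg ct_lin

subsection \<open>The cotensor product as an equaliser\<close>

definition cot_left where "cot_left t = tsum k cQ t (%v a. Co cQ V v (%v0 h. pure k V (tensor k (alg C X X) cA) v0 (pure k (alg C X X) cA h a)))"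
definition cot_right where "cot_right t = tsum k cQ t (%v a. Sw2 cQ X X Y a (%h b. pure k V (tensor k (alg C X X) cA) v (pure k (alg C X X) cA h b)))"

lemma cot_left_lin: "cot_left : lin_maps k cT cQ"
 unfolding cot_left_def[abs_def] by (assumption|intro cr cQ_mod)+
lemma cot_right_lin: "cot_right : lin_maps k cT cQ"
 unfolding cot_right_def[abs_def] by (assumption|intro cr cQ_mod)+

lemma cot_left_pure:
 assumes B: "module k B" and m: "v <: V" "a <: cA" "b <: B"
 shows "pure k cQ B (cot_left (pure k V cA v a)) b =
  Co (tensor k cQ B) V v (%v0 h. pure k cQ B (pure k V (tensor k (alg C X X) cA) v0 (pure k (alg C X X) cA h a)) b)"
proof -
 have "cot_left (pure k V cA v a) = Co cQ V v (%v0 h. pure k V (tensor k (alg C X X) cA) v0 (pure k (alg C X X) cA h a))"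
  unfolding cot_left_def by (rule ct_pure) (assumption|intro cr m)+
 then show ?thesis
  by (simp only:) (rule lin_tsum[OF cmods(1) alg_module[OF X X] _ cQ_mod tensor_module[OF cQ_mod B]], (assumption|intro cr B m)+)
qed

lemma cot_right_pure:
 assumes B: "module k B" and m: "v <: V" "a <: cA" "b <: B"
 shows "pure k cQ B (cot_right (pure k V cA v a)) b =
  Sw2 (tensor k cQ B) X X Y a (%h c. pure k cQ B (pure k V (tensor k (alg C X X) cA) v (pure k (alg C X X) cA h c)) b)"
proof -
 have "cot_right (pure k V cA v a) = Sw2 cQ X X Y a (%h c. pure k V (tensor k (alg C X X) cA) v (pure k (alg C X X) cA h c))"
  unfolding cot_right_def by (rule ct_pure) (assumption|intro cr m)+
 then show ?thesis
  by (simp only:) (rule lin_tsum[OF alg_module[OF X X] cmods(2) _ cQ_mod tensor_module[OF cQ_mod B]], (assumption|intro cr B m)+)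
qed

lemma cM_simps: "(\<oplus>\<^bsub>cM\<^esub>) = (\<oplus>\<^bsub>cT\<^esub>)" "(\<odot>\<^bsub>cM\<^esub>) = (\<odot>\<^bsub>cT\<^esub>)" "\<zero>[cM] = \<zero>[cT]"
 by (simp_all add: cotensor_def)

lemma cM_iff0: "t <: cM \<longleftrightarrow> t <: cT \<and>
  tensor_assoc k V (alg C X X) cA (tensor_map k (tensor k V (alg C X X)) cA (coact V) (%w. w) t) =
  tensor_map k V (tensor k (alg C X X) cA) (%v. v) (cocomp C X Y X) t"
 and cM_iff: "t <: cM \<longleftrightarrow> t <: cT \<and> cot_left t = cot_right t"
proof -
 interpret Q: module k cQ by (rule cQ_mod)
 have l: "tensor_assoc k V (alg C X X) cA (tensor_map k (tensor k V (alg C X X)) cA (coact V) (%w. w) t) = cot_left t" if "t <: cT"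
  unfolding cot_left_def by (rule assoc_map_eq[OF cmods(1) alg_module[OF X X] cmods(2,1) yd_coact_lin[OF X V] that])
 have r: "tensor_map k V (tensor k (alg C X X) cA) (%v. v) (cocomp C X Y X) t = cot_right t" if "t <: cT"
  unfolding cot_right_def by (rule map_right_eq[OF cmods(1) alg_module[OF X X] cmods(2,2) cocomp_lin[OF X Y X] that])
 have "t <: cM \<longleftrightarrow> t <: cT \<and> cot_left t \<ominus>\<^bsub>cQ\<^esub> cot_right t = \<zero>[cQ]"
  using l r by (auto simp: cotensor_def a_kernel_def')
 also have "... \<longleftrightarrow> t <: cT \<and> cot_left t = cot_right t"
  using lin_closed[OF cot_left_lin, of t] lin_closed[OF cot_right_lin, of t] Q.eq_if_diff_zero[of "cot_left t" "cot_right t"] Q.r_neg[of "cot_right t"]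
  unfolding a_minus_def by metis
 finally show "t <: cM \<longleftrightarrow> t <: cT \<and> cot_left t = cot_right t" .
 then show "t <: cM \<longleftrightarrow> t <: cT \<and>
  tensor_assoc k V (alg C X X) cA (tensor_map k (tensor k V (alg C X X)) cA (coact V) (%w. w) t) =
  tensor_map k V (tensor k (alg C X X) cA) (%v. v) (cocomp C X Y X) t" using l r by auto
qed

lemma cM_T: "t <: cM ==> t <: cT"
 by (simp add: cM_iff)

text \<open>The defining equation of the cotensor product, evaluated against a trilinear map: in a sum over its elements,
 \<open>v\<^sub>0 \<otimes> v\<^sub>1 \<otimes> a\<close> and \<open>v \<otimes> a\<^sub>1 \<otimes> a\<^sub>2\<close> are interchangeable.\<close>

lemma cM_cond:
 assumes t: "t <: cM" and U: "module k U" and \<beta>: "\<beta> : trilin_maps k V (alg C X X) cA U"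
 shows "tsum k U t (%v a. Co U V v (%v0 h. \<beta> v0 h a)) = tsum k U t (%v a. Sw2 U X X Y a (\<beta> v))"
 using t unfolding cM_iff0
 by (intro tsum_trilin_eq[OF cmods(1) alg_module[OF X X] cmods(2,1,2) U yd_coact_lin[OF X V] _ cocomp_lin[OF X Y X] _ _ \<beta>]) auto

lemma cM_mod: "module k cM"
proof -
 interpret T: module k cT by (rule cT_mod)
 interpret Q: module k cQ by (rule cQ_mod)
 note l = cot_left_lin and r = cot_right_lin
 have s: "submodule (carrier cM) k cT"
  by (rule T.submoduleI) (auto simp: cM_iff lin_zero[OF cT_mod cQ_mod l] lin_zero[OF cT_mod cQ_mod r] lin_inv[OF cT_mod cQ_mod l]
   lin_inv[OF cT_mod cQ_mod r] lin_add[OF l] lin_add[OF r] lin_smult[OF l] lin_smult[OF r])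
 have "same_module cM (cT\<lparr>carrier := carrier cM\<rparr>)" by (simp add: same_module_def cM_simps)
 then show ?thesis by (rule same_module_module[OF _ submodule.submodule_is_module[OF s cT_mod]])
qed

lemma cM_restrict_lin: "f : lin_maps k cT U ==> f : lin_maps k cM U"
 using cM_T by (auto simp: lin_maps_def cM_simps)

lemma cM_into_lin: "[|f : lin_maps k B cT; !!x. x <: B ==> f x <: cM|] ==> f : lin_maps k B cM"
 by (auto simp: lin_maps_def cM_simps)

lemma cM_incl: "(%x. x) : lin_maps k cM cT"
 by (rule cM_restrict_lin[OF lin_id])

lemma cM_lin_T: "E : lin_maps k B cM ==> E : lin_maps k B cT"
 by (rule lin_comp[OF cM_incl])

definition cot_proj where "cot_proj = (SOME r. \<exists>\<psi>. equaliser_projection k cT cQ cot_left cot_right r \<psi>)"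

lemma cot_proj_ex: "\<exists>\<psi>. equaliser_projection k cT cQ cot_left cot_right cot_proj \<psi>"
 unfolding cot_proj_def by (rule someI_ex[OF equaliser_projection_exists[OF base_field cT_mod cQ_mod cot_left_lin cot_right_lin]])

lemma cot_proj_lin_T: "cot_proj : lin_maps k cT cT"
 and cot_proj_closed: "t <: cT ==> cot_proj t <: cM"
 and cot_proj_id: "t <: cM ==> cot_proj t = t"
 using cot_proj_ex lin_closed[of cot_proj k cT cT t] unfolding equaliser_projection_def cM_iff by auto

lemma cot_proj_lin: "cot_proj : lin_maps k cT cM"
 by (rule cM_into_lin[OF cot_proj_lin_T cot_proj_closed])

lemma cot_proj_mlin: "E : lin_maps k B cT ==> (%z. cot_proj (E z)) : lin_maps k B cM"
 by (rule lin_comp[OF cot_proj_lin])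

text \<open>For \<open>s\<close> in \<open>(V \<otimes> \<C>(X,Y)) \<otimes> B\<close> that satisfies the equation of the cotensor product in its first factor,
 projecting this factor changes nothing.\<close>

lemma cot_proj_tensor:
 assumes B: "module k B" and U: "module k U" and s: "s <: tensor k cT B" and \<beta>: "\<beta> : bilin_maps k cT B U"
  and eq: "tsum k (tensor k cQ B) s (%p b. pure k cQ B (cot_left p) b) = tsum k (tensor k cQ B) s (%p b. pure k cQ B (cot_right p) b)"
 shows "tsum k U s (%p b. \<beta> (cot_proj p) b) = tsum k U s \<beta>"
proof -
 obtain \<psi> where \<psi>: "equaliser_projection k cT cQ cot_left cot_right cot_proj \<psi>" using cot_proj_ex by blast
 show ?thesis
  by (rule tsum_equaliser_projection[OF \<psi> cT_mod cQ_mod cT_mod B U cot_left_lin cot_right_lin s B _ _ eq \<beta>])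
qed

subsection \<open>Its action and coaction\<close>

definition cot_act where "cot_act t b = Sw3 cT Y X X Y b (%b1 b2 b3. tsum k cT t (%v a. pure k V cA (ract V v b2) (mm X Y (mm X Y (anti C Y X b1) a) b3)))"

abbreviation (input) "cN \<equiv> cotensor_yd k C X Y V"

lemma cN_same: "same_module cN cM"
 by (simp add: cotensor_yd_def Let_def)

lemma cN_ract:
 assumes t: "t <: cT" and b: "b <: alg C Y Y"
 shows "ract cN t b = cot_act t b"
proof -
 have "ract cN t b = sweedler k cT (cocomp C Y Y X b) (%b1 b'. sweedler k cT (cocomp C X Y X b') (%b2 b3.
       tensor_map k V cA (%v. ract V v b2) (%a. mm X Y (mm X Y (anti C Y X b1) a) b3) t))"
  by (simp add: cotensor_yd_def Let_def yd_data.defs module.defs)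
 also have "... = cot_act t b"
  unfolding cot_act_def
 proof (rule sweedler_eq_tsum_cong[of k "alg C Y X" "alg C X Y"], (intro cr b)+)
  show "(%b1 b'. Sw2 cT X X Y b' (%b2 b3. tsum k cT t (%v a. pure k V cA (ract V v b2) (mm X Y (mm X Y (anti C Y X b1) a) b3))))
   : bilin_maps k (alg C Y X) cA cT" by (assumption|intro cr t)+
  fix b1 b' assume m: "b1 <: alg C Y X" "b' <: cA"
  show "sweedler k cT (cocomp C X Y X b') (%b2 b3. tensor_map k V cA (%v. ract V v b2) (%a. mm X Y (mm X Y (anti C Y X b1) a) b3) t) =
   Sw2 cT X X Y b' (%b2 b3. tsum k cT t (%v a. pure k V cA (ract V v b2) (mm X Y (mm X Y (anti C Y X b1) a) b3)))"
   by (rule sweedler_eq_tsum_cong[of k "alg C X X" "alg C X Y"], (intro cr m)+, rule tensor_map_eq[of k V cA]) (assumption|intro cr t m)+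
 qed
 finally show ?thesis .
qed

lemma cot_act_lin1: "b <: alg C Y Y ==> (%t. cot_act t b) : lin_maps k cT cT"
 and cot_act_lin2: "t <: cT ==> cot_act t : lin_maps k (alg C Y Y) cT"
 unfolding cot_act_def[abs_def] by (assumption|intro cr)+

lemma cot_act_closed: "[|t <: cT; b <: alg C Y Y|] ==> cot_act t b <: cT"
 by (rule lin_closed[OF cot_act_lin1])

lemma cot_act_eval:
 assumes t: "t <: cT" and b: "b <: alg C Y Y" and U: "module k U" and \<beta>: "\<beta> : bilin_maps k V cA U"
 shows "tsum k U (cot_act t b) \<beta> = tsum k U t (%v a. Sw3 U Y X X Y b (%b1 b2 b3. \<beta> (ract V v b2) (mm X Y (mm X Y (anti C Y X b1) a) b3)))"
proof -
 note Bi = bilin_maps_left[OF \<beta>] bilin_maps_right[OF \<beta>] lin_comp[OF bilin_maps_left[OF \<beta>]] lin_comp[OF bilin_maps_right[OF \<beta>]] bilin_closed[OF \<beta>]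
 let ?F = "%b1 b2 b3 v a. pure k V cA (ract V v b2) (mm X Y (mm X Y (anti C Y X b1) a) b3)"
 let ?G = "%b1 b2 b3 v a. \<beta> (ract V v b2) (mm X Y (mm X Y (anti C Y X b1) a) b3)"
 have "tsum k U (cot_act t b) \<beta> = Sw2 U Y X Y b (%b1 r. tsum k U (Sw2 cT X X Y r (%b2 b3. tsum k cT t (?F b1 b2 b3))) \<beta>)"
  unfolding cot_act_def by (rule tsum_tsum[OF alg_module[OF Y X] cmods(2) _ U cmods _ \<beta>]) (assumption|intro cr b t)+
 also have "... = Sw2 U Y X Y b (%b1 r. Sw2 U X X Y r (%b2 b3. tsum k U (tsum k cT t (?F b1 b2 b3)) \<beta>))"
  by (rule sw_cong, (intro X Y b)+, rule tsum_tsum[OF alg_module[OF X X] cmods(2) _ U cmods _ \<beta>]) (assumption|intro cr t)+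
 also have "... = Sw3 U Y X X Y b (%b1 b2 b3. tsum k U t (?G b1 b2 b3))"
 proof (rule sw_cong, (intro X Y b)+, rule sw_cong, (assumption|intro X Y)+)
  fix b1 r b2 b3 assume m: "b1 <: alg C Y X" "b2 <: alg C X X" "b3 <: cA"
  have "tsum k U (tsum k cT t (?F b1 b2 b3)) \<beta> = tsum k U t (%v a. tsum k U (?F b1 b2 b3 v a) \<beta>)"
   by (rule ct_ct[OF t U _ \<beta>]) (assumption|intro cr m)+
  also have "... = tsum k U t (?G b1 b2 b3)"
   by (rule ct_cong[OF t], rule ct_pure[OF U \<beta>]) (assumption|intro cr m)+
  finally show "tsum k U (tsum k cT t (?F b1 b2 b3)) \<beta> = ..." .
 qed
 also have "... = Sw2 U Y X Y b (%b1 r. tsum k U t (%v a. Sw2 U X X Y r (%b2 b3. ?G b1 b2 b3 v a)))"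
  by (rule sw_cong, (intro X Y b)+, rule ct_sw_swap[OF t, symmetric]) (assumption|intro cr U Bi)+
 also have "... = tsum k U t (%v a. Sw3 U Y X X Y b (%b1 b2 b3. ?G b1 b2 b3 v a))"
  by (rule ct_sw_swap[OF t, symmetric]) (assumption|intro cr U Bi b)+
 finally show ?thesis .
qed

lemma cot_act_one:
 assumes t: "t <: cT" shows "cot_act t \<one>[alg C Y Y] = t"
proof -
 have p: "pure k V cA : bilin_maps k V cA cT" by (rule pure_bilin[OF cmods])
 have o: "\<one>[alg C Y Y] <: alg C Y Y" by (intro cr)
 have "cot_act t \<one>[alg C Y Y] = tsum k cT (cot_act t \<one>[alg C Y Y]) (pure k V cA)"
  by (rule ct_self[OF cot_act_closed[OF t o], symmetric])
 also have "... = tsum k cT t (%v a. Sw3 cT Y X X Y \<one>[alg C Y Y] (%b1 b2 b3. pure k V cA (ract V v b2) (mm X Y (mm X Y (anti C Y X b1) a) b3)))"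
  by (rule cot_act_eval[OF t o cT_mod p])
 also have "... = tsum k cT t (pure k V cA)"
 proof (rule ct_cong[OF t])
  fix v a assume m: "v <: V" "a <: cA"
  have "Sw3 cT Y X X Y \<one>[alg C Y Y] (%b1 b2 b3. pure k V cA (ract V v b2) (mm X Y (mm X Y (anti C Y X b1) a) b3)) =
   Sw2 cT X X Y \<one>[cA] (%b2 b3. pure k V cA (ract V v b2) (mm X Y (mm X Y (anti C Y X \<one>[alg C Y X]) a) b3))"
   by (rule sw_one) (assumption|intro cr m)+
  also have "... = pure k V cA (ract V v \<one>[alg C X X]) (mm X Y (mm X Y (anti C Y X \<one>[alg C Y X]) a) \<one>[cA])"
   by (rule sw_one) (assumption|intro cr m)+
  also have "... = pure k V cA v a"
   using yd_module.ract_one[OF V m(1)] by (simp add: anti_one[OF Y X] alg_simps X Y m)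
  finally show "Sw3 cT Y X X Y \<one>[alg C Y Y] (%b1 b2 b3. pure k V cA (ract V v b2) (mm X Y (mm X Y (anti C Y X b1) a) b3)) = ..." .
 qed
 also have "... = t" by (rule ct_self[OF t])
 finally show ?thesis .
qed

text \<open>By multiplicativity of the comultiplications and \<open>S(bc) = S(c) S(b)\<close>.\<close>

lemma cot_act_mult:
 assumes t: "t <: cT" and b: "b <: alg C Y Y" and c: "c <: alg C Y Y"
 shows "cot_act t (mm Y Y b c) = cot_act (cot_act t b) c"
proof -
 have p: "pure k V cA : bilin_maps k V cA cT" by (rule pure_bilin[OF cmods])
 have o: "mm Y Y b c <: alg C Y Y" by (intro cr b c)
 note tb = cot_act_closed[OF t b]
 let ?F = "%v a b1 b2 b3. pure k V cA (ract V v b2) (mm X Y (mm X Y (anti C Y X b1) a) b3)"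
 let ?G = "%v a b1 b2 b3 c1 c2 c3. ?F v a (mm Y X b1 c1) (mm X X b2 c2) (mm X Y b3 c3)"
 have "cot_act t (mm Y Y b c) = tsum k cT (cot_act t (mm Y Y b c)) (pure k V cA)"
  by (rule ct_self[OF cot_act_closed[OF t o], symmetric])
 also have "... = tsum k cT t (%v a. Sw3 cT Y X X Y (mm Y Y b c) (?F v a))"
  by (rule cot_act_eval[OF t o cT_mod p])
 also have "... = tsum k cT t (%v a. Sw3 cT Y X X Y b (%b1 b2 b3. Sw3 cT Y X X Y c (?F (ract V v b2) (mm X Y (mm X Y (anti C Y X b1) a) b3))))"
 proof (rule ct_cong[OF t])
  fix v a assume m: "v <: V" "a <: cA"
  have "Sw3 cT Y X X Y (mm Y Y b c) (?F v a) =
   Sw2 cT Y X Y b (%b1 r. Sw2 cT Y X Y c (%c1 q. Sw2 cT X X Y (mm X Y r q) (?F v a (mm Y X b1 c1))))"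
   by (rule sw_mult) (assumption|intro cr m b c)+
  also have "... = Sw2 cT Y X Y b (%b1 r. Sw2 cT Y X Y c (%c1 q. Sw2 cT X X Y r (%b2 b3. Sw2 cT X X Y q (%c2 c3. ?G v a b1 b2 b3 c1 c2 c3))))"
   by (rule sw_cong, (intro X Y b)+, rule sw_cong, (intro X Y c)+, rule sw_mult) (assumption|intro cr m)+
  also have "... = Sw3 cT Y X X Y b (%b1 b2 b3. Sw3 cT Y X X Y c (%c1 c2 c3. ?G v a b1 b2 b3 c1 c2 c3))"
   by (rule sw_cong, (intro X Y b)+, rule sw_swap) (assumption|intro cr m c)+
  also have "... = Sw3 cT Y X X Y b (%b1 b2 b3. Sw3 cT Y X X Y c (?F (ract V v b2) (mm X Y (mm X Y (anti C Y X b1) a) b3)))"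
   by (rule sw_cong, (intro X Y b)+, rule sw_cong, (assumption|intro X Y)+, rule sw_cong, (intro X Y c)+, rule sw_cong, (assumption|intro X Y)+)
    (use yd_module.ract_mult[OF V m(1)] in \<open>simp add: anti_mult[OF Y X] alg_simps X Y m\<close>)
  finally show "Sw3 cT Y X X Y (mm Y Y b c) (?F v a) = ..." .
 qed
 also have "... = tsum k cT (cot_act t b) (%v a. Sw3 cT Y X X Y c (?F v a))"
  by (rule cot_act_eval[OF t b cT_mod, symmetric]) (assumption|intro cr c)+
 also have "... = tsum k cT (cot_act (cot_act t b) c) (pure k V cA)"
  by (rule cot_act_eval[OF tb c cT_mod p, symmetric])
 also have "... = cot_act (cot_act t b) c" by (rule ct_self[OF cot_act_closed[OF tb c]])
 finally show ?thesis .
qed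

text \<open>The compatibility condition of \<open>V\<close> expands the coaction at \<open>v \<leftarrow> b\<^sub>2\<close>, the equation of the cotensor product turns
 \<open>v\<^sub>0 \<otimes> v\<^sub>1 \<otimes> a\<close> into \<open>v \<otimes> a\<^sub>1 \<otimes> a\<^sub>2\<close>, and the result is the comultiplication of \<open>S(b\<^sub>1) a b\<^sub>3\<close>.\<close>

lemma cot_act_cM:
 assumes t: "t <: cM" and b: "b <: alg C Y Y" shows "cot_act t b <: cM"
proof -
 note tT = cM_T[OF t] and U = cQ_mod
 let ?p = "%v h a. pure k V (tensor k (alg C X X) cA) v (pure k (alg C X X) cA h a)"
 let ?S = "anti C Y X" and ?SX = "anti C X X"
 let ?N = "%v g a b1 x1 x2 x3 b3. ?p (ract V v x2) (mm X X (mm X X (?SX x1) g) x3) (mm X Y (mm X Y (?S b1) a) b3)"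
 have "cot_left (cot_act t b) = tsum k cQ t (%v a. Sw3 cQ Y X X Y b (%b1 b2 b3. Co cQ V (ract V v b2) (%v0 h. ?p v0 h (mm X Y (mm X Y (?S b1) a) b3))))"
  unfolding cot_left_def by (rule cot_act_eval[OF tT b U]) (assumption|intro cr)+
 also have "... = tsum k cQ t (%v a. Co cQ V v (%v0 g. Sw3 cQ Y X X Y b (%b1 b2 b3. Sw3 cQ X X X X b2 (%x1 x2 x3. ?N v0 g a b1 x1 x2 x3 b3))))"
 proof (rule ct_cong[OF tT])
  fix v a assume m: "v <: V" "a <: cA"
  have "Sw3 cQ Y X X Y b (%b1 b2 b3. Co cQ V (ract V v b2) (%v0 h. ?p v0 h (mm X Y (mm X Y (?S b1) a) b3))) =
   Sw3 cQ Y X X Y b (%b1 b2 b3. Co cQ V v (%v0 g. Sw3 cQ X X X X b2 (%x1 x2 x3. ?N v0 g a b1 x1 x2 x3 b3)))"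
   by (rule sw_cong, (intro X Y b)+, rule sw_cong, (assumption|intro X Y)+, rule co_ract[OF X V m(1)]) (assumption|intro cr m)+
  also have "... = Sw2 cQ Y X Y b (%b1 r. Co cQ V v (%v0 g. Sw2 cQ X X Y r (%b2 b3. Sw3 cQ X X X X b2 (%x1 x2 x3. ?N v0 g a b1 x1 x2 x3 b3))))"
   by (rule sw_cong, (intro X Y b)+, rule co_sw_swap[OF X V, symmetric]) (assumption|intro cr m)+
  also have "... = Co cQ V v (%v0 g. Sw3 cQ Y X X Y b (%b1 b2 b3. Sw3 cQ X X X X b2 (%x1 x2 x3. ?N v0 g a b1 x1 x2 x3 b3)))"
   by (rule co_sw_swap[OF X V, symmetric]) (assumption|intro cr m b)+
  finally show "Sw3 cQ Y X X Y b (%b1 b2 b3. Co cQ V (ract V v b2) (%v0 h. ?p v0 h (mm X Y (mm X Y (?S b1) a) b3))) = ..." .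
 qed
 also have "... = tsum k cQ t (%v a. Sw2 cQ X X Y a (%g y. Sw3 cQ Y X X Y b (%b1 b2 b3. Sw3 cQ X X X X b2 (%x1 x2 x3. ?N v g y b1 x1 x2 x3 b3))))"
  by (rule cM_cond[OF t U]) (assumption|intro cr b)+
 also have "... = tsum k cQ t (%v a. Sw2 cQ X X Y a (%g y. Sw2 cQ Y X Y b (%b1 r. Sw4 cQ X X X X Y r (%x1 x2 x3 b3. ?N v g y b1 x1 x2 x3 b3))))"
  by (rule ct_cong[OF tT], rule sw_cong, (assumption|intro X Y)+, rule sw_cong, (intro X Y b)+, rule sw_split_first3) (assumption|intro cr)+
 also have "... = tsum k cQ t (%v a. Sw2 cQ Y X Y b (%b1 r. Sw4 cQ X X X X Y r (%x1 x2 x3 b3. Sw2 cQ X X Y a (%g y. ?N v g y b1 x1 x2 x3 b3))))"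
  by (rule ct_cong[OF tT], rule sw_swap_six) (assumption|intro cr b)+
 also have "... = tsum k cQ t (%v a. Sw3 cQ Y X X Y b (%b1 b2 b3. Sw2 cQ X X Y (mm X Y (mm X Y (?S b1) a) b3) (%p q. ?p (ract V v b2) p q)))"
  by (rule ct_cong[OF tT], rule sw_adjoint_comult[symmetric]) (assumption|intro cr b)+
 also have "... = cot_right (cot_act t b)"
  unfolding cot_right_def by (rule cot_act_eval[OF tT b U, symmetric]) (assumption|intro cr)+
 finally show ?thesis unfolding cM_iff using cot_act_closed[OF tT b] by simp
qed

end

context cotensor_product
begin

abbreviation (input) "cB \<equiv> alg C Y Y"
abbreviation (input) "pT \<equiv> pure k V cA"

text \<open>\<open>v \<otimes> a\<^sub>1 \<otimes> a\<^sub>2\<close>, summed over an element of the cotensor product, lies in \<open>(V \<box> \<C>(X,Y)) \<otimes> \<C>(Y,Y)\<close>: coassociativity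
 transports the defining equation to the first component.\<close>

lemma cot_proj_comult:
 assumes t: "t <: cM" and U: "module k U" and \<beta>: "\<beta> : bilin_maps k cT cB U"
 shows "tsum k U t (%v a. Sw2 U X Y Y a (%a1 a2. \<beta> (cot_proj (pT v a1)) a2)) = tsum k U t (%v a. Sw2 U X Y Y a (%a1 a2. \<beta> (pT v a1) a2))"
proof -
 let ?S = "tensor k cT cB" and ?Q = "tensor k cQ cB"
 let ?s = "tsum k ?S t (%v a. Sw2 ?S X Y Y a (%a1 a2. pure k cT cB (pT v a1) a2))"
 let ?p = "%v h a. pure k V (tensor k (alg C X X) cA) v (pure k (alg C X X) cA h a)"
 note tT = cM_T[OF t] and B = alg_module[OF Y Y]
 note L = lin_comp[OF cot_left_lin] lin_comp[OF cot_right_lin] lin_closed[OF cot_left_lin] lin_closed[OF cot_right_lin]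
 have S: "module k ?S" and Q: "module k ?Q" by (intro cr)+
 have s: "?s <: ?S" by (assumption|intro cr tT)+
 have ev: "tsum k W ?s \<gamma> = tsum k W t (%v a. Sw2 W X Y Y a (%a1 a2. \<gamma> (pT v a1) a2))"
  if W: "module k W" and \<gamma>: "\<gamma> : bilin_maps k cT cB W" for W :: "('k, 'w, 'n) module_scheme" and \<gamma>
 proof -
  have "tsum k W ?s \<gamma> = tsum k W t (%v a. tsum k W (Sw2 ?S X Y Y a (%a1 a2. pure k cT cB (pT v a1) a2)) \<gamma>)"
   by (rule tsum_tsum[OF cmods tT W cT_mod B _ \<gamma>]) (assumption|intro cr)+
  also have "... = tsum k W t (%v a. Sw2 W X Y Y a (%a1 a2. tsum k W (pure k cT cB (pT v a1) a2) \<gamma>))"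
   by (rule ct_cong[OF tT], rule tsum_tsum[OF cmods(2) B _ W cT_mod B _ \<gamma>]) (assumption|intro cr)+
  also have "... = tsum k W t (%v a. Sw2 W X Y Y a (%a1 a2. \<gamma> (pT v a1) a2))"
   by (rule ct_cong[OF tT], rule sw_cong, (assumption|intro X Y)+, rule tsum_pure[OF cT_mod B W \<gamma>]) (assumption|intro cr)+
  finally show ?thesis .
 qed
 have "tsum k ?Q ?s (%p b. pure k cQ cB (cot_left p) b) = tsum k ?Q t (%v a. Sw2 ?Q X Y Y a (%a1 a2. pure k cQ cB (cot_left (pT v a1)) a2))"
  by (rule ev[OF Q]) (assumption|intro cr L)+
 also have "... = tsum k ?Q t (%v a. Sw2 ?Q X Y Y a (%a1 a2. Co ?Q V v (%v0 h. pure k cQ cB (?p v0 h a1) a2)))"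
  by (rule ct_cong[OF tT], rule sw_cong, (assumption|intro X Y)+, rule cot_left_pure[OF B])
 also have "... = tsum k ?Q t (%v a. Co ?Q V v (%v0 h. Sw2 ?Q X Y Y a (%a1 a2. pure k cQ cB (?p v0 h a1) a2)))"
  by (rule ct_cong[OF tT], rule co_sw_swap[OF X V, symmetric]) (assumption|intro cr)+
 also have "... = tsum k ?Q t (%v a. Sw3 ?Q X X Y Y a (%h b a2. pure k cQ cB (?p v h b) a2))"
  by (rule cM_cond[OF t Q]) (assumption|intro cr)+
 also have "... = tsum k ?Q t (%v a. Sw2 ?Q X Y Y a (%p a2. Sw2 ?Q X X Y p (%h b. pure k cQ cB (?p v h b) a2)))"
  by (rule ct_cong[OF tT], rule sw_coassoc[symmetric]) (assumption|intro cr)+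
 also have "... = tsum k ?Q t (%v a. Sw2 ?Q X Y Y a (%a1 a2. pure k cQ cB (cot_right (pT v a1)) a2))"
  by (rule ct_cong[OF tT], rule sw_cong, (assumption|intro X Y)+, rule cot_right_pure[OF B, symmetric])
 also have "... = tsum k ?Q ?s (%p b. pure k cQ cB (cot_right p) b)"
  by (rule ev[OF Q, symmetric]) (assumption|intro cr L)+
 finally have eq: "tsum k ?Q ?s (%p b. pure k cQ cB (cot_left p) b) = ..." .
 note Bi = bilin_maps_left[OF \<beta>] bilin_maps_right[OF \<beta>] lin_comp[OF bilin_maps_left[OF \<beta>]] bilin_closed[OF \<beta>]
 have \<beta>': "(%p b. \<beta> (cot_proj p) b) : bilin_maps k cT cB U"
  by (rule bilin_mapsI, rule Bi(2)[OF lin_closed[OF cot_proj_lin_T]], assumption, rule Bi(3)[OF _ cot_proj_lin_T])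
 show ?thesis using cot_proj_tensor[OF B U s \<beta> eq] unfolding ev[OF U \<beta>] ev[OF U \<beta>'] .
qed

text \<open>The coaction, with the projection making each summand an element of \<open>(V \<box> \<C>(X,Y)) \<otimes> \<C>(Y,Y)\<close>.\<close>

definition cot_coact where "cot_coact t = tsum k (tensor k cM cB) t (%v a. Sw2 (tensor k cM cB) X Y Y a (%a1 a2. pure k cM cB (cot_proj (pT v a1)) a2))"

lemmas cs = cr cM_mod cot_proj_mlin cot_proj_closed

lemma cot_coact_lin: "cot_coact : lin_maps k cT (tensor k cM cB)"
 unfolding cot_coact_def[abs_def] by (assumption|intro cs)+

lemma cot_coact_eval:
 assumes t: "t <: cT" and U: "module k U" and \<beta>: "\<beta> : bilin_maps k cM cB U"
 shows "tsum k U (cot_coact t) \<beta> = tsum k U t (%v a. Sw2 U X Y Y a (%a1 a2. \<beta> (cot_proj (pT v a1)) a2))"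
proof -
 let ?S = "tensor k cM cB"
 note B = alg_module[OF Y Y]
 have "tsum k U (cot_coact t) \<beta> = tsum k U t (%v a. tsum k U (Sw2 ?S X Y Y a (%a1 a2. pure k cM cB (cot_proj (pT v a1)) a2)) \<beta>)"
  unfolding cot_coact_def by (rule tsum_tsum[OF cmods t U cM_mod B _ \<beta>]) (assumption|intro cs)+
 also have "... = tsum k U t (%v a. Sw2 U X Y Y a (%a1 a2. tsum k U (pure k cM cB (cot_proj (pT v a1)) a2) \<beta>))"
  by (rule ct_cong[OF t], rule tsum_tsum[OF cmods(2) B _ U cM_mod B _ \<beta>]) (assumption|intro cs)+
 also have "... = tsum k U t (%v a. Sw2 U X Y Y a (%a1 a2. \<beta> (cot_proj (pT v a1)) a2))"
  by (rule ct_cong[OF t], rule sw_cong, (assumption|intro X Y)+, rule tsum_pure[OF cM_mod B U \<beta>]) (assumption|intro cs)+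
 finally show ?thesis .
qed

text \<open>Existence and uniqueness of the element that defines the coaction. Uniqueness: applying the projection to the
 first two factors recovers an element of \<open>(V \<box> \<C>(X,Y)) \<otimes> \<C>(Y,Y)\<close> from its image.\<close>

lemma cN_coact:
 assumes t: "t <: cM" shows "coact cN t = cot_coact t"
proof -
 let ?R = "tensor k V (tensor k cA cB)" and ?p = "%v a b. pure k V (tensor k cA cB) v (pure k cA cB a b)"
 let ?E = "%u. tensor_assoc k V cA cB (tensor_map k cT cB (%s. s) (%b. b) u) = tensor_map k V (tensor k cA cB) (%v. v) (cocomp C X Y Y) t"
 let ?\<gamma> = "%s b. tsum k ?R s (%v a. ?p v a b)"
 note tT = cM_T[OF t] and B = alg_module[OF Y Y]
 have R: "module k ?R" by (intro cr)
 have u: "cot_coact t <: tensor k cM cB" by (rule lin_closed[OF cot_coact_lin tT])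
 have "tsum k ?R (cot_coact t) ?\<gamma> = tsum k ?R t (%v a. Sw2 ?R X Y Y a (%a1 a2. ?\<gamma> (cot_proj (pT v a1)) a2))"
  by (rule cot_coact_eval[OF tT R]) (assumption|intro cs cM_lin_T[OF lin_id] cM_T)+
 also have "... = tsum k ?R t (%v a. Sw2 ?R X Y Y a (%a1 a2. ?\<gamma> (pT v a1) a2))"
  by (rule cot_proj_comult[OF t R]) (assumption|intro cs)+
 also have "... = tsum k ?R t (%v a. Sw2 ?R X Y Y a (%a1 a2. ?p v a1 a2))"
  by (rule ct_cong[OF tT], rule sw_cong, (assumption|intro X Y)+, rule ct_pure) (assumption|intro cs)+
 finally have ex: "?E (cot_coact t)"
  by (simp only: assoc_map_eq[OF cmods B cM_mod cM_incl u] map_right_eq[OF cmods B cmods(2) cocomp_lin[OF X Y Y] tT])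
 have un: "u' = cot_coact t" if u': "u' <: tensor k cM cB" and E: "?E u'" for u'
 proof -
  let ?S = "tensor k cM cB"
  have S: "module k ?S" by (intro cs)
  have "u' = tsum k ?S u' (pure k cM cB)" by (rule tsum_self[OF cM_mod B u', symmetric])
  also have "... = tsum k ?S u' (%p b. tsum k ?S p (%v a. pure k cM cB (cot_proj (pT v a)) b))"
  proof (rule tsum_cong'[OF cM_mod B u'])
   fix p b assume m: "p <: cM" "b <: cB"
   have "pure k cM cB p b = pure k cM cB (cot_proj p) b" by (simp only: cot_proj_id[OF m(1)])
   also have "... = tsum k ?S p (%v a. pure k cM cB (cot_proj (pT v a)) b)"
    by (rule ct_comp[OF cM_T[OF m(1)] S]) (assumption|intro cs m)+
   finally show "pure k cM cB p b = ..." .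
  qed
  also have "... = cot_coact t"
   unfolding cot_coact_def by (rule tsum_trilin_eq[OF cmods B cM_mod cmods(2) S cM_incl u' cocomp_lin[OF X Y Y] tT E]) (assumption|intro cs)+
  finally show ?thesis .
 qed
 have "coact cN t = (THE u. u <: tensor k cM cB \<and> ?E u)"
  by (simp add: cotensor_yd_def Let_def module.defs yd_data.defs)
 also have "... = cot_coact t" by (rule the_equality, rule conjI[OF u ex], erule conjE, rule un)
 finally show ?thesis .
qed

lemma cN_co:
 assumes t: "t <: cM" and U: "module k U" and \<beta>: "\<beta> : bilin_maps k cM cB U"
 shows "Co U cN t \<beta> = tsum k U t (%v a. Sw2 U X Y Y a (%a1 a2. \<beta> (cot_proj (pT v a1)) a2))"
 unfolding cN_coact[OF t] by (rule cot_coact_eval[OF cM_T[OF t] U \<beta>])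

lemma bilin_cM: "\<beta> : bilin_maps k cT B U ==> \<beta> : bilin_maps k cM B U"
 by (auto simp: bilin_maps_def cM_restrict_lin cM_T)

lemma cN_co_T:
 assumes t: "t <: cM" and U: "module k U" and \<beta>: "\<beta> : bilin_maps k cT cB U"
 shows "Co U cN t \<beta> = tsum k U t (%v a. Sw2 U X Y Y a (%a1 a2. \<beta> (pT v a1) a2))"
 using cN_co[OF t U bilin_cM[OF \<beta>]] cot_proj_comult[OF t U \<beta>] by simp

lemma cot_act_pure:
 assumes v: "v <: V" and a: "a <: cA" and b: "b <: cB"
 shows "cot_act (pT v a) b = Sw3 cT Y X X Y b (%b1 b2 b3. pT (ract V v b2) (mm X Y (mm X Y (anti C Y X b1) a) b3))"
proof -
 have p: "pT v a <: cT" by (intro cr v a)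
 have "cot_act (pT v a) b = tsum k cT (cot_act (pT v a) b) pT" by (rule ct_self[OF cot_act_closed[OF p b], symmetric])
 also have "... = tsum k cT (pT v a) (%v a. Sw3 cT Y X X Y b (%b1 b2 b3. pT (ract V v b2) (mm X Y (mm X Y (anti C Y X b1) a) b3)))"
  by (rule cot_act_eval[OF p b cT_mod]) (assumption|intro cr)+
 also have "... = Sw3 cT Y X X Y b (%b1 b2 b3. pT (ract V v b2) (mm X Y (mm X Y (anti C Y X b1) a) b3))"
  by (rule ct_pure) (assumption|intro cr v a b)+
 finally show ?thesis .
qed

text \<open>The comodule axioms and the compatibility condition are first extended from the cotensor product to \<open>V \<otimes> \<C>(X,Y)\<close>, by composing with the projection, and
 then evaluated on pure tensors.\<close>

lemma cN_yd: "YDm Y cN"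
proof (rule yd_moduleI_same[OF Y cN_same cM_mod], unfold Let_def)
 note B = alg_module[OF Y Y]
 have cc: "coact cN p <: tensor k cM cB" if "p <: cM" for p
  unfolding cN_coact[OF that] by (rule lin_closed[OF cot_coact_lin cM_T[OF that]])
 show "ract cN : bilin_maps k cM cB cM"
 proof (rule bilin_mapsI)
  fix t assume t: "t <: cM"
  show "(%b. ract cN t b) : lin_maps k cB cM"
   by (rule lin_cong[OF cM_into_lin[OF cot_act_lin2[OF cM_T[OF t]] cot_act_cM[OF t]] B cN_ract[OF cM_T[OF t], symmetric]])
 next
  fix b assume b: "b <: cB"
  show "(%t. ract cN t b) : lin_maps k cM cM"
   by (rule lin_cong[OF cM_into_lin[OF cM_restrict_lin[OF cot_act_lin1[OF b]] cot_act_cM[OF _ b]] cM_mod cN_ract[OF cM_T b, symmetric]])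
 qed
 show "coact cN : lin_maps k cM (tensor k cM cB)"
  by (rule lin_cong[OF cM_restrict_lin[OF cot_coact_lin] cM_mod cN_coact[symmetric]])
 fix t assume t: "t <: cM"
 note tT = cM_T[OF t]
 show "ract cN t \<one>[cB] = t" using cot_act_one[OF tT] by (simp add: cN_ract[OF tT] alg_one_closed Y)
 show "Co cM cN t (%p h. coun C Y h *[cM] p) = t"
 proof -
  have "Co cM cN t (%p h. coun C Y h *[cM] p) = tsum k cM t (%v a. Sw2 cM X Y Y a (%a1 a2. coun C Y a2 *[cM] cot_proj (pT v a1)))"
   by (rule cN_co[OF t cM_mod]) (assumption|intro cs)+
  also have "... = tsum k cM t (%v a. cot_proj (pT v a))"
   by (rule ct_cong[OF tT], rule sw_coun_right) (assumption|intro cs)+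
  also have "... = cot_proj t" by (rule ct_comp[OF tT cM_mod cot_proj_lin, symmetric])
  finally show ?thesis by (simp only: cot_proj_id[OF t])
 qed
 show "Co (tensor k cM (tensor k cB cB)) cN t (%p h. Co (tensor k cM (tensor k cB cB)) cN p (%p0 g. pure k cM (tensor k cB cB) p0 (pure k cB cB g h))) =
   Co (tensor k cM (tensor k cB cB)) cN t (%p0 q. Sw2 (tensor k cM (tensor k cB cB)) Y Y Y q (%g h. pure k cM (tensor k cB cB) p0 (pure k cB cB g h)))"
  (is "Co ?U cN t (%p h. Co ?U cN p (%p0 g. ?P p0 g h)) = ?rhs")
 proof -
  have U: "module k ?U" by (intro cs)
  let ?\<gamma> = "%p h. tsum k ?U p (%v a. Sw2 ?U X Y Y a (%x y. ?P (cot_proj (pT v x)) y h))"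
  have g: "?\<gamma> : bilin_maps k cT cB ?U" by (assumption|intro cs)+
  have "Co ?U cN t (%p h. Co ?U cN p (%p0 g. ?P p0 g h)) = Co ?U cN t ?\<gamma>"
   by (rule tsum_cong'[OF cM_mod B cc[OF t]], rule cN_co) (assumption|intro cs)+
  also have "... = tsum k ?U t (%v a. Sw2 ?U X Y Y a (%a1 a2. ?\<gamma> (pT v a1) a2))"
   by (rule cN_co_T[OF t U g])
  also have "... = tsum k ?U t (%v a. Sw2 ?U X Y Y a (%a1 a2. Sw2 ?U X Y Y a1 (%x y. ?P (cot_proj (pT v x)) y a2)))"
   by (rule ct_cong[OF tT], rule sw_cong, (assumption|intro X Y)+, rule ct_pure) (assumption|intro cs)+
  also have "... = tsum k ?U t (%v a. Sw3 ?U X Y Y Y a (%x y z. ?P (cot_proj (pT v x)) y z))"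
   by (rule ct_cong[OF tT], rule sw_coassoc) (assumption|intro cs)+
  also have "... = ?rhs" by (rule cN_co[OF t U, symmetric]) (assumption|intro cs)+
  finally show ?thesis .
 qed
 fix x assume x: "x <: cB"
 show "ract cN t (mm Y Y x y) = ract cN (ract cN t x) y" if "y <: cB" for y
  using cot_act_mult[OF tT x that] that x by (simp add: cN_ract[OF tT] cN_ract[OF cot_act_closed[OF tT x]] alg_mult_closed Y)
 show "coact cN (ract cN t x) = Co (tensor k cM cB) cN t (%p h. Sw3 (tensor k cM cB) Y Y Y Y x (%x1 x2 x3.
   pure k cM cB (ract cN p x2) (mm Y Y (mm Y Y (anti C Y Y x1) h) x3)))"
 proof -
  let ?U = "tensor k cM cB" and ?S = "anti C Y Y"
  let ?R = "%v a b. pure k cM cB (cot_proj (pT v a)) b"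
  let ?G = "%v b1 b2 b3 b4 b5 y1 y2. ?R (ract V v b3) (mm X Y (mm X Y (anti C Y X b2) y1) b4) (mm Y Y (mm Y Y (?S b1) y2) b5)"
  have U: "module k ?U" by (intro cs)
  note tx = cot_act_cM[OF t x]
  have "coact cN (ract cN t x) = cot_coact (cot_act t x)" by (simp only: cN_ract[OF tT x] cN_coact[OF tx])
  also have "... = tsum k ?U t (%v a. Sw3 ?U Y X X Y x (%b1 b2 b3. Sw2 ?U X Y Y (mm X Y (mm X Y (anti C Y X b1) a) b3) (%p q. ?R (ract V v b2) p q)))"
   unfolding cot_coact_def by (rule cot_act_eval[OF tT x U]) (assumption|intro cs)+
  also have "... = tsum k ?U t (%v a. Sw2 ?U Y Y Y x (%b1 r. Sw4 ?U Y X X Y Y r (%b2 b3 b4 b5. Sw2 ?U X Y Y a (%y1 y2. ?G v b1 b2 b3 b4 b5 y1 y2))))"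
   by (rule ct_cong[OF tT], rule sw_adjoint_comult) (assumption|intro cs x)+
  finally have 1: "coact cN (ract cN t x) = ..." .
  let ?\<gamma> = "%p h. Sw3 ?U Y Y Y Y x (%x1 x2 x3. pure k cM cB (cot_proj (cot_act p x2)) (mm Y Y (mm Y Y (?S x1) h) x3))"
  note al = lin_comp[OF cot_act_lin1] lin_comp[OF cot_act_lin2] cot_act_closed
  have "Co ?U cN t (%p h. Sw3 ?U Y Y Y Y x (%x1 x2 x3. pure k cM cB (ract cN p x2) (mm Y Y (mm Y Y (?S x1) h) x3))) = Co ?U cN t ?\<gamma>"
   by (rule tsum_cong'[OF cM_mod B cc[OF t]], rule sw_cong, (intro Y x)+, rule sw_cong, (assumption|intro Y)+)
    (simp only: cN_ract[OF cM_T] cot_proj_id[OF cot_act_cM])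
  also have "... = tsum k ?U t (%v a. Sw2 ?U X Y Y a (%a1 a2. ?\<gamma> (pT v a1) a2))"
   by (rule cN_co_T[OF t U]) (assumption|intro cs x al)+
  also have "... = tsum k ?U t (%v a. Sw2 ?U X Y Y a (%a1 a2. Sw2 ?U Y Y Y x (%x1 r. Sw4 ?U Y X X Y Y r (%b2 b3 b4 b5. ?G v x1 b2 b3 b4 b5 a1 a2))))"
  proof (rule ct_cong[OF tT], rule sw_cong, (assumption|intro X Y)+, rule sw_cong, (intro Y x)+)
   fix v a a1 a2 x1 r assume m: "v <: V" "a1 <: cA" "a2 <: cB" "x1 <: cB" "r <: cB"
   have "Sw2 ?U Y Y Y r (%x2 x3. pure k cM cB (cot_proj (cot_act (pT v a1) x2)) (mm Y Y (mm Y Y (?S x1) a2) x3)) =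
    Sw2 ?U Y Y Y r (%x2 x3. Sw3 ?U Y X X Y x2 (%b2 b3 b4. ?G v x1 b2 b3 b4 x3 a1 a2))"
   proof (rule sw_cong, (intro Y m)+)
    fix x2 x3 assume n: "x2 <: cB" "x3 <: cB"
    let ?w = "mm Y Y (mm Y Y (?S x1) a2) x3"
    show "pure k cM cB (cot_proj (cot_act (pT v a1) x2)) ?w = Sw3 ?U Y X X Y x2 (%b2 b3 b4. ?G v x1 b2 b3 b4 x3 a1 a2)"
     unfolding cot_act_pure[OF m(1,2) n(1)] by (rule lin_sw3[OF Y X X Y n(1) cT_mod U]) (assumption|intro cs m n)+
   qed
   also have "... = Sw4 ?U Y X X Y Y r (%b2 b3 b4 b5. ?G v x1 b2 b3 b4 b5 a1 a2)"
    by (rule sw_split_first3) (assumption|intro cs m)+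
   finally show "Sw2 ?U Y Y Y r (%x2 x3. pure k cM cB (cot_proj (cot_act (pT v a1) x2)) (mm Y Y (mm Y Y (?S x1) a2) x3)) = ..." .
  qed
  also have "... = tsum k ?U t (%v a. Sw2 ?U Y Y Y x (%x1 r. Sw4 ?U Y X X Y Y r (%b2 b3 b4 b5. Sw2 ?U X Y Y a (%a1 a2. ?G v x1 b2 b3 b4 b5 a1 a2))))"
   by (rule ct_cong[OF tT], rule sw_swap_six) (assumption|intro cs x)+
  finally show ?thesis using 1 by simp
 qed
qed

end

section \<open>The functor\<close>

context cotensor_product
begin

lemma cN_size: "carrier cN \<lesssim> (UNIV :: 'u set)"
proof -
 have "carrier cN \<subseteq> carrier cT" using cN_same cM_T by (auto simp: same_module_def)
 then show ?thesis
  by (rule lepoll_trans[OF subset_imp_lepoll tensor_lepoll[OF infinite_univ base_lepoll univ_lepoll alg_lepoll[OF X Y] cmods]])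
qed

lemmas pkN = Y cN_yd cN_size

abbreviation (input) "FV \<equiv> cot_obj k C X Y V :: ('k, 'a, 'u) yd_data"
abbreviation (input) "eN \<equiv> enc cN :: _ \<Rightarrow> 'u"
abbreviation (input) "dN \<equiv> dec cN :: 'u \<Rightarrow> _"

lemma cN_cM: "carrier cN = carrier cM" "tensor k cN B = tensor k cM B" "pure k cN B = pure k cM B"
  "lin_maps k cN U = lin_maps k cM U" "lin_maps k U cN = lin_maps k U cM"
 using cN_same by (auto simp: same_module_tensor[OF cN_same same_module_refl] same_module_lin_maps[OF cN_same same_module_refl]
   same_module_lin_maps[OF same_module_refl cN_same] same_module_def)

lemma F_ob: "Ob Y FV"
 unfolding cot_obj_def by (rule pack_yd[OF pkN])

lemma eN_lin: "eN : lin_maps k cM FV" and dN_lin: "dN : lin_maps k FV cM"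
 using enc_lin[OF pkN] dec_lin[OF pkN] unfolding cN_cM cot_obj_def by auto

lemma dN_cM: "x <: FV ==> dN x <: cM"
 and eN_closed: "m <: cM ==> eN m <: FV"
 and eN_dN: "x <: FV ==> eN (dN x) = x"
 and dN_eN: "m <: cM ==> dN (eN m) = m"
 using lin_closed[OF dN_lin] lin_closed[OF eN_lin] enc_dec[OF pkN] dec_enc[OF pkN] unfolding cN_cM cot_obj_def by auto

lemma dN_cT: "x <: FV ==> dN x <: cT"
 by (rule cM_T[OF dN_cM])

lemma dN_mlin: "E : lin_maps k B FV ==> (%z. dN (E z)) : lin_maps k B cM"
 "E : lin_maps k B FV ==> (%z. dN (E z)) : lin_maps k B cT"
 by (rule lin_comp[OF dN_lin], assumption) (rule cM_lin_T[OF lin_comp[OF dN_lin]])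

lemma eN_mlin: "E : lin_maps k B cM ==> (%z. eN (E z)) : lin_maps k B FV"
 by (rule lin_comp[OF eN_lin])

lemma F_ract: "[|x <: FV; b <: cB|] ==> ract FV x b = eN (cot_act (dN x) b)"
 using pack_simps(5)[OF pkN, of x b] by (simp add: cot_obj_def[symmetric] cN_ract dN_cT)

lemma F_co:
 assumes x: "x <: FV" and U: "module k U" and \<beta>: "\<beta> : bilin_maps k FV cB U"
 shows "Co U FV x \<beta> = tsum k U (dN x) (%v a. Sw2 U X Y Y a (%a1 a2. \<beta> (eN (cot_proj (pT v a1))) a2))"
proof -
 have "Co U FV x \<beta> = Co U cN (dN x) (%m h. \<beta> (eN m) h)"
  using pack_co[OF pkN, of x U \<beta>] x U \<beta> by (simp add: cot_obj_def)
 also have "... = tsum k U (dN x) (%v a. Sw2 U X Y Y a (%a1 a2. \<beta> (eN (cot_proj (pT v a1))) a2))"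
  by (rule cN_co[OF dN_cM[OF x] U]) (intro bilin_mapsI lin_comp[OF bilin_maps_left[OF \<beta>] eN_lin] bilin_maps_right[OF \<beta>] eN_closed)
 finally show ?thesis .
qed

lemma F_co_T:
 assumes x: "x <: FV" and U: "module k U" and \<beta>: "\<beta> : bilin_maps k FV cB U" and \<gamma>: "\<gamma> : bilin_maps k cT cB U"
  and e: "!!m h. [|m <: cM; h <: cB|] ==> \<beta> (eN m) h = \<gamma> m h"
 shows "Co U FV x \<beta> = tsum k U (dN x) (%v a. Sw2 U X Y Y a (%a1 a2. \<gamma> (pT v a1) a2))"
 unfolding F_co[OF x U \<beta>] cot_proj_comult[OF dN_cM[OF x] U \<gamma>, symmetric]
 by (rule ct_cong[OF dN_cT[OF x]], rule sw_cong, (assumption|intro X Y)+, rule e) (assumption|intro cs)+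

lemmas cf = cs dN_cM dN_cT dN_mlin eN_closed eN_mlin yd_mlin[OF Y F_ob]

end

text \<open>Two objects with their cotensor products; \<open>Tf f\<close> is \<open>f \<otimes> 1\<close>, the functor on morphisms before transport to the
 universe.\<close>

locale cotensor_pair = V: cotensor_product k C univ X Y V + W: cotensor_product k C univ X Y W
 for k :: "('k, 'r) ring_scheme" and C :: "('k, 'a, 'o) cogroupoid_data" and univ :: "'u itself" and X Y V W
begin

lemmas X = V.X and Y = V.Y and V = V.V and W = W.V

abbreviation (input) "Tf f \<equiv> tensor_map k W V.cA f (%a. a)"

context
 fixes f assumes f: "f : lin_maps k V W"
begin

lemma Tf_lin: "Tf f : lin_maps k V.cT W.cT"
 by (rule tensor_map_lin[OF V.cmods W.cmods f lin_id])

lemma Tf_eval: "[|t <: V.cT; module k U; \<beta> : bilin_maps k W V.cA U|] ==> tsum k U (Tf f t) \<beta> = tsum k U t (%v a. \<beta> (f v) a)"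
 by (rule tsum_tensor_map[OF V.cmods W.cmods _ f lin_id])

lemma Tf_eq: "t <: V.cT ==> Tf f t = tsum k W.cT t (%v a. W.pT (f v) a)"
 by (rule tensor_map_eq[OF V.cmods W.cmods f lin_id])

lemma Tf_pure: "[|v <: V; a <: V.cA|] ==> Tf f (V.pT v a) = W.pT (f v) a"
 by (subst Tf_eq) (assumption|intro V.cm W.cm f lin_comp[OF _ f] lin_closed[OF f] V.ct_pure)+

end

lemma Tf_cM:
 assumes f: "f : yd_maps k (hopf_at C X) V W" and t: "t <: V.cM"
 shows "Tf f t <: W.cM"
proof -
 note fl = V.yd_maps_lin[OF f] note tT = V.cM_T[OF t]
 let ?Q = "W.cQ" and ?p = "%v h a. pure k W (tensor k (alg C X X) V.cA) v (pure k (alg C X X) V.cA h a)"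
 have "W.cot_left (Tf f t) = tsum k ?Q t (%v a. V.Co ?Q W (f v) (%v0 h. ?p v0 h a))"
  unfolding W.cot_left_def by (rule Tf_eval[OF fl tT W.cQ_mod]) (assumption|intro W.cr)+
 also have "... = tsum k ?Q t (%v a. V.Co ?Q V v (%v0 h. ?p (f v0) h a))"
  by (rule V.ct_cong[OF tT], rule V.yd_maps_co[OF X V W f]) (assumption|intro W.cr)+
 also have "... = tsum k ?Q t (%v a. V.Sw2 ?Q X X Y a (%h b. ?p (f v) h b))"
  by (rule V.cM_cond[OF t W.cQ_mod]) (assumption|intro W.cr fl lin_closed[OF fl])+
 also have "... = W.cot_right (Tf f t)"
  unfolding W.cot_right_def by (rule Tf_eval[OF fl tT W.cQ_mod, symmetric]) (assumption|intro W.cr)+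
 finally show ?thesis unfolding W.cM_iff using lin_closed[OF Tf_lin[OF fl] tT] by simp
qed

lemma Tf_yd:
 assumes f: "f : yd_maps k (hopf_at C X) V W"
 shows "Tf f : yd_maps k (hopf_at C Y) V.cN W.cN"
proof (rule V.yd_mapsI[OF Y V.cN_yd W.cN_yd])
 note fl = V.yd_maps_lin[OF f] note fc = lin_closed[OF fl] note Tl = Tf_lin[OF fl] note Tc = lin_closed[OF Tl]
 show "Tf f : lin_maps k V.cN W.cN"
  unfolding V.cN_cM W.cN_cM by (rule W.cM_into_lin[OF V.cM_restrict_lin[OF Tl] Tf_cM[OF f]])
 fix t assume "t <: V.cN"
 then have t: "t <: V.cM" by (simp add: V.cN_cM)
 note tT = V.cM_T[OF t]
 show "Tf f (ract V.cN t b) = ract W.cN (Tf f t) b" if b: "b <: V.cB" for b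
 proof -
  let ?G = "%v a b1 b2 b3. W.pT (ract W v b2) (V.mm X Y (V.mm X Y (anti C Y X b1) a) b3)"
  have "Tf f (V.cot_act t b) = tsum k W.cT (V.cot_act t b) (%v a. W.pT (f v) a)"
   by (rule Tf_eq[OF fl V.cot_act_closed[OF tT b]])
  also have "... = tsum k W.cT t (%v a. V.Sw3 W.cT Y X X Y b (%b1 b2 b3. W.pT (f (ract V v b2)) (V.mm X Y (V.mm X Y (anti C Y X b1) a) b3)))"
   by (rule V.cot_act_eval[OF tT b W.cT_mod]) (assumption|intro W.cr fl fc)+
  also have "... = tsum k W.cT t (%v a. V.Sw3 W.cT Y X X Y b (?G (f v) a))"
   by (rule V.ct_cong[OF tT], rule V.sw_cong, (intro X Y b)+, rule V.sw_cong, (assumption|intro X Y)+) (simp only: V.yd_maps_ract[OF f])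
  also have "... = tsum k W.cT (Tf f t) (%v a. V.Sw3 W.cT Y X X Y b (?G v a))"
   by (rule Tf_eval[OF fl tT W.cT_mod, symmetric]) (assumption|intro W.cr b)+
  also have "... = tsum k W.cT (W.cot_act (Tf f t) b) W.pT"
   by (rule W.cot_act_eval[OF Tc[OF tT] b W.cT_mod, symmetric]) (assumption|intro W.cr)+
  also have "... = W.cot_act (Tf f t) b" by (rule W.ct_self[OF W.cot_act_closed[OF Tc[OF tT] b]])
  finally show ?thesis by (simp only: V.cN_ract[OF tT b] W.cN_ract[OF Tc[OF tT] b])
 qed
 let ?S = "tensor k W.cM V.cB"
 have S: "module k ?S" by (intro W.cs)
 have "V.Co ?S V.cN t (%p h. pure k W.cM V.cB (Tf f p) h) = V.Co ?S V.cN t (%p h. pure k W.cM V.cB (W.cot_proj (Tf f p)) h)"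
  by (rule V.co_cong[OF Y V.cN_yd]) (simp_all add: V.cN_cM t W.cot_proj_id Tf_cM[OF f])
 also have "... = tsum k ?S t (%v a. V.Sw2 ?S X Y Y a (%a1 a2. pure k W.cM V.cB (W.cot_proj (Tf f (V.pT v a1))) a2))"
  by (rule V.cN_co_T[OF t S]) (assumption|intro W.cs Tl Tc)+
 also have "... = tsum k ?S t (%v a. V.Sw2 ?S X Y Y a (%a1 a2. pure k W.cM V.cB (W.cot_proj (W.pT (f v) a1)) a2))"
  by (rule V.ct_cong[OF tT], rule V.sw_cong, (assumption|intro X Y)+) (simp only: Tf_pure[OF fl])
 also have "... = W.cot_coact (Tf f t)"
  unfolding W.cot_coact_def by (rule Tf_eval[OF fl tT S, symmetric]) (assumption|intro W.cs)+
 finally show "coact W.cN (Tf f t) = tsum k (tensor k W.cN V.cB) (coact V.cN t) (%p h. pure k W.cN V.cB (Tf f p) h)"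
  by (simp only: W.cN_cM W.cN_coact[OF Tf_cM[OF f t]])
qed

lemma cot_mor_app: "x <: V.FV ==> cot_mor k C X Y V W f x = W.eN (Tf f (V.dN x))"
 by (simp add: cot_mor_def)

lemma cot_mor_hom:
 assumes f: "f : yd_maps k (hopf_at C X) V W"
 shows "cot_mor k C X Y V W f \<in> homs (V.D Y) V.FV W.FV"
proof -
 have "(%x. W.eN (Tf f (V.dN x))) : yd_maps k (hopf_at C Y) V.FV W.FV"
  unfolding cot_obj_def
  by (rule V.yd_maps_comp[OF Y V.pack_yd[OF V.pkN] W.cN_yd V.pack_yd[OF W.pkN] _ V.enc_yd_map[OF W.pkN]],
    rule V.yd_maps_comp[OF Y V.pack_yd[OF V.pkN] V.cN_yd W.cN_yd V.dec_yd_map[OF V.pkN] Tf_yd[OF f]])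
 then show ?thesis using V.restrict_hom[OF Y _ V.F_ob W.F_ob] unfolding cot_mor_def by simp
qed

lemma dN_cot_mor: "[|f : yd_maps k (hopf_at C X) V W; x <: V.FV|] ==> W.dN (cot_mor k C X Y V W f x) = Tf f (V.dN x)"
 by (simp add: cot_mor_app W.dN_eN Tf_cM V.dN_cM)

lemma cot_mor_lin: "cot_mor k C X Y V W : lin_maps k (hom_sp (V.D X) V W) (hom_sp (V.D Y) V.FV W.FV)"
proof (rule lin_mapsI; unfold V.hom_sp_simps[OF X] V.hom_sp_simps[OF Y])
 fix f assume f: "f : yd_maps k (hopf_at C X) V W \<inter> extensional (carrier V)"
 note fl = V.yd_maps_lin[OF IntD1[OF f]] note fc = lin_closed[OF fl]
 have pl: "(%v. W.pT v a) : lin_maps k W W.cT" if "a <: V.cA" for a by (intro W.cr that)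
 show "cot_mor k C X Y V W f : yd_maps k (hopf_at C Y) V.FV W.FV \<inter> extensional (carrier V.FV)"
  using cot_mor_hom[OF IntD1[OF f]] V.D_simps(2)[OF Y] by simp
 { fix g assume g: "g : yd_maps k (hopf_at C X) V W \<inter> extensional (carrier V)"
  note gl = V.yd_maps_lin[OF IntD1[OF g]] note gc = lin_closed[OF gl]
  have h: "(\<lambda>v\<in>carrier V. f v +[W] g v) : lin_maps k V W"
   by (rule V.restrict_lin) (intro lin_plus W.cr V.cr fl gl)+
  have "W.eN (Tf (\<lambda>v\<in>carrier V. f v +[W] g v) t) = W.eN (Tf f t) +[W.FV] W.eN (Tf g t)" if t: "t <: V.cM" for t
  proof -
   note tT = V.cM_T[OF t]
   have "Tf (\<lambda>v\<in>carrier V. f v +[W] g v) t = tsum k W.cT t (%v a. W.pT (f v) a +[W.cT] W.pT (g v) a)"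
    unfolding Tf_eq[OF h tT] by (rule V.ct_cong[OF tT]) (simp add: lin_add[OF pl] fc gc)
   also have "... = Tf f t +[W.cT] Tf g t"
    unfolding Tf_eq[OF fl tT] Tf_eq[OF gl tT] by (rule tsum_plus[OF V.cmods tT W.cT_mod]) (assumption|intro W.cr fc gc)+
   finally show ?thesis
    using lin_add[OF W.eN_lin Tf_cM[OF IntD1[OF f] t] Tf_cM[OF IntD1[OF g] t]] by (simp add: W.cM_simps)
  qed
  then show "cot_mor k C X Y V W (\<lambda>v\<in>carrier V. f v +[W] g v) =
   (\<lambda>x\<in>carrier V.FV. cot_mor k C X Y V W f x +[W.FV] cot_mor k C X Y V W g x)"
   unfolding cot_mor_def by (intro restrict_ext) (simp add: V.dN_cM) }
 fix c assume c: "c <: k"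
 have h: "(\<lambda>v\<in>carrier V. c *[W] f v) : lin_maps k V W"
  by (rule V.restrict_lin) (intro W.cr V.cr fl c)+
 have "W.eN (Tf (\<lambda>v\<in>carrier V. c *[W] f v) t) = c *[W.FV] W.eN (Tf f t)" if t: "t <: V.cM" for t
 proof -
  note tT = V.cM_T[OF t]
  have "Tf (\<lambda>v\<in>carrier V. c *[W] f v) t = tsum k W.cT t (%v a. c *[W.cT] W.pT (f v) a)"
   unfolding Tf_eq[OF h tT] by (rule V.ct_cong[OF tT]) (simp add: lin_smult[OF pl] fc c)
  also have "... = c *[W.cT] Tf f t"
   unfolding Tf_eq[OF fl tT] by (rule smult_tsum[OF V.cmods tT W.cT_mod c]) (assumption|intro W.cr fc)+
  finally show ?thesis using lin_smult[OF W.eN_lin c Tf_cM[OF IntD1[OF f] t]] by (simp add: W.cM_simps)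
 qed
 then show "cot_mor k C X Y V W (\<lambda>v\<in>carrier V. c *[W] f v) = (\<lambda>x\<in>carrier V.FV. c *[W.FV] cot_mor k C X Y V W f x)"
  unfolding cot_mor_def by (intro restrict_ext) (simp add: V.dN_cM)
qed

end

context cogroupoid_universe
begin

lemma cotensor_productI: "[|X : ob C; Y : ob C; Ob X V|] ==> cotensor_product k C X Y V"
 by (intro cotensor_product.intro cotensor_product_axioms.intro cogroupoid_universe_axioms)

lemma cotensor_pairI: "[|X : ob C; Y : ob C; Ob X V; Ob X W|] ==> cotensor_pair k C X Y V W"
 by (rule cotensor_pair.intro; rule cotensor_productI)

lemma cot_functor:
 assumes X: "X : ob C" and Y: "Y : ob C"
 shows "klinear_functor k (D X) (D Y) (cot_obj k C X Y) (cot_mor k C X Y)"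
proof (rule klinear_functor.intro; unfold D_simps[OF X] D_simps[OF Y] mem_Collect_eq)
 fix V assume V: "Ob X V"
 interpret V: cotensor_pair k C univ X Y V V by (rule cotensor_pairI[OF X Y V V])
 show "Ob Y (cot_obj k C X Y V)" by (rule V.V.F_ob)
 show "cot_mor k C X Y V V (\<lambda>v\<in>carrier V. v) = (\<lambda>x\<in>carrier (cot_obj k C X Y V). x)"
  unfolding cot_mor_def
 proof (rule restrict_ext)
  fix x assume x: "x <: V.V.FV"
  note t = V.V.dN_cT[OF x]
  have "V.Tf (\<lambda>v\<in>carrier V. v) (V.V.dN x) = tsum k V.V.cT (V.V.dN x) V.V.pT"
   unfolding V.Tf_eq[OF restrict_lin[OF lin_id yd_mod[OF X V]] t] by (rule V.V.ct_cong[OF t]) simp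
  then show "V.V.eN (V.Tf (\<lambda>v\<in>carrier V. v) (V.V.dN x)) = x" by (simp add: V.V.ct_self t V.V.eN_dN x)
 qed
 fix W assume W: "Ob X W"
 interpret VW: cotensor_pair k C univ X Y V W by (rule cotensor_pairI[OF X Y V W])
 show "cot_mor k C X Y V W : lin_maps k (hom_sp (D X) V W) (hom_sp (D Y) (cot_obj k C X Y V) (cot_obj k C X Y W))"
  by (rule VW.cot_mor_lin)
 fix Z f g assume Z: "Ob X Z" and f: "f : yd_maps k (H X) V W \<inter> extensional (carrier V)" and g: "g : yd_maps k (H X) W Z \<inter> extensional (carrier W)"
 interpret WZ: cotensor_pair k C univ X Y W Z by (rule cotensor_pairI[OF X Y W Z])
 interpret VZ: cotensor_pair k C univ X Y V Z by (rule cotensor_pairI[OF X Y V Z])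
 note fy = IntD1[OF f] and gy = IntD1[OF g] note fl = yd_maps_lin[OF fy] and gl = yd_maps_lin[OF gy]
 show "cot_mor k C X Y V Z (compose (carrier V) g f) = compose (carrier (cot_obj k C X Y V)) (cot_mor k C X Y W Z g) (cot_mor k C X Y V W f)"
  unfolding compose_def
 proof (subst cot_mor_def, rule restrict_ext)
  fix x assume x: "x <: V.V.FV"
  note t = V.V.dN_cT[OF x]
  have h: "(\<lambda>v\<in>carrier V. g (f v)) : lin_maps k V Z" using compose_lin[OF fl gl yd_mod[OF X V]] by (simp add: compose_def)
  have "VZ.Tf (\<lambda>v\<in>carrier V. g (f v)) (V.V.dN x) = tsum k WZ.W.cT (V.V.dN x) (%v a. WZ.W.pT (g (f v)) a)"
   unfolding VZ.Tf_eq[OF h t] by (rule V.V.ct_cong[OF t]) simp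
  also have "... = tsum k WZ.W.cT (VW.Tf f (V.V.dN x)) (%v a. WZ.W.pT (g v) a)"
   by (rule VW.Tf_eval[OF fl t WZ.W.cT_mod, symmetric]) (assumption|intro WZ.W.cr gl lin_closed[OF gl])+
  also have "... = WZ.Tf g (VW.Tf f (V.V.dN x))"
   by (rule WZ.Tf_eq[OF gl, symmetric], rule lin_closed[OF VW.Tf_lin[OF fl] t])
  finally show "WZ.W.eN (VZ.Tf (\<lambda>v\<in>carrier V. g (f v)) (V.V.dN x)) = cot_mor k C X Y W Z g (cot_mor k C X Y V W f x)"
   using lin_closed[OF yd_maps_lin] VW.cot_mor_hom[OF fy] x
   by (simp add: WZ.cot_mor_app VW.cot_mor_app VW.W.eN_closed VW.Tf_cM[OF fy] V.V.dN_cM VW.W.dN_eN)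
 qed
qed

end

section \<open>The monoidal constraints\<close>

context cogroupoid
begin

text \<open>The form in which the antipode is cancelled when elements of a cotensor product are split: after the
 comultiplication has been moved to \<open>x\<close>, its last two components collapse.\<close>

lemma sw_cancel_left_end:
 assumes ob: "X : ob C" "Y : ob C" "Z : ob C" and x: "x <: alg C X Y" and U: "module k U"
  and \<beta>: "\<beta> : bilin_maps k (alg C X Y) (alg C Z Y) U"
 shows "Sw3 U X Y Z Y x (%a b c. \<beta> a (mm Z Y (anti C Y Z b) c)) = \<beta> x \<one>[alg C Z Y]"
proof -
 note D = bilin_maps_left[OF \<beta>] bilin_maps_right[OF \<beta>]
 have "Sw3 U X Y Z Y x (%a b c. \<beta> a (mm Z Y (anti C Y Z b) c)) = Sw2 U X Y Y x (%a q. coun C Y q *[U] \<beta> a \<one>[alg C Z Y])"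
  by (rule sw_cong, (intro ob x)+, rule sw_anti_left) (assumption|intro ob U | rule D)+
 also have "... = \<beta> x \<one>[alg C Z Y]"
  by (rule sw_coun_right) (assumption|intro ob U x mlin | rule D)+
 finally show ?thesis .
qed

end

context cogroupoid_universe
begin

context
 fixes X and V W :: "('k, 'a, 'u) yd_data"
 assumes X: "X : ob C" and V: "Ob X V" and W: "Ob X W"
begin

abbreviation (input) "dt \<equiv> dec (yd_tensor k (H X) V W) :: 'u \<Rightarrow> _"

lemmas tmods = yd_mod[OF X V] yd_mod[OF X W]

lemma td_dec: "x <: TO X V W ==> dt x <: tensor k V W"
 by (rule lin_closed[OF tob_dec_lin[OF X V W]])

lemma td_closed: "[|x <: TO X V W; module k U; !!a b. [|a <: V; b <: W|] ==> \<beta> a b <: U|] ==> tsum k U (dt x) \<beta> <: U"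
 by (rule tsum_closed[OF tmods td_dec])
lemma td_lin_arg: "[|x <: TO X V W; module k U; !!a b. [|a <: V; b <: W|] ==> (%z. \<beta> z a b) : lin_maps k B U|] ==>
  (%z. tsum k U (dt x) (\<beta> z)) : lin_maps k B U"
 by (rule lin_tsum_arg[OF tmods td_dec])
lemma td_lin: "[|module k U; E : lin_maps k B (TO X V W); \<beta> : bilin_maps k V W U|] ==> (%z. tsum k U (dt (E z)) \<beta>) : lin_maps k B U"
 by (rule lin_tsum_tensor[OF tmods lin_comp[OF tob_dec_lin[OF X V W]]])
lemma td_pure: "[|module k U; \<beta> : bilin_maps k V W U; v <: V; w <: W|] ==> tsum k U (dt (P X V W v w)) \<beta> = \<beta> v w"
 using tsw_eq[OF X V W tp_mlin(1)[OF X V W]] tsw_pure[OF X V W] by metis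

end

end

context cotensor_product
begin

lemmas cg = cm cM_mod cot_proj_mlin cot_proj_closed dN_cM dN_cT dN_mlin eN_closed eN_mlin yd_mlin[OF Y F_ob]

text \<open>\<open>v\<^sub>0 \<otimes> v\<^sub>1 \<otimes> v\<^sub>2\<close> with \<open>v\<^sub>1 \<in> \<C>(X,Y)\<close> and \<open>v\<^sub>2 \<in> \<C>(Y,X)\<close> lies in \<open>(V \<box> \<C>(X,Y)) \<otimes> \<C>(Y,X)\<close>, by coassociativity.\<close>

lemma cot_proj_co:
 assumes v: "v <: V" and U: "module k U" and \<beta>: "\<beta> : bilin_maps k cT (alg C Y X) U"
 shows "Co U V v (%v0 h. Sw2 U X Y X h (%a b. \<beta> (cot_proj (pT v0 a)) b)) = Co U V v (%v0 h. Sw2 U X Y X h (%a b. \<beta> (pT v0 a) b))"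
proof -
 let ?B = "alg C Y X"
 let ?S = "tensor k cT ?B" and ?Q = "tensor k cQ ?B"
 let ?s = "Co ?S V v (%v0 h. Sw2 ?S X Y X h (%a b. pure k cT ?B (pT v0 a) b))"
 let ?p = "%v h a. pure k V (tensor k (alg C X X) cA) v (pure k (alg C X X) cA h a)"
 note B = alg_module[OF Y X]
 note L = lin_comp[OF cot_left_lin] lin_comp[OF cot_right_lin] lin_closed[OF cot_left_lin] lin_closed[OF cot_right_lin]
 have S: "module k ?S" and Q: "module k ?Q" by (intro cr)+
 have s: "?s <: ?S" by (assumption|intro cr v)+
 have ev: "tsum k W ?s \<gamma> = Co W V v (%v0 h. Sw2 W X Y X h (%a b. \<gamma> (pT v0 a) b))"
  if W: "module k W" and \<gamma>: "\<gamma> : bilin_maps k cT ?B W" for W :: "('k, 'w, 'n) module_scheme" and \<gamma>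
 proof -
  have "tsum k W ?s \<gamma> = Co W V v (%v0 h. tsum k W (Sw2 ?S X Y X h (%a b. pure k cT ?B (pT v0 a) b)) \<gamma>)"
   by (rule tsum_tsum[OF cmods(1) alg_module[OF X X] coact_mlin(1)[OF X V v] W cT_mod B _ \<gamma>]) (assumption|intro cr)+
  also have "... = Co W V v (%v0 h. Sw2 W X Y X h (%a b. tsum k W (pure k cT ?B (pT v0 a) b) \<gamma>))"
   by (rule co_cong[OF X V v], rule tsum_tsum[OF cmods(2) B _ W cT_mod B _ \<gamma>]) (assumption|intro cr)+
  also have "... = Co W V v (%v0 h. Sw2 W X Y X h (%a b. \<gamma> (pT v0 a) b))"
   by (rule co_cong[OF X V v], rule sw_cong, (assumption|intro X Y)+, rule tsum_pure[OF cT_mod B W \<gamma>]) (assumption|intro cr)+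
  finally show ?thesis .
 qed
 have "tsum k ?Q ?s (%p b. pure k cQ ?B (cot_left p) b) = Co ?Q V v (%v0 h. Sw2 ?Q X Y X h (%a b. pure k cQ ?B (cot_left (pT v0 a)) b))"
  by (rule ev[OF Q]) (assumption|intro cr L)+
 also have "... = Co ?Q V v (%v0 h. Sw2 ?Q X Y X h (%a b. Co ?Q V v0 (%v0 g. pure k cQ ?B (?p v0 g a) b)))"
  by (rule co_cong[OF X V v], rule sw_cong, (assumption|intro X Y)+, rule cot_left_pure[OF B])
 also have "... = Co ?Q V v (%v0 h. Co ?Q V v0 (%v0 g. Sw2 ?Q X Y X h (%a b. pure k cQ ?B (?p v0 g a) b)))"
  by (rule co_cong[OF X V v], rule co_sw_swap[OF X V, symmetric]) (assumption|intro cr)+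
 also have "... = Co ?Q V v (%v0 q. Sw3 ?Q X X Y X q (%g a b. pure k cQ ?B (?p v0 g a) b))"
  by (rule co_coassoc[OF X V v Q]) (assumption|intro cr)+
 also have "... = Co ?Q V v (%v0 h. Sw2 ?Q X Y X h (%p b. Sw2 ?Q X X Y p (%g a. pure k cQ ?B (?p v0 g a) b)))"
  by (rule co_cong[OF X V v], rule sw_coassoc[symmetric]) (assumption|intro cr)+
 also have "... = Co ?Q V v (%v0 h. Sw2 ?Q X Y X h (%a b. pure k cQ ?B (cot_right (pT v0 a)) b))"
  by (rule co_cong[OF X V v], rule sw_cong, (assumption|intro X Y)+, rule cot_right_pure[OF B, symmetric])
 also have "... = tsum k ?Q ?s (%p b. pure k cQ ?B (cot_right p) b)"
  by (rule ev[OF Q, symmetric]) (assumption|intro cr L)+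
 finally have eq: "tsum k ?Q ?s (%p b. pure k cQ ?B (cot_left p) b) = ..." .
 note Bi = bilin_maps_left[OF \<beta>] bilin_maps_right[OF \<beta>] lin_comp[OF bilin_maps_left[OF \<beta>]] bilin_closed[OF \<beta>]
 have \<beta>': "(%p b. \<beta> (cot_proj p) b) : bilin_maps k cT ?B U"
  by (rule bilin_mapsI, rule Bi(2)[OF lin_closed[OF cot_proj_lin_T]], assumption, rule Bi(3)[OF _ cot_proj_lin_T])
 show ?thesis using cot_proj_tensor[OF B U s \<beta> eq] unfolding ev[OF U \<beta>] ev[OF U \<beta>'] .
qed

end

context cotensor_pair
begin

abbreviation (input) "pP \<equiv> yd_pure k (hopf_at C X) V W"
abbreviation (input) "qP \<equiv> yd_pure k (hopf_at C Y) V.FV W.FV"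
abbreviation (input) "du \<equiv> dec (yd_tensor k (hopf_at C X) V W) :: 'u \<Rightarrow> _"
abbreviation (input) "dq \<equiv> dec (yd_tensor k (hopf_at C Y) V.FV W.FV) :: 'u \<Rightarrow> _"
abbreviation (input) "TP \<equiv> yd_tobj k (hopf_at C X) V W"
abbreviation (input) "TQ \<equiv> yd_tobj k (hopf_at C Y) V.FV W.FV"
abbreviation (input) "Co \<equiv> V.Co"
abbreviation (input) "Sw2 \<equiv> V.Sw2"
abbreviation (input) "Sw3 \<equiv> V.Sw3"
abbreviation (input) "Sw4 \<equiv> V.Sw4"
abbreviation (input) "mm \<equiv> V.mm"

lemma TP_ob: "yd_module k (hopf_at C X) TP" and TQ_ob: "yd_module k (hopf_at C Y) TQ"
 by (rule V.tob_yd[OF X V W]) (rule V.tob_yd[OF Y V.F_ob W.F_ob])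

end

sublocale cotensor_pair \<subseteq> Z: cotensor_product k C univ X Y "yd_tobj k (hopf_at C X) V W"
 by (rule V.cotensor_productI[OF X Y TP_ob])

context cotensor_pair
begin

text \<open>The monoidal constraint on elements of \<open>V \<otimes> \<C>(X,Y)\<close> and \<open>W \<otimes> \<C>(X,Y)\<close>, before transport to the universe.\<close>

definition mul where "mul s t = tsum k Z.cT s (%v a. tsum k Z.cT t (%w b. Z.pT (pP v w) (mm X Y a b)))"

lemmas cp = V.cg W.cg Z.cg V.tp_mlin[OF X V W] V.tp_mlin[OF Y V.F_ob W.F_ob] V.yd_mod[OF Y TQ_ob] V.td_closed[OF X V W] V.td_lin_arg[OF X V W] V.td_lin[OF X V W]
 V.td_closed[OF Y V.F_ob W.F_ob] V.td_lin_arg[OF Y V.F_ob W.F_ob] V.td_lin[OF Y V.F_ob W.F_ob]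

lemma mul_bilin: "mul : bilin_maps k V.cT W.cT Z.cT"
proof (rule bilin_mapsI)
 fix s assume s: "s <: V.cT"
 show "mul s : lin_maps k W.cT Z.cT"
  unfolding mul_def[abs_def] by (rule V.ct_lin_arg[OF s Z.cT_mod], rule W.ct_lin[OF Z.cT_mod lin_id]) (assumption|intro cp)+
next
 fix t assume t: "t <: W.cT"
 show "(%s. mul s t) : lin_maps k V.cT Z.cT"
  unfolding mul_def[abs_def] by (rule V.ct_lin[OF Z.cT_mod lin_id], rule bilin_mapsI; rule W.ct_lin_arg[OF t Z.cT_mod]) (assumption|intro cp)+
qed

lemmas mul_mlin = bilin_closed[OF mul_bilin] lin_comp[OF bilin_maps_left[OF mul_bilin]] lin_comp[OF bilin_maps_right[OF mul_bilin]]

lemma mul_eval: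
 assumes s: "s <: V.cT" and t: "t <: W.cT" and R: "module k R" and \<beta>: "\<beta> : bilin_maps k TP V.cA R"
 shows "tsum k R (mul s t) \<beta> = tsum k R s (%v a. tsum k R t (%w b. \<beta> (pP v w) (mm X Y a b)))"
proof -
 have "tsum k R (mul s t) \<beta> = tsum k R s (%v a. tsum k R (tsum k Z.cT t (%w b. Z.pT (pP v w) (mm X Y a b))) \<beta>)"
  unfolding mul_def by (rule tsum_tsum[OF V.cmods s R Z.cmods _ \<beta>], rule W.ct_closed[OF t Z.cT_mod]) (assumption|intro cp)+
 also have "... = tsum k R s (%v a. tsum k R t (%w b. tsum k R (Z.pT (pP v w) (mm X Y a b)) \<beta>))"
  by (rule V.ct_cong[OF s], rule tsum_tsum[OF W.cmods t R Z.cmods _ \<beta>]) (assumption|intro cp)+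
 also have "... = tsum k R s (%v a. tsum k R t (%w b. \<beta> (pP v w) (mm X Y a b)))"
  by (rule V.ct_cong[OF s], rule W.ct_cong[OF t], rule Z.ct_pure[OF R \<beta>]) (assumption|intro cp)+
 finally show ?thesis .
qed

lemma mul_pure:
 assumes m: "v <: V" "a <: V.cA" "w <: W" "b <: V.cA"
 shows "mul (V.pT v a) (W.pT w b) = Z.pT (pP v w) (mm X Y a b)"
proof -
 have p: "W.pT w b <: W.cT" by (intro cp m)
 have "mul (V.pT v a) (W.pT w b) = tsum k Z.cT (W.pT w b) (%w b. Z.pT (pP v w) (mm X Y a b))"
  unfolding mul_def by (rule V.ct_pure[OF Z.cT_mod _ m(1,2)], rule bilin_mapsI; rule W.ct_lin_arg[OF p Z.cT_mod]) (assumption|intro cp)+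
 also have "... = Z.pT (pP v w) (mm X Y a b)" by (rule W.ct_pure[OF Z.cT_mod _ m(3,4)]) (assumption|intro cp m)+
 finally show ?thesis .
qed

lemma mul_cM:
 assumes s: "s <: V.cM" and t: "t <: W.cM" shows "mul s t <: Z.cM"
proof -
 note sT = V.cM_T[OF s] and tT = W.cM_T[OF t]
 let ?Q = "Z.cQ" note Q = Z.cQ_mod
 let ?p = "%u h a. pure k TP (tensor k (alg C X X) V.cA) u (pure k (alg C X X) V.cA h a)"
 note i = V.ct_closed[OF sT] V.ct_lin_arg[OF sT] W.ct_closed[OF tT] W.ct_lin_arg[OF tT] cp
 have "Z.cot_left (mul s t) = tsum k ?Q s (%v a. tsum k ?Q t (%w b. Co ?Q TP (pP v w) (%u h. ?p u h (mm X Y a b))))"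
  unfolding Z.cot_left_def by (rule mul_eval[OF sT tT Q]) (assumption|intro cp)+
 also have "... = tsum k ?Q s (%v a. tsum k ?Q t (%w b. Co ?Q V v (%v0 g. Co ?Q W w (%w0 h. ?p (pP v0 w0) (mm X X g h) (mm X Y a b)))))"
  by (rule V.ct_cong[OF sT], rule W.ct_cong[OF tT], rule V.tob_co[OF X V W]) (assumption|intro cp)+
 also have "... = tsum k ?Q s (%v a. Co ?Q V v (%v0 g. tsum k ?Q t (%w b. Co ?Q W w (%w0 h. ?p (pP v0 w0) (mm X X g h) (mm X Y a b)))))"
  by (rule V.ct_cong[OF sT], rule tsum_swap[OF W.cmods tT Q V.cmods(1) V.alg_module[OF X X] V.coact_mlin(1)[OF X V]]) (assumption|intro cp)+
 also have "... = tsum k ?Q s (%v a. Sw2 ?Q X X Y a (%g a'. tsum k ?Q t (%w b. Co ?Q W w (%w0 h. ?p (pP v w0) (mm X X g h) (mm X Y a' b)))))"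
  by (rule V.cM_cond[OF s Q]) (assumption|intro i)+
 also have "... = tsum k ?Q s (%v a. Sw2 ?Q X X Y a (%g a'. tsum k ?Q t (%w b. Sw2 ?Q X X Y b (%h b'. ?p (pP v w) (mm X X g h) (mm X Y a' b')))))"
  by (rule V.ct_cong[OF sT], rule V.sw_cong, (assumption|intro X Y)+, rule W.cM_cond[OF t Q]) (assumption|intro cp)+
 also have "... = tsum k ?Q s (%v a. tsum k ?Q t (%w b. Sw2 ?Q X X Y a (%g a'. Sw2 ?Q X X Y b (%h b'. ?p (pP v w) (mm X X g h) (mm X Y a' b')))))"
  by (rule V.ct_cong[OF sT], rule W.ct_sw_swap[OF tT, symmetric]) (assumption|intro cp)+
 also have "... = tsum k ?Q s (%v a. tsum k ?Q t (%w b. Sw2 ?Q X X Y (mm X Y a b) (%g c. ?p (pP v w) g c)))"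
  by (rule V.ct_cong[OF sT], rule W.ct_cong[OF tT], rule V.sw_mult[symmetric]) (assumption|intro cp)+
 also have "... = Z.cot_right (mul s t)"
  unfolding Z.cot_right_def by (rule mul_eval[OF sT tT Q, symmetric]) (assumption|intro cp)+
 finally show ?thesis unfolding Z.cM_iff using mul_mlin(1)[OF sT tT] by simp
qed

text \<open>On the left \<open>S(x\<^sub>1) a x\<^sub>3\<close> is multiplied by \<open>S(x\<^sub>4) b x\<^sub>6\<close>, and \<open>x\<^sub>3 S(x\<^sub>4)\<close> cancels.\<close>

lemma mul_act_pure:
 assumes m: "v <: V" "a <: V.cA" "w <: W" "b <: V.cA" and x: "x <: V.cB"
 shows "Sw2 Z.cT Y Y Y x (%p q. mul (V.cot_act (V.pT v a) p) (W.cot_act (W.pT w b) q)) = Z.cot_act (Z.pT (pP v w) (mm X Y a b)) x"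
proof -
 let ?T = "Z.cT" note T = Z.cT_mod
 let ?S = "anti C Y X"
 let ?F = "%p1 p2 y q2 q3. Z.pT (pP (ract V v p2) (ract W w q2)) (mm X Y (mm X Y (mm X Y (mm X Y (?S p1) a) y) b) q3)"
 have "Sw2 ?T Y Y Y x (%p q. mul (V.cot_act (V.pT v a) p) (W.cot_act (W.pT w b) q)) =
  Sw2 ?T Y Y Y x (%p q. Sw3 ?T Y X X Y p (%p1 p2 p3. Sw3 ?T Y X X Y q (%q1 q2 q3. ?F p1 p2 (mm X Y p3 (?S q1)) q2 q3)))"
 proof (rule V.sw_cong, (intro Y x)+)
  fix p q assume n: "p <: V.cB" "q <: V.cB"
  let ?v = "%p1 p2 p3. V.pT (ract V v p2) (mm X Y (mm X Y (?S p1) a) p3)" and ?w = "%q1 q2 q3. W.pT (ract W w q2) (mm X Y (mm X Y (?S q1) b) q3)"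
  have "mul (V.cot_act (V.pT v a) p) (W.cot_act (W.pT w b) q) = mul (Sw3 V.cT Y X X Y p ?v) (Sw3 W.cT Y X X Y q ?w)"
   by (simp only: V.cot_act_pure[OF m(1,2) n(1)] W.cot_act_pure[OF m(3,4) n(2)])
  also have "... = Sw3 ?T Y X X Y p (%p1 p2 p3. mul (?v p1 p2 p3) (Sw3 W.cT Y X X Y q ?w))"
   by (rule V.lin_sw3[OF Y X X Y n(1) V.cT_mod T]) (assumption|intro cp m n mul_mlin lin_id)+
  also have "... = Sw3 ?T Y X X Y p (%p1 p2 p3. Sw3 ?T Y X X Y q (%q1 q2 q3. mul (?v p1 p2 p3) (?w q1 q2 q3)))"
   by (rule V.sw_cong, (intro X Y n)+, rule V.sw_cong, (assumption|intro X Y)+, rule V.lin_sw3[OF Y X X Y n(2) W.cT_mod T]) (assumption|intro cp m n mul_mlin lin_id)+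
  also have "... = Sw3 ?T Y X X Y p (%p1 p2 p3. Sw3 ?T Y X X Y q (%q1 q2 q3. ?F p1 p2 (mm X Y p3 (?S q1)) q2 q3))"
   by (rule V.sw_cong, (intro X Y n)+, rule V.sw_cong, (assumption|intro X Y)+, rule V.sw_cong, (intro X Y n)+, rule V.sw_cong, (assumption|intro X Y)+,
     subst mul_pure) (assumption|intro cp m | simp only: V.alg_assoc V.anti_closed V.alg_mult_closed X Y m)+
  finally show "mul (V.cot_act (V.pT v a) p) (W.cot_act (W.pT w b) q) = ..." .
 qed
 also have "... = Sw4 ?T Y X X X Y x (%p1 p2 q2 q3. ?F p1 p2 \<one>[V.cA] q2 q3)"
  by (rule V.sw_adjoint_cancel) (assumption|intro cp m x)+
 also have "... = Sw2 ?T Y X Y x (%p1 r. Sw2 ?T X X Y r (%x2 q3. Sw2 ?T X X X x2 (%p2 q2. ?F p1 p2 \<one>[V.cA] q2 q3)))"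
  by (rule V.sw_cong, (intro X Y x)+, rule V.sw_coassoc[symmetric]) (assumption|intro cp m)+
 also have "... = Sw3 ?T Y X X Y x (%p1 x2 q3. Z.pT (ract TP (pP v w) x2) (mm X Y (mm X Y (?S p1) (mm X Y a b)) q3))"
 proof (rule V.sw_cong, (intro X Y x)+, rule V.sw_cong, (assumption|intro X Y)+)
  fix p1 r x2 q3 assume n: "p1 <: alg C Y X" "x2 <: alg C X X" "q3 <: V.cA"
  have "Z.pT (ract TP (pP v w) x2) (mm X Y (mm X Y (?S p1) (mm X Y a b)) q3) =
   Z.pT (Sw2 TP X X X x2 (%p2 q2. pP (ract V v p2) (ract W w q2))) (mm X Y (mm X Y (?S p1) (mm X Y a b)) q3)"
   by (simp only: V.tob_ract[OF X V W m(1,3) n(2)])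
  also have "... = Sw2 ?T X X X x2 (%p2 q2. Z.pT (pP (ract V v p2) (ract W w q2)) (mm X Y (mm X Y (?S p1) (mm X Y a b)) q3))"
   by (rule V.lin_sw[OF X X X n(2) Z.cmods(1) T]) (assumption|intro cp m n)+
  also have "... = Sw2 ?T X X X x2 (%p2 q2. ?F p1 p2 \<one>[V.cA] q2 q3)"
   by (rule V.sw_cong, (intro X n)+) (simp add: V.alg_simps X Y m n)
  finally show "Sw2 ?T X X X x2 (%p2 q2. ?F p1 p2 \<one>[V.cA] q2 q3) = Z.pT (ract TP (pP v w) x2) (mm X Y (mm X Y (?S p1) (mm X Y a b)) q3)" by simp
 qed
 also have "... = Z.cot_act (Z.pT (pP v w) (mm X Y a b)) x"
  by (rule Z.cot_act_pure[symmetric]) (intro cp m x)+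
 finally show ?thesis .
qed

lemma mul_act:
 assumes s: "s <: V.cT" and t: "t <: W.cT" and x: "x <: V.cB"
 shows "Sw2 Z.cT Y Y Y x (%p q. mul (V.cot_act s p) (W.cot_act t q)) = Z.cot_act (mul s t) x"
proof (rule lin_tensor_eq[OF V.cmods Z.cT_mod _ _ _ s])
 note al = V.cot_act_lin1 V.cot_act_lin2 V.cot_act_closed W.cot_act_lin1 W.cot_act_lin2 W.cot_act_closed
 show "(%s. Sw2 Z.cT Y Y Y x (%p q. mul (V.cot_act s p) (W.cot_act t q))) : lin_maps k V.cT Z.cT"
  by (assumption|intro V.sw_lin_arg x Y Z.cT_mod mul_mlin al t)+
 show "(%s. Z.cot_act (mul s t) x) : lin_maps k V.cT Z.cT"
  by (rule lin_comp[OF Z.cot_act_lin1[OF x]]) (intro mul_mlin lin_id t)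
 fix v a assume m: "v <: V" "a <: V.cA"
 have p: "V.pT v a <: V.cT" by (intro cp m)
 show "Sw2 Z.cT Y Y Y x (%p q. mul (V.cot_act (V.pT v a) p) (W.cot_act t q)) = Z.cot_act (mul (V.pT v a) t) x"
 proof (rule lin_tensor_eq[OF W.cmods Z.cT_mod _ _ _ t])
  show "(%t. Sw2 Z.cT Y Y Y x (%q r. mul (V.cot_act (V.pT v a) q) (W.cot_act t r))) : lin_maps k W.cT Z.cT"
   by (assumption|intro V.sw_lin_arg x Y Z.cT_mod mul_mlin al p)+
  show "(%t. Z.cot_act (mul (V.pT v a) t) x) : lin_maps k W.cT Z.cT"
   by (rule lin_comp[OF Z.cot_act_lin1[OF x]]) (intro mul_mlin lin_id p)
 qed (simp only: mul_act_pure[OF m _ _ x] mul_pure[OF m])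
qed

definition m0 where "m0 y = tsum k Z.cT (dq y) (%s t. mul (V.dN s) (W.dN t))"

lemma m0_bilin: "(%s t. mul (V.dN s) (W.dN t)) : bilin_maps k V.FV W.FV Z.cT"
 and m0_bilin_cM: "(%s t. mul (V.dN s) (W.dN t)) : bilin_maps k V.FV W.FV Z.cM"
 by (assumption|intro bilin_mapsI Z.cM_into_lin mul_cM mul_mlin cp lin_id)+

lemma m0_lin: "m0 : lin_maps k TQ Z.cM" and m0_cM: "y <: TQ ==> m0 y <: Z.cM"
proof -
 have e: "m0 y = tsum k Z.cM (dq y) (%s t. mul (V.dN s) (W.dN t))" if "y <: TQ" for y
  unfolding m0_def
  by (rule lin_tsum[OF V.yd_mod[OF Y V.F_ob] V.yd_mod[OF Y W.F_ob] V.td_dec[OF Y V.F_ob W.F_ob that] Z.cM_mod Z.cT_mod Z.cM_incl, symmetric])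
   (rule bilin_closed[OF m0_bilin_cM])
 show "m0 : lin_maps k TQ Z.cM"
  by (rule lin_cong[OF V.td_lin[OF Y V.F_ob W.F_ob Z.cM_mod lin_id m0_bilin_cM] V.yd_mod[OF Y TQ_ob] e[symmetric]])
 then show "y <: TQ ==> m0 y <: Z.cM" by (rule lin_closed)
qed

lemma m0_pure: "[|s <: V.FV; t <: W.FV|] ==> m0 (qP s t) = mul (V.dN s) (W.dN t)"
 unfolding m0_def by (rule V.td_pure[OF Y V.F_ob W.F_ob Z.cT_mod m0_bilin])

lemma cot_mu_app:
 assumes y: "y <: TQ" shows "cot_mu k C X Y V W y = Z.eN (m0 y)"
proof -
 let ?T = "Z.cT"
 have "sweedler k ?T (dq y) (%s t. sweedler k ?T (V.dN s) (%v a. sweedler k ?T (W.dN t) (%w b. Z.pT (pP v w) (mm X Y a b)))) = m0 y"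
  unfolding m0_def
 proof (rule sweedler_eq_tsum_cong[OF V.yd_mod[OF Y V.F_ob] V.yd_mod[OF Y W.F_ob] V.td_dec[OF Y V.F_ob W.F_ob y] Z.cT_mod _ m0_bilin])
  fix s t assume "s <: V.FV" "t <: W.FV"
  then have s: "V.dN s <: V.cT" and t: "W.dN t <: W.cT" by (simp_all add: V.dN_cT W.dN_cT)
  show "sweedler k ?T (V.dN s) (%v a. sweedler k ?T (W.dN t) (%w b. Z.pT (pP v w) (mm X Y a b))) = mul (V.dN s) (W.dN t)"
   unfolding mul_def
   by (rule sweedler_eq_tsum_cong[OF V.cmods s Z.cT_mod], rule sweedler_eq_tsum_cong[OF W.cmods t Z.cT_mod])
    (assumption | rule refl | intro bilin_mapsI W.ct_lin_arg[OF t] Z.cT_mod cp)+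
 qed
 then show ?thesis using y unfolding cot_mu_def Let_def yd_sweedler_def by simp
qed

lemma cot_mu_pure: "[|s <: V.FV; t <: W.FV|] ==> cot_mu k C X Y V W (qP s t) = Z.eN (mul (V.dN s) (W.dN t))"
 by (simp add: cot_mu_app m0_pure V.tp_mlin(1)[OF Y V.F_ob W.F_ob])

lemma cot_mu_lin: "cot_mu k C X Y V W : lin_maps k TQ Z.FV"
 by (rule lin_cong[OF lin_comp[OF Z.eN_lin m0_lin] V.yd_mod[OF Y TQ_ob] cot_mu_app[symmetric]])

lemma cot_mu_ext: "cot_mu k C X Y V W \<in> extensional (carrier TQ)"
 unfolding cot_mu_def Let_def by simp

lemma cot_mu_hom: "cot_mu k C X Y V W \<in> homs (V.D Y) TQ Z.FV"
proof -
 let ?f = "cot_mu k C X Y V W"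
 have "?f : yd_maps k (hopf_at C Y) TQ Z.FV"
 proof (rule V.tob_ydI[OF Y V.F_ob W.F_ob Z.F_ob cot_mu_lin], unfold Let_def)
  fix s t assume s: "s <: V.FV" and t: "t <: W.FV"
  note sd = V.dN_cM[OF s] and td = W.dN_cM[OF t] note sT = V.cM_T[OF sd] and tT = W.cM_T[OF td]
  show "Sw2 Z.FV Y Y Y x (%p q. ?f (qP (ract V.FV s p) (ract W.FV t q))) = ract Z.FV (?f (qP s t)) x" if x: "x <: V.cB" for x
  proof -
   let ?g = "%p q. mul (V.cot_act (V.dN s) p) (W.cot_act (W.dN t) q)"
   note ac = V.cot_act_cM[OF sd] W.cot_act_cM[OF td]
   have "Sw2 Z.FV Y Y Y x (%p q. ?f (qP (ract V.FV s p) (ract W.FV t q))) = Sw2 Z.FV Y Y Y x (%p q. Z.eN (?g p q))"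
    by (rule V.sw_cong[OF Y Y Y x])
     (simp add: V.F_ract s t W.F_ract cot_mu_pure V.eN_closed W.eN_closed V.dN_eN W.dN_eN ac)
   also have "... = Z.eN (Sw2 Z.cM Y Y Y x ?g)"
    by (rule V.lin_sw[OF Y Y Y x Z.cM_mod _ Z.eN_lin, symmetric]) (assumption|intro cp mul_cM ac)+
   also have "Sw2 Z.cM Y Y Y x ?g = Sw2 Z.cT Y Y Y x ?g"
    by (rule V.lin_sw[OF Y Y Y x Z.cM_mod Z.cT_mod Z.cM_incl]) (assumption|intro mul_cM ac)+
   also have "... = Z.cot_act (mul (V.dN s) (W.dN t)) x" by (rule mul_act[OF sT tT x])
   also have "Z.eN ... = ract Z.FV (?f (qP s t)) x"
    by (simp add: cot_mu_pure s t Z.F_ract x Z.eN_closed mul_cM sd td Z.dN_eN)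
   finally show ?thesis .
  qed
  let ?B = "V.cB" let ?R = "tensor k Z.FV ?B" and ?r = "pure k Z.FV ?B"
  let ?z = "%p q g h. ?r (Z.eN (Z.cot_proj (mul p q))) (mm Y Y g h)"
  have R: "module k ?R" by (intro cp)+
  note mi = cp mul_mlin lin_id V.ct_closed[OF sT] V.ct_lin_arg[OF sT] W.ct_closed[OF tT] W.ct_lin_arg[OF tT] s t
  have zf: "?z (V.dN s0) (W.dN t0) g h = ?r (?f (qP s0 t0)) (mm Y Y g h)" if "s0 <: V.FV" "t0 <: W.FV" for s0 t0 g h
   using that by (simp add: cot_mu_pure Z.cot_proj_id mul_cM V.dN_cM W.dN_cM)
  have "Co ?R V.FV s (%s0 g. Co ?R W.FV t (%t0 h. ?r (?f (qP s0 t0)) (mm Y Y g h))) =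
   Co ?R V.FV s (%s0 g. Co ?R W.FV t (%t0 h. ?z (V.dN s0) (W.dN t0) g h))"
   by (rule V.co_cong[OF Y V.F_ob s], rule V.co_cong[OF Y W.F_ob t], rule zf[symmetric])
  also have "... = Co ?R V.FV s (%s0 g. tsum k ?R (W.dN t) (%w b. Sw2 ?R X Y Y b (%b1 b2. ?z (V.dN s0) (W.pT w b1) g b2)))"
   by (rule V.co_cong[OF Y V.F_ob s], rule W.F_co_T[OF t R]) (assumption|intro mi | simp only: W.dN_eN)+
  also have "... = tsum k ?R (V.dN s) (%v a. Sw2 ?R X Y Y a (%a1 a2. tsum k ?R (W.dN t) (%w b. Sw2 ?R X Y Y b (%b1 b2. ?z (V.pT v a1) (W.pT w b1) a2 b2))))"
   by (rule V.F_co_T[OF s R]) (assumption|intro mi | simp only: V.dN_eN)+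
  also have "... = tsum k ?R (V.dN s) (%v a. tsum k ?R (W.dN t) (%w b. Sw2 ?R X Y Y a (%a1 a2. Sw2 ?R X Y Y b (%b1 b2. ?z (V.pT v a1) (W.pT w b1) a2 b2))))"
   by (rule V.ct_cong[OF sT], rule W.ct_sw_swap[OF tT, symmetric]) (assumption|intro mi)+
  also have "... = tsum k ?R (V.dN s) (%v a. tsum k ?R (W.dN t) (%w b. Sw2 ?R X Y Y (mm X Y a b) (%c1 c2. ?r (Z.eN (Z.cot_proj (Z.pT (pP v w) c1))) c2)))"
  proof (rule V.ct_cong[OF sT], rule W.ct_cong[OF tT])
   fix v a w b assume m: "v <: V" "a <: V.cA" "w <: W" "b <: V.cA"
   have "Sw2 ?R X Y Y (mm X Y a b) (%c1 c2. ?r (Z.eN (Z.cot_proj (Z.pT (pP v w) c1))) c2) =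
    Sw2 ?R X Y Y a (%a1 a2. Sw2 ?R X Y Y b (%b1 b2. ?r (Z.eN (Z.cot_proj (Z.pT (pP v w) (mm X Y a1 b1)))) (mm Y Y a2 b2)))"
    by (rule V.sw_mult) (assumption|intro cp m)+
   also have "... = Sw2 ?R X Y Y a (%a1 a2. Sw2 ?R X Y Y b (%b1 b2. ?z (V.pT v a1) (W.pT w b1) a2 b2))"
    by (rule V.sw_cong, (intro X Y m)+, rule V.sw_cong, (intro X Y m)+) (simp only: mul_pure m)
   finally show "Sw2 ?R X Y Y a (%a1 a2. Sw2 ?R X Y Y b (%b1 b2. ?z (V.pT v a1) (W.pT w b1) a2 b2)) =
    Sw2 ?R X Y Y (mm X Y a b) (%c1 c2. ?r (Z.eN (Z.cot_proj (Z.pT (pP v w) c1))) c2)" by simp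
  qed
  also have "... = tsum k ?R (mul (V.dN s) (W.dN t)) (%u c. Sw2 ?R X Y Y c (%c1 c2. ?r (Z.eN (Z.cot_proj (Z.pT u c1))) c2))"
   by (rule mul_eval[OF sT tT R, symmetric]) (assumption|intro cp)+
  also have "... = Co ?R Z.FV (?f (qP s t)) ?r"
   unfolding cot_mu_pure[OF s t]
   by (subst Z.F_co[OF Z.eN_closed[OF mul_cM[OF sd td]] R], (assumption|intro cp)+) (simp only: Z.dN_eN[OF mul_cM[OF sd td]])
  also have "... = coact Z.FV (?f (qP s t))"
   by (rule V.co_pure[OF Y Z.F_ob lin_closed[OF cot_mu_lin]]) (intro cp s t)
  finally show "Co ?R V.FV s (%s0 g. Co ?R W.FV t (%t0 h. ?r (?f (qP s0 t0)) (mm Y Y g h))) = ..." .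
 qed
 then show ?thesis using cot_mu_ext by (simp add: V.D_simps[OF Y])
qed

end

context cotensor_pair
begin

text \<open>The composition of \<open>v \<otimes> w \<otimes> c \<mapsto> v\<^sub>0 \<otimes> v\<^sub>1 \<otimes> w \<otimes> S(v\<^sub>2) c\<close> with a bilinear map \<open>\<gamma>\<close>. As the values lie in
 \<open>(V \<box> \<C>(X,Y)) \<otimes> (W \<box> \<C>(X,Y))\<close> only as a whole, \<open>\<gamma>\<close> is allowed to be defined on the large spaces.\<close>

definition sp where "sp R \<gamma> t = tsum k R t (%u c. tsum k R (du u) (%v w. Co R V v (%v0 h. Sw2 R X Y X h (%g b. \<gamma> (V.pT v0 g) (W.pT w (mm X Y (anti C Y X b) c))))))"

context
 fixes R :: "('k, 'z, 'n) module_scheme" and \<gamma>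
 assumes R: "module k R" and \<gamma>: "\<gamma> : bilin_maps k V.cT W.cT R"
begin

lemmas sg = bilin_closed[OF \<gamma>] lin_comp[OF bilin_maps_left[OF \<gamma>]] lin_comp[OF bilin_maps_right[OF \<gamma>]] R

lemma sp_lin: "sp R \<gamma> : lin_maps k Z.cT R"
 unfolding sp_def[abs_def] by (rule Z.ct_lin[OF R lin_id]) (assumption|intro cp sg)+

lemma sp_comp:
 assumes t: "t <: Z.cT" and R': "module k R'" and f: "f : lin_maps k R R'"
 shows "f (sp R \<gamma> t) = sp R' (%p q. f (\<gamma> p q)) t"
proof -
 note i = cp sg
 have "f (sp R \<gamma> t) = tsum k R' t (%u c. f (tsum k R (du u) (%v w. Co R V v (%v0 h. Sw2 R X Y X h (%g b. \<gamma> (V.pT v0 g) (W.pT w (mm X Y (anti C Y X b) c)))))))"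
  unfolding sp_def by (rule lin_tsum[OF Z.cmods t R R' f]) (assumption|intro i)+
 also have "... = sp R' (%p q. f (\<gamma> p q)) t"
  unfolding sp_def
  by (rule Z.ct_cong[OF t], subst lin_tsum[OF V.cmods(1) W.cmods(1) V.td_dec[OF X V W] R R' f], assumption, (assumption|intro i)+,
    rule tsum_cong'[OF V.cmods(1) W.cmods(1) V.td_dec[OF X V W]], assumption, subst lin_tsum[OF V.cmods(1) V.alg_module[OF X X] V.coact_mlin(1)[OF X V] R R' f], assumption, (assumption|intro i)+,
    rule V.co_cong[OF X V], assumption, rule V.lin_sw[OF X X Y _ R R' f]) (assumption|intro i)+
 finally show ?thesis .
qed

lemma sp_projV:
 assumes t: "t <: Z.cT" shows "sp R (%p q. \<gamma> (V.cot_proj p) q) t = sp R \<gamma> t"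
 unfolding sp_def
 by (rule Z.ct_cong[OF t], rule tsum_cong'[OF V.cmods(1) W.cmods(1) V.td_dec[OF X V W]], assumption, rule V.cot_proj_co) (assumption|intro cp sg lin_id)+

text \<open>On \<open>(v \<otimes> a) \<otimes> (w \<otimes> b)\<close> the formula gives \<open>v\<^sub>0 \<otimes> v\<^sub>1 \<otimes> w \<otimes> S(v\<^sub>2) a b\<close>; the equation of the cotensor product turns this
 into \<open>v \<otimes> a\<^sub>1 \<otimes> w \<otimes> S(a\<^sub>2) a\<^sub>3 b\<close>.\<close>

lemma sp_of_mul:
 assumes s: "s <: V.cM" and t: "t <: W.cT" shows "sp R \<gamma> (mul s t) = \<gamma> s t"
proof -
 note sT = V.cM_T[OF s]
 let ?g = "%v g w b c. \<gamma> (V.pT v g) (W.pT w (mm X Y (anti C Y X b) c))"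
 note i = cp sg lin_id V.ct_closed[OF sT] V.ct_lin_arg[OF sT] W.ct_closed[OF t] W.ct_lin_arg[OF t]
 have "sp R \<gamma> (mul s t) = tsum k R s (%v a. tsum k R t (%w b. tsum k R (du (pP v w)) (%v w. Co R V v (%v0 h. Sw2 R X Y X h (%g d. ?g v0 g w d (mm X Y a b))))))"
  unfolding sp_def by (rule mul_eval[OF sT t R]) (assumption|intro i)+
 also have "... = tsum k R s (%v a. tsum k R t (%w b. Co R V v (%v0 h. Sw2 R X Y X h (%g d. ?g v0 g w d (mm X Y a b)))))"
  by (rule V.ct_cong[OF sT], rule W.ct_cong[OF t], rule V.td_pure[OF X V W R]) (assumption|intro i)+
 also have "... = tsum k R s (%v a. Co R V v (%v0 h. tsum k R t (%w b. Sw2 R X Y X h (%g d. ?g v0 g w d (mm X Y a b)))))"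
  by (rule V.ct_cong[OF sT], rule tsum_swap[OF W.cmods t R V.cmods(1) V.alg_module[OF X X] V.coact_mlin(1)[OF X V]]) (assumption|intro i)+
 also have "... = tsum k R s (%v a. Sw2 R X X Y a (%h a'. tsum k R t (%w b. Sw2 R X Y X h (%g d. ?g v g w d (mm X Y a' b)))))"
  by (rule V.cM_cond[OF s R]) (assumption|intro i)+
 also have "... = tsum k R s (%v a. tsum k R t (%w b. Sw2 R X X Y a (%h a'. Sw2 R X Y X h (%g d. ?g v g w d (mm X Y a' b)))))"
  by (rule V.ct_cong[OF sT], rule W.ct_sw_swap[OF t, symmetric]) (assumption|intro i)+
 also have "... = tsum k R s (%v a. tsum k R t (%w b. \<gamma> (V.pT v a) (W.pT w b)))"
 proof (rule V.ct_cong[OF sT], rule W.ct_cong[OF t])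
  fix v a w b assume m: "v <: V" "a <: V.cA" "w <: W" "b <: V.cA"
  have "Sw2 R X X Y a (%h a'. Sw2 R X Y X h (%g d. ?g v g w d (mm X Y a' b))) = Sw3 R X Y X Y a (%g d a'. ?g v g w d (mm X Y a' b))"
   by (rule V.sw_coassoc) (assumption|intro i m)+
  also have "... = Sw3 R X Y X Y a (%g d a'. \<gamma> (V.pT v g) (W.pT w (mm X Y (mm X Y (anti C Y X d) a') b)))"
   by (rule V.sw_cong, (intro X Y m)+, rule V.sw_cong, (assumption|intro X Y)+) (simp only: V.alg_assoc V.anti_closed X Y m)
  also have "... = \<gamma> (V.pT v a) (W.pT w (mm X Y \<one>[V.cA] b))"
   by (rule V.sw_cancel_left_end) (assumption|intro i m)+
  finally show "Sw2 R X X Y a (%h a'. Sw2 R X Y X h (%g d. ?g v g w d (mm X Y a' b))) = \<gamma> (V.pT v a) (W.pT w b)"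
   by (simp add: V.alg_l_one X Y m)
 qed
 also have "... = tsum k R s (%v a. \<gamma> (V.pT v a) t)"
  by (rule V.ct_cong[OF sT], rule W.ct_comp[OF t R, symmetric]) (assumption|intro i)+
 also have "... = \<gamma> s t" by (rule V.ct_comp[OF sT R, symmetric], rule bilin_maps_left[OF \<gamma> t])
 finally show ?thesis .
qed

end

text \<open>In \<open>v\<^sub>0 \<otimes> w \<otimes> v\<^sub>1 S(v\<^sub>2) c\<close> the antipode cancels.\<close>

lemma sp_mul:
 assumes t: "t <: Z.cT" shows "sp Z.cT mul t = t"
proof -
 note i = cp mul_mlin lin_id and T = Z.cT_mod
 have "sp Z.cT mul t = tsum k Z.cT t Z.pT"
  unfolding sp_def
 proof (rule Z.ct_cong[OF t])
  fix u c assume u: "u <: TP" and c: "c <: V.cA"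
  show "tsum k Z.cT (du u) (%v w. Co Z.cT V v (%v0 h. Sw2 Z.cT X Y X h (%g b. mul (V.pT v0 g) (W.pT w (mm X Y (anti C Y X b) c))))) = Z.pT u c"
  proof (rule V.tob_eq[OF X V W T _ _ _ u])
   fix v w assume m: "v <: V" "w <: W"
   have "tsum k Z.cT (du (pP v w)) (%v w. Co Z.cT V v (%v0 h. Sw2 Z.cT X Y X h (%g b. mul (V.pT v0 g) (W.pT w (mm X Y (anti C Y X b) c))))) =
    Co Z.cT V v (%v0 h. Sw2 Z.cT X Y X h (%g b. mul (V.pT v0 g) (W.pT w (mm X Y (anti C Y X b) c))))"
    by (rule V.td_pure[OF X V W T]) (assumption|intro i m c)+
   also have "... = Co Z.cT V v (%v0 h. Sw2 Z.cT X Y X h (%g b. Z.pT (pP v0 w) (mm X Y (mm X Y g (anti C Y X b)) c)))"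
    by (rule V.co_cong[OF X V m(1)], rule V.sw_cong, (assumption|intro X Y)+) (simp add: mul_pure m c V.alg_simps X Y V.anti_closed)
   also have "... = Co Z.cT V v (%v0 h. coun C X h *[Z.cT] Z.pT (pP v0 w) (mm X Y \<one>[V.cA] c))"
    by (rule V.co_cong[OF X V m(1)], rule V.sw_anti_right) (assumption|intro i m c)+
   also have "... = Z.pT (pP v w) (mm X Y \<one>[V.cA] c)"
    by (rule V.co_counit[OF X V m(1) T]) (assumption|intro i m c)+
   finally show "tsum k Z.cT (du (pP v w)) (%v w. Co Z.cT V v (%v0 h. Sw2 Z.cT X Y X h (%g b. mul (V.pT v0 g) (W.pT w (mm X Y (anti C Y X b) c))))) = Z.pT (pP v w) c"
    by (simp add: V.alg_l_one X Y c)
  qed (assumption|intro i c)+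
 qed
 then show ?thesis by (simp only: Z.ct_self[OF t])
qed

text \<open>The second leg lies in \<open>W \<box> \<C>(X,Y)\<close>: comultiplying \<open>S(v\<^sub>2) c\<close> gives \<open>S(v\<^sub>3) c\<^sub>1 \<otimes> S(v\<^sub>2) c\<^sub>2\<close>, and here the equation of
 \<open>(V \<otimes> W) \<box> \<C>(X,Y)\<close> replaces \<open>c\<^sub>1\<close> by \<open>v\<^sub>4 w\<^sub>1\<close>, so that \<open>S(v\<^sub>3) v\<^sub>4\<close> cancels and the coaction of \<open>w\<close> remains.\<close>

lemma sp_projW:
 assumes t: "t <: Z.cM" and R: "module k (R :: ('k, 'z, 'n) module_scheme)" and \<gamma>: "\<gamma> : bilin_maps k V.cT W.cT R"
 shows "sp R (%p q. \<gamma> p (W.cot_proj q)) t = sp R \<gamma> t"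
proof -
 note tT = Z.cM_T[OF t]
 let ?S = "tensor k W.cT V.cT" and ?Q = "tensor k W.cQ V.cT"
 let ?p = "%w g x. pure k W (tensor k (alg C X X) V.cA) w (pure k (alg C X X) V.cA g x)"
 let ?r = "%v a w g x. pure k W.cQ V.cT (?p w g x) (V.pT v a)"
 let ?S1 = "anti C Y X" and ?SX = "anti C X X"
 have S: "module k ?S" and Q: "module k ?Q" by (intro cp W.cQ_mod)+
 have pb: "(%p q. pure k W.cT V.cT q p) : bilin_maps k V.cT W.cT ?S" by (intro cp)
 note i = cp lin_id W.cQ_mod and s = lin_closed[OF sp_lin[OF S pb] tT]
 have gb: "(%q p. \<gamma> p q) : bilin_maps k W.cT V.cT R" using \<gamma> by (simp add: bilin_maps_def)
 have ev: "tsum k R' (sp ?S (%p q. pure k W.cT V.cT q p) t) (%q p. \<delta> q p) = sp R' (%p q. \<delta> q p) t"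
  if R': "module k R'" and d: "\<delta> : bilin_maps k W.cT V.cT R'" for R' :: "('k, 'y, 'm) module_scheme" and \<delta>
 proof -
  have "tsum k R' (sp ?S (%p q. pure k W.cT V.cT q p) t) \<delta> = sp R' (%p q. tsum k R' (pure k W.cT V.cT q p) \<delta>) t"
   by (rule sp_comp[OF S pb tT R' tsum_lin[OF W.cT_mod V.cT_mod R' d]])
  also have "... = sp R' (%p q. \<delta> q p) t"
   unfolding sp_def
   by (rule Z.ct_cong[OF tT], rule tsum_cong'[OF V.cmods(1) W.cmods(1) V.td_dec[OF X V W]], assumption, rule V.co_cong[OF X V], assumption,
     rule V.sw_cong, (assumption|intro X Y)+, rule tsum_pure[OF W.cT_mod V.cT_mod R' d]) (assumption|intro i)+
  finally show ?thesis .
 qed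
 let ?L = "%v w c. Co ?Q V v (%v0 h. Sw2 ?Q X Y X h (%a b. Co ?Q W w (%w0 g. ?r v0 a w0 g (mm X Y (?S1 b) c))))"
 let ?\<beta> = "%v w c1 c2. Co ?Q V v (%v0 h. Sw3 ?Q X Y X X h (%a b e. ?r v0 a w (mm X X (?SX e) c1) (mm X Y (?S1 b) c2)))"
 have right: "pure k W.cQ V.cT (W.cot_right (W.pT w (mm X Y (?S1 b) c))) p =
   Sw2 ?Q Y X X b (%b e. Sw2 ?Q X X Y c (%c1 c2. pure k W.cQ V.cT (?p w (mm X X (?SX e) c1) (mm X Y (?S1 b) c2)) p))"
  if m: "w <: W" "b <: alg C Y X" "c <: V.cA" "p <: V.cT" for w b c p
 proof -
  let ?x = "mm X Y (?S1 b) c" and ?q = "%g x. pure k W.cQ V.cT (?p w g x) p"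
  have "pure k W.cQ V.cT (W.cot_right (W.pT w ?x)) p = Sw2 ?Q X X Y ?x ?q"
   by (rule W.cot_right_pure[OF V.cT_mod]) (assumption|intro i m)+
  also have "... = Sw2 ?Q X X Y (?S1 b) (%g y. Sw2 ?Q X X Y c (%c1 c2. ?q (mm X X g c1) (mm X Y y c2)))"
   by (rule V.sw_mult) (assumption|intro i m)+
  also have "... = Sw2 ?Q Y X X b (%b e. Sw2 ?Q X X Y c (%c1 c2. ?q (mm X X (?SX e) c1) (mm X Y (?S1 b) c2)))"
   by (rule V.anti_comult) (assumption|intro i m)+
  finally show ?thesis .
 qed
 have co: "Co ?Q TP u (%u0 g. tsum k ?Q (du u0) (%v w. ?\<beta> v w g c)) = tsum k ?Q (du u) (%v w. ?L v w c)"
  if u: "u <: TP" and c: "c <: V.cA" for u c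
 proof (rule V.tob_eq[OF X V W Q _ _ _ u])
  fix v w assume m: "v <: V" "w <: W"
  have "Co ?Q TP (pP v w) (%u0 g. tsum k ?Q (du u0) (%v w. ?\<beta> v w g c)) =
   Co ?Q V v (%v' g. Co ?Q W w (%w0 l. tsum k ?Q (du (pP v' w0)) (%v w. ?\<beta> v w (mm X X g l) c)))"
   by (rule V.tob_co[OF X V W m Q]) (assumption|intro i c)+
  also have "... = Co ?Q V v (%v' g. Co ?Q W w (%w0 l. ?\<beta> v' w0 (mm X X g l) c))"
   by (rule V.co_cong[OF X V m(1)], rule V.co_cong[OF X W m(2)], rule V.td_pure[OF X V W Q]) (assumption|intro i c)+
  also have "... = Co ?Q W w (%w0 l. Co ?Q V v (%v' g. ?\<beta> v' w0 (mm X X g l) c))"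
   by (rule V.co_co_swap[OF X X V W m Q]) (assumption|intro i c)+
  also have "... = Co ?Q W w (%w0 l. Co ?Q V v (%v0 h. Sw2 ?Q X Y X h (%a b. ?r v0 a w0 l (mm X Y (?S1 b) c))))"
  proof (rule V.co_cong[OF X W m(2)])
   fix w0 l assume n: "w0 <: W" "l <: alg C X X"
   let ?k = "%v0 a b e g. ?r v0 a w0 (mm X X (mm X X (?SX e) g) l) (mm X Y (?S1 b) c)"
   have "Co ?Q V v (%v' g. ?\<beta> v' w0 (mm X X g l) c) =
    Co ?Q V v (%v' g. Co ?Q V v' (%v0 h. Sw3 ?Q X Y X X h (%a b e. ?k v0 a b e g)))"
    by (rule V.co_cong[OF X V m(1)], rule V.co_cong[OF X V], assumption, rule V.sw_cong, (assumption|intro X Y)+, rule V.sw_cong, (assumption|intro X Y)+)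
     (simp only: V.alg_assoc V.anti_closed X n)
   also have "... = Co ?Q V v (%v0 q. Sw2 ?Q X X X q (%h g. Sw3 ?Q X Y X X h (%a b e. ?k v0 a b e g)))"
    by (rule V.co_coassoc[OF X V m(1) Q]) (assumption|intro i n c)+
   also have "... = Co ?Q V v (%v0 q. Sw3 ?Q X Y X X q (%a d g. Sw2 ?Q Y X X d (%b e. ?k v0 a b e g)))"
    by (rule V.co_cong[OF X V m(1)], rule V.sw_coassoc) (assumption|intro i n c)+
   also have "... = Co ?Q V v (%v0 q. Sw2 ?Q X Y X q (%a d. Sw3 ?Q Y X X X d (%b e g. ?k v0 a b e g)))"
    by (rule V.co_cong[OF X V m(1)], rule V.sw_cong, (assumption|intro X Y)+, rule V.sw_coassoc) (assumption|intro i n c)+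
   also have "... = Co ?Q V v (%v0 q. Sw2 ?Q X Y X q (%a b. ?r v0 a w0 (mm X X \<one>[alg C X X] l) (mm X Y (?S1 b) c)))"
    by (rule V.co_cong[OF X V m(1)], rule V.sw_cong, (assumption|intro X Y)+, rule V.sw_cancel_left_end) (assumption|intro i n c)+
   finally show "Co ?Q V v (%v' g. ?\<beta> v' w0 (mm X X g l) c) = Co ?Q V v (%v0 h. Sw2 ?Q X Y X h (%a b. ?r v0 a w0 l (mm X Y (?S1 b) c)))"
    by (simp only: V.alg_l_one[OF X X n(2)])
  qed
  also have "... = Co ?Q V v (%v0 h. Co ?Q W w (%w0 l. Sw2 ?Q X Y X h (%a b. ?r v0 a w0 l (mm X Y (?S1 b) c))))"
   by (rule V.co_co_swap[OF X X W V m(2,1) Q]) (assumption|intro i c)+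
  also have "... = ?L v w c"
   by (rule V.co_cong[OF X V m(1)], rule V.co_sw_swap[OF X W]) (assumption|intro i m c)+
  also have "... = tsum k ?Q (du (pP v w)) (%v w. ?L v w c)"
   by (rule V.td_pure[OF X V W Q, symmetric]) (assumption|intro i m c)+
  finally show "Co ?Q TP (pP v w) (%u0 g. tsum k ?Q (du u0) (%v w. ?\<beta> v w g c)) = tsum k ?Q (du (pP v w)) (%v w. ?L v w c)" .
 qed (assumption|intro i c)+
 note L = lin_comp[OF W.cot_left_lin] lin_comp[OF W.cot_right_lin] lin_closed[OF W.cot_left_lin] lin_closed[OF W.cot_right_lin]
 note ud = tsum_cong'[OF V.cmods(1) W.cmods(1) V.td_dec[OF X V W]]
 have "tsum k ?Q (sp ?S (%p q. pure k W.cT V.cT q p) t) (%q p. pure k W.cQ V.cT (W.cot_left q) p) = tsum k ?Q t (%u c. tsum k ?Q (du u) (%v w. ?L v w c))"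
  by (subst ev[OF Q], (assumption|intro i L)+, unfold sp_def, rule Z.ct_cong[OF tT], rule ud, assumption, rule V.co_cong[OF X V], assumption,
    rule V.sw_cong, (assumption|intro X Y)+, rule W.cot_left_pure[OF V.cT_mod]) (assumption|intro i)+
 also have "... = tsum k ?Q t (%u c. Co ?Q TP u (%u0 g. tsum k ?Q (du u0) (%v w. ?\<beta> v w g c)))"
  by (rule Z.ct_cong[OF tT], rule co[symmetric])
 also have "... = tsum k ?Q t (%u c. Sw2 ?Q X X Y c (%c1 c2. tsum k ?Q (du u) (%v w. ?\<beta> v w c1 c2)))"
  by (rule Z.cM_cond[OF t Q]) (assumption|intro i)+
 also have "... = tsum k ?Q t (%u c. tsum k ?Q (du u) (%v w. Sw2 ?Q X X Y c (%c1 c2. ?\<beta> v w c1 c2)))"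
  by (rule Z.ct_cong[OF tT], rule tsum_swap[OF V.cmods(1) W.cmods(1) V.td_dec[OF X V W] Q V.alg_module[OF X X] V.alg_module[OF X Y] V.cocomp_closed[OF X Y X], symmetric])
   (assumption|intro i)+
 also have "... = tsum k ?Q t (%u c. tsum k ?Q (du u) (%v w. Co ?Q V v (%v0 h. Sw3 ?Q X Y X X h (%a b e. Sw2 ?Q X X Y c (%c1 c2. ?r v0 a w (mm X X (?SX e) c1) (mm X Y (?S1 b) c2))))))"
 proof (rule Z.ct_cong[OF tT], rule ud, assumption)
  fix u c v w assume m: "c <: V.cA" "v <: V" "w <: W"
  let ?z = "%v0 a b e c1 c2. ?r v0 a w (mm X X (?SX e) c1) (mm X Y (?S1 b) c2)"
  have "Sw2 ?Q X X Y c (%c1 c2. ?\<beta> v w c1 c2) = Co ?Q V v (%v0 h. Sw2 ?Q X X Y c (%c1 c2. Sw3 ?Q X Y X X h (%a b e. ?z v0 a b e c1 c2)))"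
   by (rule V.co_sw_swap[OF X V, symmetric]) (assumption|intro i m)+
  also have "... = Co ?Q V v (%v0 h. Sw2 ?Q X Y X h (%a r. Sw2 ?Q X X Y c (%c1 c2. Sw2 ?Q Y X X r (%b e. ?z v0 a b e c1 c2))))"
   by (rule V.co_cong[OF X V m(2)], rule V.sw_swap) (assumption|intro i m)+
  also have "... = Co ?Q V v (%v0 h. Sw3 ?Q X Y X X h (%a b e. Sw2 ?Q X X Y c (%c1 c2. ?z v0 a b e c1 c2)))"
   by (rule V.co_cong[OF X V m(2)], rule V.sw_cong, (assumption|intro X Y)+, rule V.sw_swap) (assumption|intro i m)+
  finally show "Sw2 ?Q X X Y c (%c1 c2. ?\<beta> v w c1 c2) = ..." .
 qed
 also have "... = tsum k ?Q (sp ?S (%p q. pure k W.cT V.cT q p) t) (%q p. pure k W.cQ V.cT (W.cot_right q) p)"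
  by (subst ev[OF Q], (assumption|intro i L)+, unfold sp_def, rule Z.ct_cong[OF tT], rule ud, assumption, rule V.co_cong[OF X V], assumption,
    rule V.sw_cong, (assumption|intro X Y)+, rule right[symmetric]) (assumption|intro i)+
 finally have eq: "tsum k ?Q (sp ?S (%p q. pure k W.cT V.cT q p) t) (%q p. pure k W.cQ V.cT (W.cot_left q) p) = ..." .
 have gb': "(%q p. \<gamma> p (W.cot_proj q)) : bilin_maps k W.cT V.cT R"
  by (rule bilin_mapsI, rule bilin_maps_left[OF \<gamma> lin_closed[OF W.cot_proj_lin_T]], assumption, rule lin_comp[OF bilin_maps_right[OF \<gamma>] W.cot_proj_lin_T])
 show ?thesis using W.cot_proj_tensor[OF V.cT_mod R s gb eq] unfolding ev[OF R gb] ev[OF R gb'] .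
qed

lemma cot_mu_iso: "iso_mor (V.D Y) TQ Z.FV (cot_mu k C X Y V W)"
proof -
 let ?\<gamma> = "%p q. qP (V.eN (V.cot_proj p)) (W.eN (W.cot_proj q))" let ?g = "%x. sp TQ ?\<gamma> (Z.dN x)"
 have N: "module k TQ" and g: "?\<gamma> : bilin_maps k V.cT W.cT TQ" by (intro cp lin_id)+
 note gl = lin_comp[OF sp_lin[OF N g] Z.dN_mlin(2)[OF lin_id]]
 show ?thesis
 proof (rule V.iso_morI[OF Y TQ_ob Z.F_ob cot_mu_hom, of ?g])
  show "?g x <: TQ" if "x <: Z.FV" for x by (rule lin_closed[OF gl that])
  show "?g (cot_mu k C X Y V W y) = y" if y: "y <: TQ" for y
  proof (rule V.tob_eq[OF Y V.F_ob W.F_ob N lin_comp[OF gl cot_mu_lin] lin_id _ y])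
   fix s t assume s: "s <: V.FV" and t: "t <: W.FV"
   note c = V.dN_cM[OF s] W.dN_cM[OF t]
   show "?g (cot_mu k C X Y V W (qP s t)) = qP s t"
    by (simp add: cot_mu_pure s t Z.dN_eN mul_cM c sp_of_mul[OF N g c(1) W.cM_T[OF c(2)]] V.cot_proj_id W.cot_proj_id V.eN_dN W.eN_dN)
  qed
  show "cot_mu k C X Y V W (?g x) = x" if x: "x <: Z.FV" for x
  proof -
   note d = Z.dN_cT[OF x] note gx = lin_closed[OF gl x]
   have "m0 (?g x) = sp Z.cT (%p q. m0 (?\<gamma> p q)) (Z.dN x)"
    by (rule sp_comp[OF N g d Z.cT_mod Z.cM_lin_T[OF m0_lin]])
   also have "... = sp Z.cT (%p q. mul (V.cot_proj p) (W.cot_proj q)) (Z.dN x)"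
    unfolding sp_def
    by (rule Z.ct_cong[OF d], rule tsum_cong'[OF V.cmods(1) W.cmods(1) V.td_dec[OF X V W]], assumption, rule V.co_cong[OF X V], assumption,
     rule V.sw_cong, (assumption|intro X Y)+, subst m0_pure, (assumption|intro cp)+, subst V.dN_eN, (assumption|intro cp)+, subst W.dN_eN) (assumption | rule refl | intro cp)+
   also have "... = sp Z.cT (%p q. mul p (W.cot_proj q)) (Z.dN x)"
    by (rule sp_projV[OF Z.cT_mod _ d], rule bilin_mapsI, rule lin_comp[OF bilin_maps_right[OF mul_bilin] W.cot_proj_lin_T], assumption,
      rule bilin_maps_left[OF mul_bilin lin_closed[OF W.cot_proj_lin_T]])
   also have "... = sp Z.cT mul (Z.dN x)" by (rule sp_projW[OF Z.dN_cM[OF x] Z.cT_mod mul_bilin])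
   finally have "m0 (?g x) = Z.dN x" by (simp only: sp_mul[OF d])
   then show ?thesis by (simp only: cot_mu_app[OF gx] Z.eN_dN[OF x])
  qed
 qed
qed

end

lemma bilin_tensor_eq:
 assumes "module k V" "module k W" "module k V'" "module k W'" "module k U"
  and f: "f : bilin_maps k (tensor k V W) (tensor k V' W') U" and g: "g : bilin_maps k (tensor k V W) (tensor k V' W') U"
  and e: "!!v w v' w'. [|v <: V; w <: W; v' <: V'; w' <: W'|] ==>
   f (pure k V W v w) (pure k V' W' v' w') = g (pure k V W v w) (pure k V' W' v' w')"
  and s: "s <: tensor k V W" and t: "t <: tensor k V' W'"
 shows "f s t = g s t"
proof (rule lin_tensor_eq[OF assms(1,2,5) bilin_maps_left[OF f t] bilin_maps_left[OF g t] _ s])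
 fix v w assume m: "v <: V" "w <: W"
 note p = pure_closed[OF assms(1,2) m]
 show "f (pure k V W v w) t = g (pure k V W v w) t"
  by (rule lin_tensor_eq[OF assms(3-5) bilin_maps_right[OF f p] bilin_maps_right[OF g p] e[OF m] t])
qed

context cogroupoid_universe
begin

context
 fixes X Y assumes X: "X : ob C" and Y: "Y : ob C"
begin

abbreviation (input) "cF \<equiv> cot_obj k C X Y :: ('k, 'a, 'u) yd_data \<Rightarrow> _"
abbreviation (input) "cm \<equiv> cot_mor k C X Y :: ('k, 'a, 'u) yd_data \<Rightarrow> _"
abbreviation (input) "cmu \<equiv> cot_mu k C X Y :: ('k, 'a, 'u) yd_data \<Rightarrow> _"

lemma unit_ract': "[|i <: I0 X; x <: A X|] ==> ract (I0 X) i x = coun C X x *[I0 X] i"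
proof -
 assume i: "i <: I0 X" and x: "x <: A X"
 interpret k: cring k by (rule base_cring[OF X])
 note c = coun_closed[OF X x] and d = unit_dec_closed[OF X i]
 have "eI X (dI X (ract (I0 X) i x)) = eI X (coun C X x *[base_algebra k] dI X i)"
  using c d by (simp add: unit_ract[OF X i x] k.m_comm)
 also have "... = coun C X x *[I0 X] eI X (dI X i)"
  by (rule lin_smult[OF unit_enc_lin[OF X]]) (simp_all add: c d)
 finally show ?thesis by (simp add: unit_enc_dec[OF X] i ract_mlin(1)[OF X unit_yd[OF X] i x])
qed

subsection \<open>The constraint for the unit object\<close>

interpretation I: cotensor_product k C univ X Y "I0 X"
 by (rule cotensor_productI[OF X Y unit_yd[OF X]])

abbreviation (input) "j c \<equiv> eI X (dI Y c)"

lemma j_lin: "(%c. j c) : lin_maps k (I0 Y) (I0 X)"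
 by (rule lin_comp[OF unit_enc_lin[OF X] unit_dec_mlin[OF Y lin_id]])

lemmas j_closed = lin_closed[OF j_lin]

lemma unit_cot_cM: assumes i: "i <: I0 X" shows "I.pT i \<one>[I.cA] <: I.cM"
proof -
 let ?p = "%v h a. pure k (I0 X) (tensor k (A X) I.cA) v (pure k (A X) I.cA h a)"
 have p: "I.pT i \<one>[I.cA] <: I.cT" by (intro I.cr i)
 have "I.cot_left (I.pT i \<one>[I.cA]) = Co I.cQ (I0 X) i (%v h. ?p v h \<one>[I.cA])"
  unfolding I.cot_left_def by (rule I.ct_pure) (assumption|intro I.cr i)+
 also have "... = ?p i \<one>[A X] \<one>[I.cA]" by (rule unit_co[OF X i I.cQ_mod]) (assumption|intro I.cr)+
 also have "... = Sw2 I.cQ X X Y \<one>[I.cA] (%h b. ?p i h b)" by (rule sw_one[symmetric]) (assumption|intro I.cr i)+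
 also have "... = I.cot_right (I.pT i \<one>[I.cA])"
  unfolding I.cot_right_def by (rule I.ct_pure[symmetric]) (assumption|intro I.cr i)+
 finally show ?thesis using p by (simp add: I.cM_iff)
qed

lemma unit_cot_act: assumes i: "i <: I0 X" and x: "x <: A Y"
 shows "I.cot_act (I.pT i \<one>[I.cA]) x = coun C Y x *[I.cT] I.pT i \<one>[I.cA]"
proof -
 have "I.cot_act (I.pT i \<one>[I.cA]) x = Sw3 I.cT Y X X Y x (%b1 b2 b3. I.pT (ract (I0 X) i b2) (mm X Y (mm X Y (anti C Y X b1) \<one>[I.cA]) b3))"
  by (rule I.cot_act_pure) (intro I.cr i x)+
 also have "... = Sw3 I.cT Y X X Y x (%b1 b2 b3. coun C X b2 *[I.cT] I.pT i (mm X Y (anti C Y X b1) b3))"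
  by (rule sw_cong, (intro X Y x)+, rule sw_cong, (assumption|intro X Y)+)
   (simp add: unit_ract' i alg_simps X Y anti_closed lin_smult[OF pure_lin_left[OF I.cmods]] coun_closed alg_mult_closed)
 also have "... = Sw2 I.cT Y X Y x (%b1 r. I.pT i (mm X Y (anti C Y X b1) r))"
  by (rule sw_cong, (intro X Y x)+, rule sw_coun_left) (assumption|intro I.cr i)+
 also have "... = coun C Y x *[I.cT] I.pT i \<one>[I.cA]" by (rule sw_anti_left) (assumption|intro I.cr i x)+
 finally show ?thesis .
qed

text \<open>The unit constraint is \<open>i \<mapsto> i \<otimes> 1\<close>, up to the bijection \<open>j\<close> between the two unit objects.\<close>

lemma cot_eta_app:
 assumes c: "c <: I0 Y" shows "cot_eta k C X Y c = I.eN (I.pT (j c) \<one>[I.cA])"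
proof -
 interpret k: cring k by (rule base_cring[OF X])
 note d = unit_dec_closed[OF Y c]
 have "dI Y c *[I.cT] I.pT (eI X \<one>[k]) \<one>[I.cA] = I.pT (dI Y c *[I0 X] eI X \<one>[k]) \<one>[I.cA]"
  by (rule lin_smult[OF pure_lin_left[OF I.cmods], symmetric]) (intro I.cr d unit_enc_closed[OF X] k.one_closed)+
 also have "dI Y c *[I0 X] eI X \<one>[k] = j c"
  using unit_elem[OF X j_closed[OF c]] by (simp add: unit_dec_enc[OF X d])
 finally show ?thesis using c by (simp add: cot_eta_def Let_def)
qed

lemma cot_eta_lin: "cot_eta k C X Y : lin_maps k (I0 Y) I.FV"
 by (rule lin_cong[OF _ yd_mod[OF Y unit_yd[OF Y]] cot_eta_app[symmetric]], rule I.eN_mlin, rule I.cM_into_lin)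
  (assumption|intro I.cr unit_cot_cM j_lin j_closed)+

lemma dN_eta: "c <: I0 Y ==> I.dN (cot_eta k C X Y c) = I.pT (j c) \<one>[I.cA]"
 by (simp add: cot_eta_app I.dN_eN unit_cot_cM j_closed)

lemma cot_eta_hom: "cot_eta k C X Y \<in> homs (D Y) (I0 Y) I.FV"
proof -
 let ?f = "cot_eta k C X Y" note IY = unit_yd[OF Y]
 have "?f : yd_maps k (H Y) (I0 Y) I.FV"
 proof (rule yd_mapsI[OF Y IY I.F_ob cot_eta_lin])
  fix c assume c: "c <: I0 Y"
  note fc = lin_closed[OF cot_eta_lin c] note jc = j_closed[OF c] note u = unit_cot_cM[OF jc]
  show "?f (ract (I0 Y) c x) = ract I.FV (?f c) x" if x: "x <: A Y" for x
  proof -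
   interpret k: cring k by (rule base_cring[OF X])
   have e: "ract (I0 Y) c x = coun C Y x *[I0 Y] c"
   proof -
    have "eI Y (dI Y (ract (I0 Y) c x)) = eI Y (coun C Y x *[base_algebra k] dI Y c)"
     using coun_closed[OF Y x] unit_dec_closed[OF Y c] by (simp add: unit_ract[OF Y c x] k.m_comm)
    also have "... = coun C Y x *[I0 Y] eI Y (dI Y c)"
     by (rule lin_smult[OF unit_enc_lin[OF Y]]) (simp_all add: coun_closed[OF Y x] unit_dec_closed[OF Y c])
    finally show ?thesis by (simp add: unit_enc_dec[OF Y] c ract_mlin(1)[OF Y IY c x])
   qed
   have "ract I.FV (?f c) x = I.eN (coun C Y x *[I.cM] I.pT (j c) \<one>[I.cA])"
    by (simp add: I.F_ract fc x dN_eta c unit_cot_act jc I.cM_simps)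
   also have "... = coun C Y x *[I.FV] ?f c"
    unfolding cot_eta_app[OF c] by (rule lin_smult[OF I.eN_lin coun_closed[OF Y x] u])
   also have "... = ?f (ract (I0 Y) c x)"
    unfolding e by (rule lin_smult[OF cot_eta_lin coun_closed[OF Y x] c, symmetric])
   finally show ?thesis by simp
  qed
  let ?T = "tensor k I.FV I.cB" and ?p = "pure k I.FV I.cB"
  have T: "module k ?T" by (intro I.cf)
  have "coact I.FV (?f c) = Co ?T I.FV (?f c) ?p" by (rule co_pure[OF Y I.F_ob fc, symmetric])
  also have "... = tsum k ?T (I.pT (j c) \<one>[I.cA]) (%v a. Sw2 ?T X Y Y a (%a1 a2. ?p (I.eN (I.cot_proj (I.pT v a1))) a2))"
   by (subst I.F_co[OF fc T], (assumption|intro I.cf)+) (simp only: dN_eta[OF c])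
  also have "... = Sw2 ?T X Y Y \<one>[I.cA] (%a1 a2. ?p (I.eN (I.cot_proj (I.pT (j c) a1))) a2)"
   by (rule I.ct_pure[OF T]) (assumption|intro I.cf jc)+
  also have "... = ?p (I.eN (I.cot_proj (I.pT (j c) \<one>[I.cA]))) \<one>[I.cB]"
   by (rule sw_one) (assumption|intro I.cf jc)+
  also have "... = ?p (?f c) \<one>[I.cB]" by (simp only: I.cot_proj_id[OF u] cot_eta_app[OF c])
  also have "... = Co ?T (I0 Y) c (%v0 h. ?p (?f v0) h)"
   by (rule unit_co[OF Y c T, symmetric]) (assumption|intro I.cf cot_eta_lin lin_closed[OF cot_eta_lin])+
  finally show "coact I.FV (?f c) = ..." .
 qed
 then show ?thesis by (simp add: D_simps[OF Y] cot_eta_def Let_def)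
qed

lemma cot_eta_iso:
 assumes ne: "carrier I.cA \<noteq> {\<zero>[I.cA]}"
 shows "iso_mor (D Y) (I0 Y) I.FV (cot_eta k C X Y)"
proof -
 interpret k: cring k by (rule base_cring[OF X])
 obtain \<omega> where w: "\<omega> : lin_maps k I.cA (base_algebra k)" and w1: "\<omega> \<one>[I.cA] = \<one>[k]"
  using unit_functional_exists[OF base_field alg_algebra[OF X Y] ne] by blast
 have wc: "a <: I.cA ==> \<omega> a <: k" for a using lin_closed[OF w] by simp
 let ?i = "%t. tsum k (I0 X) t (%i a. \<omega> a *[I0 X] i)" let ?g = "%x. eI Y (dI X (?i (I.dN x)))"
 note I0 = yd_mod[OF X unit_yd[OF X]] note r = I.cf lin_comp[OF w] wc w lin_id
 interpret I0: module k "I0 X" by (rule I0)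
 have b: "(%i a. \<omega> a *[I0 X] i) : bilin_maps k (I0 X) I.cA (I0 X)" by (intro r)
 have ic: "?i t <: I0 X" if "t <: I.cT" for t by (rule I.ct_closed[OF that I0]) (assumption|intro r)+
 have key: "I.pT (?i t) \<one>[I.cA] = t" if t: "t <: I.cM" for t
 proof -
  note tT = I.cM_T[OF t]
  (* \<omega>(a) 1 = \<omega>(a1) S(a2) a3; the equation of the cotensor product makes a1 and a2 trivial, and a remains *)
  let ?q = "%i g b a. I.pT (\<omega> g *[I0 X] i) (mm X Y (anti C Y X b) a)"
  have "I.pT (?i t) \<one>[I.cA] = tsum k I.cT t (%i a. I.pT (\<omega> a *[I0 X] i) \<one>[I.cA])"
   by (rule lin_tsum[OF I.cmods tT I0 I.cT_mod]) (assumption|intro r)+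
  also have "... = tsum k I.cT t (%i a. Sw3 I.cT X Y X Y a (%g b a. ?q i g b a))"
   by (rule I.ct_cong[OF tT], rule sw_cancel_left_end[symmetric]) (assumption|intro r)+
  also have "... = tsum k I.cT t (%i a. Sw2 I.cT X X Y a (%h a. Sw2 I.cT X Y X h (%g b. ?q i g b a)))"
   by (rule I.ct_cong[OF tT], rule sw_coassoc[symmetric]) (assumption|intro r)+
  also have "... = tsum k I.cT t (%i a. Co I.cT (I0 X) i (%i h. Sw2 I.cT X Y X h (%g b. ?q i g b a)))"
   by (rule I.cM_cond[OF t I.cT_mod, symmetric]) (assumption|intro r)+
  also have "... = tsum k I.cT t (%i a. Sw2 I.cT X Y X \<one>[A X] (%g b. ?q i g b a))"
   by (rule I.ct_cong[OF tT], rule unit_co[OF X _ I.cT_mod]) (assumption|intro r)+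
  also have "... = tsum k I.cT t (%i a. ?q i \<one>[I.cA] \<one>[alg C Y X] a)"
   by (rule I.ct_cong[OF tT], rule sw_one) (assumption|intro r)+
  also have "... = tsum k I.cT t I.pT"
   by (rule I.ct_cong[OF tT]) (simp add: w1 anti_one[OF Y X] alg_l_one X Y)
  finally show ?thesis by (simp only: I.ct_self[OF tT])
 qed
 show ?thesis
 proof (rule iso_morI[OF Y unit_yd[OF Y] I.F_ob cot_eta_hom, of ?g])
  show "?g x <: I0 Y" if "x <: I.FV" for x
   by (intro unit_enc_closed[OF Y] unit_dec_closed[OF X] ic I.dN_cT that)
  show "?g (cot_eta k C X Y c) = c" if c: "c <: I0 Y" for c
  proof -
   have "?i (I.pT (j c) \<one>[I.cA]) = \<omega> \<one>[I.cA] *[I0 X] j c"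
    by (rule I.ct_pure[OF I0 b]) (intro r j_closed c)+
   then show ?thesis by (simp add: dN_eta c w1 j_closed unit_dec_enc[OF X] unit_dec_closed[OF Y] unit_enc_dec[OF Y])
  qed
  show "cot_eta k C X Y (?g x) = x" if x: "x <: I.FV" for x
  proof -
   note t = I.dN_cM[OF x] note i = ic[OF I.cM_T[OF t]]
   have "j (?g x) = ?i (I.dN x)" by (simp add: unit_dec_enc[OF Y] unit_dec_closed[OF X i] unit_enc_dec[OF X i])
   then show ?thesis using cot_eta_app[of "?g x"] unit_enc_closed[OF Y unit_dec_closed[OF X i]] by (simp add: key[OF t] I.eN_dN[OF x])
  qed
 qed
qed

subsection \<open>Coherence\<close>

lemma cot_constraints:
 assumes ne: "carrier (alg C X Y) \<noteq> {\<zero>[alg C X Y]}"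
 shows "monoidal_constraints (D X) (D Y) cF cm cmu (cot_eta k C X Y)"
proof (rule monoidal_constraints.intro; unfold D_simps[OF X] D_simps[OF Y] mem_Collect_eq)
 show "iso_mor (D Y) (I0 Y) (cF (I0 X)) (cot_eta k C X Y)" by (rule cot_eta_iso[OF ne])
 have ml: "cm V W f : lin_maps k (cF V) (cF W)" "cm V W f \<in> extensional (carrier (cF V))" if "Ob X V" "Ob X W" "f \<in> homs (D X) V W" for V W f
  using cotensor_pair.cot_mor_hom[OF cotensor_pairI[OF X Y that(1,2)], of f] that(3) by (auto simp: D_simps[OF X] D_simps[OF Y] intro: yd_maps_lin)
 have mul: "cmu V W : lin_maps k (TO Y (cF V) (cF W)) (cF (TO X V W))" "cmu V W \<in> extensional (carrier (TO Y (cF V) (cF W)))" if "Ob X V" "Ob X W" for V W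
  using cotensor_pair.cot_mu_lin[OF cotensor_pairI[OF X Y that]] cotensor_pair.cot_mu_ext[OF cotensor_pairI[OF X Y that]] by auto
 have Fo: "Ob Y (cF V)" if "Ob X V" for V by (rule cotensor_product.F_ob[OF cotensor_productI[OF X Y that]])
 note ob = Fo tob_yd[OF X] tob_yd[OF Y] unit_yd[OF X] unit_yd[OF Y]
 note yp = tp_mlin(1)[OF Y] tp_mlin(1)[OF X]
 fix A assume A: "Ob X A"
 interpret IA: cotensor_pair k C univ X Y "I0 X" A by (rule cotensor_pairI[OF X Y unit_yd[OF X] A])
 interpret AI: cotensor_pair k C univ X Y A "I0 X" by (rule cotensor_pairI[OF X Y A unit_yd[OF X]])
 interpret L: cotensor_pair k C univ X Y "TO X (I0 X) A" A by (rule cotensor_pairI[OF X Y tob_yd[OF X unit_yd[OF X] A] A])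
 interpret R: cotensor_pair k C univ X Y "TO X A (I0 X)" A by (rule cotensor_pairI[OF X Y tob_yd[OF X A unit_yd[OF X]] A])
 let ?\<eta> = "cot_eta k C X Y" let ?idF = "\<lambda>v\<in>carrier (cF A). v"
 note idl = restrict_lin[OF lin_id yd_mod[OF Y Fo[OF A]]] and lu = lunit_lin[OF X A] runit_lin[OF X A] lunit_hom[OF X A] runit_hom[OF X A]
 { fix c s assume c: "c <: I0 Y" and s: "s <: cF A"
  let ?d = "IA.W.dN s"
  note d = IA.W.dN_cM[OF s] note dT = IA.W.cM_T[OF d] note jc = j_closed[OF c] note u = unit_cot_cM[OF jc] note uT = I.cM_T[OF u]
  note ec = lin_closed[OF cot_eta_lin c]
  have dc: "dI Y c <: k" by (rule unit_dec_closed[OF Y c])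
  have dj: "dI X (j c) = dI Y c" by (rule unit_dec_enc[OF X dc])
  have sm: "(%t. dI Y c *[IA.W.cT] t) : lin_maps k IA.W.cT IA.W.cT" by (intro IA.W.cm lin_id dc)
  have "L.Tf (lunit (D X) A) (IA.mul (I.pT (j c) \<one>[I.cA]) ?d) = dI Y c *[IA.W.cT] ?d"
  proof (rule lin_tensor_eq[OF IA.W.cmods IA.W.cT_mod _ sm _ dT])
   show "(%t. L.Tf (lunit (D X) A) (IA.mul (I.pT (j c) \<one>[I.cA]) t)) : lin_maps k IA.W.cT IA.W.cT"
    by (rule lin_comp[OF L.Tf_lin[OF lu(1)] bilin_maps_right[OF IA.mul_bilin uT]])
   fix v a assume m: "v <: A" "a <: I.cA"
   show "L.Tf (lunit (D X) A) (IA.mul (I.pT (j c) \<one>[I.cA]) (IA.W.pT v a)) = dI Y c *[IA.W.cT] IA.W.pT v a"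
    by (simp add: IA.mul_pure jc m alg_one_closed X Y alg_l_one L.Tf_pure[OF lu(1)] yp unit_yd A lunit_pure[OF X A] dj
      lin_smult[OF pure_lin_left[OF IA.W.cmods]] dc)
  qed
  then have "cm (TO X (I0 X) A) A (lunit (D X) A) (cmu (I0 X) A (P Y (cF (I0 X)) (cF A) (?\<eta> c) s)) = IA.W.eN (dI Y c *[IA.W.cM] ?d)"
   by (simp add: IA.cot_mu_pure ec s dN_eta c L.cot_mor_app IA.Z.eN_closed IA.mul_cM u d IA.Z.dN_eN IA.W.cM_simps)
  then have 1: "cm (TO X (I0 X) A) A (lunit (D X) A) (cmu (I0 X) A (P Y (cF (I0 X)) (cF A) (?\<eta> c) s)) = dI Y c *[cF A] s"
   by (simp add: lin_smult[OF IA.W.eN_lin dc d] IA.W.eN_dN s)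
  have "R.Tf (runit (D X) A) (AI.mul ?d (I.pT (j c) \<one>[I.cA])) = dI Y c *[IA.W.cT] ?d"
  proof (rule lin_tensor_eq[OF IA.W.cmods IA.W.cT_mod _ sm _ dT])
   show "(%t. R.Tf (runit (D X) A) (AI.mul t (I.pT (j c) \<one>[I.cA]))) : lin_maps k IA.W.cT IA.W.cT"
    by (rule lin_comp[OF R.Tf_lin[OF lu(2)] bilin_maps_left[OF AI.mul_bilin uT]])
   fix v a assume m: "v <: A" "a <: I.cA"
   show "R.Tf (runit (D X) A) (AI.mul (IA.W.pT v a) (I.pT (j c) \<one>[I.cA])) = dI Y c *[IA.W.cT] IA.W.pT v a"
    by (simp add: AI.mul_pure jc m alg_one_closed X Y alg_r_one R.Tf_pure[OF lu(2)] yp unit_yd A runit_pure[OF X A] dj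
      lin_smult[OF pure_lin_left[OF IA.W.cmods]] dc)
  qed
  then have "cm (TO X A (I0 X)) A (runit (D X) A) (cmu A (I0 X) (P Y (cF A) (cF (I0 X)) s (?\<eta> c))) = IA.W.eN (dI Y c *[IA.W.cM] ?d)"
   by (simp add: AI.cot_mu_pure ec s dN_eta c R.cot_mor_app AI.Z.eN_closed AI.mul_cM u d AI.Z.dN_eN IA.W.cM_simps)
  then have 2: "cm (TO X A (I0 X)) A (runit (D X) A) (cmu A (I0 X) (P Y (cF A) (cF (I0 X)) s (?\<eta> c))) = dI Y c *[cF A] s"
   by (simp add: lin_smult[OF IA.W.eN_lin dc d] IA.W.eN_dN s)
  note 1 2 }
 note un = this
 note sets = Y cat_ext[OF Y] compose_lin tmor_lin[OF Y] idl cot_eta_lin lunit_lin[OF Y] runit_lin[OF Y] ml mul lu ob A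
 show "compose (carrier (TO Y (I0 Y) (cF A))) (cm (TO X (I0 X) A) A (lunit (D X) A))
   (compose (carrier (TO Y (I0 Y) (cF A))) (cmu (I0 X) A) (tmor (D Y) (I0 Y) (cF (I0 X)) (cF A) (cF A) ?\<eta> ?idF)) = lunit (D Y) (cF A)"
  by (rule tob_eq2[OF Y unit_yd[OF Y] Fo[OF A] yd_mod[OF Y Fo[OF A]]]) (rule sets yd_mod[OF Y] |
   simp add: compose_eq yp ob A tmor_pure[OF Y] idl cot_eta_lin un lunit_pure[OF Y])+
 show "compose (carrier (TO Y (cF A) (I0 Y))) (cm (TO X A (I0 X)) A (runit (D X) A))
   (compose (carrier (TO Y (cF A) (I0 Y))) (cmu A (I0 X)) (tmor (D Y) (cF A) (cF A) (I0 Y) (cF (I0 X)) ?idF ?\<eta>)) = runit (D Y) (cF A)"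
  by (rule tob_eq2[OF Y Fo[OF A] unit_yd[OF Y] yd_mod[OF Y Fo[OF A]]]) (rule sets yd_mod[OF Y] |
   simp add: compose_eq yp ob A tmor_pure[OF Y] idl cot_eta_lin un runit_pure[OF Y])+
 fix B assume B: "Ob X B"
 interpret AB: cotensor_pair k C univ X Y A B by (rule cotensor_pairI[OF X Y A B])
 show "iso_mor (D Y) (TO Y (cF A) (cF B)) (cF (TO X A B)) (cmu A B)" by (rule AB.cot_mu_iso)
 { fix A' B' f g assume A': "Ob X A'" and B': "Ob X B'" and f: "f : yd_maps k (H X) A A' \<inter> extensional (carrier A)" and g: "g : yd_maps k (H X) B B' \<inter> extensional (carrier B)"
  interpret AB': cotensor_pair k C univ X Y A' B' by (rule cotensor_pairI[OF X Y A' B'])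
  interpret F: cotensor_pair k C univ X Y A A' by (rule cotensor_pairI[OF X Y A A'])
  interpret G: cotensor_pair k C univ X Y B B' by (rule cotensor_pairI[OF X Y B B'])
  interpret ZZ: cotensor_pair k C univ X Y "TO X A B" "TO X A' B'" by (rule cotensor_pairI[OF X Y tob_yd[OF X A B] tob_yd[OF X A' B']])
  note fy = IntD1[OF f] and gy = IntD1[OF g] note fl = yd_maps_lin[OF fy] and gl = yd_maps_lin[OF gy]
  let ?t = "tmor (D X) A A' B B' f g"
  have th: "?t \<in> homs (D X) (TO X A B) (TO X A' B')" by (rule tmor_hom[OF X A A' B B']) (simp_all add: D_simps[OF X] f[simplified] g[simplified])
  have fh: "f \<in> homs (D X) A A'" "g \<in> homs (D X) B B'" using f g by (simp_all add: D_simps[OF X])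
  note tl = tmor_lin[OF X A A' B B' fl gl]
  have ty: "?t : yd_maps k (H X) (TO X A B) (TO X A' B')" using th by (simp add: D_simps[OF X])
  have e: "ZZ.Tf ?t (AB.mul s t) = AB'.mul (F.Tf f s) (G.Tf g t)" if st: "s <: IA.W.cT" "t <: AB.W.cT" for s t
  proof (rule bilin_tensor_eq[OF IA.W.cmods AB.W.cmods AB'.Z.cT_mod _ _ _ st])
   show "(%s t. ZZ.Tf ?t (AB.mul s t)) : bilin_maps k IA.W.cT AB.W.cT AB'.Z.cT"
    by (intro bilin_mapsI lin_comp[OF ZZ.Tf_lin[OF tl]] AB.mul_mlin lin_id)
   show "(%s t. AB'.mul (F.Tf f s) (G.Tf g t)) : bilin_maps k IA.W.cT AB.W.cT AB'.Z.cT"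
    by (intro bilin_mapsI AB'.mul_mlin lin_closed[OF F.Tf_lin[OF fl]] lin_closed[OF G.Tf_lin[OF gl]] F.Tf_lin[OF fl] G.Tf_lin[OF gl])
  qed (simp add: AB.mul_pure AB'.mul_pure ZZ.Tf_pure[OF tl] F.Tf_pure[OF fl] G.Tf_pure[OF gl] yp A B alg_mult_closed X Y tmor_pure[OF X A A' B B' fl gl]
    lin_closed[OF fl] lin_closed[OF gl])
  have p: "cmu A' B' (P Y (cF A') (cF B') (cm A A' f s) (cm B B' g t)) = cm (TO X A B) (TO X A' B') ?t (cmu A B (P Y (cF A) (cF B) s t))"
   if s: "s <: cF A" and t: "t <: cF B" for s t
  proof -
   note c = lin_closed[OF ml(1)[OF A A' fh(1)] s] lin_closed[OF ml(1)[OF B B' fh(2)] t]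
   show ?thesis
    by (simp add: AB'.cot_mu_pure c F.dN_cot_mor[OF fy s] G.dN_cot_mor[OF gy t] AB.cot_mu_pure s t ZZ.cot_mor_app AB.Z.eN_closed AB.mul_cM
      IA.W.dN_cM AB.W.dN_cM AB.Z.dN_eN e IA.W.dN_cT AB.W.dN_cT)
  qed
  show "compose (carrier (TO Y (cF A) (cF B))) (cmu A' B') (tmor (D Y) (cF A) (cF A') (cF B) (cF B') (cm A A' f) (cm B B' g)) =
   compose (carrier (TO Y (cF A) (cF B))) (cm (TO X A B) (TO X A' B') ?t) (cmu A B)"
   by (rule tob_eq2[OF Y Fo[OF A] Fo[OF B] yd_mod[OF Y Fo[OF tob_yd[OF X A' B']]]]) (rule sets A' B' B fh th yd_mod[OF Y] |
    simp add: compose_eq yp ob A B A' B' tmor_pure[OF Y] ml fh p)+ }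
 fix G assume G: "Ob X G"
 interpret BG: cotensor_pair k C univ X Y B G by (rule cotensor_pairI[OF X Y B G])
 interpret ABG: cotensor_pair k C univ X Y "TO X A B" G by (rule cotensor_pairI[OF X Y tob_yd[OF X A B] G])
 interpret ABG': cotensor_pair k C univ X Y A "TO X B G" by (rule cotensor_pairI[OF X Y A tob_yd[OF X B G]])
 interpret ZZ: cotensor_pair k C univ X Y "TO X (TO X A B) G" "TO X A (TO X B G)"
  by (rule cotensor_pairI[OF X Y tob_yd[OF X tob_yd[OF X A B] G] tob_yd[OF X A tob_yd[OF X B G]]])
 let ?a = "assoc (D X) A B G"
 note al = assoc_lin[OF X A B G] note ah = assoc_hom[OF X A B G]
 have e: "ZZ.Tf ?a (ABG.mul (AB.mul s t) r) = ABG'.mul s (BG.mul t r)" if str: "s <: IA.W.cT" "t <: AB.W.cT" "r <: BG.W.cT" for s t r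
 proof (rule bilin_tensor_eq[OF IA.W.cmods AB.W.cmods ABG'.Z.cT_mod _ _ _ str(1,2)])
  show "(%s t. ZZ.Tf ?a (ABG.mul (AB.mul s t) r)) : bilin_maps k IA.W.cT AB.W.cT ABG'.Z.cT"
   by (intro bilin_mapsI lin_comp[OF ZZ.Tf_lin[OF al]] ABG.mul_mlin AB.mul_mlin lin_id str)
  show "(%s t. ABG'.mul s (BG.mul t r)) : bilin_maps k IA.W.cT AB.W.cT ABG'.Z.cT"
   by (intro bilin_mapsI ABG'.mul_mlin BG.mul_mlin lin_id str)
  fix v a w b assume m: "v <: A" "a <: I.cA" "w <: B" "b <: I.cA"
  have q: "IA.W.pT v a <: IA.W.cT" "AB.W.pT w b <: AB.W.cT" by (intro IA.W.cm AB.W.cm m)+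
  show "ZZ.Tf ?a (ABG.mul (AB.mul (IA.W.pT v a) (AB.W.pT w b)) r) = ABG'.mul (IA.W.pT v a) (BG.mul (AB.W.pT w b) r)"
  proof (rule lin_tensor_eq[OF BG.W.cmods ABG'.Z.cT_mod _ _ _ str(3)])
   show "(%r. ZZ.Tf ?a (ABG.mul (AB.mul (IA.W.pT v a) (AB.W.pT w b)) r)) : lin_maps k BG.W.cT ABG'.Z.cT"
    by (intro lin_comp[OF ZZ.Tf_lin[OF al]] ABG.mul_mlin AB.mul_mlin lin_id q)
   show "(%r. ABG'.mul (IA.W.pT v a) (BG.mul (AB.W.pT w b) r)) : lin_maps k BG.W.cT ABG'.Z.cT"
    by (intro ABG'.mul_mlin BG.mul_mlin lin_id q)
  qed (simp add: AB.mul_pure ABG.mul_pure BG.mul_pure ABG'.mul_pure m yp tob_yd[OF X] A B G alg_mult_closed X Y ZZ.Tf_pure[OF al] assoc_pure[OF X A B G] alg_assoc)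
 qed
 have p: "cm (TO X (TO X A B) G) (TO X A (TO X B G)) ?a (cmu (TO X A B) G (P Y (cF (TO X A B)) (cF G) (cmu A B (P Y (cF A) (cF B) s t)) r)) =
   cmu A (TO X B G) (P Y (cF A) (cF (TO X B G)) s (cmu B G (P Y (cF B) (cF G) t r)))"
  if str: "s <: cF A" "t <: cF B" "r <: cF G" for s t r
  by (simp add: AB.cot_mu_pure BG.cot_mu_pure ABG.cot_mu_pure ABG'.cot_mu_pure ZZ.cot_mor_app str AB.Z.eN_closed BG.Z.eN_closed ABG.Z.eN_closed
    AB.mul_cM BG.mul_cM ABG.mul_cM IA.W.dN_cM AB.W.dN_cM BG.W.dN_cM AB.Z.dN_eN BG.Z.dN_eN ABG.Z.dN_eN e IA.W.dN_cT AB.W.dN_cT BG.W.dN_cT)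
 note idl' = restrict_lin[OF lin_id yd_mod[OF Y Fo[OF G]]]
 let ?S = "TO Y (TO Y (cF A) (cF B)) (cF G)"
 show "compose (carrier ?S) (cm (TO X (TO X A B) G) (TO X A (TO X B G)) ?a)
    (compose (carrier ?S) (cmu (TO X A B) G) (tmor (D Y) (TO Y (cF A) (cF B)) (cF (TO X A B)) (cF G) (cF G) (cmu A B) (\<lambda>v\<in>carrier (cF G). v))) =
   compose (carrier ?S) (cmu A (TO X B G))
    (compose (carrier ?S) (tmor (D Y) (cF A) (cF A) (TO Y (cF B) (cF G)) (cF (TO X B G)) ?idF (cmu B G)) (assoc (D Y) (cF A) (cF B) (cF G)))"
  by (rule tob_eq3[OF Y Fo[OF A] Fo[OF B] Fo[OF G] yd_mod[OF Y Fo[OF tob_yd[OF X A tob_yd[OF X B G]]]]]) (rule sets assoc_lin[OF Y] idl' B G ah al yd_mod[OF Y] |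
   simp add: compose_eq yp ob A B G tmor_pure[OF Y] assoc_pure[OF Y] assoc_lin[OF Y] idl idl' mul lin_closed[OF mul(1)] p)+
qed

end

end

section \<open>The equivalence\<close>

text \<open>The construction applied twice; \<open>G\<close> is the cotensor product \<open>(V \<box> \<C>(X,Y)) \<box> \<C>(Y,X)\<close>.\<close>

locale cotensor_return = cotensor_product k C univ X Y V
 for k :: "('k, 'r) ring_scheme" and C :: "('k, 'a, 'o) cogroupoid_data" and univ :: "'u itself" and X Y V

sublocale cotensor_return \<subseteq> G: cotensor_product k C univ Y X "cot_obj k C X Y V"
 by (rule cotensor_productI[OF Y X F_ob])

context cotensor_return
begin

lemmas ch = cg G.cg lin_id

abbreviation (input) "K v a b \<equiv> G.pT (eN (cot_proj (pT v a))) b"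

text \<open>\<open>v \<mapsto> v\<^sub>0 \<otimes> v\<^sub>1 \<otimes> v\<^sub>2\<close>; each \<open>v\<^sub>0 \<otimes> v\<^sub>1\<close> is projected, so that the first two factors form an element of \<open>F V\<close>.\<close>

definition s0 where "s0 v = Co G.cT V v (%v0 h. Sw2 G.cT X Y X h (%a b. K v0 a b))"

lemma s0_lin: "s0 : lin_maps k V G.cT"
 unfolding s0_def[abs_def] by (assumption|intro ch)+

lemma s0_closed: "v <: V ==> s0 v <: G.cT"
 by (rule lin_closed[OF s0_lin])

lemma s0_eval:
 assumes v: "v <: V" and R: "module k R" and \<beta>: "\<beta> : bilin_maps k FV G.cA R"
 shows "tsum k R (s0 v) \<beta> = Co R V v (%v0 h. Sw2 R X Y X h (%a b. \<beta> (eN (cot_proj (pT v0 a))) b))"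
proof -
 have "tsum k R (s0 v) \<beta> = Co R V v (%v0 h. tsum k R (Sw2 G.cT X Y X h (%a b. K v0 a b)) \<beta>)"
  unfolding s0_def by (rule tsum_tsum[OF cmods(1) alg_module[OF X X] coact_mlin(1)[OF X V v] R G.cmods _ \<beta>]) (assumption|intro ch)+
 also have "... = Co R V v (%v0 h. Sw2 R X Y X h (%a b. tsum k R (K v0 a b) \<beta>))"
  by (rule co_cong[OF X V v], rule tsum_tsum[OF alg_module[OF X Y] alg_module[OF Y X] _ R G.cmods _ \<beta>]) (assumption|intro ch)+
 also have "... = Co R V v (%v0 h. Sw2 R X Y X h (%a b. \<beta> (eN (cot_proj (pT v0 a))) b))"
  by (rule co_cong[OF X V v], rule sw_cong, (assumption|intro X Y)+, rule G.ct_pure[OF R \<beta>]) (assumption|intro ch)+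
 finally show ?thesis .
qed

lemma s0_eval_T:
 assumes v: "v <: V" and R: "module k R" and \<beta>: "\<beta> : bilin_maps k FV G.cA R" and \<gamma>: "\<gamma> : bilin_maps k cT G.cA R"
  and e: "!!p b. [|p <: cM; b <: G.cA|] ==> \<beta> (eN p) b = \<gamma> p b"
 shows "tsum k R (s0 v) \<beta> = Co R V v (%v0 h. Sw2 R X Y X h (%a b. \<gamma> (pT v0 a) b))"
 unfolding s0_eval[OF v R \<beta>] cot_proj_co[OF v R \<gamma>, symmetric]
 by (rule co_cong[OF X V v], rule sw_cong, (assumption|intro X Y)+, rule e) (assumption|intro ch)+

lemma s0_cM: assumes v: "v <: V" shows "s0 v <: G.cM"
proof -
 let ?Q = "G.cQ" let ?p = "%m g b. pure k FV (tensor k cB G.cA) m (pure k cB G.cA g b)"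
 note Q = G.cQ_mod
 let ?\<gamma> = "%p b. tsum k ?Q p (%v a. Sw2 ?Q X Y Y a (%a1 a2. ?p (eN (cot_proj (pT v a1))) a2 b))"
 have g: "?\<gamma> : bilin_maps k cT G.cA ?Q" by (rule bilin_mapsI, rule ct_lin_arg, assumption, rule Q, (assumption|intro ch)+, rule ct_lin[OF Q lin_id]) (assumption|intro ch)+
 have "G.cot_left (s0 v) = Co ?Q V v (%v0 h. Sw2 ?Q X Y X h (%a b. ?\<gamma> (pT v0 a) b))"
  unfolding G.cot_left_def
 proof (rule s0_eval_T[OF v Q _ g], (assumption|intro ch)+)
  fix p b assume m: "p <: cM" "b <: G.cA"
  show "Co ?Q FV (eN p) (%m g. ?p m g b) = ?\<gamma> p b"
   by (subst F_co[OF eN_closed[OF m(1)] Q], (assumption|intro ch m)+) (simp only: dN_eN[OF m(1)])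
 qed
 also have "... = Co ?Q V v (%v0 h. Sw2 ?Q X Y X h (%a b. Sw2 ?Q X Y Y a (%a1 a2. ?p (eN (cot_proj (pT v0 a1))) a2 b)))"
  by (rule co_cong[OF X V v], rule sw_cong, (assumption|intro X Y)+, rule ct_pure[OF Q]) (assumption|intro ch)+
 also have "... = Co ?Q V v (%v0 h. Sw3 ?Q X Y Y X h (%a g b. ?p (eN (cot_proj (pT v0 a))) g b))"
  by (rule co_cong[OF X V v], rule sw_coassoc) (assumption|intro ch)+
 also have "... = G.cot_right (s0 v)"
  unfolding G.cot_right_def by (rule s0_eval[OF v Q, symmetric]) (assumption|intro ch)+
 finally show ?thesis using s0_closed[OF v] by (simp add: G.cM_iff)
qed

text \<open>Acting by \<open>x\<close> on both levels of \<open>s0 v\<close> conjugates \<open>v\<^sub>1\<close> by inner and \<open>v\<^sub>2\<close> by outer components of \<open>x\<close>; by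
 \<open>sw_adjoint_comult\<close> this is what comultiplying \<open>S(x\<^sub>1) v\<^sub>1 x\<^sub>3\<close> gives.\<close>

lemma s0_act:
 assumes v: "v <: V" and x: "x <: alg C X X"
 shows "s0 (ract V v x) = G.cot_act (s0 v) x"
proof -
 let ?T = "G.cT" and ?S = "anti C X Y" and ?S' = "anti C Y X"
 note T = G.cT_mod
 note al = lin_comp[OF cot_act_lin1] lin_comp[OF cot_act_lin2] cot_act_closed
 let ?z = "%v0 b1 b2 b3 b4 b5 y1 y2. K (ract V v0 b3) (mm X Y (mm X Y (?S' b2) y1) b4) (mm Y X (mm Y X (?S b1) y2) b5)"
 let ?\<gamma> = "%p b. Sw3 ?T X Y Y X x (%x1 x2 x3. G.pT (eN (cot_proj (cot_act p x2))) (mm Y X (mm Y X (?S x1) b) x3))"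
 have "G.cot_act (s0 v) x = tsum k ?T (G.cot_act (s0 v) x) G.pT"
  by (rule G.ct_self[OF G.cot_act_closed[OF s0_closed[OF v] x], symmetric])
 also have "... = tsum k ?T (s0 v) (%m b. Sw3 ?T X Y Y X x (%x1 x2 x3. G.pT (ract FV m x2) (mm Y X (mm Y X (?S x1) b) x3)))"
  by (rule G.cot_act_eval[OF s0_closed[OF v] x T]) (assumption|intro ch)+
 also have "... = Co ?T V v (%v0 h. Sw2 ?T X Y X h (%a b. ?\<gamma> (pT v0 a) b))"
 proof (rule s0_eval_T[OF v T], (assumption|intro ch x)+, (assumption|intro ch x al)+)
  fix p b assume m: "p <: cM" "b <: G.cA"
  show "Sw3 ?T X Y Y X x (%x1 x2 x3. G.pT (ract FV (eN p) x2) (mm Y X (mm Y X (?S x1) b) x3)) = ?\<gamma> p b"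
   by (rule sw_cong, (intro X Y x)+, rule sw_cong, (assumption|intro X Y)+)
    (simp only: F_ract[OF eN_closed[OF m(1)]] dN_eN[OF m(1)] cot_proj_id[OF cot_act_cM[OF m(1)]])
 qed
 also have "... = Co ?T V v (%v0 h. Sw2 ?T X Y X h (%y1 y2. Sw2 ?T X Y X x (%b1 r. Sw4 ?T Y X X Y X r (%b2 b3 b4 b5. ?z v0 b1 b2 b3 b4 b5 y1 y2))))"
 proof (rule co_cong[OF X V v], rule sw_cong, (assumption|intro X Y)+, rule sw_cong, (intro X Y x)+)
  fix v0 h a b x1 r assume m: "v0 <: V" "a <: cA" "b <: G.cA" "x1 <: cA" "r <: G.cA"
  have "Sw2 ?T Y Y X r (%x2 x3. G.pT (eN (cot_proj (cot_act (pT v0 a) x2))) (mm Y X (mm Y X (?S x1) b) x3)) =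
   Sw2 ?T Y Y X r (%x2 x3. Sw3 ?T Y X X Y x2 (%b2 b3 b4. ?z v0 x1 b2 b3 b4 x3 a b))"
  proof (rule sw_cong, (intro X Y m)+)
   fix x2 x3 assume n: "x2 <: cB" "x3 <: G.cA"
   show "G.pT (eN (cot_proj (cot_act (pT v0 a) x2))) (mm Y X (mm Y X (?S x1) b) x3) = Sw3 ?T Y X X Y x2 (%b2 b3 b4. ?z v0 x1 b2 b3 b4 x3 a b)"
    unfolding cot_act_pure[OF m(1,2) n(1)] by (rule lin_sw3[OF Y X X Y n(1) cT_mod T]) (assumption|intro ch m n)+
  qed
  also have "... = Sw4 ?T Y X X Y X r (%b2 b3 b4 b5. ?z v0 x1 b2 b3 b4 b5 a b)"
   by (rule sw_split_first3) (assumption|intro ch m)+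
  finally show "Sw2 ?T Y Y X r (%x2 x3. G.pT (eN (cot_proj (cot_act (pT v0 a) x2))) (mm Y X (mm Y X (?S x1) b) x3)) = ..." .
 qed
 also have "... = Co ?T V v (%v0 h. Sw2 ?T X Y X x (%b1 r. Sw4 ?T Y X X Y X r (%b2 b3 b4 b5. Sw2 ?T X Y X h (%y1 y2. ?z v0 b1 b2 b3 b4 b5 y1 y2))))"
  by (rule co_cong[OF X V v], rule sw_swap_six) (assumption|intro ch x)+
 also have "... = Co ?T V v (%v0 h. Sw3 ?T X X X X x (%x1 x2 x3. Sw2 ?T X Y X (mm X X (mm X X (anti C X X x1) h) x3) (%a b. K (ract V v0 x2) a b)))"
  by (rule co_cong[OF X V v], rule sw_adjoint_comult[symmetric]) (assumption|intro ch x)+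
 also have "... = s0 (ract V v x)"
  unfolding s0_def by (rule co_ract[OF X V v x T, symmetric]) (assumption|intro ch)+
 finally show ?thesis by simp
qed

definition sig where "sig = (\<lambda>v\<in>carrier V. G.eN (s0 v))"

lemma sig_app: "v <: V ==> sig v = G.eN (s0 v)"
 by (simp add: sig_def)

lemma sig_lin: "sig : lin_maps k V G.FV"
 unfolding sig_def by (rule restrict_lin[OF G.eN_mlin[OF G.cM_into_lin[OF s0_lin s0_cM]] cmods(1)])

lemma dN_sig: "v <: V ==> G.dN (sig v) = s0 v"
 by (simp add: sig_app G.dN_eN s0_cM)

lemma sig_hom: "sig \<in> homs (D X) V G.FV"
proof -
 have "sig : yd_maps k (H X) V G.FV"
 proof (rule yd_mapsI[OF X V G.F_ob sig_lin])
  fix v assume v: "v <: V"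
  note sv = lin_closed[OF sig_lin v]
  show "sig (ract V v x) = ract G.FV (sig v) x" if x: "x <: alg C X X" for x
   by (simp only: sig_app[OF ract_mlin(1)[OF X V v x]] G.F_ract[OF sv x] dN_sig[OF v] s0_act[OF v x])
  let ?R = "tensor k G.FV (alg C X X)" and ?r = "pure k G.FV (alg C X X)"
  let ?f = "%v0 a b h. ?r (G.eN (G.cot_proj (K v0 a b))) h"
  have R: "module k ?R" by (intro ch)
  have "Co ?R V v (%v0 h. ?r (sig v0) h) = Co ?R V v (%v' l. Co ?R V v' (%v0 h. Sw2 ?R X Y X h (%a b. ?f v0 a b l)))"
  proof (rule co_cong[OF X V v])
   fix v' l assume m: "v' <: V" "l <: alg C X X"
   have "?r (sig v') l = ?r (G.eN (G.cot_proj (Co G.cT V v' (%v0 h. Sw2 G.cT X Y X h (%a b. K v0 a b))))) l"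
    by (simp only: sig_app[OF m(1)] G.cot_proj_id[OF s0_cM[OF m(1)]] s0_def[symmetric])
   also have "... = Co ?R V v' (%v0 h. ?r (G.eN (G.cot_proj (Sw2 G.cT X Y X h (%a b. K v0 a b)))) l)"
    by (rule lin_tsum[OF cmods(1) alg_module[OF X X] _ G.cT_mod R]) (assumption|intro ch m)+
   also have "... = Co ?R V v' (%v0 h. Sw2 ?R X Y X h (%a b. ?f v0 a b l))"
    by (rule co_cong[OF X V m(1)], rule lin_sw[OF X X Y _ G.cT_mod R]) (assumption|intro ch m)+
   finally show "?r (sig v') l = ..." .
  qed
  also have "... = Co ?R V v (%v0 q. Sw2 ?R X X X q (%h l. Sw2 ?R X Y X h (%a b. ?f v0 a b l)))"
   by (rule co_coassoc[OF X V v R]) (assumption|intro ch)+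
  also have "... = Co ?R V v (%v0 h. Sw3 ?R X Y X X h (%a b l. ?f v0 a b l))"
   by (rule co_cong[OF X V v], rule sw_coassoc) (assumption|intro ch)+
  also have "... = tsum k ?R (s0 v) (%m b. Sw2 ?R Y X X b (%b l. ?r (G.eN (G.cot_proj (G.pT m b))) l))"
   by (rule s0_eval[OF v R, symmetric]) (assumption|intro ch)+
  also have "... = Co ?R G.FV (sig v) ?r"
   by (subst G.F_co[OF sv R], (assumption|intro ch)+) (simp only: dN_sig[OF v])
  also have "... = coact G.FV (sig v)" by (rule co_pure[OF X G.F_ob sv])
  finally show "coact G.FV (sig v) = Co ?R V v (%v0 h. ?r (sig v0) h)" by simp
 qed
 then show ?thesis by (simp add: D_simps[OF X] sig_def)
qed

text \<open>The inverse is \<open>v \<otimes> a \<otimes> b \<mapsto> \<omega> (a S(b)) v\<close>. Applied after \<open>s0\<close>, it gives \<open>\<omega> (v\<^sub>1 S(v\<^sub>2)) v\<^sub>0 = v\<close>. In the other order it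
 gives \<open>\<omega> (a S(b)) v\<^sub>0 \<otimes> v\<^sub>1 \<otimes> v\<^sub>2\<close>; the equation of the inner cotensor product turns this into
 \<open>\<omega> (a\<^sub>3 S(b)) v \<otimes> a\<^sub>1 \<otimes> a\<^sub>2\<close>, and that of the outer one into \<open>\<omega> (b\<^sub>2 S(b\<^sub>3)) v \<otimes> a \<otimes> b\<^sub>1\<close>.\<close>

lemma sig_bij:
 assumes ne: "carrier cA \<noteq> {\<zero>[cA]}"
 shows "\<exists>\<rho>. (\<forall>y\<in>carrier G.FV. \<rho> y <: V \<and> sig (\<rho> y) = y) \<and> (\<forall>v\<in>carrier V. \<rho> (sig v) = v)"
proof -
 interpret k: cring k by (rule base_cring[OF X])
 interpret VM: module k V by (rule cmods(1))
 obtain \<omega> where w: "\<omega> : lin_maps k cA (base_algebra k)" and w1: "\<omega> \<one>[cA] = \<one>[k]"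
  using unit_functional_exists[OF base_field alg_algebra[OF X Y] ne] by blast
 have wc: "a <: cA ==> \<omega> a <: k" for a using lin_closed[OF w] by simp
 note r = ch lin_comp[OF w] wc w
 let ?w = "%a b. \<omega> (mm X Y a (anti C Y X b))"
 let ?\<gamma> = "%p b. tsum k V p (%v a. ?w a b *[V] v)" let ?\<rho> = "%t. tsum k V t (%m b. ?\<gamma> (dN m) b)"
 have g: "?\<gamma> : bilin_maps k cT G.cA V"
  by (rule bilin_mapsI, rule ct_lin_arg, assumption, rule cmods(1), (assumption|intro r)+, rule ct_lin[OF cmods(1) lin_id]) (assumption|intro r)+
 note gi = bilin_closed[OF g] lin_comp[OF bilin_maps_left[OF g]] bilin_maps_right[OF g]
 have gF: "(%m b. ?\<gamma> (dN m) b) : bilin_maps k FV G.cA V" by (rule bilin_mapsI) (assumption|intro gi dN_cT dN_mlin lin_id)+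
 have rc: "?\<rho> t <: V" if "t <: G.cT" for t
  by (rule G.ct_closed[OF that cmods(1)]) (rule bilin_closed[OF gF])
 have rs: "?\<rho> (s0 v) = v" if v: "v <: V" for v
 proof -
  have "?\<rho> (s0 v) = Co V V v (%v0 h. Sw2 V X Y X h (%a b. ?\<gamma> (pT v0 a) b))"
   by (rule s0_eval_T[OF v cmods(1) gF g]) (simp only: dN_eN)
  also have "... = Co V V v (%v0 h. Sw2 V X Y X h (%a b. ?w a b *[V] v0))"
   by (rule co_cong[OF X V v], rule sw_cong, (assumption|intro X Y)+, rule ct_pure[OF cmods(1)]) (assumption|intro r)+
  also have "... = Co V V v (%v0 h. coun C X h *[V] (\<omega> \<one>[cA] *[V] v0))"
   by (rule co_cong[OF X V v], rule sw_anti_right) (assumption|intro r)+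
  also have "... = \<omega> \<one>[cA] *[V] v"
   by (rule co_counit[OF X V v cmods(1)]) (assumption|intro r)+
  finally show ?thesis by (simp add: w1 v)
 qed
 have sr: "s0 (?\<rho> t) = t" if t: "t <: G.cM" for t
 proof -
  let ?T = "G.cT" note T = G.cT_mod note tT = G.cM_T[OF t]
  interpret TM: module k ?T by (rule T)
  let ?z = "%m g b. Sw2 ?T Y X Y g (%d a. ?w a b *[?T] G.pT m d)"
  have "s0 (?\<rho> t) = tsum k ?T t (%m b. s0 (?\<gamma> (dN m) b))"
   by (rule lin_tsum[OF G.cmods tT cmods(1) T s0_lin]) (rule bilin_closed[OF gF])
  also have "... = tsum k ?T t (%m b. Co ?T FV m (%m g. ?z m g b))"
  proof (rule G.ct_cong[OF tT])
   fix m b assume m: "m <: FV" and b: "b <: G.cA"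
   note d = dN_cM[OF m] note dT = cM_T[OF d]
   have "s0 (?\<gamma> (dN m) b) = tsum k ?T (dN m) (%v a. s0 (?w a b *[V] v))"
    by (rule lin_tsum[OF cmods dT cmods(1) T s0_lin]) (assumption|intro r b)+
   also have "... = tsum k ?T (dN m) (%v a. Co ?T V v (%v0 h. Sw2 ?T X Y X h (%c d. ?w a b *[?T] K v0 c d)))"
   proof (rule ct_cong[OF dT])
    fix v a assume n: "v <: V" "a <: cA"
    have c: "?w a b <: k" by (intro r n b)
    have "s0 (?w a b *[V] v) = ?w a b *[?T] s0 v" by (rule lin_smult[OF s0_lin c n(1)])
    also have "... = Co ?T V v (%v0 h. ?w a b *[?T] Sw2 ?T X Y X h (%c d. K v0 c d))"
     unfolding s0_def by (rule smult_tsum[OF cmods(1) alg_module[OF X X] coact_mlin(1)[OF X V n(1)] T c, symmetric]) (assumption|intro ch)+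
    also have "... = Co ?T V v (%v0 h. Sw2 ?T X Y X h (%c d. ?w a b *[?T] K v0 c d))"
     by (rule co_cong[OF X V n(1)], rule sw_smult[symmetric]) (assumption|intro ch c)+
    finally show "s0 (?w a b *[V] v) = ..." .
   qed
   also have "... = tsum k ?T (dN m) (%v a. Sw2 ?T X X Y a (%h a. Sw2 ?T X Y X h (%c d. ?w a b *[?T] K v c d)))"
    by (rule cM_cond[OF d T]) (assumption|intro r b)+
   also have "... = tsum k ?T (dN m) (%v a. Sw2 ?T X Y Y a (%c g. ?z (eN (cot_proj (pT v c))) g b))"
    by (rule ct_cong[OF dT], rule sw_coassoc) (assumption|intro r b)+
   also have "... = Co ?T FV m (%m g. ?z m g b)"
    by (rule F_co[OF m T, symmetric]) (assumption|intro r b)+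
   finally show "s0 (?\<gamma> (dN m) b) = ..." .
  qed
  also have "... = tsum k ?T t (%m b. Sw2 ?T Y Y X b (%g b. ?z m g b))"
   by (rule G.cM_cond[OF t T]) (assumption|intro r)+
  also have "... = tsum k ?T t (%m b. Sw3 ?T Y X Y X b (%d a b. ?w a b *[?T] G.pT m d))"
   by (rule G.ct_cong[OF tT], rule sw_coassoc) (assumption|intro r)+
  also have "... = tsum k ?T t (%m b. \<omega> \<one>[cA] *[?T] G.pT m b)"
   by (rule G.ct_cong[OF tT], rule sw_cancel_right_end) (assumption|intro r)+
  also have "... = tsum k ?T t G.pT"
   by (rule G.ct_cong[OF tT], simp only: w1, rule TM.smult_one) (assumption|intro r)+
  finally show ?thesis by (simp only: G.ct_self[OF tT])
 qed
 show ?thesis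
 proof (rule exI[of _ "%y. ?\<rho> (G.dN y)"], intro conjI ballI)
  fix y assume y: "y <: G.FV"
  show c: "?\<rho> (G.dN y) <: V" by (rule rc[OF G.dN_cT[OF y]])
  show "sig (?\<rho> (G.dN y)) = y" by (simp only: sig_app[OF c] sr[OF G.dN_cM[OF y]] G.eN_dN[OF y])
 next
  fix v assume v: "v <: V"
  show "?\<rho> (G.dN (sig v)) = v" by (simp only: dN_sig[OF v] rs[OF v])
 qed
qed

end

context cogroupoid_universe
begin

lemma cotensor_returnI: "[|X : ob C; Y : ob C; Ob X V|] ==> cotensor_return k C X Y V"
 by (rule cotensor_return.intro, rule cotensor_productI)

lemma sig_natural:
 assumes X: "X : ob C" and Y: "Y : ob C" and V: "Ob X V" and W: "Ob X W" and f: "f : yd_maps k (H X) V W" and v: "v <: V"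
 shows "cotensor_return.sig k C X Y W (f v) =
  cot_mor k C Y X (cot_obj k C X Y V) (cot_obj k C X Y W) (cot_mor k C X Y V W f) (cotensor_return.sig k C X Y V v)"
proof -
 interpret V: cotensor_return k C univ X Y V by (rule cotensor_returnI[OF X Y V])
 interpret W: cotensor_return k C univ X Y W by (rule cotensor_returnI[OF X Y W])
 interpret F: cotensor_pair k C univ X Y V W by (rule cotensor_pairI[OF X Y V W])
 interpret G: cotensor_pair k C univ Y X "cot_obj k C X Y V" "cot_obj k C X Y W" by (rule cotensor_pairI[OF Y X V.F_ob W.F_ob])
 note fl = yd_maps_lin[OF f] note T = W.G.cT_mod
 let ?c = "cot_mor k C X Y V W f"
 have cy: "?c : yd_maps k (H Y) V.FV W.FV" using F.cot_mor_hom[OF f] by (simp add: D_simps[OF Y])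
 note cl = yd_maps_lin[OF cy]
 note Tl = F.Tf_lin[OF fl]
 have "G.Tf ?c (V.s0 v) = tsum k W.G.cT (V.s0 v) (%m b. W.G.pT (?c m) b)" by (rule G.Tf_eq[OF cl V.s0_closed[OF v]])
 also have "... = Co W.G.cT V v (%v0 h. Sw2 W.G.cT X Y X h (%a b. W.G.pT (W.eN (W.cot_proj (F.Tf f (V.pT v0 a)))) b))"
  by (rule V.s0_eval_T[OF v T], (assumption|intro W.ch cl lin_closed[OF cl] | rule lin_comp[OF _ cl])+, (assumption|intro W.ch Tl lin_closed[OF Tl] | rule lin_comp[OF _ Tl])+)
   (simp only: F.cot_mor_app V.eN_closed V.dN_eN W.cot_proj_id F.Tf_cM[OF f])
 also have "... = Co W.G.cT V v (%v0 h. Sw2 W.G.cT X Y X h (%a b. W.K (f v0) a b))"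
  by (rule co_cong[OF X V v], rule sw_cong, (assumption|intro X Y)+) (simp only: F.Tf_pure[OF fl])
 also have "... = W.s0 (f v)"
  unfolding W.s0_def by (rule yd_maps_co[OF X V W f v T, symmetric]) (assumption|intro W.ch)+
 finally show ?thesis
  using lin_closed[OF V.sig_lin v] by (simp add: W.sig_app lin_closed[OF fl v] G.cot_mor_app V.dN_sig v)
qed

text \<open>Both natural isomorphisms come from \<open>\<sigma>\<close>: for \<open>(X,Y)\<close> itself, and for \<open>(Y,X)\<close> its pointwise inverse.\<close>

lemma cot_equivalence:
 assumes X: "X : ob C" and Y: "Y : ob C"
  and ne: "carrier (alg C X Y) \<noteq> {\<zero>[alg C X Y]}" "carrier (alg C Y X) \<noteq> {\<zero>[alg C Y X]}"
 shows "klinear_equivalence k (D X) (D Y) (cot_obj k C X Y) (cot_mor k C X Y)"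
proof -
 let ?s = "%X Y V. cotensor_return.sig k C X Y V :: 'u \<Rightarrow> 'u" and ?F = "%X Y V. cot_obj k C Y X (cot_obj k C X Y V) :: ('k, 'a, 'u) yd_data"
 let ?M = "%X Y V W f. cot_mor k C Y X (cot_obj k C X Y V) (cot_obj k C X Y W) (cot_mor k C X Y V W f) :: 'u \<Rightarrow> 'u"
 let ?t = "%X Y V. restrict (inv_into (carrier V) (?s X Y V)) (carrier (?F X Y V))"
 have fwd: "natural_iso (D X) (D X) (%A. A) (%A B f. f) (?F X Y) (?M X Y) (?s X Y)"
  and bwd: "natural_iso (D X) (D X) (?F X Y) (?M X Y) (%A. A) (%A B f. f) (?t X Y)"
  if X: "X : ob C" and Y: "Y : ob C" and ne: "carrier (alg C X Y) \<noteq> {\<zero>[alg C X Y]}" for X Y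
 proof -
  { fix V assume V: "Ob X V"
   interpret V: cotensor_return k C univ X Y V by (rule cotensor_returnI[OF X Y V])
   obtain \<rho> where r: "\<forall>y\<in>carrier V.G.FV. \<rho> y <: V \<and> V.sig (\<rho> y) = y" "\<forall>v\<in>carrier V. \<rho> (V.sig v) = v"
    using V.sig_bij[OF ne] by blast
   have i: "inv_into (carrier V) V.sig (V.sig v) = v" if "v <: V" for v
    by (rule inv_into_f_f[OF inj_on_inverseI[of _ \<rho>] that]) (use r in auto)
   have i': "inv_into (carrier V) V.sig y <: V" "V.sig (inv_into (carrier V) V.sig y) = y" if "y <: V.G.FV" for y
    using i r(1) that by metis+
   have c: "!!v. v <: V ==> V.sig v <: V.G.FV" by (rule lin_closed[OF V.sig_lin])
   have sy: "V.sig : yd_maps k (H X) V V.G.FV" using V.sig_hom by (simp add: D_simps[OF X])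
   have "?t X Y V \<in> homs (D X) V.G.FV V"
    by (rule restrict_hom[OF X yd_maps_inverse[OF X V V.G.F_ob sy i'(1) i i'(2)] V.G.F_ob V])
   then have "iso_mor (D X) V.G.FV V (?t X Y V)"
   proof (rule iso_morI[OF X V.G.F_ob V _ c])
    show "V.sig (?t X Y V y) = y" if y: "y <: V.G.FV" for y
     unfolding restrict_apply'[OF y] by (rule i'(2)[OF y])
    show "?t X Y V (V.sig v) = v" if v: "v <: V" for v
     unfolding restrict_apply'[OF c[OF v]] by (rule i[OF v])
   qed
   moreover have "iso_mor (D X) V V.G.FV V.sig" by (rule iso_morI[OF X V V.G.F_ob V.sig_hom i'(1) i i'(2)])
   ultimately have "iso_mor (D X) V.G.FV V (?t X Y V)" "iso_mor (D X) V V.G.FV V.sig" .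
   note this c i i' }
  note V = this
  { fix V W f assume VW: "Ob X V" "Ob X W" and f: "f : yd_maps k (H X) V W \<inter> extensional (carrier V)"
   note fy = IntD1[OF f] note n = sig_natural[OF X Y VW fy] and fc = lin_closed[OF yd_maps_lin[OF fy]]
   have FV: "Ob Y (cot_obj k C X Y V)" "Ob Y (cot_obj k C X Y W)" using cotensor_product.F_ob[OF cotensor_productI[OF X Y]] VW by auto
   have cy: "cot_mor k C X Y V W f : yd_maps k (H Y) (cot_obj k C X Y V) (cot_obj k C X Y W)"
    using cotensor_pair.cot_mor_hom[OF cotensor_pairI[OF X Y VW] fy] by (simp add: D_simps[OF Y])
   have my: "?M X Y V W f : yd_maps k (H X) (?F X Y V) (?F X Y W)"
    using cotensor_pair.cot_mor_hom[OF cotensor_pairI[OF Y X FV] cy] by (simp add: D_simps[OF X])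
   have "compose (carrier V) (?s X Y W) f = compose (carrier V) (?M X Y V W f) (?s X Y V)"
    unfolding compose_def by (rule restrict_ext) (rule n)
   moreover have "compose (carrier (?F X Y V)) (?t X Y W) (?M X Y V W f) = compose (carrier (?F X Y V)) f (?t X Y V)"
    unfolding compose_def
   proof (rule restrict_ext)
    fix y assume y: "y <: ?F X Y V"
    let ?v = "inv_into (carrier V) (?s X Y V) y"
    have v: "?v <: V" "?s X Y V ?v = y" by (rule V(5,6)[OF VW(1) y])+
    have "?t X Y W (?M X Y V W f y) = inv_into (carrier W) (?s X Y W) (?M X Y V W f y)"
     using lin_closed[OF yd_maps_lin[OF my] y] by simp
    also have "... = inv_into (carrier W) (?s X Y W) (?s X Y W (f ?v))" by (simp only: n[OF v(1)] v(2))
    also have "... = f ?v" by (rule V(4)[OF VW(2) fc[OF v(1)]])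
    finally show "?t X Y W (?M X Y V W f y) = f (?t X Y V y)" using y by simp
   qed
   ultimately have "compose (carrier V) (?s X Y W) f = compose (carrier V) (?M X Y V W f) (?s X Y V)"
    "compose (carrier (?F X Y V)) (?t X Y W) (?M X Y V W f) = compose (carrier (?F X Y V)) f (?t X Y V)" .
   note this }
  note N = this
  show "natural_iso (D X) (D X) (%A. A) (%A B f. f) (?F X Y) (?M X Y) (?s X Y)"
   unfolding natural_iso_def D_simps[OF X] mem_Collect_eq using V(2) N(1) by blast
  show "natural_iso (D X) (D X) (?F X Y) (?M X Y) (%A. A) (%A B f. f) (?t X Y)"
   unfolding natural_iso_def D_simps[OF X] mem_Collect_eq using V(1) N(2) by blast
 qed
 show ?thesis
  unfolding klinear_equivalence_def using cot_functor[OF X Y] cot_functor[OF Y X] fwd[OF X Y ne(1)] bwd[OF Y X ne(2)] by blast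
qed

end

theorem theorem6p3:
  fixes k :: "('k, 'r) ring_scheme"
    and C :: "('k, 'a, 'o) cogroupoid_data"
    and X Y :: 'o
  assumes "field k"
    and "cogroupoid k C"
    and "connected_cogroupoid C"
    and "X \<in> ob C" and "Y \<in> ob C"
    and "infinite (UNIV :: 'u set)"
    and "carrier k \<lesssim> (UNIV :: 'u set)"
    and "\<And>Z W. \<lbrakk>Z \<in> ob C; W \<in> ob C\<rbrakk> \<Longrightarrow> carrier (alg C Z W) \<lesssim> (UNIV :: 'u set)"
  shows "klinear_monoidal_equivalence k
    (YD k (hopf_at C X) :: ('k, ('k, 'a, 'u) yd_data, 'u \<Rightarrow> 'u) moncat_data)
    (YD k (hopf_at C Y) :: ('k, ('k, 'a, 'u) yd_data, 'u \<Rightarrow> 'u) moncat_data)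
    (cot_obj k C X Y) (cot_mor k C X Y) (cot_mu k C X Y) (cot_eta k C X Y)"
proof -
  interpret cogroupoid_universe k C "TYPE('u)"
    by (intro cogroupoid_universe.intro cogroupoid_universe_axioms.intro assms)
  have ne: "carrier (alg C Z W) \<noteq> {\<zero>\<^bsub>alg C Z W\<^esub>}" if "Z \<in> ob C" "W \<in> ob C" for Z W
    using assms(3) that by (simp add: connected_cogroupoid_def)
  note XY = assms(4,5)
  show ?thesis
    unfolding klinear_monoidal_equivalence_def
    by (intro conjI YD_monoidal XY cot_constraints[OF XY ne[OF XY]] cot_equivalence[OF XY ne[OF XY] ne[OF XY(2,1)]])
qed

end
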